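(* Let ${}_1Q$ be the queue length process of a fractional $M/M/1$ queue with order $\alpha\in(0,1)$ and generalized inter-arrival and service rates $\lambda,\mu>0$, and for $\delta>0$ let ${}_1\mathbf{Q}_n(t)=n^{-\delta}\,{}_1Q(n^{1/\alpha}t)$. Let $\rho=\lambda/\mu$, let $\mathbf{W}$ be a standard Brownian motion and $L_\alpha$ an inverse $\alpha$-stable subordinator independent of it. Then, as $n\to+\infty$: (i) if $\rho>1$, then for $\delta=1$ it holds ${}_1\mathbf{Q}_n\overset{\mathsf U}{\Rightarrow}(\lambda-\mu)L_\alpha$; (ii) if $\rho=1$, then for $\delta=\frac12$ it holds ${}_1\mathbf{Q}_n\overset{\mathsf U}{\Rightarrow}\sqrt{2\lambda}\,\Phi(\mathbf{W})\circ L_\alpha$; (iii) if $\rho<1$, then for any $\delta>0$ it holds $\lim_{n\to+\infty}\sup_{t>0}{}_1\mathbf{Q}_n(t)=0$ almost surely.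
   Context: An $\alpha$-stable subordinator $\sigma_\alpha$ ($\alpha\in(0,1)$) is the L\'evy process with $\mathbb{E}[e^{-z\sigma_\alpha(t)}]=e^{-tz^\alpha}$, $z\ge0$; its inverse is $L_\alpha(t)=\min\{s\ge0:\sigma_\alpha(s)\ge t\}$. The fractional $M/M/1$ queue length process is ${}_1Q=Q\circ L_\alpha$, where $Q$ is the queue length process of a classical $M/M/1$ queue (continuous-time Markov chain on the non-negative integers, started at $0$, birth rate $\lambda$, death rate $\mu$ from positive states) and $L_\alpha$ is an inverse $\alpha$-stable subordinator independent of $Q$. $\Phi(f)(t)=f(t)+\sup_{0\le s\le t}\max\{-f(s),0\}$ is the Skorokhod reflection map. $\overset{\mathsf U}{\Rightarrow}$ denotes convergence in distribution of processes in the space $\mathbb{D}$ of c\`adl\`ag functions $[0,+\infty)\to\mathbb{R}$ with the topology of uniform convergence on compact sets.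
   Formalization: In (iii) the supremum over all t>0 is replaced by the supremum over 0<t≤T, for every T>0 (almost surely, simultaneously in T), because for ρ<1 the recurrent queue visits every state, so the supremum over all t>0 is almost surely infinite. *)

theory Defs
  imports "HOL-Probability.Probability"
begin

text \<open>
  A process is a map \<open>X :: real \<Rightarrow> 'a \<Rightarrow> 'b\<close> (time first, then outcome). Only times \<open>t \<ge> 0\<close>
  are meaningful; nothing below depends on the values at negative times.
  Path properties of processes are required almost surely.
\<close>

subsection \<open>The space of cadlag functions with locally uniform convergence\<close>

definition cadlag :: "(real \<Rightarrow> real) set" where
  "cadlag = {x. (\<forall>t\<ge>0. (x \<longlongrightarrow> x t) (at_right t)) \<and> (\<forall>t>0. \<exists>l. (x \<longlongrightarrow> l) (at_left t))}"

definition U_topology :: "(real \<Rightarrow> real) topology" where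
  "U_topology = topology (\<lambda>S. S \<subseteq> cadlag \<and>
     (\<forall>x\<in>S. \<exists>T\<ge>0. \<exists>d>0. {y\<in>cadlag. \<forall>t\<in>{0..T}. \<bar>y t - x t\<bar> < d} \<subseteq> S))"

lemma openin_U_topology:
  "openin U_topology S \<longleftrightarrow> S \<subseteq> cadlag \<and>
     (\<forall>x\<in>S. \<exists>T\<ge>0. \<exists>d>0. {y\<in>cadlag. \<forall>t\<in>{0..T}. \<bar>y t - x t\<bar> < d} \<subseteq> S)"
proof -
  let ?B = "\<lambda>x T d. {y\<in>cadlag. \<forall>t\<in>{0..T}. \<bar>y t - x t\<bar> < (d::real)}"
  let ?P = "\<lambda>S. S \<subseteq> cadlag \<and> (\<forall>x\<in>S. \<exists>T\<ge>0. \<exists>d>0. ?B x T d \<subseteq> S)"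
  have "istopology ?P"
    unfolding istopology_def
  proof (intro conjI allI impI)
    fix S S' assume S: "?P S" and S': "?P S'"
    show "S \<inter> S' \<subseteq> cadlag" using S by blast
    show "\<forall>x\<in>S \<inter> S'. \<exists>T\<ge>0. \<exists>d>0. ?B x T d \<subseteq> S \<inter> S'"
    proof
      fix x assume x: "x \<in> S \<inter> S'"
      obtain T d where 1: "T \<ge> 0" "d > 0" "?B x T d \<subseteq> S" using S x by blast
      obtain T' d' where 2: "T' \<ge> 0" "d' > 0" "?B x T' d' \<subseteq> S'" using S' x by blast
      have "?B x (max T T') (min d d') \<subseteq> ?B x T d" by auto
      from this 1(3) have 3: "?B x (max T T') (min d d') \<subseteq> S" by (rule order_trans)
      have "?B x (max T T') (min d d') \<subseteq> ?B x T' d'" by auto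
      from this 2(3) have "?B x (max T T') (min d d') \<subseteq> S'" by (rule order_trans)
      with 3 have 3: "?B x (max T T') (min d d') \<subseteq> S \<inter> S'" by (rule Int_greatest)
      have "max T T' \<ge> 0" "min d d' > 0" using 1 2 by auto
      with 3 show "\<exists>T\<ge>0. \<exists>d>0. ?B x T d \<subseteq> S \<inter> S'"
        by (intro exI[of _ "max T T'"] conjI exI[of _ "min d d'"])
    qed
  next
    fix K assume K: "\<forall>S\<in>K. ?P S"
    show "\<Union>K \<subseteq> cadlag" using K by blast
    show "\<forall>x\<in>\<Union>K. \<exists>T\<ge>0. \<exists>d>0. ?B x T d \<subseteq> \<Union>K"
    proof
      fix x assume "x \<in> \<Union>K"
      then obtain S where "S \<in> K" "x \<in> S" by blast
      then obtain T d where "T \<ge> 0" "d > 0" "?B x T d \<subseteq> S" using K by blast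
      moreover have "?B x T d \<subseteq> \<Union>K"
        by (rule order_trans[OF \<open>?B x T d \<subseteq> S\<close> Union_upper[OF \<open>S \<in> K\<close>]])
      ultimately show "\<exists>T\<ge>0. \<exists>d>0. ?B x T d \<subseteq> \<Union>K"
        by (intro exI[of _ T] conjI exI[of _ d])
    qed
  qed
  then show ?thesis by (simp only: U_topology_def topology_inverse')
qed

lemma topspace_U_topology: "topspace U_topology = cadlag"
proof
  show "topspace U_topology \<subseteq> cadlag"
    using openin_U_topology[of "topspace U_topology"] openin_topspace by blast
  have "\<exists>T\<ge>0. \<exists>d>0. {y\<in>cadlag. \<forall>t\<in>{0..T}. \<bar>y t - x t\<bar> < d} \<subseteq> cadlag" for x :: "real \<Rightarrow> real"
    by (rule exI[of _ 0], rule conjI, simp, rule exI[of _ 1], rule conjI, simp) blast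
  then have "openin U_topology cadlag"
    unfolding openin_U_topology by blast
  then show "cadlag \<subseteq> topspace U_topology" by (rule openin_subset)
qed

subsection \<open>Convergence in distribution\<close>

text \<open>
  The locally uniform topology is not separable on the cadlag functions, and jump processes are in
  general not Borel measurable for it. Convergence in distribution is therefore taken in the sense
  of Hoffmann-Joergensen: the expectations of all bounded continuous functionals converge, where
  expectation means outer expectation. It is the ordinary expectation for measurable functionals.
  Replacing \<open>f\<close> by \<open>-f\<close> gives the convergence of the inner expectations as well.
\<close>

definition outer_expectation :: "'a measure \<Rightarrow> ('a \<Rightarrow> real) \<Rightarrow> real" where
  "outer_expectation M g =
     Inf {integral\<^sup>L M h | h. integrable M h \<and> (AE \<omega> in M. g \<omega> \<le> h \<omega>)}"

definition converges_in_distribution_U ::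
  "'a measure \<Rightarrow> (nat \<Rightarrow> real \<Rightarrow> 'a \<Rightarrow> real) \<Rightarrow> 'b measure \<Rightarrow> (real \<Rightarrow> 'b \<Rightarrow> real) \<Rightarrow> bool"
where
  "converges_in_distribution_U M X N Y \<longleftrightarrow>
     (\<forall>n. AE \<omega> in M. (\<lambda>t. X n t \<omega>) \<in> cadlag) \<and>
     (AE \<omega> in N. (\<lambda>t. Y t \<omega>) \<in> cadlag) \<and>
     (\<forall>f. continuous_map U_topology euclideanreal f \<and> bounded (f ` cadlag) \<longrightarrow>
        (\<lambda>n. outer_expectation M (\<lambda>\<omega>. f (\<lambda>t. X n t \<omega>)))
          \<longlonglongrightarrow> outer_expectation N (\<lambda>\<omega>. f (\<lambda>t. Y t \<omega>)))"

subsection \<open>Levy processes, stable subordinators and their inverses\<close>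

definition levy_process :: "'a measure \<Rightarrow> (real \<Rightarrow> 'a \<Rightarrow> real) \<Rightarrow> bool" where
  "levy_process M X \<longleftrightarrow>
     prob_space M \<and>
     (\<forall>t\<ge>0. X t \<in> borel_measurable M) \<and>
     (AE \<omega> in M. X 0 \<omega> = 0) \<and>
     (AE \<omega> in M. (\<lambda>t. X t \<omega>) \<in> cadlag) \<and>
     (\<forall>n. \<forall>s :: nat \<Rightarrow> real. 0 \<le> s 0 \<and> (\<forall>i<n. s i \<le> s (Suc i)) \<longrightarrow>
        prob_space.indep_vars M (\<lambda>_. borel) (\<lambda>i \<omega>. X (s (Suc i)) \<omega> - X (s i) \<omega>) {..<n}) \<and>
     (\<forall>t\<ge>0. \<forall>h\<ge>0. distr M borel (\<lambda>\<omega>. X (t + h) \<omega> - X t \<omega>) = distr M borel (X h))"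

definition brownian_motion :: "'a measure \<Rightarrow> (real \<Rightarrow> 'a \<Rightarrow> real) \<Rightarrow> bool" where
  "brownian_motion M W \<longleftrightarrow>
     levy_process M W \<and>
     (\<forall>t>0. distributed M lborel (W t) (\<lambda>x. ennreal (normal_density 0 (sqrt t) x))) \<and>
     (AE \<omega> in M. continuous_on {0..} (\<lambda>t. W t \<omega>))"

text \<open>
  The Laplace transform condition also forces integrability, since the integral of a
  non-integrable function is \<open>0\<close>.
\<close>

definition stable_subordinator :: "'a measure \<Rightarrow> real \<Rightarrow> (real \<Rightarrow> 'a \<Rightarrow> real) \<Rightarrow> bool" where
  "stable_subordinator M \<alpha> \<sigma> \<longleftrightarrow>
     levy_process M \<sigma> \<and>
     (AE \<omega> in M. mono_on {0..} (\<lambda>t. \<sigma> t \<omega>)) \<and>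
     (\<forall>t\<ge>0. \<forall>z\<ge>0. (\<integral>\<omega>. exp (- z * \<sigma> t \<omega>) \<partial>M) = exp (- t * z powr \<alpha>))"

text \<open>The minimum exists almost surely, by right continuity and unboundedness of the paths.\<close>

definition inverse_stable_subordinator :: "'a measure \<Rightarrow> real \<Rightarrow> (real \<Rightarrow> 'a \<Rightarrow> real) \<Rightarrow> bool" where
  "inverse_stable_subordinator M \<alpha> L \<longleftrightarrow>
     (\<forall>t\<ge>0. L t \<in> borel_measurable M) \<and>
     (\<exists>\<sigma>. stable_subordinator M \<alpha> \<sigma> \<and>
        (AE \<omega> in M. \<forall>t\<ge>0. L t \<omega> = (LEAST s. s \<ge> 0 \<and> \<sigma> s \<omega> \<ge> t)))"

definition indep_processes ::
  "'a measure \<Rightarrow> (real \<Rightarrow> 'a \<Rightarrow> real) \<Rightarrow> (real \<Rightarrow> 'a \<Rightarrow> real) \<Rightarrow> bool"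
where
  "indep_processes M X Y \<longleftrightarrow>
     prob_space.indep_var M
       (PiM {0..} (\<lambda>_. borel)) (\<lambda>\<omega>. \<lambda>t\<in>{0..}. X t \<omega>)
       (PiM {0..} (\<lambda>_. borel)) (\<lambda>\<omega>. \<lambda>t\<in>{0..}. Y t \<omega>)"

subsection \<open>The classical and the fractional M/M/1 queue\<close>

definition transition_function :: "(real \<Rightarrow> nat \<Rightarrow> nat \<Rightarrow> real) \<Rightarrow> bool" where
  "transition_function P \<longleftrightarrow>
     (\<forall>t\<ge>0. \<forall>i j. P t i j \<ge> 0) \<and>
     (\<forall>t\<ge>0. \<forall>i. P t i sums 1) \<and>
     (\<forall>i j. P 0 i j = (if i = j then 1 else 0)) \<and>
     (\<forall>s\<ge>0. \<forall>t\<ge>0. \<forall>i j. (\<lambda>k. P s i k * P t k j) sums P (s + t) i j)"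

text \<open>
  Continuous-time Markov chain on the natural numbers with initial state \<open>x\<close> and rate matrix \<open>q\<close>:
  the Markov property with a homogeneous transition function \<open>P\<close>, written in product form to avoid
  conditioning on null events, where \<open>q\<close> is the derivative of \<open>P\<close> at time \<open>0\<close>.
\<close>

definition markov_chain ::
  "'a measure \<Rightarrow> nat \<Rightarrow> (nat \<Rightarrow> nat \<Rightarrow> real) \<Rightarrow> (real \<Rightarrow> 'a \<Rightarrow> nat) \<Rightarrow> bool"
where
  "markov_chain M x q Q \<longleftrightarrow>
     prob_space M \<and>
     (\<forall>t\<ge>0. Q t \<in> measurable M (count_space UNIV)) \<and>
     (AE \<omega> in M. Q 0 \<omega> = x) \<and>
     (AE \<omega> in M. (\<lambda>t. real (Q t \<omega>)) \<in> cadlag) \<and>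
     (\<exists>P. transition_function P \<and>
        (\<forall>i j. ((\<lambda>h. (P h i j - P 0 i j) / h) \<longlongrightarrow> q i j) (at_right 0)) \<and>
        (\<forall>n. \<forall>s :: nat \<Rightarrow> real. \<forall>y :: nat \<Rightarrow> nat. 0 \<le> s 0 \<and> (\<forall>i\<le>n. s i \<le> s (Suc i)) \<longrightarrow>
           measure M {\<omega>\<in>space M. \<forall>i\<le>Suc n. Q (s i) \<omega> = y i} =
           measure M {\<omega>\<in>space M. \<forall>i\<le>n. Q (s i) \<omega> = y i}
             * P (s (Suc n) - s n) (y n) (y (Suc n))))"

definition mm1_rates :: "real \<Rightarrow> real \<Rightarrow> nat \<Rightarrow> nat \<Rightarrow> real" where
  "mm1_rates lam mu i j =
     (if j = Suc i then lam
      else if i = Suc j then mu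
      else if i = j then - (lam + (if i > 0 then mu else 0))
      else 0)"

definition mm1_queue :: "'a measure \<Rightarrow> real \<Rightarrow> real \<Rightarrow> (real \<Rightarrow> 'a \<Rightarrow> nat) \<Rightarrow> bool" where
  "mm1_queue M lam mu Q \<longleftrightarrow> markov_chain M 0 (mm1_rates lam mu) Q"

definition fractional_mm1_queue ::
  "'a measure \<Rightarrow> real \<Rightarrow> real \<Rightarrow> real \<Rightarrow> (real \<Rightarrow> 'a \<Rightarrow> nat) \<Rightarrow> bool"
where
  "fractional_mm1_queue M \<alpha> lam mu Q1 \<longleftrightarrow>
     (\<exists>Q L. mm1_queue M lam mu Q \<and> inverse_stable_subordinator M \<alpha> L \<and>
        indep_processes M (\<lambda>t \<omega>. real (Q t \<omega>)) L \<and>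
        Q1 = (\<lambda>t \<omega>. Q (L t \<omega>) \<omega>))"

text \<open>
  If \<open>lam < mu\<close>, the supremum of \<open>scaled_queue \<alpha> \<delta> Q1 n\<close> over all \<open>t > 0\<close> is almost surely
  infinite for every \<open>n \<ge> 1\<close>: the underlying recurrent chain visits all states, and \<open>L\<close> runs
  through all of \<open>[0, \<infinity>)\<close>. Only suprema over bounded time intervals can tend to \<open>0\<close>.
\<close>

definition scaled_queue ::
  "real \<Rightarrow> real \<Rightarrow> (real \<Rightarrow> 'a \<Rightarrow> nat) \<Rightarrow> nat \<Rightarrow> real \<Rightarrow> 'a \<Rightarrow> real"
where
  "scaled_queue \<alpha> \<delta> Q1 n t \<omega> =
     real n powr (- \<delta>) * real (Q1 (real n powr (1 / \<alpha>) * t) \<omega>)"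

definition skorokhod_reflection :: "(real \<Rightarrow> real) \<Rightarrow> real \<Rightarrow> real" where
  "skorokhod_reflection f t = f t + (SUP s\<in>{0..t}. max (- f s) 0)"

end

theory Submission
  imports Defs "HOL-Real_Asymp.Real_Asymp"
begin

text \<open>
  Write \<open>Z_n(t) = n^-\<delta> Q(n t)\<close> and \<open>L_n(t) = L(n^(1/\<alpha>) t) / n\<close>, so that the rescaled queue is
  \<open>Z_n \<circ> L_n\<close>, with \<open>L_n\<close> again an inverse stable subordinator independent of \<open>Z_n\<close>. By
  inf-convolution it suffices to treat functionals that are Lipschitz for a metric of locally uniform
  convergence. Given a modulus of continuity of \<open>Z_n\<close> in probability, such a functional of \<open>Z_n \<circ> L_n\<close>
  is close to one of finitely many values of \<open>Z_n\<close>, at indices determined by finitely many values of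
  the subordinator. So only finite-dimensional distributions of \<open>Z_n\<close> remain.

  The rates being bounded, the transition function over a time \<open>h\<close> differs in total variation by
  \<open>O(h^2)\<close> from one step of a lazy random walk reflected at \<open>0\<close>. Hence the skeleton of \<open>Q\<close> on a fine
  mesh may be replaced by a reflected walk. For this walk supermartingales give the law of large numbers
  when \<open>lam > mu\<close>, a geometric tail of the running maximum when \<open>lam < mu\<close>, and the modulus of
  continuity when \<open>lam = mu\<close>. In the last case the Levy continuity theorem yields the convergence of
  the unreflected walk to a Brownian motion, and reflection is continuous. For \<open>lam < mu\<close> the tail
  bound and \<open>L(n^(1/\<alpha>) T) \<le> n^2\<close> conclude by the Borel-Cantelli lemma.
\<close>

section \<open>Reduction to Lipschitz functionals\<close>

text \<open>Three obstacles shape the proof. The space is not separable and functionals of the queue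
  may fail to be measurable, so they are only bounded below by integrable minorants; as
  \<open>f\<close> may be replaced by \<open>- f\<close>, one side is enough. The limit has to hold
  for a composition, but no joint convergence of queue and time change is required: the law of the
  rescaled time change does not depend on \<open>n\<close>, and independence does the rest. Finally,
  all that is known of the chain is its transition function and the derivative of that at
  \<open>0\<close>, neither jump times nor a differential equation. Comparison with a walk on mesh
  \<open>h\<close> over a fixed time takes \<open>O(1/h)\<close> steps and costs
  \<open>O(h^2)\<close> for each, in total \<open>O(h)\<close>. So a bound for the walk that is
  uniform in the mesh passes to the queue along dyadic meshes, and right continuity extends it from
  dyadic to all times.\<close>

text \<open>A metric of locally uniform convergence in the style of Ky Fan. Inserting \<open>1\<close> keeps the
  infimum away from the empty set.\<close>

definition path_dist :: "(real \<Rightarrow> real) \<Rightarrow> (real \<Rightarrow> real) \<Rightarrow> real" where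
  "path_dist x y = Inf (insert 1 {e. 0 < e \<and> e < 1 \<and> (\<forall>t\<in>{0..1/e}. \<bar>x t - y t\<bar> \<le> e)})"

lemma path_dist_bdd_below: "bdd_below {e::real. 0 < e \<and> P e}"
  by (rule bdd_belowI[of _ 0]) auto

lemma path_dist_nonneg: "0 \<le> path_dist x y"
  unfolding path_dist_def by (rule cInf_greatest) auto

lemma path_dist_le_1: "path_dist x y \<le> 1"
  unfolding path_dist_def by (rule cInf_lower) (auto intro: path_dist_bdd_below)

lemma path_dist_le:
  assumes "0 < e" "\<And>t. 0 \<le> t \<Longrightarrow> t \<le> 1/e \<Longrightarrow> \<bar>x t - y t\<bar> \<le> e"
  shows "path_dist x y \<le> e"
proof (cases "e < 1")
  case True
  then show ?thesis
    unfolding path_dist_def using assms by (intro cInf_lower) (auto intro: path_dist_bdd_below)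
next
  case False
  then show ?thesis using path_dist_le_1[of x y] by simp
qed

lemma path_dist_lessD:
  assumes "path_dist x y < e" "e \<le> 1" "0 \<le> t" "t \<le> 1/e"
  shows "\<bar>x t - y t\<bar> < e"
proof -
  obtain d where d: "d \<in> insert 1 {e. 0 < e \<and> e < 1 \<and> (\<forall>t\<in>{0..1/e}. \<bar>x t - y t\<bar> \<le> e)}" "d < e"
    using assms(1) unfolding path_dist_def by (subst (asm) cInf_less_iff) (auto intro: path_dist_bdd_below)
  then have "0 < d" "\<forall>t\<in>{0..1/d}. \<bar>x t - y t\<bar> \<le> d"
    using assms(2) by auto
  moreover have "1/e \<le> 1/d" using d \<open>0 < d\<close> by (simp add: frac_le)
  ultimately have "\<bar>x t - y t\<bar> \<le> d" using assms(3,4) by simp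
  then show ?thesis using d(2) by simp
qed

lemma path_dist_commute: "path_dist x y = path_dist y x"
  by (simp add: path_dist_def abs_minus_commute)

text \<open>Radii add while horizons shrink: on \<open>[0, 1/(a + b)]\<close> both bounds are
  available, as \<open>1/(a + b)\<close> is at most \<open>1/a\<close> and \<open>1/b\<close>. If
  \<open>a + b\<close> exceeds \<open>1\<close>, the cap in the definition decides.\<close>

lemma path_dist_triangle: "path_dist x z \<le> path_dist x y + path_dist y z"
proof (rule field_le_epsilon)
  fix e :: real assume "0 < e"
  define a where "a = path_dist x y + e/2"
  define b where "b = path_dist y z + e/2"
  have pos: "a > 0" "b > 0" 
    using \<open>0 < e\<close> path_dist_nonneg[of x y] path_dist_nonneg[of y z] by (auto simp: a_def b_def)
  have lt: "path_dist x y < a" "path_dist y z < b" using \<open>0 < e\<close> by (auto simp: a_def b_def)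
  have "path_dist x z \<le> a + b"
  proof (cases "a + b \<le> 1")
    case True
    show ?thesis
    proof (rule path_dist_le)
      fix t assume t: "0 \<le> t" "t \<le> 1 / (a + b)"
      have "1 / (a + b) \<le> 1 / a" "1 / (a + b) \<le> 1 / b" using pos by (auto intro!: frac_le)
      then have "\<bar>x t - y t\<bar> < a" "\<bar>y t - z t\<bar> < b"
        using path_dist_lessD[OF lt(1), of t] path_dist_lessD[OF lt(2), of t] True t pos by auto
      then show "\<bar>x t - z t\<bar> \<le> a + b" by linarith
    qed (use pos in simp)
  next
    case False
    then show ?thesis using path_dist_le_1[of x z] by simp
  qed
  then show "path_dist x z \<le> path_dist x y + path_dist y z + e" by (simp add: a_def b_def)
qed

text \<open>Required for all functions, cadlag or not: the discretised paths to which these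
  functionals are applied are never shown to be cadlag, and null sets with irregular paths need no
  care.\<close>

definition lip_functional :: "((real \<Rightarrow> real) \<Rightarrow> real) \<Rightarrow> bool" where
  "lip_functional g \<longleftrightarrow> (\<exists>C\<ge>0. \<forall>x y. \<bar>g x - g y\<bar> \<le> C * path_dist x y) \<and> (\<exists>B. \<forall>x. \<bar>g x\<bar> \<le> B)"

text \<open>The Pasch-Hausdorff envelope: on cadlag paths the largest minorant of \<open>f\<close>
  with Lipschitz constant \<open>k\<close> for \<open>path_dist\<close>.\<close>

definition inf_conv :: "((real \<Rightarrow> real) \<Rightarrow> real) \<Rightarrow> nat \<Rightarrow> (real \<Rightarrow> real) \<Rightarrow> real" where
  "inf_conv f k x = (INF y\<in>cadlag. f y + real k * path_dist x y)"

text \<open>The exceptional set is named because the event \<open>P\<close> itself, typically about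
  a supremum over uncountably many times, need not be measurable.\<close>

abbreviation mostly :: "'a measure \<Rightarrow> real \<Rightarrow> ('a \<Rightarrow> bool) \<Rightarrow> bool" where
  "mostly M e P \<equiv> \<exists>A\<in>sets M. measure M A \<le> e \<and> (AE \<omega> in M. \<omega> \<notin> A \<longrightarrow> P \<omega>)"

abbreviation oscillation_le :: "(real \<Rightarrow> real) \<Rightarrow> real \<Rightarrow> real \<Rightarrow> real \<Rightarrow> bool" where
  "oscillation_le f S \<eta> e \<equiv> \<forall>s t. 0 \<le> s \<and> s \<le> S \<and> 0 \<le> t \<and> t \<le> S \<and> \<bar>s - t\<bar> \<le> \<eta> \<longrightarrow> \<bar>f s - f t\<bar> \<le> e"

lemma cadlag_const: "(\<lambda>_. c) \<in> cadlag"
  by (auto simp: cadlag_def)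

section \<open>Properties of the inf-convolution\<close>

context
  fixes f :: "(real \<Rightarrow> real) \<Rightarrow> real" and B :: real
  assumes bound: "\<And>x. x \<in> cadlag \<Longrightarrow> \<bar>f x\<bar> \<le> B"
begin

lemma inf_conv_bdd_below: "bdd_below ((\<lambda>y. f y + real k * path_dist x y) ` cadlag)"
proof (rule bdd_belowI2)
  fix y assume "y \<in> cadlag"
  have "- B \<le> f y" using bound[OF \<open>y \<in> cadlag\<close>] by linarith
  moreover have "0 \<le> real k * path_dist x y" using path_dist_nonneg by simp
  ultimately show "- B \<le> f y + real k * path_dist x y" by linarith
qed

lemma inf_conv_le: "y \<in> cadlag \<Longrightarrow> inf_conv f k x \<le> f y + real k * path_dist x y"
  unfolding inf_conv_def by (rule cINF_lower[OF inf_conv_bdd_below])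

lemma inf_conv_greatest:
  "(\<And>y. y \<in> cadlag \<Longrightarrow> c \<le> f y + real k * path_dist x y) \<Longrightarrow> c \<le> inf_conv f k x"
  unfolding inf_conv_def using cadlag_const by (intro cINF_greatest) auto

lemma path_dist_refl: "path_dist x x = 0"
proof -
  have "path_dist x x \<le> 0 + e" if "0 < e" for e by (rule path_dist_le) (use that in auto)
  then have "path_dist x x \<le> 0" by (rule field_le_epsilon)
  then show ?thesis using path_dist_nonneg[of x x] by linarith
qed

lemma inf_conv_le_self: "x \<in> cadlag \<Longrightarrow> inf_conv f k x \<le> f x"
  using inf_conv_le[of x k x] by (simp add: path_dist_refl)

lemma inf_conv_lip: "inf_conv f k x \<le> inf_conv f k y + real k * path_dist x y"
proof -
  have "inf_conv f k x - real k * path_dist x y \<le> inf_conv f k y"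
  proof (rule inf_conv_greatest)
    fix z assume z: "z \<in> cadlag"
    have "inf_conv f k x \<le> f z + real k * path_dist x z" by (rule inf_conv_le[OF z])
    also have "real k * path_dist x z \<le> real k * (path_dist x y + path_dist y z)"
      by (intro mult_left_mono path_dist_triangle) auto
    finally show "inf_conv f k x - real k * path_dist x y \<le> f z + real k * path_dist y z"
      by (simp add: algebra_simps)
  qed
  then show ?thesis by simp
qed

lemma inf_conv_ge: "- B \<le> inf_conv f k x"
proof (rule inf_conv_greatest)
  fix y assume "y \<in> cadlag"
  have "- B \<le> f y" using bound[OF \<open>y \<in> cadlag\<close>] by linarith
  moreover have "0 \<le> real k * path_dist x y" using path_dist_nonneg by simp
  ultimately show "- B \<le> f y + real k * path_dist x y" by linarith
qed

lemma inf_conv_abs_le: "\<bar>inf_conv f k x\<bar> \<le> B + real k"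
proof -
  have "inf_conv f k x \<le> f (\<lambda>_. 0) + real k * path_dist x (\<lambda>_. 0)"
    by (rule inf_conv_le[OF cadlag_const])
  also have "\<dots> \<le> B + real k * 1"
    using bound[OF cadlag_const[of 0]] path_dist_le_1 by (intro add_mono mult_left_mono) auto
  finally show ?thesis using inf_conv_ge[of k x] by linarith
qed

lemma inf_conv_abs_le_cadlag: "x \<in> cadlag \<Longrightarrow> \<bar>inf_conv f k x\<bar> \<le> B"
  using inf_conv_ge[of k x] inf_conv_le_self[of x k] bound[of x] by linarith

lemma lip_functional_inf_conv: "lip_functional (inf_conv f k)"
proof -
  have "\<bar>inf_conv f k x - inf_conv f k y\<bar> \<le> real k * path_dist x y" for x y
    using inf_conv_lip[of k x y] inf_conv_lip[of k y x] by (simp add: path_dist_commute abs_le_iff)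
  then show ?thesis
    unfolding lip_functional_def using inf_conv_abs_le[of k] of_nat_0_le_iff[of k] by blast
qed

text \<open>A competitor \<open>y\<close> within \<open>e\<close> of \<open>x\<close> has
  \<open>f y\<close> close to \<open>f x\<close> by continuity. Any other pays at least
  \<open>k * e\<close>, which for large \<open>k\<close> exceeds the largest possible gain
  \<open>2 * B\<close>.\<close>

lemma inf_conv_tendsto:
  assumes cont: "continuous_map U_topology euclideanreal f" and x: "x \<in> cadlag"
  shows "(\<lambda>k. inf_conv f k x) \<longlonglongrightarrow> f x"
proof (rule LIMSEQ_I)
  fix r :: real assume r: "0 < r"
  have "openin U_topology {y \<in> topspace U_topology. f y \<in> {f x - r/2 <..< f x + r/2}}"
    using cont by (rule openin_continuous_map_preimage) auto
  moreover have "x \<in> {y \<in> topspace U_topology. f y \<in> {f x - r/2 <..< f x + r/2}}"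
    using x r by (simp add: topspace_U_topology)
  ultimately obtain T d where T: "T \<ge> 0" "d > 0"
    and sub: "{y\<in>cadlag. \<forall>t\<in>{0..T}. \<bar>y t - x t\<bar> < d} \<subseteq> {y \<in> topspace U_topology. f y \<in> {f x - r/2 <..< f x + r/2}}"
    unfolding openin_U_topology by blast
  \<comment> \<open>Small enough that \<open>path_dist x y < e\<close> forces distance below
    \<open>d\<close> on all of \<open>[0, T]\<close>: the radius is at most \<open>d\<close> and the
    horizon \<open>1/e\<close> at least \<open>T + 1\<close>.\<close>
  define e where "e = min (min 1 d) (1 / (T + 1))"
  have e: "0 < e" "e \<le> 1" "e \<le> d" using T by (auto simp: e_def)
  have Te: "T \<le> 1 / e" 
  proof -
    have "T + 1 \<le> 1 / e" using e T by (auto simp: e_def field_simps min_def)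
    then show ?thesis by simp
  qed
  obtain k0 :: nat where k0: "real k0 * e \<ge> 2 * B + 1" 
    using e(1) by (metis mult.commute ex_less_of_nat_mult less_eq_real_def)
  have "\<bar>inf_conv f k x - f x\<bar> < r" if k: "k \<ge> k0" for k
  proof -
    have "f x - r/2 \<le> inf_conv f k x"
    proof (rule inf_conv_greatest)
      fix y assume y: "y \<in> cadlag"
      show "f x - r/2 \<le> f y + real k * path_dist x y"
      proof (cases "path_dist x y < e")
        case True
        have "\<forall>t\<in>{0..T}. \<bar>y t - x t\<bar> < d"
        proof
          fix t assume "t \<in> {0..T}"
          then have "\<bar>x t - y t\<bar> < e" using path_dist_lessD[OF True e(2), of t] Te by auto
          then show "\<bar>y t - x t\<bar> < d" using e(3) by linarith
        qed
        then have "f y \<in> {f x - r/2 <..< f x + r/2}" using sub y by blast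
        moreover have "0 \<le> real k * path_dist x y" using path_dist_nonneg by simp
        ultimately show ?thesis by (simp add: )
      next
        case False
        then have "real k * path_dist x y \<ge> real k0 * e" using k e by (intro mult_mono) auto
        with k0 have "real k * path_dist x y \<ge> 2 * B" by linarith
        then show ?thesis using bound[OF y] bound[OF x] r by linarith
      qed
    qed
    then show ?thesis using inf_conv_le_self[OF x, of k] r by linarith
  qed
  then show "\<exists>no. \<forall>n\<ge>no. norm (inf_conv f n x - f x) < r" by auto
qed

end

text \<open>The real infimum over majorants is meaningful only for a nonempty set that is bounded
  below. Here the bound \<open>B\<close> provides a majorant, in the next lemma it provides the
  lower bound.\<close>

lemma (in prob_space) outer_expectation_ge:
  assumes h: "integrable M h" "AE \<omega> in M. h \<omega> \<le> g \<omega>" and B: "AE \<omega> in M. g \<omega> \<le> B"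
  shows "integral\<^sup>L M h \<le> outer_expectation M g"
  unfolding outer_expectation_def
proof (rule cInf_greatest)
  show "{integral\<^sup>L M h |h. integrable M h \<and> (AE \<omega> in M. g \<omega> \<le> h \<omega>)} \<noteq> {}"
    using B integrable_const[of B] by blast
next
  fix c assume "c \<in> {integral\<^sup>L M h |h. integrable M h \<and> (AE \<omega> in M. g \<omega> \<le> h \<omega>)}"
  then obtain h' where h': "c = integral\<^sup>L M h'" "integrable M h'" "AE \<omega> in M. g \<omega> \<le> h' \<omega>" by blast
  have "AE \<omega> in M. h \<omega> \<le> h' \<omega>" using h(2) h'(3) by eventually_elim simp
  then show "integral\<^sup>L M h \<le> c" unfolding h'(1) by (rule integral_mono_AE[OF h(1) h'(2)])
qed

lemma (in prob_space) outer_expectation_le: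
  assumes h: "integrable M h" "AE \<omega> in M. g \<omega> \<le> h \<omega>" and B: "AE \<omega> in M. B \<le> g \<omega>"
  shows "outer_expectation M g \<le> integral\<^sup>L M h"
  unfolding outer_expectation_def
proof (rule cInf_lower)
  show "bdd_below {integral\<^sup>L M h |h. integrable M h \<and> (AE \<omega> in M. g \<omega> \<le> h \<omega>)}"
  proof (rule bdd_belowI)
    fix c assume "c \<in> {integral\<^sup>L M h |h. integrable M h \<and> (AE \<omega> in M. g \<omega> \<le> h \<omega>)}"
    then obtain h' where h': "c = integral\<^sup>L M h'" "integrable M h'" "AE \<omega> in M. g \<omega> \<le> h' \<omega>" by blast
    have "AE \<omega> in M. B \<le> h' \<omega>" using B h'(3) by eventually_elim simp
    then have "integral\<^sup>L M (\<lambda>_. B) \<le> c" unfolding h'(1) by (intro integral_mono_AE h') auto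
    then show "B \<le> c" by (simp add: prob_space)
  qed
qed (use h in blast)

lemma (in prob_space) outer_expectation_eq:
  assumes u: "u \<in> borel_measurable M" "AE \<omega> in M. g \<omega> = u \<omega>" and B: "AE \<omega> in M. \<bar>g \<omega>\<bar> \<le> B"
  shows "outer_expectation M g = integral\<^sup>L M u"
proof -
  have "AE \<omega> in M. \<bar>u \<omega>\<bar> \<le> B" using u(2) B by eventually_elim simp
  then have "integrable M u" using u(1) by (intro integrable_const_bound[of _ B]) auto
  moreover have "AE \<omega> in M. g \<omega> \<le> u \<omega>" using u(2) by eventually_elim simp
  moreover have "AE \<omega> in M. u \<omega> \<le> g \<omega>" using u(2) by eventually_elim simp
  moreover have "AE \<omega> in M. g \<omega> \<le> B" "AE \<omega> in M. -B \<le> g \<omega>" using B by (eventually_elim, linarith)+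
  ultimately show ?thesis
    by (intro antisym outer_expectation_le outer_expectation_ge)
qed

text \<open>Only the limit has to turn bounded Lipschitz functionals into measurable functions up to
  a null set. For \<open>X n\<close>, an integrable minorant with nearly the right integral is
  enough.\<close>

lemma converges_in_distribution_U_I_lip:
  fixes X :: "nat \<Rightarrow> real \<Rightarrow> 'a \<Rightarrow> real" and Y :: "real \<Rightarrow> 'b \<Rightarrow> real"
  assumes "prob_space M" "prob_space N"
    and X: "\<And>n. AE \<omega> in M. (\<lambda>t. X n t \<omega>) \<in> cadlag"
    and Y: "AE \<omega> in N. (\<lambda>t. Y t \<omega>) \<in> cadlag"
    and lip: "\<And>g. lip_functional g \<Longrightarrow> \<exists>u. u \<in> borel_measurable N \<and> (AE \<omega> in N. g (\<lambda>t. Y t \<omega>) = u \<omega>) \<and>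
       (\<forall>e>0. \<forall>\<^sub>F n in sequentially. \<exists>h. integrable M h \<and> (AE \<omega> in M. h \<omega> \<le> g (\<lambda>t. X n t \<omega>)) \<and>
           integral\<^sup>L N u - e \<le> integral\<^sup>L M h)"
  shows "converges_in_distribution_U M X N Y"
proof -
  interpret M: prob_space M by fact
  interpret N: prob_space N by fact
  text \<open>It suffices to bound the lower expectations from below, for all functionals at once:
    the upper bound is the lower bound for the negated functional.\<close>
  have lower: "\<exists>u. u \<in> borel_measurable N \<and> (AE \<omega> in N. f (\<lambda>t. Y t \<omega>) = u \<omega>) \<and>
       (\<forall>e>0. \<forall>\<^sub>F n in sequentially. \<exists>h. integrable M h \<and> (AE \<omega> in M. h \<omega> \<le> f (\<lambda>t. X n t \<omega>)) \<and>
           integral\<^sup>L N u - e \<le> integral\<^sup>L M h)"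
    if cont: "continuous_map U_topology euclideanreal f" and B: "\<And>x. x \<in> cadlag \<Longrightarrow> \<bar>f x\<bar> \<le> B" for f B
  proof -
    have lf: "lip_functional (inf_conv f k)" for k by (rule lip_functional_inf_conv[where f=f and B=B, OF B])
    have "\<forall>k. \<exists>u. u \<in> borel_measurable N \<and> (AE \<omega> in N. inf_conv f k (\<lambda>t. Y t \<omega>) = u \<omega>) \<and>
       (\<forall>e>0. \<forall>\<^sub>F n in sequentially. \<exists>h. integrable M h \<and> (AE \<omega> in M. h \<omega> \<le> inf_conv f k (\<lambda>t. X n t \<omega>)) \<and>
           integral\<^sup>L N u - e \<le> integral\<^sup>L M h)"
      by (intro allI lip[OF lf])
    from choice[OF this] obtain u where "\<forall>k. u k \<in> borel_measurable N \<and>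
       (AE \<omega> in N. inf_conv f k (\<lambda>t. Y t \<omega>) = u k \<omega>) \<and>
       (\<forall>e>0. \<forall>\<^sub>F n in sequentially. \<exists>h. integrable M h \<and> (AE \<omega> in M. h \<omega> \<le> inf_conv f k (\<lambda>t. X n t \<omega>)) \<and>
           integral\<^sup>L N (u k) - e \<le> integral\<^sup>L M h)"
      by (rule exE)
    then have u: "\<And>k. u k \<in> borel_measurable N"
      "\<And>k. AE \<omega> in N. inf_conv f k (\<lambda>t. Y t \<omega>) = u k \<omega>"
      "\<And>k e. e > 0 \<Longrightarrow> \<forall>\<^sub>F n in sequentially. \<exists>h. integrable M h \<and> (AE \<omega> in M. h \<omega> \<le> inf_conv f k (\<lambda>t. X n t \<omega>)) \<and>
           integral\<^sup>L N (u k) - e \<le> integral\<^sup>L M h"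
      by simp_all
    \<comment> \<open>\<open>f\<close> is continuous only for a topology that is not separable, so
      measurability of \<open>f\<close> along \<open>Y\<close> is not automatic; as a limit of the
      measurable \<open>u k\<close> it holds up to a null set.\<close>
    define v where "v \<omega> = lim (\<lambda>k. u k \<omega>)" for \<omega>
    have v_meas: "v \<in> borel_measurable N" unfolding v_def using u(1) by measurable
    have uk: "AE \<omega> in N. \<forall>k. inf_conv f k (\<lambda>t. Y t \<omega>) = u k \<omega>" using u(2) by (simp add: AE_all_countable)
    have v_lim: "AE \<omega> in N. (\<lambda>k. u k \<omega>) \<longlonglongrightarrow> f (\<lambda>t. Y t \<omega>)"
      using uk Y
    proof eventually_elim
      case (elim \<omega>)
      then have "(\<lambda>k. u k \<omega>) = (\<lambda>k. inf_conv f k (\<lambda>t. Y t \<omega>))" by auto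
      then show ?case using inf_conv_tendsto[where f=f and B=B, OF B cont elim(2)] by simp
    qed
    then have v_eq: "AE \<omega> in N. f (\<lambda>t. Y t \<omega>) = v \<omega>"
      by eventually_elim (simp add: v_def limI)
    have conv: "(\<lambda>k. integral\<^sup>L N (u k)) \<longlonglongrightarrow> integral\<^sup>L N v"
    proof (rule integral_dominated_convergence[where w="\<lambda>_. B"])
      show "AE \<omega> in N. (\<lambda>k. u k \<omega>) \<longlonglongrightarrow> v \<omega>" using v_lim v_eq by eventually_elim simp
      show "AE \<omega> in N. norm (u k \<omega>) \<le> B" for k
        using uk Y
      proof eventually_elim
        case (elim \<omega>)
        show ?case using inf_conv_abs_le_cadlag[where f=f and B=B, OF B elim(2)] elim(1) by simp
      qed
    qed (use u v_meas in auto)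
    show ?thesis
    proof (intro exI[of _ v] conjI v_meas v_eq allI impI)
      fix e :: real assume e: "e > 0"
      obtain k where k: "\<bar>integral\<^sup>L N (u k) - integral\<^sup>L N v\<bar> < e/2"
        using LIMSEQ_D[OF conv, of "e/2"] e by fastforce
      have "\<forall>\<^sub>F n in sequentially. \<exists>h. integrable M h \<and> (AE \<omega> in M. h \<omega> \<le> inf_conv f k (\<lambda>t. X n t \<omega>)) \<and>
           integral\<^sup>L N (u k) - e/2 \<le> integral\<^sup>L M h" using u(3)[of "e/2" k] e by simp
      then show "\<forall>\<^sub>F n in sequentially. \<exists>h. integrable M h \<and> (AE \<omega> in M. h \<omega> \<le> f (\<lambda>t. X n t \<omega>)) \<and>
           integral\<^sup>L N v - e \<le> integral\<^sup>L M h"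
      proof eventually_elim
        case (elim n)
        then obtain h where h: "integrable M h" "AE \<omega> in M. h \<omega> \<le> inf_conv f k (\<lambda>t. X n t \<omega>)"
           "integral\<^sup>L N (u k) - e/2 \<le> integral\<^sup>L M h" by blast
        have "AE \<omega> in M. h \<omega> \<le> f (\<lambda>t. X n t \<omega>)"
          using h(2) X[of n] by eventually_elim (rule order_trans[OF _ inf_conv_le_self[where f=f and B=B, OF B]])
        moreover have "integral\<^sup>L N v - e \<le> integral\<^sup>L M h" using h(3) k by linarith
        ultimately show ?case using h(1) by blast
      qed
    qed
  qed
  show ?thesis
    unfolding converges_in_distribution_U_def
  proof (intro conjI allI impI)
    fix f :: "(real \<Rightarrow> real) \<Rightarrow> real"
    assume f: "continuous_map U_topology euclideanreal f \<and> bounded (f ` cadlag)"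
    then obtain B where B: "\<And>x. x \<in> cadlag \<Longrightarrow> \<bar>f x\<bar> \<le> B"
      unfolding bounded_iff by auto
    have cont': "continuous_map U_topology euclideanreal (\<lambda>x. - f x)"
      using f by (intro continuous_map_minus) auto
    obtain u where u: "u \<in> borel_measurable N" "AE \<omega> in N. f (\<lambda>t. Y t \<omega>) = u \<omega>"
       "\<And>e. e>0 \<Longrightarrow> \<forall>\<^sub>F n in sequentially. \<exists>h. integrable M h \<and> (AE \<omega> in M. h \<omega> \<le> f (\<lambda>t. X n t \<omega>)) \<and>
           integral\<^sup>L N u - e \<le> integral\<^sup>L M h" using lower[of f B] f B by blast
    obtain u' where u': "u' \<in> borel_measurable N" "AE \<omega> in N. - f (\<lambda>t. Y t \<omega>) = u' \<omega>"
       "\<And>e. e>0 \<Longrightarrow> \<forall>\<^sub>F n in sequentially. \<exists>h. integrable M h \<and> (AE \<omega> in M. h \<omega> \<le> - f (\<lambda>t. X n t \<omega>)) \<and>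
           integral\<^sup>L N u' - e \<le> integral\<^sup>L M h" using lower[of "\<lambda>x. - f x" B] cont' B by auto
    have bdY: "AE \<omega> in N. \<bar>f (\<lambda>t. Y t \<omega>)\<bar> \<le> B" using Y by eventually_elim (rule B)
    have uu': "integral\<^sup>L N u' = - integral\<^sup>L N u"
    proof -
      have "AE \<omega> in N. u' \<omega> = - u \<omega>" using u(2) u'(2) by eventually_elim simp
      then have "integral\<^sup>L N u' = integral\<^sup>L N (\<lambda>\<omega>. - u \<omega>)" using u(1) u'(1) by (intro integral_cong_AE) auto
      then show ?thesis by simp
    qed
    have bdX: "AE \<omega> in M. \<bar>f (\<lambda>t. X n t \<omega>)\<bar> \<le> B" for n using X[of n] by eventually_elim (rule B)
    have bdX': "AE \<omega> in M. f (\<lambda>t. X n t \<omega>) \<le> B" "AE \<omega> in M. - B \<le> f (\<lambda>t. X n t \<omega>)" for n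
      using bdX[of n] by (eventually_elim, linarith)+
    have "(\<lambda>n. outer_expectation M (\<lambda>\<omega>. f (\<lambda>t. X n t \<omega>))) \<longlonglongrightarrow> integral\<^sup>L N u"
    proof (rule LIMSEQ_I, unfold eventually_sequentially[symmetric])
      fix e :: real assume "e > 0"
      then have "e/2 > 0" by simp
      show "\<forall>\<^sub>F n in sequentially. norm (outer_expectation M (\<lambda>\<omega>. f (\<lambda>t. X n t \<omega>)) - integral\<^sup>L N u) < e"
        using u(3)[OF \<open>e/2 > 0\<close>] u'(3)[OF \<open>e/2 > 0\<close>]
      proof eventually_elim
        case (elim n)
        obtain h where h: "integrable M h" "AE \<omega> in M. h \<omega> \<le> f (\<lambda>t. X n t \<omega>)"
           "integral\<^sup>L N u - e/2 \<le> integral\<^sup>L M h" using elim by blast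
        obtain h' where h': "integrable M h'" "AE \<omega> in M. h' \<omega> \<le> - f (\<lambda>t. X n t \<omega>)"
           "integral\<^sup>L N u' - e/2 \<le> integral\<^sup>L M h'" using elim by blast
        have "integral\<^sup>L M h \<le> outer_expectation M (\<lambda>\<omega>. f (\<lambda>t. X n t \<omega>))"
          by (rule M.outer_expectation_ge[OF h(1,2) bdX'(1)])
        moreover have "outer_expectation M (\<lambda>\<omega>. f (\<lambda>t. X n t \<omega>)) \<le> integral\<^sup>L M (\<lambda>\<omega>. - h' \<omega>)"
        proof (rule M.outer_expectation_le[OF _ _ bdX'(2)])
          show "AE \<omega> in M. f (\<lambda>t. X n t \<omega>) \<le> - h' \<omega>" using h'(2) by eventually_elim linarith
        qed (use h' in simp)
        ultimately show ?case using h(3) h'(3) uu' \<open>e > 0\<close> by (auto simp: abs_if)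
      qed
    qed
    then show "(\<lambda>n. outer_expectation M (\<lambda>\<omega>. f (\<lambda>t. X n t \<omega>)))
          \<longlonglongrightarrow> outer_expectation N (\<lambda>\<omega>. f (\<lambda>t. Y t \<omega>))"
      using N.outer_expectation_eq[OF u(1,2) bdY] by simp
  qed (use X Y in auto)
qed

text \<open>The classical approximation scheme: \<open>X' j n\<close> tends to \<open>Y' j\<close>
  in law as \<open>n\<close> grows, \<open>Y' j\<close> tends to \<open>Y\<close>, and
  \<open>X' j n\<close> is close to \<open>X n\<close> in probability, first for \<open>n\<close>
  and then for \<open>j\<close> tending to infinity. In the application \<open>j\<close> is the
  fineness of a grid of mesh \<open>1/j\<close>, hence the exclusion of \<open>0\<close>.\<close>

lemma converges_in_distribution_U_I:
  fixes X :: "nat \<Rightarrow> real \<Rightarrow> 'a \<Rightarrow> real" and Y :: "real \<Rightarrow> 'b \<Rightarrow> real"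
    and X' :: "nat \<Rightarrow> nat \<Rightarrow> real \<Rightarrow> 'a \<Rightarrow> real" and Y' :: "nat \<Rightarrow> real \<Rightarrow> 'b \<Rightarrow> real"
  assumes "prob_space M" "prob_space N"
    and X: "\<And>n. AE \<omega> in M. (\<lambda>t. X n t \<omega>) \<in> cadlag"
    and Y: "AE \<omega> in N. (\<lambda>t. Y t \<omega>) \<in> cadlag"
    and Y': "AE \<omega> in N. (\<lambda>j. path_dist (\<lambda>t. Y' j t \<omega>) (\<lambda>t. Y t \<omega>)) \<longlonglongrightarrow> 0"
    and X': "\<And>e. e > 0 \<Longrightarrow> \<forall>\<^sub>F j in sequentially. \<forall>\<^sub>F n in sequentially. mostly M e (\<lambda>\<omega>. path_dist (\<lambda>t. X n t \<omega>) (\<lambda>t. X' j n t \<omega>) \<le> e)"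
    and meas: "\<And>g j n. lip_functional g \<Longrightarrow> j > 0 \<Longrightarrow> (\<lambda>\<omega>. g (\<lambda>t. X' j n t \<omega>)) \<in> borel_measurable M"
      "\<And>g j. lip_functional g \<Longrightarrow> j > 0 \<Longrightarrow> (\<lambda>\<omega>. g (\<lambda>t. Y' j t \<omega>)) \<in> borel_measurable N"
    and conv: "\<And>g j. lip_functional g \<Longrightarrow> j > 0 \<Longrightarrow> (\<lambda>n. \<integral>\<omega>. g (\<lambda>t. X' j n t \<omega>) \<partial>M) \<longlonglongrightarrow> (\<integral>\<omega>. g (\<lambda>t. Y' j t \<omega>) \<partial>N)"
  shows "converges_in_distribution_U M X N Y"
proof (rule converges_in_distribution_U_I_lip[OF assms(1,2) X Y])
  interpret M: prob_space M by fact
  interpret N: prob_space N by fact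
  fix g assume g: "lip_functional g"
  then obtain C B where C: "C \<ge> 0" "\<And>x y. \<bar>g x - g y\<bar> \<le> C * path_dist x y" and B: "\<And>x. \<bar>g x\<bar> \<le> B"
    unfolding lip_functional_def by blast
  have B0: "B \<ge> 0" using B[of "\<lambda>_. 0"] by simp
  \<comment> \<open>The shift to \<open>Suc j\<close> is there because measurability is assumed for
    positive indices only.\<close>
  define u where "u \<omega> = lim (\<lambda>j. g (\<lambda>t. Y' (Suc j) t \<omega>))" for \<omega>
  have u_meas: "u \<in> borel_measurable N" unfolding u_def using meas(2)[OF g] by measurable
  have lim: "AE \<omega> in N. (\<lambda>j. g (\<lambda>t. Y' (Suc j) t \<omega>)) \<longlonglongrightarrow> g (\<lambda>t. Y t \<omega>)"
    using Y'
  proof eventually_elim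
    case (elim \<omega>)
    have lim0: "(\<lambda>j. C * path_dist (\<lambda>t. Y' (Suc j) t \<omega>) (\<lambda>t. Y t \<omega>)) \<longlonglongrightarrow> 0"
      by (rule tendsto_mult_right_zero[OF LIMSEQ_Suc[OF elim]])
    have "(\<lambda>j. g (\<lambda>t. Y' (Suc j) t \<omega>) - g (\<lambda>t. Y t \<omega>)) \<longlonglongrightarrow> 0"
      by (rule Lim_null_comparison[OF always_eventually[OF allI] lim0]) (simp add: C(2))
    then show ?case by (rule LIM_zero_cancel)
  qed
  have u_eq: "AE \<omega> in N. g (\<lambda>t. Y t \<omega>) = u \<omega>"
    using lim by eventually_elim (simp add: u_def limI)
  have limint: "(\<lambda>j. \<integral>\<omega>. g (\<lambda>t. Y' (Suc j) t \<omega>) \<partial>N) \<longlonglongrightarrow> integral\<^sup>L N u"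
  proof (rule integral_dominated_convergence[where w="\<lambda>_. B"])
    show "AE \<omega> in N. (\<lambda>j. g (\<lambda>t. Y' (Suc j) t \<omega>)) \<longlonglongrightarrow> u \<omega>" using lim u_eq by eventually_elim simp
  qed (use meas(2)[OF g] u_meas B in auto)
  have "\<forall>\<^sub>F n in sequentially. \<exists>h. integrable M h \<and> (AE \<omega> in M. h \<omega> \<le> g (\<lambda>t. X n t \<omega>)) \<and>
           integral\<^sup>L N u - e \<le> integral\<^sup>L M h" if e: "e > 0" for e
  proof -
    \<comment> \<open>Off the exceptional set the functional moves by at most \<open>C * d\<close>,
      on it by at most \<open>2 * B\<close>; with this \<open>d\<close> the expected loss is at most
      \<open>e/3\<close>.\<close>
    define d where "d = e / (3 * (C + 2 * B + 1))"
    have d: "d > 0" "(C + 2 * B) * d \<le> e/3" using e C(1) B0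
      by (auto simp: d_def field_simps)
    have ev1: "\<forall>\<^sub>F j in sequentially. \<bar>(\<integral>\<omega>. g (\<lambda>t. Y' j t \<omega>) \<partial>N) - integral\<^sup>L N u\<bar> < e/3"
      using tendstoD[OF iffD1[OF filterlim_sequentially_Suc limint], of "e/3"] e by (simp add: dist_real_def)
    have "\<forall>\<^sub>F j in sequentially. (\<forall>\<^sub>F n in sequentially. mostly M d (\<lambda>\<omega>. path_dist (\<lambda>t. X n t \<omega>) (\<lambda>t. X' j n t \<omega>) \<le> d)) \<and> j > 0 \<and> 
        \<bar>(\<integral>\<omega>. g (\<lambda>t. Y' j t \<omega>) \<partial>N) - integral\<^sup>L N u\<bar> < e/3"
      using ev1 X'[OF d(1)] eventually_gt_at_top[of 0] by eventually_elim auto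
    then obtain j where j: "\<forall>\<^sub>F n in sequentially. mostly M d (\<lambda>\<omega>. path_dist (\<lambda>t. X n t \<omega>) (\<lambda>t. X' j n t \<omega>) \<le> d)"
       "\<bar>(\<integral>\<omega>. g (\<lambda>t. Y' j t \<omega>) \<partial>N) - integral\<^sup>L N u\<bar> < e/3" "j > 0"
      using eventually_happens by fastforce
    have ev2: "\<forall>\<^sub>F n in sequentially. \<bar>(\<integral>\<omega>. g (\<lambda>t. X' j n t \<omega>) \<partial>M) - (\<integral>\<omega>. g (\<lambda>t. Y' j t \<omega>) \<partial>N)\<bar> < e/3"
      using tendstoD[OF conv[OF g j(3)], of "e/3"] e by (simp add: dist_real_def)
    show ?thesis using j(1) ev2
    proof eventually_elim
      case (elim n)
      then obtain A where A: "A \<in> sets M" "measure M A \<le> d"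
        "AE \<omega> in M. \<omega> \<notin> A \<longrightarrow> path_dist (\<lambda>t. X n t \<omega>) (\<lambda>t. X' j n t \<omega>) \<le> d" by blast
      define h where "h \<omega> = g (\<lambda>t. X' j n t \<omega>) - C * d - 2 * B * indicator A \<omega>" for \<omega>
      have ig: "integrable M (\<lambda>\<omega>. g (\<lambda>t. X' j n t \<omega>))"
        using meas(1)[OF g j(3)] B by (intro M.integrable_const_bound[of _ B]) auto
      have iA: "integrable M (\<lambda>\<omega>. 2 * B * indicator A \<omega>)"
        using A(1) by (intro integrable_mult_right integrable_real_indicator) (auto simp: M.emeasure_eq_measure)
      have ih: "integrable M h" unfolding h_def using ig iA by auto
      have "AE \<omega> in M. h \<omega> \<le> g (\<lambda>t. X n t \<omega>)"
        using A(3)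
      proof eventually_elim
        case (elim \<omega>)
        show ?case
        proof (cases "\<omega> \<in> A")
          case True
          have "0 \<le> C * d" using C d by simp
          then show ?thesis using B[of "\<lambda>t. X' j n t \<omega>"] B[of "\<lambda>t. X n t \<omega>"] True unfolding h_def
            by (simp add: abs_le_iff)
        next
          case False
          have "\<bar>g (\<lambda>t. X n t \<omega>) - g (\<lambda>t. X' j n t \<omega>)\<bar> \<le> C * d"
            using C(2) elim False C(1) by (meson mult_left_mono order_trans)
          then show ?thesis using False unfolding h_def by (simp add: abs_le_iff)
        qed
      qed
      moreover have "integral\<^sup>L M h = (\<integral>\<omega>. g (\<lambda>t. X' j n t \<omega>) \<partial>M) - C * d - 2 * B * measure M A"
        unfolding h_def using ig iA A(1) by (simp add: M.prob_space)
      moreover have "C * d + 2 * B * measure M A \<le> e/3"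
      proof -
        have "C * d + 2 * B * measure M A \<le> C * d + 2 * B * d" using A(2) B0 by (intro add_left_mono mult_left_mono) auto
        also have "\<dots> \<le> e/3" using d(2) by (simp add: algebra_simps)
        finally show ?thesis .
      qed
      moreover have "integral\<^sup>L N u - e \<le> (\<integral>\<omega>. g (\<lambda>t. X' j n t \<omega>) \<partial>M) - e/3"
        using elim(2) j(2) by linarith
      ultimately show ?case using ih by (intro exI[of _ h]) auto
    qed
  qed
  then show "\<exists>u. u \<in> borel_measurable N \<and> (AE \<omega> in N. g (\<lambda>t. Y t \<omega>) = u \<omega>) \<and>
       (\<forall>e>0. \<forall>\<^sub>F n in sequentially. \<exists>h. integrable M h \<and> (AE \<omega> in M. h \<omega> \<le> g (\<lambda>t. X n t \<omega>)) \<and>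
           integral\<^sup>L N u - e \<le> integral\<^sup>L M h)"
    using u_meas u_eq by blast
qed

section \<open>Laplace transforms and increments\<close>

text \<open>With \<open>U = exp (- X)\<close> the hypothesis gives the moments of \<open>U\<close>.
  Induction on \<open>l\<close> by
  \<open>U^k (1 - U)^(l+1) = U^k (1 - U)^l - U^(k+1) (1 - U)^l\<close> yields the integrals of all
  Bernstein monomials.\<close>

lemma integral_exp_minus_moments:
  fixes X :: "'a \<Rightarrow> real" and Y :: "'b \<Rightarrow> real"
  assumes M: "prob_space M" "X \<in> borel_measurable M" "AE \<omega> in M. 0 \<le> X \<omega>"
    and N: "prob_space N" "Y \<in> borel_measurable N" "AE \<omega> in N. 0 \<le> Y \<omega>"
    and eq: "\<And>k::nat. (\<integral>\<omega>. exp (- real k * X \<omega>) \<partial>M) = (\<integral>\<omega>. exp (- real k * Y \<omega>) \<partial>N)"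
  shows "(\<integral>\<omega>. exp (- X \<omega>) ^ k * (1 - exp (- X \<omega>)) ^ l \<partial>M) = (\<integral>\<omega>. exp (- Y \<omega>) ^ k * (1 - exp (- Y \<omega>)) ^ l \<partial>N)"
proof -
  have int: "integrable P (\<lambda>\<omega>. exp (- Z \<omega>) ^ k * (1 - exp (- Z \<omega>)) ^ l)"
    if "prob_space P" "Z \<in> borel_measurable P" "AE \<omega> in P. 0 \<le> Z \<omega>" for P :: "'c measure" and Z :: "'c \<Rightarrow> real" and k l
  proof -
    interpret prob_space P by fact
    have "AE \<omega> in P. norm (exp (- Z \<omega>) ^ k * (1 - exp (- Z \<omega>)) ^ l) \<le> 1"
      using that(3)
    proof eventually_elim
      case (elim \<omega>)
      have "exp (- Z \<omega>) ^ k \<le> 1" "(1 - exp (- Z \<omega>)) ^ l \<le> 1" using elim by (auto intro!: power_le_one)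
      then show ?case using elim by (auto simp: abs_mult intro!: mult_le_one)
    qed
    then show ?thesis using that(2) by (intro integrable_const_bound[of _ 1]) auto
  qed
  show ?thesis
  proof (induction l arbitrary: k)
    case 0
    then show ?case using eq[of k] by (simp add: exp_of_nat_mult[symmetric])
  next
    case (Suc l)
    have step: "(\<integral>\<omega>. exp (- Z \<omega>) ^ k * (1 - exp (- Z \<omega>)) ^ Suc l \<partial>P) =
       (\<integral>\<omega>. exp (- Z \<omega>) ^ k * (1 - exp (- Z \<omega>)) ^ l \<partial>P) - (\<integral>\<omega>. exp (- Z \<omega>) ^ Suc k * (1 - exp (- Z \<omega>)) ^ l \<partial>P)"
      if "prob_space P" "Z \<in> borel_measurable P" "AE \<omega> in P. 0 \<le> Z \<omega>" for P :: "'c measure" and Z :: "'c \<Rightarrow> real"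
      by (subst Bochner_Integration.integral_diff[OF int[OF that] int[OF that], symmetric])
         (simp add: algebra_simps)
    show ?case unfolding step[OF M] step[OF N] using Suc by metis
  qed
qed

text \<open>The Hausdorff moment problem: \<open>exp (- X)\<close> lives in \<open>[0, 1]\<close>,
  where Bernstein polynomials approximate every continuous function uniformly. Taking cosine and
  sine gives equal characteristic functions, hence equal laws of \<open>exp (- X)\<close>, and
  \<open>- ln\<close> recovers \<open>X\<close>.\<close>

lemma distr_eq_if_Laplace_eq:
  fixes X :: "'a \<Rightarrow> real" and Y :: "'b \<Rightarrow> real"
  assumes M: "prob_space M" "X \<in> borel_measurable M" "AE \<omega> in M. 0 \<le> X \<omega>"
    and N: "prob_space N" "Y \<in> borel_measurable N" "AE \<omega> in N. 0 \<le> Y \<omega>"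
    and eq: "\<And>k::nat. (\<integral>\<omega>. exp (- real k * X \<omega>) \<partial>M) = (\<integral>\<omega>. exp (- real k * Y \<omega>) \<partial>N)"
  shows "distr M borel X = distr N borel Y"
proof -
  interpret M: prob_space M by fact
  interpret N: prob_space N by fact
  let ?U = "\<lambda>\<omega>. exp (- X \<omega>)" and ?V = "\<lambda>\<omega>. exp (- Y \<omega>)"
  have phi: "(\<integral>\<omega>. \<phi> (?U \<omega>) \<partial>M) = (\<integral>\<omega>. \<phi> (?V \<omega>) \<partial>N)"
    if cont: "continuous_on UNIV \<phi>" and bd: "\<And>x. \<bar>\<phi> x\<bar> \<le> 1" for \<phi> :: "real \<Rightarrow> real"
  proof -
    have [measurable]: "\<phi> \<in> borel_measurable borel" using cont by (rule borel_measurable_continuous_onI)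
    have close: "\<bar>(\<integral>\<omega>. \<phi> (exp (- Z \<omega>)) \<partial>P) - (\<integral>\<omega>. (\<Sum>k\<le>n. \<phi> (k/n) * Bernstein n k (exp (- Z \<omega>))) \<partial>P)\<bar> \<le> e"
      if P: "prob_space P" "Z \<in> borel_measurable P" "AE \<omega> in P. 0 \<le> Z \<omega>"
       and n: "\<And>x. x \<in> {0..1} \<Longrightarrow> \<bar>\<phi> x - (\<Sum>k\<le>n. \<phi> (k/n) * Bernstein n k x)\<bar> \<le> e"
      for P :: "'c measure" and Z :: "'c \<Rightarrow> real" and e n
    proof -
      interpret P: prob_space P by fact
      have [measurable]: "Z \<in> borel_measurable P" by fact
      have le: "AE \<omega> in P. \<bar>\<phi> (exp (- Z \<omega>)) - (\<Sum>k\<le>n. \<phi> (k/n) * Bernstein n k (exp (- Z \<omega>)))\<bar> \<le> e"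
        using P(3) by eventually_elim (rule n, auto)
      have i1: "integrable P (\<lambda>\<omega>. \<phi> (exp (- Z \<omega>)))"
        using bd by (intro P.integrable_const_bound[of _ 1]) auto
      have le': "AE \<omega> in P. norm (\<Sum>k\<le>n. \<phi> (k/n) * Bernstein n k (exp (- Z \<omega>))) \<le> e + 1"
        using le
      proof eventually_elim
        case (elim \<omega>)
        then show ?case using bd[of "exp (- Z \<omega>)"] by (simp add: abs_le_iff)
      qed
      have i2: "integrable P (\<lambda>\<omega>. (\<Sum>k\<le>n. \<phi> (k/n) * Bernstein n k (exp (- Z \<omega>))))"
        by (rule P.integrable_const_bound[OF le']) (simp add: Bernstein_def)
      have "\<bar>\<integral>\<omega>. \<phi> (exp (- Z \<omega>)) - (\<Sum>k\<le>n. \<phi> (k/n) * Bernstein n k (exp (- Z \<omega>))) \<partial>P\<bar> \<le>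
         (\<integral>\<omega>. \<bar>\<phi> (exp (- Z \<omega>)) - (\<Sum>k\<le>n. \<phi> (k/n) * Bernstein n k (exp (- Z \<omega>)))\<bar> \<partial>P)"
        by (rule integral_abs_bound)
      also have "\<dots> \<le> (\<integral>\<omega>. e \<partial>P)" using i1 i2 le by (intro integral_mono_AE) auto
      finally show ?thesis using i1 i2 by (simp add: P.prob_space)
    qed
    have bern: "(\<integral>\<omega>. (\<Sum>k\<le>n. \<phi> (k/n) * Bernstein n k (?U \<omega>)) \<partial>M) = (\<integral>\<omega>. (\<Sum>k\<le>n. \<phi> (k/n) * Bernstein n k (?V \<omega>)) \<partial>N)" for n
    proof -
      have int: "integrable P (\<lambda>\<omega>. \<phi> (k/n) * Bernstein n k (exp (- Z \<omega>)))"
        if P: "prob_space P" "Z \<in> borel_measurable P" "AE \<omega> in P. 0 \<le> Z \<omega>" and k: "k \<in> {..n}"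
          for P :: "'c measure" and Z :: "'c \<Rightarrow> real" and k
      proof -
        interpret P: prob_space P by fact
        have [measurable]: "Z \<in> borel_measurable P" by fact
        have "AE \<omega> in P. norm (\<phi> (k/n) * Bernstein n k (exp (- Z \<omega>))) \<le> 1"
          using P(3)
        proof eventually_elim
          case (elim \<omega>)
          have "Bernstein n k (exp (- Z \<omega>)) \<le> (\<Sum>k\<le>n. Bernstein n k (exp (- Z \<omega>)))"
            using k elim by (intro member_le_sum) (auto simp: Bernstein_nonneg)
          then have "Bernstein n k (exp (- Z \<omega>)) \<le> 1" by simp
          then show ?case using bd[of "k/n"] elim by (auto simp: abs_mult Bernstein_nonneg intro!: mult_le_one)
        qed
        then show ?thesis by (intro P.integrable_const_bound[of _ 1]) (auto simp: Bernstein_def)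
      qed
      have mom: "(\<integral>\<omega>. Bernstein n k (?U \<omega>) \<partial>M) = (\<integral>\<omega>. Bernstein n k (?V \<omega>) \<partial>N)" for k
        using integral_exp_minus_moments[OF M N eq, of k "n - k"]
        by (simp add: Bernstein_def mult.assoc)
      show ?thesis
        by (subst Bochner_Integration.integral_sum[OF int[OF M]], assumption)
           (subst Bochner_Integration.integral_sum[OF int[OF N]], assumption, simp add: mom)
    qed
    have "\<bar>(\<integral>\<omega>. \<phi> (?U \<omega>) \<partial>M) - (\<integral>\<omega>. \<phi> (?V \<omega>) \<partial>N)\<bar> \<le> 0 + e" if e: "e > 0" for e
    proof -
      obtain n where n: "\<And>x. x \<in> {0..1} \<Longrightarrow> \<bar>\<phi> x - (\<Sum>k\<le>n. \<phi> (k/n) * Bernstein n k x)\<bar> < e/2"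
        using Bernstein_Weierstrass[OF continuous_on_subset[OF cont subset_UNIV], of "e/2"] e by auto
      have n': "\<And>x. x \<in> {0..1} \<Longrightarrow> \<bar>\<phi> x - (\<Sum>k\<le>n. \<phi> (k/n) * Bernstein n k x)\<bar> \<le> e/2" using n by fastforce
      show ?thesis using close[OF M n'] close[OF N n'] bern[of n] by linarith
    qed
    then have "\<bar>(\<integral>\<omega>. \<phi> (?U \<omega>) \<partial>M) - (\<integral>\<omega>. \<phi> (?V \<omega>) \<partial>N)\<bar> \<le> 0" by (rule field_le_epsilon)
    then show ?thesis by simp
  qed
  have [measurable]: "X \<in> borel_measurable M" "Y \<in> borel_measurable N" by fact+
  have "distr M borel ?U = distr N borel ?V"
  proof (rule Levy_uniqueness)
    show "real_distribution (distr M borel ?U)" "real_distribution (distr N borel ?V)"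
      by (simp_all add: M.real_distribution_distr N.real_distribution_distr)
    show "char (distr M borel ?U) = char (distr N borel ?V)"
    proof
      fix t
      have 1: "char (distr P borel Z) t = complex_of_real (\<integral>\<omega>. cos (t * Z \<omega>) \<partial>P) + \<i> * complex_of_real (\<integral>\<omega>. sin (t * Z \<omega>) \<partial>P)"
        if "prob_space P" and [measurable]: "Z \<in> borel_measurable P" for P :: "'c measure" and Z :: "'c \<Rightarrow> real"
      proof -
        interpret P: prob_space P by fact
        have ii: "integrable P (\<lambda>\<omega>. iexp (t * Z \<omega>))"
          by (rule P.integrable_const_bound[of _ 1]) auto
        have "char (distr P borel Z) t = (\<integral>\<omega>. iexp (t * Z \<omega>) \<partial>P)"
          unfolding char_def by (simp add: integral_distr)
        also have "\<dots> = complex_of_real (\<integral>\<omega>. Re (iexp (t * Z \<omega>)) \<partial>P) + \<i> * complex_of_real (\<integral>\<omega>. Im (iexp (t * Z \<omega>)) \<partial>P)"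
          using integral_Re[OF ii] integral_Im[OF ii] by (simp add: complex_eq_iff)
        finally show ?thesis by (simp add: Re_exp Im_exp)
      qed
      have c: "continuous_on UNIV (\<lambda>u. cos (t * u))" "continuous_on UNIV (\<lambda>u. sin (t * u))"
        by (auto intro!: continuous_intros)
      show "char (distr M borel ?U) t = char (distr N borel ?V) t"
        using phi[OF c(1)] phi[OF c(2)] 
        by (subst 1[OF M(1)], simp, subst 1[OF N(1)], simp, simp)
    qed
  qed
  then have "distr (distr M borel ?U) borel (\<lambda>u. - ln u) = distr (distr N borel ?V) borel (\<lambda>u. - ln u)" by simp
  then show ?thesis by (simp add: distr_distr comp_def)
qed

text \<open>The padding by \<open>0\<close> makes the value a full sequence, so that the laws for
  all \<open>J\<close> live on one space, the Borel sets of \<open>nat => real\<close>.\<close>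

definition grid :: "(real \<Rightarrow> 'a \<Rightarrow> real) \<Rightarrow> real \<Rightarrow> nat \<Rightarrow> 'a \<Rightarrow> nat \<Rightarrow> real" where
  "grid X h J \<omega> k = (if k \<le> J then X (real k * h) \<omega> else 0)"

lemma grid_measurable:
  assumes "\<And>t. t \<ge> 0 \<Longrightarrow> X t \<in> borel_measurable M" "h \<ge> 0"
  shows "grid X h J \<in> borel_measurable M"
proof (rule measurable_coordinatewise_then_product)
  fix k show "(\<lambda>\<omega>. grid X h J \<omega> k) \<in> borel_measurable M"
    using assms by (cases "k \<le> J") (auto simp: grid_def)
qed

definition increments :: "(real \<Rightarrow> 'a \<Rightarrow> real) \<Rightarrow> real \<Rightarrow> nat \<Rightarrow> 'a \<Rightarrow> nat \<Rightarrow> real" where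
  "increments X h J \<omega> = (\<lambda>i\<in>{..<J}. X (real (Suc i) * h) \<omega> - X (real i * h) \<omega>)"

text \<open>Rebuilds \<open>grid X h J\<close> from \<open>increments X h J\<close> for a process
  that starts at \<open>0\<close>.\<close>

definition partial_sums :: "nat \<Rightarrow> (nat \<Rightarrow> real) \<Rightarrow> nat \<Rightarrow> real" where
  "partial_sums J x k = (if k \<le> J then \<Sum>i<k. x i else 0)"

lemma partial_sums_measurable:
  "partial_sums J \<in> borel_measurable (\<Pi>\<^sub>M i\<in>{..<J}. borel)"
proof (rule measurable_coordinatewise_then_product)
  fix k show "(\<lambda>x. partial_sums J x k) \<in> borel_measurable (\<Pi>\<^sub>M i\<in>{..<J}. borel)"
    by (cases "k \<le> J") (auto simp: partial_sums_def intro!: borel_measurable_sum measurable_component_singleton)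
qed

lemma levy_processD:
  assumes "levy_process M X"
  shows "prob_space M" "\<And>t. t \<ge> 0 \<Longrightarrow> X t \<in> borel_measurable M" "AE \<omega> in M. X 0 \<omega> = 0"
    "AE \<omega> in M. (\<lambda>t. X t \<omega>) \<in> cadlag"
    "\<And>t h. t \<ge> 0 \<Longrightarrow> h \<ge> 0 \<Longrightarrow> distr M borel (\<lambda>\<omega>. X (t + h) \<omega> - X t \<omega>) = distr M borel (X h)"
  using assms unfolding levy_process_def by auto

lemma levy_indep_increments:
  assumes "levy_process M X" "h \<ge> 0"
  shows "prob_space.indep_vars M (\<lambda>_. borel) (\<lambda>i \<omega>. X (real (Suc i) * h) \<omega> - X (real i * h) \<omega>) {..<J}"
proof -
  have "\<forall>n. \<forall>s :: nat \<Rightarrow> real. 0 \<le> s 0 \<and> (\<forall>i<n. s i \<le> s (Suc i)) \<longrightarrow>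
        prob_space.indep_vars M (\<lambda>_. borel) (\<lambda>i \<omega>. X (s (Suc i)) \<omega> - X (s i) \<omega>) {..<n}"
    using assms unfolding levy_process_def by blast
  from this[rule_format, of "\<lambda>i. real i * h" J] show ?thesis
    using assms(2) by (simp add: mult_right_mono)
qed

lemma levy_increments_distr:
  assumes "levy_process M X" "h \<ge> 0" and J: "J > 0"
  shows "distr M (\<Pi>\<^sub>M i\<in>{..<J}. borel) (increments X h J) = (\<Pi>\<^sub>M i\<in>{..<J}. distr M borel (X h))"
proof -
  interpret prob_space M using assms(1) by (rule levy_processD)
  have X: "X t \<in> borel_measurable M" if "t \<ge> 0" for t using levy_processD(2)[OF assms(1) that] .
  have "distr M (\<Pi>\<^sub>M i\<in>{..<J}. borel) (increments X h J) =
    (\<Pi>\<^sub>M i\<in>{..<J}. distr M borel (\<lambda>\<omega>. X (real (Suc i) * h) \<omega> - X (real i * h) \<omega>))"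
    unfolding increments_def
    by (rule iffD1[OF indep_vars_iff_distr_eq_PiM' levy_indep_increments[OF assms(1,2)]])
       (use J X assms in auto)
  also have "\<dots> = (\<Pi>\<^sub>M i\<in>{..<J}. distr M borel (X h))"
  proof (rule PiM_cong)
    fix i show "distr M borel (\<lambda>\<omega>. X (real (Suc i) * h) \<omega> - X (real i * h) \<omega>) = distr M borel (X h)"
      using levy_processD(5)[OF assms(1), of "real i * h" h] assms(2) by (simp add: algebra_simps)
  qed simp
  finally show ?thesis .
qed

lemma increments_measurable:
  assumes "\<And>t. t \<ge> 0 \<Longrightarrow> X t \<in> borel_measurable M" "h \<ge> 0"
  shows "increments X h J \<in> measurable M (\<Pi>\<^sub>M i\<in>{..<J}. borel)"
  unfolding increments_def
  by (intro measurable_restrict borel_measurable_diff assms(1)) (use assms(2) in auto)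

text \<open>The increments over cells of length \<open>h\<close> are independent copies of
  \<open>X h\<close>, so the law of \<open>X h\<close> alone fixes the law on the grid. This serves
  to compare processes living on different probability spaces.\<close>

lemma levy_grid_distr:
  assumes "levy_process M X" "h \<ge> 0" "J > 0"
  shows "distr M borel (grid X h J) = distr (\<Pi>\<^sub>M i\<in>{..<J}. distr M borel (X h)) borel (partial_sums J)"
proof -
  interpret prob_space M using assms(1) by (rule levy_processD)
  have X: "X t \<in> borel_measurable M" if "t \<ge> 0" for t using levy_processD(2)[OF assms(1) that] .
  have inc: "increments X h J \<in> measurable M (\<Pi>\<^sub>M i\<in>{..<J}. borel)"
    by (rule increments_measurable[OF X assms(2)])
  have "distr M borel (grid X h J) = distr M borel (partial_sums J \<circ> increments X h J)"
  proof (rule distr_cong_AE)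
    show "AE \<omega> in M. grid X h J \<omega> = (partial_sums J \<circ> increments X h J) \<omega>"
      using levy_processD(3)[OF assms(1)]
    proof eventually_elim
      case (elim \<omega>)
      show ?case
      proof
        fix k
        have "(\<Sum>i<k. X (real (Suc i) * h) \<omega> - X (real i * h) \<omega>) = X (real k * h) \<omega>"
          by (subst sum_lessThan_telescope) (simp add: elim)
        then show "grid X h J \<omega> k = (partial_sums J \<circ> increments X h J) \<omega> k"
          by (auto simp: grid_def partial_sums_def increments_def)
      qed
    qed
  qed (auto intro!: grid_measurable X assms inc measurable_comp[OF inc partial_sums_measurable])
  also have "\<dots> = distr (distr M (\<Pi>\<^sub>M i\<in>{..<J}. borel) (increments X h J)) borel (partial_sums J)"
    by (rule distr_distr[OF partial_sums_measurable inc, symmetric])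
  finally show ?thesis by (simp add: levy_increments_distr[OF assms])
qed

lemma stable_subordinatorD:
  assumes "stable_subordinator M \<alpha> \<sigma>"
  shows "levy_process M \<sigma>" "AE \<omega> in M. mono_on {0..} (\<lambda>t. \<sigma> t \<omega>)"
    "\<And>t z. t \<ge> 0 \<Longrightarrow> z \<ge> 0 \<Longrightarrow> (\<integral>\<omega>. exp (- z * \<sigma> t \<omega>) \<partial>M) = exp (- t * z powr \<alpha>)"
  using assms unfolding stable_subordinator_def by auto

lemma stable_subordinator_nonneg:
  assumes "stable_subordinator M \<alpha> \<sigma>"
  shows "AE \<omega> in M. \<forall>t\<ge>0. 0 \<le> \<sigma> t \<omega>"
  using stable_subordinatorD(2)[OF assms] levy_processD(3)[OF stable_subordinatorD(1)[OF assms]]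
proof eventually_elim
  case (elim \<omega>)
  show ?case
  proof (intro allI impI)
    fix t :: real assume "0 \<le> t"
    then show "0 \<le> \<sigma> t \<omega>" using mono_onD[OF elim(1), of 0 t] elim(2) by simp
  qed
qed

lemma stable_subordinator_grid_distr:
  assumes \<sigma>: "stable_subordinator M \<alpha> \<sigma>" and \<sigma>': "stable_subordinator N \<alpha> \<sigma>'" and h: "h \<ge> 0" and J: "J > 0"
  shows "distr M borel (grid \<sigma> h J) = distr N borel (grid \<sigma>' h J)"
proof -
  note L = stable_subordinatorD(1)[OF \<sigma>] stable_subordinatorD(1)[OF \<sigma>']
  have "distr M borel (\<sigma> h) = distr N borel (\<sigma>' h)"
  proof (rule distr_eq_if_Laplace_eq)
    show "AE \<omega> in M. 0 \<le> \<sigma> h \<omega>" "AE \<omega> in N. 0 \<le> \<sigma>' h \<omega>"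
      using stable_subordinator_nonneg[OF \<sigma>] stable_subordinator_nonneg[OF \<sigma>'] h by auto
    show "(\<integral>\<omega>. exp (- real k * \<sigma> h \<omega>) \<partial>M) = (\<integral>\<omega>. exp (- real k * \<sigma>' h \<omega>) \<partial>N)" for k
      using stable_subordinatorD(3)[OF \<sigma> h, of "real k"] stable_subordinatorD(3)[OF \<sigma>' h, of "real k"] by simp
  qed (use levy_processD[OF L(1)] levy_processD[OF L(2)] h in auto)
  then show ?thesis using levy_grid_distr[OF L(1) h J] levy_grid_distr[OF L(2) h J] by simp
qed

section \<open>Inverse subordinators\<close>

text \<open>Right continuity and unboundedness make the \<open>LEAST\<close> in the inverse exist;
  strict increase makes the inverse continuous.\<close>

definition subordinator_path :: "(real \<Rightarrow> real) \<Rightarrow> bool" where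
  "subordinator_path f \<longleftrightarrow> f 0 = 0 \<and> strict_mono_on {0..} f \<and> (\<forall>t\<ge>0. (f \<longlongrightarrow> f t) (at_right t)) \<and> (\<forall>c. \<exists>s\<ge>0. c \<le> f s)"

text \<open>The set of \<open>s\<close> with \<open>t \<le> f s\<close> is upward closed, and by
  right continuity it contains its infimum. The resulting equivalence, a Galois connection, is what
  later proofs use in place of the \<open>LEAST\<close>.\<close>

lemma subordinator_path_inverse:
  assumes f: "subordinator_path f" and t: "t \<ge> 0"
  defines "l \<equiv> \<lambda>t. LEAST s. 0 \<le> s \<and> t \<le> f s"
  shows "0 \<le> l t" and "s \<ge> 0 \<Longrightarrow> l t \<le> s \<longleftrightarrow> t \<le> f s"
proof -
  have mono: "f s \<le> f s'" if "0 \<le> s" "s \<le> s'" for s s'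
    using f that strict_mono_onD[of "{0..}" f s s'] unfolding subordinator_path_def by (cases "s = s'") auto
  define A where "A = {s. 0 \<le> s \<and> t \<le> f s}"
  have ne: "A \<noteq> {}" using f unfolding subordinator_path_def A_def by auto
  have bdd: "bdd_below A" unfolding A_def by (rule bdd_belowI[of _ 0]) auto
  have I0: "0 \<le> Inf A" using ne by (rule cInf_greatest) (auto simp: A_def)
  have "t \<le> f (Inf A)"
  proof (rule tendsto_lowerbound)
    show "(f \<longlongrightarrow> f (Inf A)) (at_right (Inf A))" using f I0 unfolding subordinator_path_def by auto
    have "t \<le> f s" if s: "Inf A < s" for s
    proof -
      obtain s' where "s' \<in> A" "s' < s" using cInf_lessD[OF ne s] by blast
      then show ?thesis using mono[of s' s] by (auto simp: A_def)
    qed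
    then show "\<forall>\<^sub>F s in at_right (Inf A). t \<le> f s"
      by (auto simp: eventually_at_right_field intro!: exI[of _ "Inf A + 1"])
  qed simp
  then have "Inf A \<in> A" using I0 by (simp add: A_def)
  then have l: "l t = Inf A"
    unfolding l_def by (intro Least_equality) (auto simp: A_def intro: cInf_lower[OF _ bdd, unfolded A_def])
  show "0 \<le> l t" using l I0 by simp
  show "l t \<le> s \<longleftrightarrow> t \<le> f s" if "s \<ge> 0"
  proof
    assume "l t \<le> s"
    then show "t \<le> f s" using mono[of "Inf A" s] I0 \<open>t \<le> f (Inf A)\<close> l by simp
  next
    assume "t \<le> f s"
    then show "l t \<le> s" unfolding l using that by (intro cInf_lower[OF _ bdd]) (simp add: A_def)
  qed
qed

definition time_change :: "(real \<Rightarrow> real) \<Rightarrow> bool" where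
  "time_change l \<longleftrightarrow> (\<forall>t\<ge>0. 0 \<le> l t) \<and> mono_on {0..} l \<and> continuous_on {0..} l"

text \<open>A jump of \<open>l\<close> would be an interval of constancy of \<open>f\<close>.
  Quantitatively, \<open>t < f (l t + e/2)\<close> bounds \<open>l\<close> from above near
  \<open>t\<close>, and \<open>f (l t - e) < t\<close> bounds it from below unless
  \<open>l t - e\<close> is negative, where nonnegativity of \<open>l\<close> suffices.\<close>

lemma time_changeI:
  assumes f: "subordinator_path f" and nn: "\<And>t. t \<ge> 0 \<Longrightarrow> 0 \<le> l t"
    and iff: "\<And>t s. t \<ge> 0 \<Longrightarrow> s \<ge> 0 \<Longrightarrow> l t \<le> s \<longleftrightarrow> t \<le> f s"
  shows "time_change l"
proof -
  have mono: "l t \<le> l t'" if "0 \<le> t" "t \<le> t'" for t t'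
  proof -
    have "t' \<le> f (l t')" using iff[of t' "l t'"] nn[of t'] that by simp
    then show ?thesis using iff[of t "l t'"] nn[of t'] that by simp
  qed
  have strict: "f s < f s'" if "0 \<le> s" "s < s'" for s s'
    using f that strict_mono_onD[of "{0..}" f s s'] unfolding subordinator_path_def by auto
  have "continuous_on {0..} l"
    unfolding continuous_on_iff
  proof (intro ballI allI impI)
    fix t e :: real assume t: "t \<in> {0..}" and e: "0 < e"
    then have lt: "0 \<le> l t" using nn by simp
    have "t \<le> f (l t)" using iff[of t "l t"] t lt by simp
    also have "\<dots> < f (l t + e/2)" using lt e by (intro strict) auto
    finally have up: "t < f (l t + e/2)" .
    define d1 where "d1 = f (l t + e/2) - t"
    obtain d2 where d2: "d2 > 0" "\<And>t'. t' \<ge> 0 \<Longrightarrow> t - d2 < t' \<Longrightarrow> l t - e < l t'"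
    proof (cases "l t - e \<ge> 0")
      case True
      have "\<not> l t \<le> l t - e" using e by simp
      then have *: "f (l t - e) < t" using iff[of t "l t - e"] t True by auto
      show ?thesis
      proof (rule that[of "t - f (l t - e)"])
        fix t' assume t': "t' \<ge> 0" "t - (t - f (l t - e)) < t'"
        then have "\<not> t' \<le> f (l t - e)" by simp
        then show "l t - e < l t'" using iff[of t' "l t - e"] True t' by auto
      qed (use * in simp)
    next
      case False
      show ?thesis
      proof (rule that[of 1])
        fix t' :: real assume "t' \<ge> 0"
        then show "l t - e < l t'" using nn[of t'] False by linarith
      qed simp
    qed
    show "\<exists>d>0. \<forall>x'\<in>{0..}. dist x' t < d \<longrightarrow> dist (l x') (l t) < e"
    proof (intro exI[of _ "min d1 d2"] conjI ballI impI)
      fix t' assume t': "t' \<in> {0..}" "dist t' t < min d1 d2"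
      then have "t' \<le> f (l t + e/2)" "t - d2 < t'" by (auto simp: d1_def dist_real_def)
      then have "l t' \<le> l t + e/2" "l t - e < l t'" using iff[of t' "l t + e/2"] d2(2)[of t'] t' lt e by auto
      then show "dist (l t') (l t) < e" using e by (simp add: dist_real_def abs_less_iff)
    qed (use up d2(1) in \<open>simp add: d1_def\<close>)
  qed
  then show ?thesis using nn mono by (auto simp: time_change_def mono_on_def)
qed

text \<open>Markov's inequality for \<open>exp (- z * \<sigma> t)\<close>. The parameter stays free:
  large \<open>z\<close> yields positive increments, \<open>z = 1\<close> unbounded paths, and
  \<open>z = 1 / c\<close> the growth of the inverse.\<close>

lemma stable_subordinator_tail:
  assumes \<sigma>: "stable_subordinator M \<alpha> \<sigma>" and "t \<ge> 0" "z \<ge> 0"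
  shows "measure M {\<omega>\<in>space M. \<sigma> t \<omega> \<le> c} \<le> exp (z * c - t * z powr \<alpha>)"
proof -
  note L = levy_processD[OF stable_subordinatorD(1)[OF \<sigma>]]
  interpret prob_space M by (rule L(1))
  have [measurable]: "\<sigma> t \<in> borel_measurable M" using L(2) assms by simp
  let ?A = "{\<omega>\<in>space M. \<sigma> t \<omega> \<le> c}"
  have A: "?A \<in> sets M" by measurable
  have "AE \<omega> in M. norm (exp (- z * \<sigma> t \<omega>)) \<le> 1"
    using stable_subordinator_nonneg[OF \<sigma>] by eventually_elim (use assms in auto)
  then have int: "integrable M (\<lambda>\<omega>. exp (- z * \<sigma> t \<omega>))" by (rule integrable_const_bound) simp
  have "measure M ?A * exp (- z * c) = (\<integral>\<omega>. indicator ?A \<omega> * exp (- z * c) \<partial>M)"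
    using A by simp
  also have "\<dots> \<le> (\<integral>\<omega>. exp (- z * \<sigma> t \<omega>) \<partial>M)"
  proof (rule integral_mono_AE[OF _ int])
    show "AE \<omega> in M. indicator ?A \<omega> * exp (- z * c) \<le> exp (- z * \<sigma> t \<omega>)"
      using assms(3) by (intro AE_I2) (auto simp: indicator_def mult_left_mono)
    show "integrable M (\<lambda>\<omega>. indicator ?A \<omega> * exp (- z * c))"
      using A by (intro integrable_mult_left integrable_real_indicator) (auto simp: emeasure_eq_measure)
  qed
  also have "\<dots> = exp (- t * z powr \<alpha>)" using stable_subordinatorD(3)[OF \<sigma> assms(2,3)] .
  finally have "measure M ?A * exp (- z * c) * exp (z * c) \<le> exp (- t * z powr \<alpha>) * exp (z * c)"
    by (intro mult_right_mono) auto
  then show ?thesis by (simp add: mult.assoc flip: exp_add)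
qed

text \<open>An increment is almost surely positive by the tail bound with \<open>c = 0\<close> and
  \<open>z\<close> tending to infinity. This holds for all pairs of rationals at once, and since
  paths are nondecreasing, two rationals between \<open>s\<close> and \<open>t\<close> give it for
  all reals. For unboundedness, integer times and levels are enough.\<close>

lemma stable_subordinator_subordinator_path:
  assumes \<sigma>: "stable_subordinator M \<alpha> \<sigma>" and \<alpha>: "0 < \<alpha>"
  shows "AE \<omega> in M. subordinator_path (\<lambda>t. \<sigma> t \<omega>)"
proof -
  note L = levy_processD[OF stable_subordinatorD(1)[OF \<sigma>]]
  interpret prob_space M by (rule L(1))
  have strict: "AE \<omega> in M. \<sigma> q \<omega> < \<sigma> r \<omega>" if "0 \<le> q" "q < r" for q r
  proof -
    have [measurable]: "\<sigma> q \<in> borel_measurable M" "\<sigma> r \<in> borel_measurable M" "\<sigma> (r - q) \<in> borel_measurable M"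
      using L(2) that by auto
    have d: "distr M borel (\<lambda>\<omega>. \<sigma> r \<omega> - \<sigma> q \<omega>) = distr M borel (\<sigma> (r - q))"
      using L(5)[of q "r - q"] that by simp
    have "measure M {\<omega>\<in>space M. \<sigma> (r - q) \<omega> \<le> 0} \<le> 0"
    proof (rule tendsto_lowerbound[OF _ eventually_mono[OF eventually_ge_at_top[of 0]]])
      show "((\<lambda>z. exp (- ((r - q) * z powr \<alpha>))) \<longlongrightarrow> 0) (at_top :: real filter)"
      proof -
        have "r - q > 0" using that by simp
        then show ?thesis using \<alpha> by real_asymp
      qed
      show "measure M {\<omega>\<in>space M. \<sigma> (r - q) \<omega> \<le> 0} \<le> exp (- ((r - q) * z powr \<alpha>))" if "0 \<le> z" for z :: real
        using stable_subordinator_tail[OF \<sigma>, of "r - q" z 0] \<open>q < r\<close> that by simp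
    qed simp
    then have "measure (distr M borel (\<sigma> (r - q))) {..0} = 0"
      by (subst measure_distr) (auto simp: vimage_def Int_def conj_commute measure_le_0_iff)
    then have "measure M {\<omega>\<in>space M. \<sigma> r \<omega> - \<sigma> q \<omega> \<le> 0} = 0"
      unfolding d[symmetric] by (subst (asm) measure_distr) (auto simp: vimage_def Int_def conj_commute)
    then have "AE \<omega> in M. \<not> (\<sigma> r \<omega> - \<sigma> q \<omega> \<le> 0)"
      by (subst (asm) prob_eq_0) auto
    then show ?thesis by eventually_elim simp
  qed
  have strictQ: "AE \<omega> in M. \<forall>q r :: rat. 0 \<le> q \<longrightarrow> q < r \<longrightarrow> \<sigma> (of_rat q) \<omega> < \<sigma> (of_rat r) \<omega>"
    unfolding AE_all_countable by (intro allI AE_impI strict) (auto simp: of_rat_less)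
  have unb: "AE \<omega> in M. \<exists>k::nat. real c < \<sigma> (real k) \<omega>" for c :: nat
  proof -
    have [measurable]: "\<sigma> (real k) \<in> borel_measurable M" for k using L(2) by simp
    have "measure M {\<omega>\<in>space M. \<not> (\<exists>k::nat. real c < \<sigma> (real k) \<omega>)} \<le> 0"
    proof (rule tendsto_lowerbound[OF _ always_eventually[OF allI]])
      show "((\<lambda>k. exp (real c - real k)) \<longlongrightarrow> 0) sequentially"
        by real_asymp
      show "measure M {\<omega>\<in>space M. \<not> (\<exists>k::nat. real c < \<sigma> (real k) \<omega>)} \<le> exp (real c - real k)" for k
      proof -
        have "measure M {\<omega>\<in>space M. \<not> (\<exists>k::nat. real c < \<sigma> (real k) \<omega>)} \<le> measure M {\<omega>\<in>space M. \<sigma> (real k) \<omega> \<le> real c}"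
          by (intro finite_measure_mono) (auto simp: not_less)
        also have "\<dots> \<le> exp (real c - real k)" using stable_subordinator_tail[OF \<sigma>, of "real k" 1 "real c"] by simp
        finally show ?thesis .
      qed
    qed simp
    then have "measure M {\<omega>\<in>space M. \<not> (\<exists>k::nat. real c < \<sigma> (real k) \<omega>)} = 0" by (simp add: measure_le_0_iff)
    then show ?thesis by (subst (asm) prob_eq_0) auto
  qed
  have unb': "AE \<omega> in M. \<forall>c::nat. \<exists>k::nat. real c < \<sigma> (real k) \<omega>"
    unfolding AE_all_countable by (intro allI unb)
  show ?thesis using L(3,4) stable_subordinatorD(2)[OF \<sigma>] strictQ unb'
  proof eventually_elim
    case (elim \<omega>)
    have "strict_mono_on {0..} (\<lambda>t. \<sigma> t \<omega>)"
    proof (rule strict_mono_onI)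
      fix s t :: real assume st: "s \<in> {0..}" "t \<in> {0..}" "s < t"
      obtain q where q: "s < of_rat q" "of_rat q < (s + t) / 2" using of_rat_dense[of s "(s + t)/2"] st by auto
      obtain r where r: "(s + t) / 2 < of_rat r" "of_rat r < t" using of_rat_dense[of "(s + t)/2" t] st by auto
      have "0 \<le> real_of_rat q" "real_of_rat q < of_rat r"
        using q(1) st(1) less_trans[OF q(2) r(1)] by (auto simp del: zero_le_of_rat_iff of_rat_less)
      then have "0 \<le> q" "q < r" by (auto simp: of_rat_less)
      then have "\<sigma> (of_rat q) \<omega> < \<sigma> (of_rat r) \<omega>" using elim by blast
      moreover have "\<sigma> s \<omega> \<le> \<sigma> (of_rat q) \<omega>" "\<sigma> (of_rat r) \<omega> \<le> \<sigma> t \<omega>"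
        using mono_onD[OF elim(3), of s "of_rat q"] mono_onD[OF elim(3), of "of_rat r" t] q r st \<open>0 \<le> q\<close> \<open>q < r\<close> by auto
      ultimately show "\<sigma> s \<omega> < \<sigma> t \<omega>" by simp
    qed
    moreover have "\<exists>s\<ge>0. c \<le> \<sigma> s \<omega>" for c
    proof -
      obtain k where "real (nat \<lceil>c\<rceil>) < \<sigma> (real k) \<omega>" using elim(5) by blast
      then show ?thesis using real_nat_ceiling_ge[of c] by (intro exI[of _ "real k"]) simp
    qed
    ultimately show ?case using elim(1,2) by (auto simp: subordinator_path_def cadlag_def)
  qed
qed

lemma inverse_stable_subordinatorE:
  assumes L: "inverse_stable_subordinator M \<alpha> L" and \<alpha>: "0 < \<alpha>"
  obtains \<sigma> where "stable_subordinator M \<alpha> \<sigma>" "\<And>t. t \<ge> 0 \<Longrightarrow> L t \<in> borel_measurable M"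
    "AE \<omega> in M. \<forall>t\<ge>0. \<forall>s\<ge>0. L t \<omega> \<le> s \<longleftrightarrow> t \<le> \<sigma> s \<omega>"
    "AE \<omega> in M. time_change (\<lambda>t. L t \<omega>)"
proof -
  from L obtain \<sigma> where \<sigma>: "stable_subordinator M \<alpha> \<sigma>" and m: "\<And>t. t \<ge> 0 \<Longrightarrow> L t \<in> borel_measurable M"
    and least: "AE \<omega> in M. \<forall>t\<ge>0. L t \<omega> = (LEAST s. s \<ge> 0 \<and> \<sigma> s \<omega> \<ge> t)"
    unfolding inverse_stable_subordinator_def by blast
  have "AE \<omega> in M. (\<forall>t\<ge>0. \<forall>s\<ge>0. L t \<omega> \<le> s \<longleftrightarrow> t \<le> \<sigma> s \<omega>) \<and> time_change (\<lambda>t. L t \<omega>)"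
    using least stable_subordinator_subordinator_path[OF \<sigma> \<alpha>]
  proof eventually_elim
    case (elim \<omega>)
    have 1: "L t \<omega> \<le> s \<longleftrightarrow> t \<le> \<sigma> s \<omega>" if "t \<ge> 0" "s \<ge> 0" for t s
      using subordinator_path_inverse(2)[OF elim(2) that] elim(1) that by simp
    have 2: "0 \<le> L t \<omega>" if "t \<ge> 0" for t
      using subordinator_path_inverse(1)[OF elim(2) that] elim(1) that by simp
    show ?case using time_changeI[OF elim(2), of "\<lambda>t. L t \<omega>"] 1 2 by blast
  qed
  then have "AE \<omega> in M. \<forall>t\<ge>0. \<forall>s\<ge>0. L t \<omega> \<le> s \<longleftrightarrow> t \<le> \<sigma> s \<omega>" "AE \<omega> in M. time_change (\<lambda>t. L t \<omega>)"
    by (eventually_elim, blast)+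
  then show thesis using that[OF \<sigma> m] by blast
qed

section \<open>Self-similarity and the discretised time change\<close>

lemma levy_process_scale:
  assumes X: "levy_process M X" and c: "c > 0"
  shows "levy_process M (\<lambda>t \<omega>. a * X (c * t) \<omega>)"
proof -
  note L = levy_processD[OF X]
  interpret prob_space M by (rule L(1))
  show ?thesis unfolding levy_process_def
  proof (intro conjI allI impI)
    show "AE \<omega> in M. a * X (c * 0) \<omega> = 0" using L(3) by auto
    show "AE \<omega> in M. (\<lambda>t. a * X (c * t) \<omega>) \<in> cadlag"
      using L(4)
    proof eventually_elim
      case (elim \<omega>)
      have fl: "filterlim (\<lambda>t. c * t) (at_right (c * t)) (at_right t)" for t
        using c by (auto simp: filterlim_at eventually_at_right_field intro!: tendsto_intros exI[of _ "t+1"])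
      have fr: "filterlim (\<lambda>t. c * t) (at_left (c * t)) (at_left t)" for t
        using c by (auto simp: filterlim_at eventually_at_left_field intro!: tendsto_intros exI[of _ "t-1"])
      have 1: "((\<lambda>t. a * X (c * t) \<omega>) \<longlongrightarrow> a * X (c * t) \<omega>) (at_right t)" if "t \<ge> 0" for t
      proof -
        have "((\<lambda>s. X s \<omega>) \<longlongrightarrow> X (c * t) \<omega>) (at_right (c * t))" using elim that c by (auto simp: cadlag_def)
        from tendsto_mult[OF tendsto_const filterlim_compose[OF this fl]] show ?thesis .
      qed
      have 2: "\<exists>l. ((\<lambda>t. a * X (c * t) \<omega>) \<longlongrightarrow> l) (at_left t)" if "t > 0" for t
      proof -
        have "0 < c * t" using c that by simp
        then obtain l where "((\<lambda>s. X s \<omega>) \<longlongrightarrow> l) (at_left (c * t))" using elim unfolding cadlag_def by blast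
        from tendsto_mult[OF tendsto_const filterlim_compose[OF this fr]] show ?thesis by blast
      qed
      show ?case unfolding cadlag_def using 1 2 by blast
    qed
    fix n and s :: "nat \<Rightarrow> real" assume s: "0 \<le> s 0 \<and> (\<forall>i<n. s i \<le> s (Suc i))"
    have "\<forall>n. \<forall>s :: nat \<Rightarrow> real. 0 \<le> s 0 \<and> (\<forall>i<n. s i \<le> s (Suc i)) \<longrightarrow>
        prob_space.indep_vars M (\<lambda>_. borel) (\<lambda>i \<omega>. X (s (Suc i)) \<omega> - X (s i) \<omega>) {..<n}"
      using X unfolding levy_process_def by blast
    from this[rule_format, of "\<lambda>i. c * s i" n] 
    have "indep_vars (\<lambda>_. borel) (\<lambda>i \<omega>. X (c * s (Suc i)) \<omega> - X (c * s i) \<omega>) {..<n}"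
      using s c by auto
    from indep_vars_compose2[OF this, of "\<lambda>_ x. a * x" "\<lambda>_. borel"]
    show "indep_vars (\<lambda>_. borel) (\<lambda>i \<omega>. a * X (c * s (Suc i)) \<omega> - a * X (c * s i) \<omega>) {..<n}"
      by (simp add: right_diff_distrib)
  next
    fix t h :: real assume th: "t \<ge> 0" "h \<ge> 0"
    have [measurable]: "X (c * t) \<in> borel_measurable M" "X (c * (t + h)) \<in> borel_measurable M" "X (c * h) \<in> borel_measurable M"
      using L(2) c th by auto
    have "distr M borel (\<lambda>\<omega>. a * X (c * (t + h)) \<omega> - a * X (c * t) \<omega>) =
       distr (distr M borel (\<lambda>\<omega>. X (c * (t + h)) \<omega> - X (c * t) \<omega>)) borel (\<lambda>x. a * x)"
      by (subst distr_distr) (auto simp: comp_def right_diff_distrib)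
    also have "distr M borel (\<lambda>\<omega>. X (c * (t + h)) \<omega> - X (c * t) \<omega>) = distr M borel (X (c * h))"
      using L(5)[of "c * t" "c * h"] c th by (simp add: algebra_simps)
    also have "distr (distr M borel (X (c * h))) borel (\<lambda>x. a * x) = distr M borel (\<lambda>\<omega>. a * X (c * h) \<omega>)"
      by (subst distr_distr) (auto simp: comp_def)
    finally show "distr M borel (\<lambda>\<omega>. a * X (c * (t + h)) \<omega> - a * X (c * t) \<omega>) = distr M borel (\<lambda>\<omega>. a * X (c * h) \<omega>)" .
  qed (use L c prob_space_axioms in auto)
qed

text \<open>The factor is forced by the Laplace exponent: stretching time contributes
  \<open>c\<close>, and \<open>(z * c powr (- 1 / \<alpha>)) powr \<alpha>\<close> contributes
  \<open>1 / c\<close>.\<close>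

lemma stable_subordinator_scale:
  assumes \<sigma>: "stable_subordinator M \<alpha> \<sigma>" and c: "c > 0" and \<alpha>: "\<alpha> > 0"
  shows "stable_subordinator M \<alpha> (\<lambda>t \<omega>. c powr (- 1 / \<alpha>) * \<sigma> (c * t) \<omega>)"
  unfolding stable_subordinator_def
proof (intro conjI allI impI)
  show "levy_process M (\<lambda>t \<omega>. c powr (- 1 / \<alpha>) * \<sigma> (c * t) \<omega>)"
    by (rule levy_process_scale[OF stable_subordinatorD(1)[OF \<sigma>] c])
  show "AE \<omega> in M. mono_on {0..} (\<lambda>t. c powr (- 1 / \<alpha>) * \<sigma> (c * t) \<omega>)"
    using stable_subordinatorD(2)[OF \<sigma>]
    by eventually_elim (use c in \<open>auto simp: mono_on_def intro!: mult_left_mono\<close>)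
  fix t z :: real assume tz: "t \<ge> 0" "z \<ge> 0"
  have "(\<integral>\<omega>. exp (- z * (c powr (- 1 / \<alpha>) * \<sigma> (c * t) \<omega>)) \<partial>M) = exp (- (c * t) * (z * c powr (- 1 / \<alpha>)) powr \<alpha>)"
    using stable_subordinatorD(3)[OF \<sigma>, of "c * t" "z * c powr (- 1 / \<alpha>)"] tz c by (simp add: mult.assoc)
  also have "(z * c powr (- 1 / \<alpha>)) powr \<alpha> = z powr \<alpha> * c powr (- 1 / \<alpha> * \<alpha>)"
    using tz by (simp only: powr_mult powr_powr)
  also have "c powr (- 1 / \<alpha> * \<alpha>) = 1 / c" using c \<alpha> by (simp add: powr_neg_one)
  finally show "(\<integral>\<omega>. exp (- z * (c powr (- 1 / \<alpha>) * \<sigma> (c * t) \<omega>)) \<partial>M) = exp (- t * z powr \<alpha>)"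
    using c by simp
qed

lemma inverse_stable_subordinator_scale:
  assumes L: "inverse_stable_subordinator M \<alpha> L" and c: "c > 0" and \<alpha>: "\<alpha> > 0"
  shows "inverse_stable_subordinator M \<alpha> (\<lambda>t \<omega>. L (c powr (1 / \<alpha>) * t) \<omega> / c)"
proof -
  obtain \<sigma> where \<sigma>: "stable_subordinator M \<alpha> \<sigma>" "\<And>t. t \<ge> 0 \<Longrightarrow> L t \<in> borel_measurable M"
    and iff: "AE \<omega> in M. \<forall>t\<ge>0. \<forall>s\<ge>0. L t \<omega> \<le> s \<longleftrightarrow> t \<le> \<sigma> s \<omega>"
    and good: "AE \<omega> in M. time_change (\<lambda>t. L t \<omega>)" using inverse_stable_subordinatorE[OF L \<alpha>] by blast
  have p: "c powr (1 / \<alpha>) > 0" using c by simp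
  have pp: "c powr (- 1 / \<alpha>) = 1 / c powr (1 / \<alpha>)" by (simp add: powr_minus divide_inverse)
  have "AE \<omega> in M. \<forall>t\<ge>0. L (c powr (1 / \<alpha>) * t) \<omega> / c = (LEAST s. s \<ge> 0 \<and> c powr (- 1 / \<alpha>) * \<sigma> (c * s) \<omega> \<ge> t)"
    using iff good
  proof eventually_elim
    case (elim \<omega>)
    show ?case
    proof (intro allI impI)
      fix t :: real assume t: "t \<ge> 0"
      define u where "u = c powr (1 / \<alpha>) * t"
      have u: "u \<ge> 0" "L u \<omega> \<ge> 0" using t elim(2) by (auto simp: u_def time_change_def)
      have iff': "c powr (- 1 / \<alpha>) * \<sigma> (c * s) \<omega> \<ge> t \<longleftrightarrow> L u \<omega> \<le> c * s" if "s \<ge> 0" for s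
        using elim(1)[rule_format, of u "c * s"] u c that p unfolding pp u_def by (simp add: field_simps)
      have "(LEAST s. s \<ge> 0 \<and> c powr (- 1 / \<alpha>) * \<sigma> (c * s) \<omega> \<ge> t) = L u \<omega> / c"
      proof (rule Least_equality)
        show "0 \<le> L u \<omega> / c \<and> t \<le> c powr (- 1 / \<alpha>) * \<sigma> (c * (L u \<omega> / c)) \<omega>"
          using iff'[of "L u \<omega> / c"] u c by simp
        show "L u \<omega> / c \<le> s" if "0 \<le> s \<and> t \<le> c powr (- 1 / \<alpha>) * \<sigma> (c * s) \<omega>" for s
          using iff'[of s] that c by (simp add: field_simps)
      qed
      then show "L (c powr (1 / \<alpha>) * t) \<omega> / c = (LEAST s. s \<ge> 0 \<and> c powr (- 1 / \<alpha>) * \<sigma> (c * s) \<omega> \<ge> t)"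
        by (simp add: u_def)
    qed
  qed
  moreover have "\<forall>t\<ge>0. (\<lambda>\<omega>. L (c powr (1 / \<alpha>) * t) \<omega> / c) \<in> borel_measurable M"
    using \<sigma>(2) p by (auto intro!: borel_measurable_divide)
  ultimately show ?thesis
    unfolding inverse_stable_subordinator_def using stable_subordinator_scale[OF \<sigma>(1) c \<alpha>] by blast
qed

text \<open>Since \<open>L t \<le> s\<close> iff \<open>t \<le> \<sigma> s\<close>, rounding up (and not down) makes these indices functions of
  the values of the subordinator on the grid \<open>k / j\<close>.\<close>

definition rounded :: "(real \<Rightarrow> 'a \<Rightarrow> real) \<Rightarrow> nat \<Rightarrow> nat \<Rightarrow> 'a \<Rightarrow> nat \<Rightarrow> nat" where
  "rounded L j J \<omega> i = (if i \<le> J then min (nat \<lceil>real j * L (real i / real j) \<omega>\<rceil>) J else 0)"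

definition index_set :: "nat \<Rightarrow> (nat \<Rightarrow> nat) set" where
  "index_set J = {\<kappa>. (\<forall>i\<le>J. \<kappa> i \<le> J) \<and> (\<forall>i>J. \<kappa> i = 0)}"

lemma finite_index_set: "finite (index_set J)"
proof -
  have "index_set J = {f. \<forall>x. (x \<in> {..J} \<longrightarrow> f x \<in> {..J}) \<and> (x \<notin> {..J} \<longrightarrow> f x = 0)}"
    by (auto simp: index_set_def not_le)
  then show ?thesis using finite_set_of_finite_funs[of "{..J}" "{..J}" "0::nat"] by simp
qed

lemma rounded_in_index_set: "rounded L j J \<omega> \<in> index_set J"
  by (simp add: rounded_def index_set_def)

lemma measurable_index_set:
  assumes "\<And>i. (\<lambda>\<omega>. \<kappa> \<omega> i) \<in> measurable M (count_space UNIV)" "\<And>\<omega>. \<kappa> \<omega> \<in> index_set J"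
  shows "\<kappa> \<in> measurable M (count_space (index_set J))"
proof -
  have "\<kappa> -` {a} \<inter> space M \<in> sets M" for a
  proof -
    have "\<kappa> -` {a} \<inter> space M = (\<Inter>i. (\<lambda>\<omega>. \<kappa> \<omega> i) -` {a i} \<inter> space M)" by auto
    also have "\<dots> \<in> sets M" by (intro sets.countable_INT) (auto intro!: measurable_sets[OF assms(1)])
    finally show ?thesis .
  qed
  then show ?thesis using assms(2) by (subst measurable_count_space_eq2[OF finite_index_set]) auto
qed

lemma rounded_measurable:
  assumes "\<And>t. t \<ge> 0 \<Longrightarrow> L t \<in> borel_measurable M"
  shows "rounded L j J \<in> measurable M (count_space (index_set J))"
proof (rule measurable_index_set[OF _ rounded_in_index_set])
  fix i
  have [measurable]: "L (real i / real j) \<in> borel_measurable M" using assms by simp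
  show "(\<lambda>\<omega>. rounded L j J \<omega> i) \<in> measurable M (count_space UNIV)" unfolding rounded_def by measurable
qed

text \<open>For a natural number \<open>k\<close>, the value \<open>j * H (i/j)\<close> rounded up
  is at most \<open>k\<close> exactly if \<open>i/j \<le> \<sigma> (k/j)\<close>. So the index
  vector is one fixed function \<open>\<Psi>\<close> of the subordinator on a grid, whose law
  depends on \<alpha> only.\<close>

lemma rounded_distr:
  assumes L: "inverse_stable_subordinator M \<alpha> L" and L': "inverse_stable_subordinator N \<alpha> L'" and \<alpha>: "\<alpha> > 0"
    and j: "j > 0" and J: "J > 0"
  shows "distr M (count_space (index_set J)) (rounded L j J) = distr N (count_space (index_set J)) (rounded L' j J)"
proof -
  \<comment> \<open>The alternative \<open>k = J\<close> builds in the truncation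
    \<open>min _ J\<close> and guarantees that the \<open>LEAST\<close> exists.\<close>
  define \<Psi> :: "(nat \<Rightarrow> real) \<Rightarrow> nat \<Rightarrow> nat" where
    "\<Psi> v i = (if i \<le> J then LEAST k. k = J \<or> real i / real j \<le> v k else 0)" for v i
  have \<Psi>_in: "\<Psi> v \<in> index_set J" for v
    by (auto simp: \<Psi>_def index_set_def intro: Least_le)
  have [measurable]: "(\<lambda>v. v k) \<in> borel_measurable (borel :: (nat \<Rightarrow> real) measure)" for k
    by (rule measurable_product_then_coordinatewise) simp
  have \<Psi>_meas: "\<Psi> \<in> measurable borel (count_space (index_set J))"
    by (rule measurable_index_set[OF _ \<Psi>_in]) (unfold \<Psi>_def, measurable)
  have key: "distr P (count_space (index_set J)) (rounded H j J) =
     distr (distr P borel (grid \<sigma> (1 / real j) J)) (count_space (index_set J)) \<Psi>"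
    if \<sigma>: "stable_subordinator P \<alpha> \<sigma>" and m: "\<And>t. t \<ge> 0 \<Longrightarrow> H t \<in> borel_measurable P"
    and iff: "AE \<omega> in P. \<forall>t\<ge>0. \<forall>s\<ge>0. H t \<omega> \<le> s \<longleftrightarrow> t \<le> \<sigma> s \<omega>"
    and good: "AE \<omega> in P. time_change (\<lambda>t. H t \<omega>)"
    for P :: "'c measure" and \<sigma> H
  proof -
    have g: "grid \<sigma> (1 / real j) J \<in> borel_measurable P"
      by (rule grid_measurable) (use levy_processD(2)[OF stable_subordinatorD(1)[OF \<sigma>]] in auto)
    have "distr P (count_space (index_set J)) (rounded H j J) = 
      distr P (count_space (index_set J)) (\<Psi> \<circ> grid \<sigma> (1 / real j) J)"
    proof (rule distr_cong_AE)
      show "AE \<omega> in P. rounded H j J \<omega> = (\<Psi> \<circ> grid \<sigma> (1 / real j) J) \<omega>"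
        using iff good
      proof eventually_elim
        case (elim \<omega>)
        show ?case
        proof
          fix i
          have iff': "real i / real j \<le> \<sigma> (real k / real j) \<omega> \<longleftrightarrow> nat \<lceil>real j * H (real i / real j) \<omega>\<rceil> \<le> k" for k
          proof -
            have "nat \<lceil>real j * H (real i / real j) \<omega>\<rceil> \<le> k \<longleftrightarrow> real j * H (real i / real j) \<omega> \<le> real k"
              by (simp add: nat_le_iff ceiling_le_iff)
            also have "\<dots> \<longleftrightarrow> H (real i / real j) \<omega> \<le> real k / real j" using j by (simp add: field_simps)
            also have "\<dots> \<longleftrightarrow> real i / real j \<le> \<sigma> (real k / real j) \<omega>" using elim(1) by simp
            finally show ?thesis by simp
          qed
          have "(LEAST k. k = J \<or> real i / real j \<le> grid \<sigma> (1 / real j) J \<omega> k) = min (nat \<lceil>real j * H (real i / real j) \<omega>\<rceil>) J"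
            (is "_ = min ?m J")
          proof (rule Least_equality)
            show "min ?m J = J \<or> real i / real j \<le> grid \<sigma> (1 / real j) J \<omega> (min ?m J)"
              using iff'[of ?m] by (auto simp: grid_def min_def)
            fix k assume k: "k = J \<or> real i / real j \<le> grid \<sigma> (1 / real j) J \<omega> k"
            show "min ?m J \<le> k"
            proof (cases "k < J")
              case True
              then have "real i / real j \<le> \<sigma> (real k / real j) \<omega>" using k by (simp add: grid_def)
              then show ?thesis using iff'[of k] by (simp add: min_le_iff_disj)
            qed simp
          qed
          then show "rounded H j J \<omega> i = (\<Psi> \<circ> grid \<sigma> (1 / real j) J) \<omega> i"
            by (simp add: rounded_def \<Psi>_def)
        qed
      qed
    qed (use rounded_measurable[OF m] measurable_comp[OF g \<Psi>_meas] in auto)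
    also have "\<dots> = distr (distr P borel (grid \<sigma> (1 / real j) J)) (count_space (index_set J)) \<Psi>"
      by (rule distr_distr[OF \<Psi>_meas g, symmetric])
    finally show ?thesis .
  qed
  obtain \<sigma> where \<sigma>: "stable_subordinator M \<alpha> \<sigma>" "\<And>t. t \<ge> 0 \<Longrightarrow> L t \<in> borel_measurable M"
    "AE \<omega> in M. \<forall>t\<ge>0. \<forall>s\<ge>0. L t \<omega> \<le> s \<longleftrightarrow> t \<le> \<sigma> s \<omega>"
    "AE \<omega> in M. time_change (\<lambda>t. L t \<omega>)" using inverse_stable_subordinatorE[OF L \<alpha>] by blast
  obtain \<sigma>' where \<sigma>': "stable_subordinator N \<alpha> \<sigma>'" "\<And>t. t \<ge> 0 \<Longrightarrow> L' t \<in> borel_measurable N"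
    "AE \<omega> in N. \<forall>t\<ge>0. \<forall>s\<ge>0. L' t \<omega> \<le> s \<longleftrightarrow> t \<le> \<sigma>' s \<omega>"
    "AE \<omega> in N. time_change (\<lambda>t. L' t \<omega>)" using inverse_stable_subordinatorE[OF L' \<alpha>] by blast
  show ?thesis
    using key[OF \<sigma>] key[OF \<sigma>'] stable_subordinator_grid_distr[OF \<sigma>(1) \<sigma>'(1) _ J, of "1 / real j"] by simp
qed

text \<open>\<open>L s > n^2\<close> means \<open>\<sigma> (n^2) < s\<close>. For
  \<open>s = n^(1/\<alpha>) T\<close> the typical values of \<open>L\<close> are of order
  \<open>n\<close>, so this event is exponentially rare. Integer \<open>T\<close> suffice by
  monotonicity.\<close>

lemma inverse_stable_growth:
  assumes L: "inverse_stable_subordinator M \<alpha> L" and \<alpha>: "0 < \<alpha>"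
  shows "AE \<omega> in M. \<forall>T>0. \<forall>\<^sub>F n in sequentially. L (real n powr (1 / \<alpha>) * T) \<omega> \<le> (real n)\<^sup>2"
proof -
  obtain \<sigma> where \<sigma>: "stable_subordinator M \<alpha> \<sigma>" "\<And>t. t \<ge> 0 \<Longrightarrow> L t \<in> borel_measurable M"
    and iff: "AE \<omega> in M. \<forall>t\<ge>0. \<forall>s\<ge>0. L t \<omega> \<le> s \<longleftrightarrow> t \<le> \<sigma> s \<omega>"
    and good: "AE \<omega> in M. time_change (\<lambda>t. L t \<omega>)" using inverse_stable_subordinatorE[OF L \<alpha>] by blast
  note P = levy_processD[OF stable_subordinatorD(1)[OF \<sigma>(1)]]
  interpret prob_space M by (rule P(1))
  have "AE \<omega> in M. \<forall>\<^sub>F n in sequentially. \<omega> \<in> space M - {\<omega>\<in>space M. \<sigma> ((real n)\<^sup>2) \<omega> \<le> real n powr (1 / \<alpha>) * real T}"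
    if T: "T > 0" for T :: nat
  proof (rule borel_cantelli_AE1)
    have [measurable]: "\<sigma> ((real n)\<^sup>2) \<in> borel_measurable M" for n using P(2) by simp
    show "{\<omega>\<in>space M. \<sigma> ((real n)\<^sup>2) \<omega> \<le> real n powr (1 / \<alpha>) * real T} \<in> sets M" for n by measurable
    show "emeasure M {\<omega>\<in>space M. \<sigma> ((real n)\<^sup>2) \<omega> \<le> real n powr (1 / \<alpha>) * real T} < \<infinity>" for n
      by (simp add: emeasure_eq_measure)
    let ?q = "exp (- (real T powr - \<alpha>))"
    show "summable (\<lambda>n. measure M {\<omega>\<in>space M. \<sigma> ((real n)\<^sup>2) \<omega> \<le> real n powr (1 / \<alpha>) * real T})"
    proof (rule summable_comparison_test_ev)
      show "summable (\<lambda>n. exp 1 * ?q ^ n)"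
        using T by (intro summable_mult summable_geometric) auto
      show "\<forall>\<^sub>F n in sequentially. norm (measure M {\<omega>\<in>space M. \<sigma> ((real n)\<^sup>2) \<omega> \<le> real n powr (1 / \<alpha>) * real T}) \<le> exp 1 * ?q ^ n"
        using eventually_gt_at_top[of 0]
      proof eventually_elim
        case (elim n)
        \<comment> \<open>Taking \<open>z = 1 / c\<close> in the tail bound makes
          \<open>z * c = 1\<close> and \<open>n^2 * z powr \<alpha> = n * T powr - \<alpha>\<close>,
          hence geometric decay in \<open>n\<close>.\<close>
        define c where "c = real n powr (1 / \<alpha>) * real T"
        have c: "c > 0" using elim T by (simp add: c_def)
        have "c powr \<alpha> = real n powr (1 / \<alpha> * \<alpha>) * real T powr \<alpha>"
          unfolding c_def by (simp only: powr_mult powr_powr)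
        also have "real n powr (1 / \<alpha> * \<alpha>) = real n" using elim \<alpha> by simp
        finally have "(1 / c) powr \<alpha> = real T powr - \<alpha> / real n"
          using c by (simp add: powr_divide powr_minus divide_simps)
        then have "(real n)\<^sup>2 * (1 / c) powr \<alpha> = real n * (real T powr - \<alpha>)"
          using elim by (simp add: power2_eq_square)
        then have "measure M {\<omega>\<in>space M. \<sigma> ((real n)\<^sup>2) \<omega> \<le> c} \<le> exp (1 - real n * (real T powr - \<alpha>))"
          using stable_subordinator_tail[OF \<sigma>(1), of "(real n)\<^sup>2" "1 / c" c] c by simp
        also have "\<dots> = exp 1 * ?q ^ n" using exp_of_nat_mult[of n "- (real T powr - \<alpha>)"] by (simp add: exp_diff exp_minus divide_inverse)
        finally show ?case by (simp add: c_def)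
      qed
    qed
  qed
  then have "AE \<omega> in M. \<forall>T::nat. T > 0 \<longrightarrow> (\<forall>\<^sub>F n in sequentially. \<omega> \<in> space M - {\<omega>\<in>space M. \<sigma> ((real n)\<^sup>2) \<omega> \<le> real n powr (1 / \<alpha>) * real T})"
    unfolding AE_all_countable by (intro allI AE_impI) 
  then show ?thesis using iff good
  proof eventually_elim
    case (elim \<omega>)
    show ?case
    proof (intro allI impI)
      fix T :: real assume T: "T > 0"
      define T' where "T' = nat \<lceil>T\<rceil>"
      have T': "T \<le> real T'" "T' > 0" using T by (auto simp: T'_def)
      have "\<forall>\<^sub>F n in sequentially. \<omega> \<in> space M - {\<omega>\<in>space M. \<sigma> ((real n)\<^sup>2) \<omega> \<le> real n powr (1 / \<alpha>) * real T'}"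
        using elim(1) T' by blast
      then show "\<forall>\<^sub>F n in sequentially. L (real n powr (1 / \<alpha>) * T) \<omega> \<le> (real n)\<^sup>2"
      proof eventually_elim
        case (elim n)
        then have "real n powr (1 / \<alpha>) * real T' \<le> \<sigma> ((real n)\<^sup>2) \<omega>" by auto
        moreover have "real n powr (1 / \<alpha>) * T \<le> real n powr (1 / \<alpha>) * real T'" using T' by (intro mult_left_mono) auto
        ultimately have "real n powr (1 / \<alpha>) * T \<le> \<sigma> ((real n)\<^sup>2) \<omega>" by linarith
        then show ?case using \<open>\<forall>t\<ge>0. \<forall>s\<ge>0. L t \<omega> \<le> s \<longleftrightarrow> t \<le> \<sigma> s \<omega>\<close> T by simp
      qed
    qed
  qed
qed

section \<open>Composition with an independent time change\<close>

text \<open>The bound forces \<open>H\<close> to depend on the coordinates up to \<open>J\<close>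
  only, which makes it continuous for the product topology.\<close>

definition bounded_lipschitz :: "nat \<Rightarrow> ((nat \<Rightarrow> real) \<Rightarrow> real) \<Rightarrow> bool" where
  "bounded_lipschitz J H \<longleftrightarrow> (\<exists>C\<ge>0. \<forall>z z'. \<bar>H z - H z'\<bar> \<le> C * (\<Sum>k\<le>J. \<bar>z k - z' k\<bar>)) \<and> (\<exists>B. \<forall>z. \<bar>H z\<bar> \<le> B)"

lemma bounded_lipschitzE:
  assumes "bounded_lipschitz J H"
  obtains C B where "C \<ge> 0" "\<And>z z'. \<bar>H z - H z'\<bar> \<le> C * (\<Sum>k\<le>J. \<bar>z k - z' k\<bar>)" "\<And>z. \<bar>H z\<bar> \<le> B" "B \<ge> 0"
proof -
  obtain C B where *: "C \<ge> 0" "\<And>z z'. \<bar>H z - H z'\<bar> \<le> C * (\<Sum>k\<le>J. \<bar>z k - z' k\<bar>)" "\<And>z. \<bar>H z\<bar> \<le> B"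
    using assms unfolding bounded_lipschitz_def by blast
  moreover have "B \<ge> 0" using *(3)[of "\<lambda>_. 0"] by simp
  ultimately show thesis using that by blast
qed

lemma bounded_lipschitz_measurable:
  assumes "bounded_lipschitz J H"
  shows "H \<in> borel_measurable borel"
proof (rule borel_measurable_continuous_onI, unfold continuous_on_def, intro ballI)
  fix z :: "nat \<Rightarrow> real"
  obtain C B where C: "\<And>z z'. \<bar>H z - H z'\<bar> \<le> C * (\<Sum>k\<le>J. \<bar>z k - z' k\<bar>)" using bounded_lipschitzE[OF assms] by metis
  have co: "((\<lambda>z'. z' k) \<longlongrightarrow> z k) (at z within UNIV)" for k
    using continuous_on_product_coordinates[of k] unfolding continuous_on_def by blast
  have "((\<lambda>z'. C * (\<Sum>k\<le>J. \<bar>z' k - z k\<bar>)) \<longlongrightarrow> C * (\<Sum>k\<le>J. \<bar>z k - z k\<bar>)) (at z within UNIV)"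
    by (intro tendsto_intros co)
  then have lim0: "((\<lambda>z'. C * (\<Sum>k\<le>J. \<bar>z' k - z k\<bar>)) \<longlongrightarrow> 0) (at z within UNIV)" by simp
  have "((\<lambda>z'. H z' - H z) \<longlongrightarrow> 0) (at z within UNIV)"
    by (rule Lim_null_comparison[OF always_eventually[OF allI] lim0]) (simp add: C)
  then show "(H \<longlongrightarrow> H z) (at z within UNIV)" by (rule LIM_zero_cancel)
qed

lemma path_dist_le_uniform:
  assumes "s \<ge> 0" "\<And>t. \<bar>x t - y t\<bar> \<le> s"
  shows "path_dist x y \<le> s"
proof (rule field_le_epsilon)
  fix e :: real assume "0 < e"
  show "path_dist x y \<le> s + e"
  proof (rule path_dist_le)
    fix t show "\<bar>x t - y t\<bar> \<le> s + e" using assms(2)[of t] \<open>0 < e\<close> by linarith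
  qed (use assms \<open>0 < e\<close> in simp)
qed

lemma bounded_lipschitz_lip_functional:
  assumes g: "lip_functional g" and \<kappa>: "\<And>t. i t \<le> J"
  shows "bounded_lipschitz J (\<lambda>z. g (\<lambda>t. z (i t)))"
proof -
  obtain C B where C: "C \<ge> 0" "\<And>x y. \<bar>g x - g y\<bar> \<le> C * path_dist x y" and B: "\<And>x. \<bar>g x\<bar> \<le> B"
    using g unfolding lip_functional_def by blast
  have "\<bar>g (\<lambda>t. z (i t)) - g (\<lambda>t. z' (i t))\<bar> \<le> C * (\<Sum>k\<le>J. \<bar>z k - z' k\<bar>)" for z z'
  proof -
    have "path_dist (\<lambda>t. z (i t)) (\<lambda>t. z' (i t)) \<le> (\<Sum>k\<le>J. \<bar>z k - z' k\<bar>)"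
      by (rule path_dist_le_uniform) (use \<kappa> in \<open>auto intro!: sum_nonneg member_le_sum[of _ _ "\<lambda>k. \<bar>z k - z' k\<bar>"]\<close>)
    then show ?thesis using C by (meson mult_left_mono order_trans)
  qed
  then show ?thesis unfolding bounded_lipschitz_def using C(1) B by blast
qed

text \<open>Conditioning on the time change without conditional expectations: the index vector takes
  finitely many values, and on each of them the independent grid of \<open>Z\<close> factors
  out.\<close>

lemma indep_processes_grid_integral:
  assumes P: "prob_space P" and ind: "indep_processes P Z L"
    and Z: "\<And>t. t \<ge> 0 \<Longrightarrow> Z t \<in> borel_measurable P" and L: "\<And>t. t \<ge> 0 \<Longrightarrow> L t \<in> borel_measurable P"
    and F: "\<And>\<kappa>. F \<kappa> \<in> borel_measurable borel" "\<And>\<kappa> z. \<bar>F \<kappa> z\<bar> \<le> B"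
    and h: "h \<ge> 0"
  shows "(\<lambda>\<omega>. F (rounded L j J \<omega>) (grid Z h J \<omega>)) \<in> borel_measurable P"
    and "(\<integral>\<omega>. F (rounded L j J \<omega>) (grid Z h J \<omega>) \<partial>P) =
      (\<Sum>\<kappa>\<in>index_set J. measure (distr P (count_space (index_set J)) (rounded L j J)) {\<kappa>} * (\<integral>\<omega>. F \<kappa> (grid Z h J \<omega>) \<partial>P))"
proof -
  interpret prob_space P by fact
  let ?Pi = "PiM {0..} (\<lambda>_. borel) :: (real \<Rightarrow> real) measure"
  have co: "(\<lambda>z. z t) \<in> borel_measurable ?Pi" if "t \<ge> 0" for t :: real
    using that by (intro measurable_component_singleton) simp
  have r: "rounded L j J \<in> measurable P (count_space (index_set J))" by (rule rounded_measurable[OF L])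
  have g: "grid Z h J \<in> borel_measurable P" by (rule grid_measurable[OF Z h])
  have split: "F (rounded L j J \<omega>) (grid Z h J \<omega>) =
     (\<Sum>\<kappa>\<in>index_set J. F \<kappa> (grid Z h J \<omega>) * indicator {\<kappa>} (rounded L j J \<omega>))" for \<omega>
    using rounded_in_index_set[of L j J \<omega>] by (simp add: indicator_def finite_index_set if_distrib cong: if_cong)
  have Fm: "(\<lambda>\<omega>. F \<kappa> (grid Z h J \<omega>)) \<in> borel_measurable P" for \<kappa>
    by (rule measurable_compose[OF g F(1)])
  have Im: "(\<lambda>\<omega>. indicator {\<kappa>} (rounded L j J \<omega>)) \<in> borel_measurable P" for \<kappa>
    by (rule measurable_compose[OF r]) simp
  show "(\<lambda>\<omega>. F (rounded L j J \<omega>) (grid Z h J \<omega>)) \<in> borel_measurable P"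
    unfolding split by (intro borel_measurable_sum borel_measurable_times Fm Im)
  have Fi: "integrable P (\<lambda>\<omega>. F \<kappa> (grid Z h J \<omega>))" for \<kappa>
    using F(2) Fm by (intro integrable_const_bound[of _ B]) auto
  have Ii: "integrable P (\<lambda>\<omega>. indicator {\<kappa>} (rounded L j J \<omega>) :: real)" for \<kappa>
    using Im by (intro integrable_const_bound[of _ 1]) (auto simp: indicator_def)
  have ind': "indep_var borel (\<lambda>\<omega>. F \<kappa> (grid Z h J \<omega>)) borel (\<lambda>\<omega>. indicator {\<kappa>} (rounded L j J \<omega>) :: real)" for \<kappa>
  proof -
    \<comment> \<open>Reading both discretisations with the coordinate process on path space shows
      them to be measurable functions of the restricted paths, to which independence refers.\<close>
    have "indep_var borel ((\<lambda>z. F \<kappa> (grid (\<lambda>t z. z t) h J z)) \<circ> (\<lambda>\<omega>. \<lambda>t\<in>{0..}. Z t \<omega>))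
       borel ((\<lambda>l. indicator {\<kappa>} (rounded (\<lambda>t l. l t) j J l) :: real) \<circ> (\<lambda>\<omega>. \<lambda>t\<in>{0..}. L t \<omega>))"
    proof (rule indep_var_compose)
      show "indep_var ?Pi (\<lambda>\<omega>. \<lambda>t\<in>{0..}. Z t \<omega>) ?Pi (\<lambda>\<omega>. \<lambda>t\<in>{0..}. L t \<omega>)"
        using ind unfolding indep_processes_def .
      show "(\<lambda>z. F \<kappa> (grid (\<lambda>t z. z t) h J z)) \<in> borel_measurable ?Pi"
        by (rule measurable_compose[OF grid_measurable F(1)]) (use co h in auto)
      have "rounded (\<lambda>t l. l t) j J \<in> measurable ?Pi (count_space (index_set J))"
        by (rule rounded_measurable) (use co in auto)
      then show "(\<lambda>l. indicator {\<kappa>} (rounded (\<lambda>t l. l t) j J l) :: real) \<in> borel_measurable ?Pi"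
        by (rule measurable_compose) simp
    qed
    moreover have "grid (\<lambda>t z. z t) h J (\<lambda>t\<in>{0..}. Z t \<omega>) = grid Z h J \<omega>" for \<omega>
      using h by (auto simp: grid_def)
    moreover have "rounded (\<lambda>t l. l t) j J (\<lambda>t\<in>{0..}. L t \<omega>) = rounded L j J \<omega>" for \<omega>
      by (auto simp: rounded_def)
    ultimately show ?thesis by (simp add: comp_def)
  qed
  have "(\<integral>\<omega>. F (rounded L j J \<omega>) (grid Z h J \<omega>) \<partial>P) =
     (\<Sum>\<kappa>\<in>index_set J. \<integral>\<omega>. F \<kappa> (grid Z h J \<omega>) * indicator {\<kappa>} (rounded L j J \<omega>) \<partial>P)"
    unfolding split by (rule Bochner_Integration.integral_sum) (rule indep_var_integrable[OF ind' Fi Ii])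
  also have "\<dots> = (\<Sum>\<kappa>\<in>index_set J. measure (distr P (count_space (index_set J)) (rounded L j J)) {\<kappa>} * (\<integral>\<omega>. F \<kappa> (grid Z h J \<omega>) \<partial>P))"
  proof (rule sum.cong[OF refl])
    fix \<kappa> assume \<kappa>: "\<kappa> \<in> index_set J"
    have "(\<integral>\<omega>. indicator {\<kappa>} (rounded L j J \<omega>) \<partial>P) = (\<integral>x. (indicator {\<kappa>} x :: real) \<partial>distr P (count_space (index_set J)) (rounded L j J))"
      by (subst integral_distr[OF r]) (simp_all add: \<kappa>)
    also have "\<dots> = measure (distr P (count_space (index_set J)) (rounded L j J)) {\<kappa>}"
      using \<kappa> by simp
    finally show "(\<integral>\<omega>. F \<kappa> (grid Z h J \<omega>) * indicator {\<kappa>} (rounded L j J \<omega>) \<partial>P) =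
       measure (distr P (count_space (index_set J)) (rounded L j J)) {\<kappa>} * (\<integral>\<omega>. F \<kappa> (grid Z h J \<omega>) \<partial>P)"
      using indep_var_lebesgue_integral[OF ind' Fi Ii] by simp
  qed
  finally show "(\<integral>\<omega>. F (rounded L j J \<omega>) (grid Z h J \<omega>) \<partial>P) =
      (\<Sum>\<kappa>\<in>index_set J. measure (distr P (count_space (index_set J)) (rounded L j J)) {\<kappa>} * (\<integral>\<omega>. F \<kappa> (grid Z h J \<omega>) \<partial>P))" .
qed

section \<open>Discretisation of the composed process\<close>

lemma (in prob_space) measure_tendsto_0:
  assumes A: "\<And>j. A j \<in> sets M" and ev: "AE \<omega> in M. \<forall>\<^sub>F j in sequentially. \<omega> \<notin> A j"
  shows "(\<lambda>j. measure M (A j)) \<longlonglongrightarrow> 0"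
proof -
  have "(\<lambda>j. \<integral>\<omega>. indicator (A j) \<omega> \<partial>M) \<longlonglongrightarrow> (\<integral>\<omega>. (0::real) \<partial>M)"
  proof (rule integral_dominated_convergence[where w="\<lambda>_. 1"])
    show "AE \<omega> in M. (\<lambda>j. indicator (A j) \<omega> :: real) \<longlonglongrightarrow> 0"
      using ev
    proof eventually_elim
      case (elim \<omega>)
      then have "\<forall>\<^sub>F j in sequentially. indicator (A j) \<omega> = (0::real)" by eventually_elim simp
      then show ?case by (rule tendsto_eventually)
    qed
  qed (use A in \<open>auto simp: indicator_def\<close>)
  moreover have "(\<integral>\<omega>. indicator (A j) \<omega> \<partial>M) = measure M (A j)" for j using A[of j] sets.sets_into_space[OF A[of j]] 
    by (simp add: Int_absorb2)
  ultimately show ?thesis by simp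
qed

lemma time_changeD:
  assumes "time_change l"
  shows "\<And>t. t \<ge> 0 \<Longrightarrow> 0 \<le> l t" "\<And>s t. 0 \<le> s \<Longrightarrow> s \<le> t \<Longrightarrow> l s \<le> l t" "continuous_on {0..} l"
  using assms unfolding time_change_def mono_on_def by auto

lemma rounded_le:
  assumes "L (real i / real j) \<omega> \<ge> 0"
  shows "real (rounded L j J \<omega> i) \<le> real j * L (real i / real j) \<omega> + 1"
proof -
  have "real (nat \<lceil>real j * L (real i / real j) \<omega>\<rceil>) \<le> real j * L (real i / real j) \<omega> + 1"
    using assms of_int_ceiling_le_add_one[of "real j * L (real i / real j) \<omega>"] by (simp add: of_nat_nat)
  then show ?thesis by (auto simp: rounded_def min_def)
qed

lemma rounded_eq:
  assumes "L (real i / real j) \<omega> \<ge> 0" "i \<le> J" "rounded L j J \<omega> i < J"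
  shows "real j * L (real i / real j) \<omega> \<le> real (rounded L j J \<omega> i)"
    "real (rounded L j J \<omega> i) \<le> real j * L (real i / real j) \<omega> + 1"
proof -
  have "rounded L j J \<omega> i = nat \<lceil>real j * L (real i / real j) \<omega>\<rceil>"
    using assms(2,3) by (auto simp: rounded_def min_def split: if_splits)
  then show "real j * L (real i / real j) \<omega> \<le> real (rounded L j J \<omega> i)"
    using real_nat_ceiling_ge[of "real j * L (real i / real j) \<omega>"] by simp
  show "real (rounded L j J \<omega> i) \<le> real j * L (real i / real j) \<omega> + 1"
    by (rule rounded_le[where L=L and j=j and i=i and \<omega>=\<omega>, OF assms(1)])
qed


text \<open>A discrete modulus of continuity stated for the index vector alone. Its probability
  therefore depends only on the law of \<open>rounded\<close> and can be moved between the two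
  probability spaces.\<close>

definition small_steps :: "real \<Rightarrow> nat \<Rightarrow> nat \<Rightarrow> nat \<Rightarrow> (nat \<Rightarrow> nat) \<Rightarrow> bool" where
  "small_steps \<eta> S j I \<kappa> \<longleftrightarrow> (\<forall>i\<le>I. real (\<kappa> (Suc i)) \<le> real (\<kappa> i) + \<eta> * real j) \<and> \<kappa> (Suc I) \<le> S * j"

text \<open>Monotonicity traps \<open>L t\<close> between its values at the two neighbouring grid
  points, and rounding up costs at most \<open>1/j \<le> \<eta>\<close>. As
  \<open>S * j < J\<close>, the truncation at \<open>J\<close> is not active.\<close>

lemma small_steps_close:
  assumes l: "time_change (\<lambda>t. L t \<omega>)" and s: "small_steps \<eta> S j I (rounded L j J \<omega>)"
    and J: "S * j < J" "Suc I \<le> J" and j: "j > 0" "1 / real j \<le> \<eta>"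
    and t: "0 \<le> t" "real j * t < real (Suc I)"
  defines "i \<equiv> min (nat \<lfloor>real j * t\<rfloor>) J"
  shows "0 \<le> L t \<omega>" "L t \<omega> \<le> real S" "real (rounded L j J \<omega> i) / real j \<le> real S"
    "\<bar>L t \<omega> - real (rounded L j J \<omega> i) / real j\<bar> \<le> \<eta>"
proof -
  note L = time_changeD[OF l]
  define \<kappa> where "\<kappa> = rounded L j J \<omega>"
  have iI: "nat \<lfloor>real j * t\<rfloor> \<le> I" using t by (simp add: nat_le_iff floor_le_iff)
  then have i: "i = nat \<lfloor>real j * t\<rfloor>" "i \<le> I" using J by (auto simp: i_def)
  have it: "real i \<le> real j * t" "real j * t \<le> real (Suc i)"
    using t j of_int_floor_le[of "real j * t"] real_of_int_floor_add_one_ge[of "real j * t"] by (auto simp: i(1) of_nat_nat add.commute)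
  have mono: "\<kappa> a \<le> \<kappa> b" if "a \<le> b" "b \<le> J" for a b
  proof -
    have "L (real a / real j) \<omega> \<le> L (real b / real j) \<omega>" using that j by (intro L(2)) (auto simp: divide_right_mono)
    then have "nat \<lceil>real j * L (real a / real j) \<omega>\<rceil> \<le> nat \<lceil>real j * L (real b / real j) \<omega>\<rceil>"
      by (intro nat_mono ceiling_mono mult_left_mono) auto
    then show ?thesis using that unfolding \<kappa>_def rounded_def by (auto intro: min.mono simp del: nat_le_iff ceiling_le_iff nat_ceiling_le_eq)
  qed
  have kS: "\<kappa> (Suc i) \<le> S * j" using mono[of "Suc i" "Suc I"] i J s by (auto simp: small_steps_def \<kappa>_def)
  have kS': "\<kappa> i \<le> S * j" using mono[of i "Suc i"] kS i J by auto
  have nn: "L (real a / real j) \<omega> \<ge> 0" for a by (rule L(1)) simp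
  have 1: "real j * L (real (Suc i) / real j) \<omega> \<le> real (\<kappa> (Suc i))"
    using rounded_eq(1)[where L=L and j=j and J=J and \<omega>=\<omega>, OF nn, of "Suc i"] kS J i by (simp add: \<kappa>_def)
  have 2: "real (\<kappa> i) \<le> real j * L (real i / real j) \<omega> + 1" unfolding \<kappa>_def by (rule rounded_le[where L=L and j=j and \<omega>=\<omega>, OF nn])
  have Lt: "L (real i / real j) \<omega> \<le> L t \<omega>" "L t \<omega> \<le> L (real (Suc i) / real j) \<omega>"
    using it j t by (auto intro!: L(2) simp: field_simps)
  have Lt': "real j * L (real i / real j) \<omega> \<le> real j * L t \<omega>" "real j * L t \<omega> \<le> real j * L (real (Suc i) / real j) \<omega>"
    using Lt by (auto intro!: mult_left_mono)
  show "0 \<le> L t \<omega>" using L(1) t by simp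
  have "real j * L t \<omega> \<le> real (S * j)" using Lt'(2) 1 kS by (metis of_nat_mono order_trans)
  then show "L t \<omega> \<le> real S" using j by (simp add: mult.commute)
  show "real (rounded L j J \<omega> i) / real j \<le> real S" using kS' j 
    by (simp add: \<kappa>_def[symmetric] field_simps flip: of_nat_mult)
  have "real (\<kappa> (Suc i)) \<le> real (\<kappa> i) + \<eta> * real j" using s i by (simp add: small_steps_def \<kappa>_def)
  then have "real j * L t \<omega> - real (\<kappa> i) \<le> \<eta> * real j" using Lt' 1 by linarith
  moreover have "1 \<le> \<eta> * real j" using j by (simp add: field_simps)
  then have "real (\<kappa> i) - real j * L t \<omega> \<le> \<eta> * real j" using 2 Lt' by linarith
  ultimately have "L t \<omega> - real (\<kappa> i) / real j \<le> \<eta>" "real (\<kappa> i) / real j - L t \<omega> \<le> \<eta>" using j by (auto simp: field_simps)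
  then show "\<bar>L t \<omega> - real (rounded L j J \<omega> i) / real j\<bar> \<le> \<eta>" by (simp add: \<kappa>_def abs_le_iff)
qed

text \<open>By uniform continuity \<open>L\<close> moves by less than \<open>\<eta>/2\<close> over a
  cell, and the rounding error \<open>1/j\<close> is below the other half. The slack
  \<open>2\<close> in \<open>T + 2\<close> covers rounding up \<open>j * T\<close> and one further
  cell; the \<open>1\<close> next to \<open>L (T + 2)\<close> covers rounding up its value.\<close>

lemma eventually_small_steps:
  assumes l: "time_change (\<lambda>t. L t \<omega>)" and \<eta>: "\<eta> > 0" and T: "T \<ge> 0" and S: "L (T + 2) \<omega> + 1 \<le> real S"
  shows "\<forall>\<^sub>F j in sequentially. small_steps \<eta> S j (nat \<lceil>real j * T\<rceil>) (rounded L j (j * j) \<omega>)"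
proof -
  note L = time_changeD[OF l]
  have "uniformly_continuous_on {0..T+2} (\<lambda>t. L t \<omega>)"
    by (rule compact_uniformly_continuous[OF continuous_on_subset[OF L(3)]]) auto
  then obtain d where d: "d > 0" "\<And>s t. s \<in> {0..T+2} \<Longrightarrow> t \<in> {0..T+2} \<Longrightarrow> \<bar>t - s\<bar> < d \<Longrightarrow> \<bar>L t \<omega> - L s \<omega>\<bar> < \<eta>/2"
    unfolding uniformly_continuous_on_def dist_real_def using \<eta> by (metis half_gt_zero)
  have "\<forall>\<^sub>F j in sequentially. real j > max (1 / d) (max (2 / \<eta>) (max (real S) (T + 2)))"
    by (rule eventually_compose_filterlim[OF eventually_gt_at_top filterlim_real_sequentially])
  then show ?thesis using eventually_gt_at_top[of 0]
  proof eventually_elim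
    case (elim j)
    define I where "I = nat \<lceil>real j * T\<rceil>"
    have "real I \<le> real j * T + 1" using T of_int_ceiling_le_add_one[of "real j * T"] by (simp add: I_def of_nat_nat)
    then have I: "real (Suc I) / real j \<le> T + 2" using elim(2) by (simp add: field_simps)
    have IJ: "Suc I \<le> j * j"
    proof -
      have "real (Suc I) \<le> (T + 2) * real j" using I elim(2) by (simp add: field_simps)
      also have "\<dots> \<le> real j * real j" using elim by (intro mult_right_mono) auto
      finally show ?thesis by (simp flip: of_nat_mult)
    qed
    have nn: "L (real a / real j) \<omega> \<ge> 0" for a by (rule L(1)) simp
    have top: "L (real a / real j) \<omega> \<le> real S - 1" if "a \<le> Suc I" for a
    proof -
      have "real a / real j \<le> real (Suc I) / real j" using that by (intro divide_right_mono) auto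
      then have "L (real a / real j) \<omega> \<le> L (T + 2) \<omega>" using I by (intro L(2)) auto
      then show ?thesis using S by simp
    qed
    have top': "real (rounded L j (j * j) \<omega> a) \<le> real S * real j" if "a \<le> Suc I" for a
    proof -
      have "real (rounded L j (j * j) \<omega> a) \<le> real j * L (real a / real j) \<omega> + 1" by (rule rounded_le[where L=L and j=j and \<omega>=\<omega>, OF nn])
      also have "\<dots> \<le> real j * (real S - 1) + real j" using top[OF that] elim(2) by (intro add_mono mult_left_mono) auto
      finally show ?thesis by (simp add: algebra_simps)
    qed
    have lt: "rounded L j (j * j) \<omega> a < j * j" if "a \<le> Suc I" for a
    proof -
      have "real S * real j < real j * real j" using elim by (intro mult_strict_right_mono) auto
      then have "real (rounded L j (j * j) \<omega> a) < real (j * j)" using top'[OF that] by simp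
      then show ?thesis by (simp only: of_nat_less_iff)
    qed
    have "real (rounded L j (j * j) \<omega> (Suc i)) \<le> real (rounded L j (j * j) \<omega> i) + \<eta> * real j" if i: "i \<le> I" for i
    proof -
      have "real (Suc i) / real j \<le> real (Suc I) / real j" "real i / real j \<le> real (Suc i) / real j" using i by (auto intro!: divide_right_mono)
      moreover have "real (Suc i) / real j - real i / real j = 1 / real j" by (simp add: diff_divide_distrib[symmetric])
      moreover have "1 / real j < d" using elim d(1) by (simp add: field_simps)
      ultimately have "\<bar>L (real (Suc i) / real j) \<omega> - L (real i / real j) \<omega>\<bar> < \<eta>/2"
        using I by (intro d(2)) (auto simp del: of_nat_Suc)
      then have "real j * (L (real (Suc i) / real j) \<omega> - L (real i / real j) \<omega>) \<le> real j * (\<eta>/2)"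
        by (intro mult_left_mono) linarith+
      moreover have "real (rounded L j (j * j) \<omega> (Suc i)) \<le> real j * L (real (Suc i) / real j) \<omega> + 1" by (rule rounded_le[where L=L and j=j and \<omega>=\<omega>, OF nn])
      moreover have "real j * L (real i / real j) \<omega> \<le> real (rounded L j (j * j) \<omega> i)"
        using i IJ lt[of i] by (intro rounded_eq(1)[where L=L and j=j and \<omega>=\<omega>, OF nn]) auto
      moreover have "1 \<le> real j * (\<eta>/2)" using elim \<eta> by (simp add: field_simps)
      ultimately show ?thesis by (simp add: algebra_simps)
    qed
    moreover have "rounded L j (j * j) \<omega> (Suc I) \<le> S * j" using top'[of "Suc I"] by (simp flip: of_nat_mult)
    ultimately show ?case unfolding small_steps_def I_def by blast
  qed
qed

text \<open>The modulus of \<open>Z n\<close> fixes \<eta> on \<open>[0, S]\<close>, with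
  \<open>S\<close> bounding the time change with high probability. Then \<open>j\<close> is taken so
  large that \<open>small_steps\<close> fails rarely for \<open>L2\<close>, and by equality of laws
  as rarely for every \<open>L1 n\<close>. Outside these events \<open>X n\<close> is uniformly
  close to its discretisation on a long interval.\<close>

theorem composition_converges:
  fixes Z :: "nat \<Rightarrow> real \<Rightarrow> 'a \<Rightarrow> real" and L1 :: "nat \<Rightarrow> real \<Rightarrow> 'a \<Rightarrow> real"
    and Z' L2 :: "real \<Rightarrow> 'b \<Rightarrow> real" and X :: "nat \<Rightarrow> real \<Rightarrow> 'a \<Rightarrow> real"
  assumes M: "prob_space M" and \<alpha>: "\<alpha> > 0"
    and L1: "\<And>n. n > 0 \<Longrightarrow> inverse_stable_subordinator M \<alpha> (L1 n)"
    and Z: "\<And>n t. t \<ge> 0 \<Longrightarrow> Z n t \<in> borel_measurable M"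
    and ind1: "\<And>n. n > 0 \<Longrightarrow> indep_processes M (Z n) (L1 n)"
    and L2: "inverse_stable_subordinator N \<alpha> L2"
    and Z': "\<And>t. t \<ge> 0 \<Longrightarrow> Z' t \<in> borel_measurable N"
    and ind2: "indep_processes N Z' L2"
    and cont: "AE \<omega> in N. continuous_on {0..} (\<lambda>t. Z' t \<omega>)"
    and fdd: "\<And>j J H. j > 0 \<Longrightarrow> J > 0 \<Longrightarrow> bounded_lipschitz J H \<Longrightarrow>
       (\<lambda>n. \<integral>\<omega>. H (grid (Z n) (1 / real j) J \<omega>) \<partial>M) \<longlonglongrightarrow> (\<integral>\<omega>. H (grid Z' (1 / real j) J \<omega>) \<partial>N)"
    and modulus: "\<And>S e. S > 0 \<Longrightarrow> e > 0 \<Longrightarrow> \<exists>\<eta>>0. \<forall>\<^sub>F n in sequentially. mostly M e (\<lambda>\<omega>. oscillation_le (\<lambda>t. Z n t \<omega>) S \<eta> e)"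
    and X: "\<And>n. AE \<omega> in M. (\<lambda>t. X n t \<omega>) \<in> cadlag"
    and XZ: "\<And>n. n > 0 \<Longrightarrow> AE \<omega> in M. \<forall>t\<ge>0. X n t \<omega> = Z n (L1 n t \<omega>) \<omega>"
    and Y: "AE \<omega> in N. \<forall>t\<ge>0. Y t \<omega> = Z' (L2 t \<omega>) \<omega>"
  shows "converges_in_distribution_U M X N Y"
proof -
  obtain \<sigma>2 where \<sigma>2: "stable_subordinator N \<alpha> \<sigma>2" and L2m: "\<And>t. t \<ge> 0 \<Longrightarrow> L2 t \<in> borel_measurable N"
    and good2: "AE \<omega> in N. time_change (\<lambda>t. L2 t \<omega>)" using inverse_stable_subordinatorE[OF L2 \<alpha>] by blast
  have L1m: "\<And>t. t \<ge> 0 \<Longrightarrow> L1 n t \<in> borel_measurable M" and good1: "AE \<omega> in M. time_change (\<lambda>t. L1 n t \<omega>)" if "n > 0" for n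
    using inverse_stable_subordinatorE[OF L1[OF that] \<alpha>] by blast+
  interpret M: prob_space M by fact
  interpret N: prob_space N by (rule levy_processD(1)[OF stable_subordinatorD(1)[OF \<sigma>2]])
  \<comment> \<open>Nothing is known about \<open>L1 0\<close>, whereas the criterion asks for
    measurability at every \<open>n\<close>.\<close>
  define LL where "LL n = (if n > 0 then L1 n else (\<lambda>t \<omega>. 0))" for n
  have LLm: "LL n t \<in> borel_measurable M" if "t \<ge> 0" for n t using L1m that by (simp add: LL_def)
  \<comment> \<open>Mesh \<open>1/j\<close> and \<open>j * j\<close> cells: refining the grid also
    pushes its horizon \<open>j\<close> to infinity.\<close>
  define i where "i j t = min (nat \<lfloor>real j * t\<rfloor>) (j * j)" for j and t :: real
  define X' where "X' j n t \<omega> = grid (Z n) (1 / real j) (j * j) \<omega> (rounded (LL n) j (j * j) \<omega> (i j t))" for j n t \<omega>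
  define Y' where "Y' j t \<omega> = grid Z' (1 / real j) (j * j) \<omega> (rounded L2 j (j * j) \<omega> (i j t))" for j t \<omega>
  have rle: "rounded L j J \<omega> k \<le> J" for L :: "real \<Rightarrow> 'c \<Rightarrow> real" and j J \<omega> k by (simp add: rounded_def)
  \<comment> \<open>Cut off outside \<open>index_set\<close> so that it is bounded and Lipschitz in
    \<open>z\<close> for every \<open>\<kappa>\<close>, since the conditioning lemma quantifies over
    all of them.\<close>
  define F where "F g j \<kappa> z = (if \<kappa> \<in> index_set (j * j) then g (\<lambda>t. z (\<kappa> (i j t))) else 0)"
    for g :: "(real \<Rightarrow> real) \<Rightarrow> real" and j and \<kappa> :: "nat \<Rightarrow> nat" and z :: "nat \<Rightarrow> real"
  have F_lipschitz: "bounded_lipschitz (j * j) (F g j \<kappa>)" if "lip_functional g" for g j \<kappa>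
  proof (cases "\<kappa> \<in> index_set (j * j)")
    case True
    then have "\<kappa> (i j t) \<le> j * j" for t by (auto simp: index_set_def i_def)
    then show ?thesis unfolding F_def using True bounded_lipschitz_lip_functional[OF that, of "\<lambda>t. \<kappa> (i j t)" "j * j"] by simp
  next
    case False
    then show ?thesis unfolding F_def bounded_lipschitz_def by auto
  qed
  have F_X': "g (\<lambda>t. X' j n t \<omega>) = F g j (rounded (LL n) j (j * j) \<omega>) (grid (Z n) (1 / real j) (j * j) \<omega>)" for g j n \<omega>
    unfolding F_def X'_def by (simp add: rounded_in_index_set)
  have F_Y': "g (\<lambda>t. Y' j t \<omega>) = F g j (rounded L2 j (j * j) \<omega>) (grid Z' (1 / real j) (j * j) \<omega>)" for g j \<omega>
    unfolding F_def Y'_def by (simp add: rounded_in_index_set)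
  have F_bd: "\<exists>B. \<forall>\<kappa> z. \<bar>F g j \<kappa> z\<bar> \<le> B" if g: "lip_functional g" for g j
  proof -
    obtain B where "\<And>x. \<bar>g x\<bar> \<le> B" using g unfolding lip_functional_def by blast
    then show ?thesis unfolding F_def by (intro exI[of _ "\<bar>B\<bar>"]) (auto intro: order_trans[OF _ abs_ge_self])
  qed
  note F_meas = bounded_lipschitz_measurable[OF F_lipschitz]
  have X'_meas: "(\<lambda>\<omega>. g (\<lambda>t. X' j n t \<omega>)) \<in> borel_measurable M" if g: "lip_functional g" and j: "j > 0" for g j n
  proof -
    have r: "rounded (LL n) j (j * j) \<in> measurable M (count_space (index_set (j * j)))" by (rule rounded_measurable[OF LLm])
    have gr: "grid (Z n) (1 / real j) (j * j) \<in> borel_measurable M" by (rule grid_measurable[OF Z]) simp_all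
    have split: "F g j (rounded (LL n) j (j * j) \<omega>) (grid (Z n) (1 / real j) (j * j) \<omega>) =
      (\<Sum>\<kappa>\<in>index_set (j * j). F g j \<kappa> (grid (Z n) (1 / real j) (j * j) \<omega>) * indicator {\<kappa>} (rounded (LL n) j (j * j) \<omega>))" for \<omega>
      using rounded_in_index_set[of "LL n" j "j * j" \<omega>] by (simp add: indicator_def finite_index_set if_distrib cong: if_cong)
    show ?thesis unfolding F_X' split
      by (intro borel_measurable_sum borel_measurable_times measurable_compose[OF gr F_meas[OF g]] measurable_compose[OF r]) simp
  qed
  show ?thesis
  proof (rule converges_in_distribution_U_I[where X' = X' and Y' = Y'])
    show "AE \<omega> in N. (\<lambda>t. Y t \<omega>) \<in> cadlag"
      using Y good2 cont
    proof eventually_elim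
      case (elim \<omega>)
      note L = time_changeD[OF elim(2)]
      have "continuous_on {0..} (\<lambda>t. Z' (L2 t \<omega>) \<omega>)"
        by (rule continuous_on_compose2[OF elim(3) L(3)]) (use L(1) in auto)
      then have co: "continuous_on {0..} (\<lambda>t. Y t \<omega>)"
        by (rule continuous_on_cong[THEN iffD1, rotated -1]) (use elim(1) in auto)
      show ?case unfolding cadlag_def
      proof (intro CollectI conjI allI impI)
        fix t :: real assume "t \<ge> 0"
        then have "((\<lambda>t. Y t \<omega>) \<longlongrightarrow> Y t \<omega>) (at t within {0..})" using co by (auto simp: continuous_on_def)
        then show "((\<lambda>t. Y t \<omega>) \<longlongrightarrow> Y t \<omega>) (at_right t)" by (rule tendsto_within_subset) (use \<open>t \<ge> 0\<close> in auto)
      next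
        fix t :: real assume t: "t > 0"
        then have "((\<lambda>t. Y t \<omega>) \<longlongrightarrow> Y t \<omega>) (at t within {0..})" using co by (auto simp: continuous_on_def)
        then have "((\<lambda>t. Y t \<omega>) \<longlongrightarrow> Y t \<omega>) (at t within {0<..<t})" by (rule tendsto_within_subset) auto
        moreover have "at t within {0<..<t} = at_left t" using t by (intro at_within_nhd[of _ "{0<..}"]) auto
        ultimately show "\<exists>l. ((\<lambda>t. Y t \<omega>) \<longlongrightarrow> l) (at_left t)" by auto
      qed
    qed
    show "AE \<omega> in N. (\<lambda>j. path_dist (\<lambda>t. Y' j t \<omega>) (\<lambda>t. Y t \<omega>)) \<longlonglongrightarrow> 0"
      using Y good2 cont
    proof eventually_elim
      case (elim \<omega>)
      note L = time_changeD[OF elim(2)]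
      show ?case
      proof (rule LIMSEQ_I, unfold eventually_sequentially[symmetric])
        fix r :: real assume r: "r > 0"
        define e where "e = r / 2"
        have e: "e > 0" using r by (simp add: e_def)
        define T where "T = 1 / e"
        have T: "T \<ge> 0" using e by (simp add: T_def)
        define S where "S = nat \<lceil>L2 (T + 2) \<omega> + 1\<rceil>"
        have S: "L2 (T + 2) \<omega> + 1 \<le> real S" unfolding S_def by (rule real_nat_ceiling_ge)
        have "uniformly_continuous_on {0..real S} (\<lambda>t. Z' t \<omega>)"
          by (rule compact_uniformly_continuous[OF continuous_on_subset[OF elim(3)]]) auto
        then obtain d where d: "d > 0" "\<And>s t. s \<in> {0..real S} \<Longrightarrow> t \<in> {0..real S} \<Longrightarrow> \<bar>t - s\<bar> < d \<Longrightarrow> \<bar>Z' t \<omega> - Z' s \<omega>\<bar> < e"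
          unfolding uniformly_continuous_on_def dist_real_def using e by metis
        have \<eta>: "d / 2 > 0" using d by simp
        have "\<forall>\<^sub>F j in sequentially. real j > max (2 / d) (max (real S) (T + 2))"
          by (rule eventually_compose_filterlim[OF eventually_gt_at_top filterlim_real_sequentially])
        then show "\<forall>\<^sub>F j in sequentially. norm (path_dist (\<lambda>t. Y' j t \<omega>) (\<lambda>t. Y t \<omega>) - 0) < r"
          using eventually_small_steps[where L=L2 and \<omega>=\<omega>, OF elim(2) \<eta> T S]
        proof eventually_elim
          case (elim j)
          define I where "I = nat \<lceil>real j * T\<rceil>"
          have j: "j > 0" "1 / real j \<le> d / 2" using elim(1) d(1) by (auto simp: field_simps intro: gr0I)
          have SJ: "S * j < j * j" using elim(1) j by simp
          have IJ: "Suc I \<le> j * j"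
          proof -
            have "real I \<le> real j * T + 1" using T of_int_ceiling_le_add_one[of "real j * T"] by (simp add: I_def of_nat_nat)
            then have "real (Suc I) \<le> (T + 2) * real j" using j(1) by (simp add: algebra_simps)
            also have "\<dots> \<le> real j * real j" using elim by (intro mult_right_mono) auto
            finally show ?thesis by (simp flip: of_nat_mult)
          qed
          have "path_dist (\<lambda>t. Y' j t \<omega>) (\<lambda>t. Y t \<omega>) \<le> e"
          proof (rule path_dist_le[OF e])
            fix t :: real assume t: "0 \<le> t" "t \<le> 1 / e"
            have "real j * t \<le> real j * T" using t by (intro mult_left_mono) (auto simp: T_def)
            then have tI: "real j * t < real (Suc I)" using real_nat_ceiling_ge[of "real j * T"] by (simp add: I_def)
            note cl = small_steps_close[where L=L2 and \<omega>=\<omega>, OF \<open>time_change (\<lambda>t. L2 t \<omega>)\<close> elim(2)[folded I_def] SJ IJ j t(1) tI, folded i_def]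
            have "Y' j t \<omega> = Z' (real (rounded L2 j (j * j) \<omega> (i j t)) / real j) \<omega>" by (simp add: Y'_def grid_def rle)
            moreover have "Y t \<omega> = Z' (L2 t \<omega>) \<omega>" using \<open>\<forall>t\<ge>0. Y t \<omega> = Z' (L2 t \<omega>) \<omega>\<close> t by simp
            moreover have "\<bar>Z' (real (rounded L2 j (j * j) \<omega> (i j t)) / real j) \<omega> - Z' (L2 t \<omega>) \<omega>\<bar> < e"
              by (rule d(2)) (use cl d(1) in \<open>auto simp: abs_minus_commute\<close>)
            ultimately show "\<bar>Y' j t \<omega> - Y t \<omega>\<bar> \<le> e" by simp
          qed
          then show ?case using path_dist_nonneg[of "\<lambda>t. Y' j t \<omega>" "\<lambda>t. Y t \<omega>"] r by (simp add: e_def)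
        qed
      qed
    qed
    show "(\<lambda>\<omega>. g (\<lambda>t. X' j n t \<omega>)) \<in> borel_measurable M" if "lip_functional g" "j > 0" for g j n
      by (rule X'_meas[OF that])
    show "(\<lambda>\<omega>. g (\<lambda>t. Y' j t \<omega>)) \<in> borel_measurable N" if g: "lip_functional g" and j: "j > 0" for g j
    proof -
      obtain B where B: "\<And>\<kappa> z. \<bar>F g j \<kappa> z\<bar> \<le> B" using F_bd[OF g] by blast
      show ?thesis unfolding F_Y'
        by (rule indep_processes_grid_integral(1)[OF N.prob_space_axioms ind2 Z' L2m F_meas[OF g] B]) simp_all
    qed
    show "(\<lambda>n. \<integral>\<omega>. g (\<lambda>t. X' j n t \<omega>) \<partial>M) \<longlonglongrightarrow> (\<integral>\<omega>. g (\<lambda>t. Y' j t \<omega>) \<partial>N)" if g: "lip_functional g" and j: "j > 0" for g j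
    proof -
      obtain B where B: "\<And>\<kappa> z. \<bar>F g j \<kappa> z\<bar> \<le> B" using F_bd[OF g] by blast
      let ?D = "distr N (count_space (index_set (j * j))) (rounded L2 j (j * j))"
      have "(\<lambda>n. \<Sum>\<kappa>\<in>index_set (j * j). measure ?D {\<kappa>} * (\<integral>\<omega>. F g j \<kappa> (grid (Z n) (1 / real j) (j * j) \<omega>) \<partial>M))
         \<longlonglongrightarrow> (\<Sum>\<kappa>\<in>index_set (j * j). measure ?D {\<kappa>} * (\<integral>\<omega>. F g j \<kappa> (grid Z' (1 / real j) (j * j) \<omega>) \<partial>N))"
        by (intro tendsto_intros fdd[OF j _ F_lipschitz[OF g]]) (use j in simp)
      moreover have "(\<Sum>\<kappa>\<in>index_set (j * j). measure ?D {\<kappa>} * (\<integral>\<omega>. F g j \<kappa> (grid Z' (1 / real j) (j * j) \<omega>) \<partial>N)) = (\<integral>\<omega>. g (\<lambda>t. Y' j t \<omega>) \<partial>N)"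
        unfolding F_Y'
        by (rule indep_processes_grid_integral(2)[OF N.prob_space_axioms ind2 Z' L2m F_meas[OF g] B, symmetric]) simp_all
      moreover have "\<forall>\<^sub>F n in sequentially. (\<Sum>\<kappa>\<in>index_set (j * j). measure ?D {\<kappa>} * (\<integral>\<omega>. F g j \<kappa> (grid (Z n) (1 / real j) (j * j) \<omega>) \<partial>M)) = (\<integral>\<omega>. g (\<lambda>t. X' j n t \<omega>) \<partial>M)"
        using eventually_gt_at_top[of 0]
      proof eventually_elim
        case (elim n)
        have LLn: "LL n = L1 n" using elim by (simp add: LL_def)
        have "?D = distr M (count_space (index_set (j * j))) (rounded (L1 n) j (j * j))"
          by (rule rounded_distr[OF L2 L1[OF elim] \<alpha> j]) (use j in simp)
        then show ?case unfolding F_X' LLn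
          using indep_processes_grid_integral(2)[where h = "1 / real j" and F = "F g j" and j = j and J = "j * j",
            OF M.prob_space_axioms ind1[OF elim] Z L1m[OF elim] F_meas[OF g] B] by simp
      qed
      ultimately show ?thesis by (simp add: tendsto_cong)
    qed
    show "\<forall>\<^sub>F j in sequentially. \<forall>\<^sub>F n in sequentially. mostly M e (\<lambda>\<omega>. path_dist (\<lambda>t. X n t \<omega>) (\<lambda>t. X' j n t \<omega>) \<le> e)" if e: "e > 0" for e
    proof -
      define T where "T = 1 / e"
      have T: "T \<ge> 0" using e by (simp add: T_def)
      have L2T[measurable]: "L2 (T + 2) \<in> borel_measurable N" using L2m T by simp
      have "(\<lambda>S. measure N {\<omega>\<in>space N. \<not> (L2 (T + 2) \<omega> + 1 \<le> real S)}) \<longlonglongrightarrow> 0"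
      proof (rule N.measure_tendsto_0)
        show "AE \<omega> in N. \<forall>\<^sub>F S in sequentially. \<omega> \<notin> {\<omega>\<in>space N. \<not> (L2 (T + 2) \<omega> + 1 \<le> real S)}"
        proof (rule AE_I2)
          fix \<omega>
          have "\<forall>\<^sub>F S in sequentially. real S \<ge> L2 (T + 2) \<omega> + 1"
            by (rule eventually_compose_filterlim[OF eventually_ge_at_top filterlim_real_sequentially])
          then show "\<forall>\<^sub>F S in sequentially. \<omega> \<notin> {\<omega>\<in>space N. \<not> (L2 (T + 2) \<omega> + 1 \<le> real S)}" by eventually_elim simp
        qed
      qed simp
      then have "\<forall>\<^sub>F S in sequentially. measure N {\<omega>\<in>space N. \<not> (L2 (T + 2) \<omega> + 1 \<le> real S)} < e/4"
        using e by (intro order_tendstoD) auto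
      then have "\<forall>\<^sub>F S in sequentially. measure N {\<omega>\<in>space N. \<not> (L2 (T + 2) \<omega> + 1 \<le> real S)} < e/4 \<and> S > 0"
        using eventually_gt_at_top[of 0] by eventually_elim simp
      then obtain S :: nat where S: "measure N {\<omega>\<in>space N. \<not> (L2 (T + 2) \<omega> + 1 \<le> real S)} < e/4" "S > 0"
        using eventually_happens by fastforce
      obtain \<eta> where \<eta>: "\<eta> > 0" and mod: "\<forall>\<^sub>F n in sequentially. mostly M (e/2) (\<lambda>\<omega>. oscillation_le (\<lambda>t. Z n t \<omega>) (real S) \<eta> (e/2))"
        using modulus[of "real S" "e/2"] S(2) e by auto
      define I where "I j = nat \<lceil>real j * T\<rceil>" for j
      \<comment> \<open>The bad index vectors. The event that \<open>L2 (T + 2) + 1\<close> exceeds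
        \<open>S\<close> is split off on \<open>N\<close> only; on \<open>M\<close> just the law of
        the index vector is used.\<close>
      define G where "G j = {\<kappa> \<in> index_set (j * j). \<not> small_steps \<eta> S j (I j) \<kappa>}" for j
      define D where "D j = distr N (count_space (index_set (j * j))) (rounded L2 j (j * j))" for j
      have r2: "rounded L2 j (j * j) \<in> measurable N (count_space (index_set (j * j)))" for j
        by (rule rounded_measurable[OF L2m])
      define E where "E j = {\<omega>\<in>space N. rounded L2 j (j * j) \<omega> \<in> G j \<and> L2 (T + 2) \<omega> + 1 \<le> real S}" for j
      have GN: "{\<omega>\<in>space N. rounded L2 j (j * j) \<omega> \<in> G j} \<in> sets N" for j
      proof -
        have "rounded L2 j (j * j) -` G j \<inter> space N \<in> sets N" by (rule measurable_sets[OF r2]) (auto simp: G_def)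
        moreover have "rounded L2 j (j * j) -` G j \<inter> space N = {\<omega>\<in>space N. rounded L2 j (j * j) \<omega> \<in> G j}" by auto
        ultimately show ?thesis by simp
      qed
      have EN: "E j \<in> sets N" for j
      proof -
        have "E j = {\<omega>\<in>space N. rounded L2 j (j * j) \<omega> \<in> G j} \<inter> {\<omega>\<in>space N. L2 (T + 2) \<omega> + 1 \<le> real S}" by (auto simp: E_def)
        also have "\<dots> \<in> sets N" by (rule sets.Int[OF GN]) measurable
        finally show ?thesis .
      qed
      have "(\<lambda>j. measure N (E j)) \<longlonglongrightarrow> 0"
      proof (rule N.measure_tendsto_0[OF EN])
        show "AE \<omega> in N. \<forall>\<^sub>F j in sequentially. \<omega> \<notin> E j"
          using good2
        proof eventually_elim
          case (elim \<omega>)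
          show ?case
          proof (cases "L2 (T + 2) \<omega> + 1 \<le> real S")
            case True
            show ?thesis using eventually_small_steps[where L=L2 and \<omega>=\<omega>, OF elim \<eta> T True]
              by eventually_elim (simp add: E_def G_def I_def)
          qed (simp add: E_def)
        qed
      qed
      then have ev1: "\<forall>\<^sub>F j in sequentially. measure N (E j) < e/4" using e by (intro order_tendstoD) auto
      have "\<forall>\<^sub>F j in sequentially. real j > max (1 / \<eta>) (max (real S) (T + 2))"
        by (rule eventually_compose_filterlim[OF eventually_gt_at_top filterlim_real_sequentially])
      then show ?thesis using ev1
      proof eventually_elim
        case (elim j)
        have j: "j > 0" "1 / real j \<le> \<eta>" using elim(1) \<eta> by (auto simp: field_simps intro: gr0I)
        have SJ: "S * j < j * j" using elim(1) j by simp
        have IJ: "Suc (I j) \<le> j * j"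
        proof -
          have "real (I j) \<le> real j * T + 1" using T of_int_ceiling_le_add_one[of "real j * T"] by (simp add: I_def of_nat_nat)
          then have "real (Suc (I j)) \<le> (T + 2) * real j" using j(1) by (simp add: algebra_simps)
          also have "\<dots> \<le> real j * real j" using elim by (intro mult_right_mono) auto
          finally show ?thesis by (simp flip: of_nat_mult)
        qed
        have GD: "measure (D j) (G j) \<le> e/2"
        proof -
          have "measure (D j) (G j) = measure N (rounded L2 j (j * j) -` G j \<inter> space N)"
            unfolding D_def by (rule measure_distr[OF r2]) (auto simp: G_def)
          also have "\<dots> \<le> measure N (E j \<union> {\<omega>\<in>space N. \<not> (L2 (T + 2) \<omega> + 1 \<le> real S)})"
          proof (rule N.finite_measure_mono)
            show "E j \<union> {\<omega>\<in>space N. \<not> (L2 (T + 2) \<omega> + 1 \<le> real S)} \<in> sets N"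
              by (intro sets.Un EN) measurable
          qed (auto simp: E_def)
          also have "\<dots> \<le> measure N (E j) + measure N {\<omega>\<in>space N. \<not> (L2 (T + 2) \<omega> + 1 \<le> real S)}"
            by (rule measure_Un_le[OF EN]) measurable
          also have "\<dots> \<le> e/2" using elim(2) S(1) by linarith
          finally show ?thesis .
        qed
        show ?case using mod eventually_gt_at_top[of 0]
        proof eventually_elim
          case (elim n)
          then obtain A where A: "A \<in> sets M" "measure M A \<le> e/2"
            "AE \<omega> in M. \<omega> \<notin> A \<longrightarrow> (oscillation_le (\<lambda>t. Z n t \<omega>) (real S) \<eta> (e/2))"
            by blast
          have LLn: "LL n = L1 n" using elim by (simp add: LL_def)
          have r1: "rounded (L1 n) j (j * j) \<in> measurable M (count_space (index_set (j * j)))"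
            by (rule rounded_measurable[OF L1m[OF elim(2)]])
          define A' where "A' = rounded (L1 n) j (j * j) -` G j \<inter> space M"
          have A'm: "A' \<in> sets M" unfolding A'_def by (rule measurable_sets[OF r1]) (auto simp: G_def)
          have "D j = distr M (count_space (index_set (j * j))) (rounded (L1 n) j (j * j))"
            unfolding D_def by (rule rounded_distr[OF L2 L1[OF elim(2)] \<alpha> j(1)]) (use j in simp)
          then have "measure (D j) (G j) = measure M A'"
            unfolding A'_def by (simp only:) (rule measure_distr[OF r1], auto simp: G_def)
          then have "measure M A' \<le> e/2" using GD by simp
          then have mA: "measure M (A \<union> A') \<le> e" using measure_Un_le[OF A(1) A'm] A(2) by linarith
          have "AE \<omega> in M. \<omega> \<notin> A \<union> A' \<longrightarrow> path_dist (\<lambda>t. X n t \<omega>) (\<lambda>t. X' j n t \<omega>) \<le> e"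
            using A(3) good1[OF elim(2)] XZ[OF elim(2)] AE_space
          proof eventually_elim
            case (elim \<omega>)
            show ?case
            proof
              assume \<omega>: "\<omega> \<notin> A \<union> A'"
              then have ss: "small_steps \<eta> S j (I j) (rounded (L1 n) j (j * j) \<omega>)"
                using elim(4) by (simp add: A'_def G_def rounded_in_index_set)
              show "path_dist (\<lambda>t. X n t \<omega>) (\<lambda>t. X' j n t \<omega>) \<le> e"
              proof (rule path_dist_le[OF e])
                fix t :: real assume t: "0 \<le> t" "t \<le> 1 / e"
                have "real j * t \<le> real j * T" using t by (intro mult_left_mono) (auto simp: T_def)
                then have tI: "real j * t < real (Suc (I j))" using real_nat_ceiling_ge[of "real j * T"] by (simp add: I_def)
                note cl = small_steps_close[where L="L1 n" and \<omega>=\<omega>, OF elim(2) ss SJ IJ j t(1) tI, folded i_def]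
                have "X' j n t \<omega> = Z n (real (rounded (L1 n) j (j * j) \<omega> (i j t)) / real j) \<omega>" by (simp add: X'_def grid_def rle LLn)
                moreover have "X n t \<omega> = Z n (L1 n t \<omega>) \<omega>" using elim(3) t by simp
                moreover have "\<bar>Z n (L1 n t \<omega>) \<omega> - Z n (real (rounded (L1 n) j (j * j) \<omega> (i j t)) / real j) \<omega>\<bar> \<le> e/2"
                  using elim(1) \<omega> cl by auto
                ultimately show "\<bar>X n t \<omega> - X' j n t \<omega>\<bar> \<le> e" using e by simp
              qed
            qed
          qed
          then show ?case using mA A(1) A'm by (intro bexI[of _ "A \<union> A'"]) auto
        qed
      qed
    qed
  qed (use M X N.prob_space_axioms in auto)
qed

section \<open>Markov chains and their skeletons\<close>

lemma integral_bind_pmf_bounded: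
  fixes f :: "'b \<Rightarrow> real"
  assumes "\<And>y. \<bar>f y\<bar> \<le> B"
  shows "(\<integral>y. f y \<partial>measure_pmf (bind_pmf p k)) = (\<integral>x. (\<integral>y. f y \<partial>measure_pmf (k x)) \<partial>measure_pmf p)"
  unfolding measure_pmf_bind
  by (rule integral_bind[where K="count_space UNIV" and B=B and B'=1])
     (use assms in \<open>auto simp: measure_pmf.emeasure_space_1 space_subprob_algebra intro: prob_space_imp_subprob_space measure_pmf.prob_space_axioms\<close>)

lemma integrable_pmf_bounded:
  fixes f :: "'b \<Rightarrow> real"
  assumes "\<And>y. \<bar>f y\<bar> \<le> B"
  shows "integrable (measure_pmf p) f"
  by (rule measure_pmf.integrable_const_bound[of _ B]) (use assms in auto)

lemma integral_pmf_cong: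
  assumes "\<And>x. x \<in> set_pmf p \<Longrightarrow> f x = (g x :: real)"
  shows "(\<integral>x. f x \<partial>measure_pmf p) = (\<integral>x. g x \<partial>measure_pmf p)"
  by (rule integral_cong_AE) (auto simp: AE_measure_pmf_iff assms)

text \<open>The law of the whole trajectory rather than of the last state, since running maxima and
  hitting events are read off it.\<close>

primrec chain :: "('s \<Rightarrow> 's pmf) \<Rightarrow> 's \<Rightarrow> nat \<Rightarrow> 's list pmf" where
  "chain \<kappa> x 0 = return_pmf [x]"
| "chain \<kappa> x (Suc K) = bind_pmf (chain \<kappa> x K) (\<lambda>l. map_pmf (\<lambda>y. l @ [y]) (\<kappa> (last l)))"

lemma chain_length: "l \<in> set_pmf (chain \<kappa> x K) \<Longrightarrow> length l = Suc K \<and> l ! 0 = x"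
  by (induction K arbitrary: l) (auto simp: nth_append)

lemma chain_last: "l \<in> set_pmf (chain \<kappa> x K) \<Longrightarrow> last l = l ! K"
  using chain_length[of l \<kappa> x K] by (subst last_conv_nth) auto

lemma integral_chain_Suc:
  fixes f :: "'s list \<Rightarrow> real"
  assumes "\<And>l. \<bar>f l\<bar> \<le> B"
  shows "(\<integral>l. f l \<partial>measure_pmf (chain \<kappa> x (Suc K))) =
    (\<integral>l. (\<integral>y. f (l @ [y]) \<partial>measure_pmf (\<kappa> (last l))) \<partial>measure_pmf (chain \<kappa> x K))"
  by (simp add: integral_bind_pmf_bounded[OF assms])

lemma pmf_integral_in_01:
  assumes "\<And>y. 0 \<le> f y" "\<And>y. f y \<le> (1::real)"
  shows "0 \<le> (\<integral>y. f y \<partial>measure_pmf p)" "(\<integral>y. f y \<partial>measure_pmf p) \<le> 1"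
proof -
  show "0 \<le> (\<integral>y. f y \<partial>measure_pmf p)" using assms by (intro integral_nonneg_AE) auto
  have "(\<integral>y. f y \<partial>measure_pmf p) \<le> (\<integral>y. 1 \<partial>measure_pmf p)"
    using assms by (intro integral_mono integrable_pmf_bounded[of _ 1]) (auto simp: abs_le_iff intro: order_trans[of _ 0])
  then show "(\<integral>y. f y \<partial>measure_pmf p) \<le> 1" by simp
qed

text \<open>Averaging over the last step keeps a test function within \<open>[0, 1]\<close>, so
  exchanging the kernels one step at a time costs \<delta> per step.\<close>

lemma chain_total_variation:
  fixes f :: "'s list \<Rightarrow> real"
  assumes \<delta>: "\<And>s g. (\<And>y. 0 \<le> g y \<and> g y \<le> 1) \<Longrightarrow>
      \<bar>(\<integral>y. g y \<partial>measure_pmf (\<kappa> s)) - (\<integral>y. g y \<partial>measure_pmf (\<kappa>' s))\<bar> \<le> \<delta>"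
    and f: "\<And>l. 0 \<le> f l \<and> f l \<le> 1"
  shows "\<bar>(\<integral>l. f l \<partial>measure_pmf (chain \<kappa> x K)) - (\<integral>l. f l \<partial>measure_pmf (chain \<kappa>' x K))\<bar> \<le> real K * \<delta>"
  using f
proof (induction K arbitrary: f)
  case 0
  then show ?case by simp
next
  case (Suc K)
  have f1: "\<bar>f l\<bar> \<le> 1" for l using Suc.prems[of l] by simp
  define F where "F l = (\<integral>y. f (l @ [y]) \<partial>measure_pmf (\<kappa> (last l)))" for l
  define F' where "F' l = (\<integral>y. f (l @ [y]) \<partial>measure_pmf (\<kappa>' (last l)))" for l
  have F01: "0 \<le> F l \<and> F l \<le> 1" "0 \<le> F' l \<and> F' l \<le> 1" for l
    unfolding F_def F'_def using Suc.prems by (auto intro!: pmf_integral_in_01)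
  have int: "integrable (measure_pmf p) F" "integrable (measure_pmf p) F'" for p
    by (rule integrable_pmf_bounded[of _ 1]; use F01 in \<open>auto simp: abs_le_iff intro: order_trans[of _ 0]\<close>)+
  have "\<bar>(\<integral>l. F l - F' l \<partial>measure_pmf (chain \<kappa>' x K))\<bar> \<le> (\<integral>l. \<bar>F l - F' l\<bar> \<partial>measure_pmf (chain \<kappa>' x K))"
    by (rule integral_abs_bound)
  also have "\<dots> \<le> (\<integral>l. \<delta> \<partial>measure_pmf (chain \<kappa>' x K))"
  proof (rule integral_mono)
    show "integrable (measure_pmf (chain \<kappa>' x K)) (\<lambda>l. \<bar>F l - F' l\<bar>)" using int by auto
    show "\<bar>F l - F' l\<bar> \<le> \<delta>" for l unfolding F_def F'_def by (rule \<delta>) (rule Suc.prems)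
  qed simp
  finally have "\<bar>(\<integral>l. F l \<partial>measure_pmf (chain \<kappa>' x K)) - (\<integral>l. F' l \<partial>measure_pmf (chain \<kappa>' x K))\<bar> \<le> \<delta>"
    using int by simp
  moreover have "\<bar>(\<integral>l. F l \<partial>measure_pmf (chain \<kappa> x K)) - (\<integral>l. F l \<partial>measure_pmf (chain \<kappa>' x K))\<bar> \<le> real K * \<delta>"
    by (rule Suc.IH) (use F01 in auto)
  ultimately show ?case
    unfolding integral_chain_Suc[OF f1] F_def[symmetric] F'_def[symmetric]
    by (simp add: algebra_simps abs_le_iff)
qed

text \<open>In \<open>\<Psi> m\<close> the index counts the remaining steps, so the potential may
  depend on time as well as on the past. Unfolding the last step \<open>m\<close> times moves the
  expectation back to time \<open>k\<close>.\<close>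

lemma chain_supermartingale:
  fixes \<Psi> :: "nat \<Rightarrow> 's list \<Rightarrow> real"
  assumes fin: "\<And>s. finite (set_pmf (\<kappa> s))"
    and step: "\<And>m l. length l > k \<Longrightarrow> (\<integral>y. \<Psi> m (l @ [y]) \<partial>measure_pmf (\<kappa> (last l))) \<le> \<Psi> (Suc m) l"
  shows "(\<integral>l. \<Psi> 0 l \<partial>measure_pmf (chain \<kappa> x (k + m))) \<le> (\<integral>l. \<Psi> m l \<partial>measure_pmf (chain \<kappa> x k))"
proof -
  have finc: "finite (set_pmf (chain \<kappa> x K))" for K using fin by (induction K) auto
  have "(\<integral>l. \<Psi> 0 l \<partial>measure_pmf (chain \<kappa> x (k + m))) \<le> (\<integral>l. \<Psi> i l \<partial>measure_pmf (chain \<kappa> x (k + (m - i))))" if "i \<le> m" for i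
    using that
  proof (induction i)
    case (Suc i)
    define K where "K = k + (m - Suc i)"
    have K: "k + (m - i) = Suc K" using Suc.prems by (simp add: K_def)
    have "(\<integral>l. \<Psi> i l \<partial>measure_pmf (chain \<kappa> x (Suc K))) = 
       (\<integral>l. (\<integral>y. \<Psi> i (l @ [y]) \<partial>measure_pmf (\<kappa> (last l))) \<partial>measure_pmf (chain \<kappa> x K))"
    proof -
      define B where "B = Max ((\<lambda>l. \<bar>\<Psi> i l\<bar>) ` set_pmf (chain \<kappa> x (Suc K)))"
      have B: "\<bar>\<Psi> i l\<bar> \<le> B" if "l \<in> set_pmf (chain \<kappa> x (Suc K))" for l
        unfolding B_def using that by (intro Max_ge finite_imageI imageI finc)
      have B0: "0 \<le> B"
      proof -
        obtain l where "l \<in> set_pmf (chain \<kappa> x (Suc K))" using set_pmf_not_empty by fast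
        then show ?thesis using B[of l] by simp
      qed
      \<comment> \<open>\<open>\<Psi> i\<close> is known to be bounded only on the finite support of
        the chain; cutting it off elsewhere gives the global bound that
        \<open>integral_chain_Suc\<close> asks for.\<close>
      define f where "f l = (if l \<in> set_pmf (chain \<kappa> x (Suc K)) then \<Psi> i l else 0)" for l
      have fB: "\<bar>f l\<bar> \<le> B" for l using B B0 by (simp add: f_def)
      have "(\<integral>l. \<Psi> i l \<partial>measure_pmf (chain \<kappa> x (Suc K))) = (\<integral>l. f l \<partial>measure_pmf (chain \<kappa> x (Suc K)))"
        by (rule integral_pmf_cong) (simp add: f_def)
      also have "\<dots> = (\<integral>l. (\<integral>y. f (l @ [y]) \<partial>measure_pmf (\<kappa> (last l))) \<partial>measure_pmf (chain \<kappa> x K))"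
        by (rule integral_chain_Suc[OF fB])
      also have "\<dots> = (\<integral>l. (\<integral>y. \<Psi> i (l @ [y]) \<partial>measure_pmf (\<kappa> (last l))) \<partial>measure_pmf (chain \<kappa> x K))"
      proof (intro integral_pmf_cong)
        fix l y assume "l \<in> set_pmf (chain \<kappa> x K)" "y \<in> set_pmf (\<kappa> (last l))"
        then have "l @ [y] \<in> set_pmf (chain \<kappa> x (Suc K))" by auto
        then show "f (l @ [y]) = \<Psi> i (l @ [y])" unfolding f_def by (rule if_P)
      qed
      finally show ?thesis .
    qed
    also have "\<dots> \<le> (\<integral>l. \<Psi> (Suc i) l \<partial>measure_pmf (chain \<kappa> x K))"
    proof (rule integral_mono_AE)
      show "AE l in measure_pmf (chain \<kappa> x K). (\<integral>y. \<Psi> i (l @ [y]) \<partial>measure_pmf (\<kappa> (last l))) \<le> \<Psi> (Suc i) l"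
        unfolding AE_measure_pmf_iff
      proof
        fix l assume "l \<in> set_pmf (chain \<kappa> x K)"
        then have "length l > k" using chain_length[of l \<kappa> x K] by (simp add: K_def)
        then show "(\<integral>y. \<Psi> i (l @ [y]) \<partial>measure_pmf (\<kappa> (last l))) \<le> \<Psi> (Suc i) l" by (rule step)
      qed
    qed (auto intro!: integrable_measure_pmf_finite finc)
    finally show ?case using Suc K by (simp add: K_def)
  qed simp
  from this[of m] show ?thesis by simp
qed

lemma pmf_chain_Suc:
  "pmf (chain \<kappa> x (Suc K)) (l @ [y]) = (if l = [] then 0 else pmf (chain \<kappa> x K) l * pmf (\<kappa> (last l)) y)"
proof -
  have "pmf (chain \<kappa> x (Suc K)) (l @ [y]) = (\<integral>l'. pmf (map_pmf (\<lambda>y. l' @ [y]) (\<kappa> (last l'))) (l @ [y]) \<partial>measure_pmf (chain \<kappa> x K))"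
    by (simp add: pmf_bind)
  also have "\<dots> = (\<integral>l'. indicator {l} l' * pmf (\<kappa> (last l)) y \<partial>measure_pmf (chain \<kappa> x K))"
  proof (rule Bochner_Integration.integral_cong[OF refl])
    fix l'
    show "pmf (map_pmf (\<lambda>y. l' @ [y]) (\<kappa> (last l'))) (l @ [y]) = indicator {l} l' * pmf (\<kappa> (last l)) y"
    proof (cases "l' = l")
      case True
      then show ?thesis using pmf_map_inj'[of "\<lambda>y. l @ [y]" "\<kappa> (last l)" y] by (simp add: inj_def)
    next
      case False
      then show ?thesis by (auto simp: pmf_eq_0_set_pmf)
    qed
  qed
  also have "\<dots> = pmf (chain \<kappa> x K) l * pmf (\<kappa> (last l)) y"
    by (simp add: measure_pmf_single)
  also have "\<dots> = (if l = [] then 0 else pmf (chain \<kappa> x K) l * pmf (\<kappa> (last l)) y)"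
    using chain_length[of "[]" \<kappa> x K] by (auto simp: pmf_eq_0_set_pmf)
  finally show ?thesis .
qed

definition row_pmf :: "(real \<Rightarrow> nat \<Rightarrow> nat \<Rightarrow> real) \<Rightarrow> real \<Rightarrow> nat \<Rightarrow> nat pmf" where
  "row_pmf P h i = embed_pmf (P h i)"

lemma transition_functionD:
  assumes "transition_function P"
  shows "\<And>t i j. t \<ge> 0 \<Longrightarrow> 0 \<le> P t i j" "\<And>t i. t \<ge> 0 \<Longrightarrow> P t i sums 1"
    "\<And>i j. P 0 i j = (if i = j then 1 else 0)"
    "\<And>s t i j. s \<ge> 0 \<Longrightarrow> t \<ge> 0 \<Longrightarrow> (\<lambda>k. P s i k * P t k j) sums P (s + t) i j"
  using assms unfolding transition_function_def by auto

lemma pmf_row_pmf: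
  assumes P: "transition_function P" and "h \<ge> 0"
  shows "pmf (row_pmf P h i) j = P h i j"
  unfolding row_pmf_def
proof (rule pmf_embed_pmf)
  show "0 \<le> P h i j" for j using transition_functionD(1)[OF P] assms by simp
  have "(\<integral>\<^sup>+j. ennreal (P h i j) \<partial>count_space UNIV) = (\<Sum>j. ennreal (P h i j))" by (rule nn_integral_count_space_nat)
  also have "\<dots> = ennreal 1"
    using transition_functionD(1,2)[OF P] assms by (intro suminf_ennreal_eq) auto
  finally show "(\<integral>\<^sup>+j. ennreal (P h i j) \<partial>count_space UNIV) = 1" by simp
qed

definition skeleton :: "(real \<Rightarrow> 'a \<Rightarrow> nat) \<Rightarrow> real \<Rightarrow> nat \<Rightarrow> 'a \<Rightarrow> nat list" where
  "skeleton Q h K \<omega> = map (\<lambda>k. Q (real k * h) \<omega>) [0..<Suc K]"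

lemma skeleton_nth: "k \<le> K \<Longrightarrow> skeleton Q h K \<omega> ! k = Q (real k * h) \<omega>"
  by (simp add: skeleton_def del: upt_Suc)

lemma skeleton_length: "length (skeleton Q h K \<omega>) = Suc K" by (simp add: skeleton_def)

lemma skeleton_eq_iff:
  "skeleton Q h K \<omega> = l \<longleftrightarrow> length l = Suc K \<and> (\<forall>k\<le>K. Q (real k * h) \<omega> = l ! k)"
proof
  assume "skeleton Q h K \<omega> = l"
  then show "length l = Suc K \<and> (\<forall>k\<le>K. Q (real k * h) \<omega> = l ! k)"
    using skeleton_nth[of _ K Q h \<omega>] skeleton_length[of Q h K \<omega>] by auto
next
  assume "length l = Suc K \<and> (\<forall>k\<le>K. Q (real k * h) \<omega> = l ! k)"
  then show "skeleton Q h K \<omega> = l"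
    by (intro nth_equalityI) (auto simp: skeleton_length skeleton_nth less_Suc_eq_le)
qed

lemma markov_chainD:
  assumes "markov_chain M x q Q"
  shows "prob_space M" "\<And>t. t \<ge> 0 \<Longrightarrow> Q t \<in> measurable M (count_space UNIV)" "AE \<omega> in M. Q 0 \<omega> = x"
    "AE \<omega> in M. (\<lambda>t. real (Q t \<omega>)) \<in> cadlag"
  using assms unfolding markov_chain_def by auto

lemma skeleton_measurable:
  assumes Q: "\<And>t. t \<ge> 0 \<Longrightarrow> Q t \<in> measurable M (count_space UNIV)" and h: "h \<ge> 0"
  shows "skeleton Q h K \<in> measurable M (count_space UNIV)"
proof (subst measurable_count_space_eq2_countable)
  have "skeleton Q h K -` {l} \<inter> space M \<in> sets M" for l
  proof (cases "length l = Suc K")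
    case True
    then have "skeleton Q h K -` {l} \<inter> space M = {\<omega>\<in>space M. \<forall>k\<in>{..K}. Q (real k * h) \<omega> = l ! k}"
      using skeleton_eq_iff[of Q h K _ l] by blast
    also have "\<dots> \<in> sets M"
    proof (rule sets.sets_Collect_finite_All)
      fix k assume "k \<in> {..K}"
      have "Q (real k * h) -` {l ! k} \<inter> space M \<in> sets M" by (rule measurable_sets[OF Q]) (use h in auto)
      moreover have "Q (real k * h) -` {l ! k} \<inter> space M = {\<omega>\<in>space M. Q (real k * h) \<omega> = l ! k}" by auto
      ultimately show "{\<omega>\<in>space M. Q (real k * h) \<omega> = l ! k} \<in> sets M" by simp
    qed simp
    finally show ?thesis .
  next
    case False
    then have "skeleton Q h K -` {l} \<inter> space M = {}" by (auto simp: skeleton_length)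
    then show ?thesis by simp
  qed
  then show "skeleton Q h K \<in> space M \<rightarrow> UNIV \<and> (\<forall>a\<in>UNIV. skeleton Q h K -` {a} \<inter> space M \<in> sets M)" by auto
qed

text \<open>One transition function serves all meshes \<open>h\<close>. The product form of the
  Markov property gives the point masses of the skeleton, which determine its law as lists of
  naturals are countable.\<close>

lemma skeleton_distr:
  assumes mc: "markov_chain M x q Q"
  shows "\<exists>P. transition_function P \<and> (\<forall>i j. ((\<lambda>h. (P h i j - P 0 i j) / h) \<longlongrightarrow> q i j) (at_right 0)) \<and>
    (\<forall>h\<ge>0. \<forall>K. distr M (count_space UNIV) (skeleton Q h K) = measure_pmf (chain (row_pmf P h) x K))"
proof -
  note mcD = markov_chainD[OF mc]
  interpret prob_space M by (rule mcD(1))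
  obtain P where P: "transition_function P" "\<And>i j. ((\<lambda>h. (P h i j - P 0 i j) / h) \<longlongrightarrow> q i j) (at_right 0)"
    and markov: "\<And>n (s :: nat \<Rightarrow> real) (y :: nat \<Rightarrow> nat). 0 \<le> s 0 \<Longrightarrow> (\<And>i. i \<le> n \<Longrightarrow> s i \<le> s (Suc i)) \<Longrightarrow>
           measure M {\<omega>\<in>space M. \<forall>i\<le>Suc n. Q (s i) \<omega> = y i} =
           measure M {\<omega>\<in>space M. \<forall>i\<le>n. Q (s i) \<omega> = y i}
             * P (s (Suc n) - s n) (y n) (y (Suc n))"
    using mc unfolding markov_chain_def by blast
  have "distr M (count_space UNIV) (skeleton Q h K) = measure_pmf (chain (row_pmf P h) x K)" if h: "h \<ge> 0" for h K
  proof (rule measure_eqI_countable[where A=UNIV])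
    have "measure M {\<omega>\<in>space M. skeleton Q h K \<omega> = l} = pmf (chain (row_pmf P h) x K) l" for l
    proof (induction K arbitrary: l)
      case 0
      have "measure M {\<omega>\<in>space M. skeleton Q h 0 \<omega> = l} = measure M {\<omega>\<in>space M. l = [x]}"
      proof (rule measure_eq_AE)
        show "AE \<omega> in M. (\<omega> \<in> {\<omega> \<in> space M. skeleton Q h 0 \<omega> = l}) = (\<omega> \<in> {\<omega> \<in> space M. l = [x]})"
          using mcD(3) by eventually_elim (auto simp: skeleton_def)
        have "skeleton Q h 0 -` {l} \<inter> space M \<in> sets M" by (rule measurable_sets[OF skeleton_measurable[OF mcD(2) h]]) auto
        then show "{\<omega> \<in> space M. skeleton Q h 0 \<omega> = l} \<in> sets M" by (simp add: vimage_def Int_def conj_commute)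
      qed simp
      then show ?case by (simp add: prob_space indicator_def)
    next
      case (Suc K)
      show ?case
      proof (cases "length l = Suc (Suc K)")
        case False
        then have e: "{\<omega>\<in>space M. skeleton Q h (Suc K) \<omega> = l} = {}" by (auto simp: skeleton_eq_iff)
        have "pmf (chain (row_pmf P h) x (Suc K)) l = 0"
          using False chain_length[of l "row_pmf P h" x "Suc K"] by (auto simp del: chain.simps simp: pmf_eq_0_set_pmf)
        then show ?thesis unfolding e by (simp only: measure_empty)
      next
        case True
        then obtain l' y where l: "l = l' @ [y]" by (metis Zero_not_Suc length_0_conv rev_exhaust)
        then have l': "length l' = Suc K" "l' \<noteq> []" using True by auto
        have lK: "l ! K = last l'" "l ! Suc K = y" using l l' by (auto simp: nth_append last_conv_nth)
        have "measure M {\<omega>\<in>space M. skeleton Q h (Suc K) \<omega> = l} = measure M {\<omega>\<in>space M. \<forall>i\<le>Suc K. Q (real i * h) \<omega> = l ! i}"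
          using True by (simp add: skeleton_eq_iff)
        also have "\<dots> = measure M {\<omega>\<in>space M. \<forall>i\<le>K. Q (real i * h) \<omega> = l ! i} * P (real (Suc K) * h - real K * h) (l ! K) (l ! Suc K)"
          using h by (intro markov) (auto intro: mult_right_mono)
        also have "{\<omega>\<in>space M. \<forall>i\<le>K. Q (real i * h) \<omega> = l ! i} = {\<omega>\<in>space M. skeleton Q h K \<omega> = l'}"
          using l l' by (auto simp: skeleton_eq_iff nth_append)
        also have "measure M {\<omega>\<in>space M. skeleton Q h K \<omega> = l'} = pmf (chain (row_pmf P h) x K) l'" by (rule Suc.IH)
        also have "P (real (Suc K) * h - real K * h) (l ! K) (l ! Suc K) = pmf (row_pmf P h (last l')) y"
          unfolding pmf_row_pmf[OF P(1) h] lK by (simp add: algebra_simps)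
        also have "pmf (chain (row_pmf P h) x K) l' * pmf (row_pmf P h (last l')) y = pmf (chain (row_pmf P h) x (Suc K)) l"
          using l'(2) by (simp only: l pmf_chain_Suc if_False)
        finally show ?thesis .
      qed
    qed
    then show "emeasure (distr M (count_space UNIV) (skeleton Q h K)) {l} = emeasure (measure_pmf (chain (row_pmf P h) x K)) {l}" for l
      by (subst emeasure_distr[OF skeleton_measurable[OF mcD(2) h]])
         (auto simp: emeasure_pmf_single emeasure_eq_measure vimage_def Int_def conj_commute)
  qed simp_all
  then show ?thesis using P by blast
qed

section \<open>The queue as a reflected random walk\<close>

lemma transition_function_ge:
  assumes P: "transition_function P" and s: "s \<ge> 0" "t \<ge> 0" and A: "finite A"
  shows "(\<Sum>k\<in>A. P s i k * P t k j) \<le> P (s + t) i j"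
proof -
  have "(\<lambda>k. P s i k * P t k j) sums P (s + t) i j" using transition_functionD(4)[OF P s] .
  then show ?thesis
    using sum_le_suminf[of "\<lambda>k. P s i k * P t k j" A] A transition_functionD(1)[OF P] s
    by (auto simp: sums_iff)
qed

text \<open>Being at \<open>i\<close> after each of \<open>n\<close> short intervals is one way of
  being there at the end, so \<open>P s i i ^ n \<le> P (n s) i i\<close>. The derivative bounds one
  short interval below by \<open>1 - c * s\<close> with \<open>c\<close> slightly above
  \<open>a\<close>, and Bernoulli's inequality gives \<open>1 - c * t\<close> for the
  product.\<close>

lemma transition_function_diag_lower:
  assumes P: "transition_function P" and q: "((\<lambda>h. (P h i i - P 0 i i) / h) \<longlongrightarrow> - a) (at_right 0)"
    and t: "t \<ge> 0"
  shows "1 - a * t \<le> P t i i"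
proof (cases "t = 0")
  case True
  then show ?thesis using transition_functionD(3)[OF P] by simp
next
  case False
  have P0: "P 0 i i = 1" using transition_functionD(3)[OF P] by simp
  have pow: "P s i i ^ n \<le> P (real n * s) i i" if "s \<ge> 0" for s n
  proof (induction n)
    case (Suc n)
    have "P s i i ^ Suc n \<le> P s i i * P (real n * s) i i"
      using Suc transition_functionD(1)[OF P that] by (simp add: mult_left_mono)
    also have "\<dots> \<le> P (s + real n * s) i i" using transition_function_ge[OF P, of s "real n * s" "{i}"] that by simp
    finally show ?case by (simp add: algebra_simps)
  qed (simp add: P0)
  have "1 - a * t \<le> P t i i + t * e" if e: "e > 0" for e
  proof -
    define c where "c = a + e"
    have "\<forall>\<^sub>F h in at_right 0. - c < (P h i i - P 0 i i) / h"
      using order_tendstoD(1)[OF q, of "-c"] e by (simp add: c_def)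
    then obtain d where d: "d > 0" "\<And>h. 0 < h \<Longrightarrow> h < d \<Longrightarrow> - c < (P h i i - 1) / h"
      unfolding eventually_at_right_field P0 by auto
    \<comment> \<open>The first bound brings \<open>t / n\<close> into the range of the derivative
      estimate, the second makes Bernoulli's inequality applicable.\<close>
    obtain n :: nat where n: "real n > max (t / d) (\<bar>c\<bar> * t)" using reals_Archimedean2 by blast
    have npos: "real n > 0" using n t by (metis abs_ge_zero less_le_trans max.strict_boundedE mult_nonneg_nonneg not_less order_less_le_trans)
    define s where "s = t / real n"
    have s: "0 < s" "s < d" "real n * s = t" using npos n t False d(1) by (auto simp: s_def field_simps)
    have "- c < (P s i i - 1) / s" using d(2)[OF s(1,2)] .
    then have "1 - c * s \<le> P s i i" using s(1) by (simp add: field_simps)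
    moreover have cs: "\<bar>c * s\<bar> \<le> 1" using n npos t by (simp add: s_def abs_mult field_simps)
    ultimately have "(1 - c * s) ^ n \<le> P s i i ^ n" by (intro power_mono) auto
    moreover have "1 + real n * (- (c * s)) \<le> (1 + (- (c * s))) ^ n" using cs by (intro Bernoulli_inequality) auto
    moreover have "P s i i ^ n \<le> P t i i" using pow[of s n] s by simp
    moreover have "real n * (- (c * s)) = - c * t" using s(3) by (simp add: algebra_simps)
    ultimately show ?thesis by (simp add: c_def algebra_simps)
  qed
  then have "1 - a * t \<le> P t i i + e" if "e > 0" for e
    using that[THEN divide_pos_pos, of t] False t by (metis nonzero_mult_div_cancel_left order_less_le times_divide_eq_right)
  then show ?thesis by (rule field_le_epsilon)
qed

text \<open>Cut \<open>[0, h]\<close> into \<open>n\<close> pieces and jump in one of them: being at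
  \<open>i\<close> before and at \<open>j\<close> after costs the factor
  \<open>1 - \<nu> * h\<close>. In the induction the first piece is split off, over which the chain
  goes either from \<open>i\<close> to \<open>i\<close> or from \<open>i\<close> to
  \<open>j\<close>.\<close>

lemma transition_function_offdiag_lower:
  assumes P: "transition_function P" and q: "((\<lambda>h. (P h i j - P 0 i j) / h) \<longlongrightarrow> r) (at_right 0)"
    and ij: "i \<noteq> j" and r: "r > 0" and \<nu>: "\<nu> \<ge> 0"
    and diag: "\<And>t. t \<ge> 0 \<Longrightarrow> 1 - \<nu> * t \<le> P t i i" "\<And>t. t \<ge> 0 \<Longrightarrow> 1 - \<nu> * t \<le> P t j j"
    and h: "h \<ge> 0" "\<nu> * h \<le> 1"
  shows "r * h * (1 - \<nu> * h) \<le> P h i j"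
proof (cases "h = 0")
  case True
  then show ?thesis using transition_functionD(1)[OF P, of 0] by simp
next
  case False
  have P0: "P 0 i j = 0" using transition_functionD(3)[OF P] ij by simp
  show ?thesis
  proof (rule field_le_mult_one_interval)
    fix z :: real assume z: "0 < z" "z < 1"
    \<comment> \<open>Any rate below \<open>r\<close> is eventually below the difference quotient;
      the factor \<open>z\<close> is removed at the end by letting it tend to
      \<open>1\<close>.\<close>
    define c where "c = z * r"
    have c: "0 < c" "c < r" using z r by (auto simp: c_def)
    have "\<forall>\<^sub>F h in at_right 0. c < (P h i j - P 0 i j) / h" by (rule order_tendstoD(1)[OF q c(2)])
    then obtain d where d: "d > 0" "\<And>h. 0 < h \<Longrightarrow> h < d \<Longrightarrow> c < P h i j / h"
      unfolding eventually_at_right_field P0 by auto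
    obtain n :: nat where n: "real n > max (h / d) 1" using reals_Archimedean2 by blast
    define \<delta> where "\<delta> = h / real n"
    have \<delta>: "0 < \<delta>" "\<delta> < d" "real n * \<delta> = h" using n h False d(1) by (auto simp: \<delta>_def field_simps)
    have P\<delta>: "c * \<delta> \<le> P \<delta> i j" using d(2)[OF \<delta>(1,2)] \<delta>(1) by (simp add: field_simps)
    have nh: "\<nu> * (real m * \<delta>) \<le> 1" if "m \<le> n" for m
    proof -
      have "real m * \<delta> \<le> real n * \<delta>" using that \<delta> by (intro mult_right_mono) auto
      then show ?thesis using h(2) \<nu> \<delta>(3) by (metis mult_left_mono order_trans)
    qed
    have n1: "1 \<le> n" using n by simp
    have "real m * c * \<delta> * (1 - \<nu> * (real m * \<delta>)) \<le> P (real m * \<delta>) i j" if "m \<le> n" for m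
      using that
    proof (induction m)
      case (Suc m)
      have m: "m \<le> n" using Suc by simp
      define u where "u = 1 - \<nu> * (real m * \<delta>)"
      have u: "0 \<le> u" using nh[OF m] by (simp add: u_def)
      have v: "0 \<le> 1 - \<nu> * \<delta>" using nh[OF n1] by simp
      have md: "0 \<le> real m * \<delta>" using \<delta> by simp
      have "real (Suc m) * c * \<delta> * (1 - \<nu> * (real (Suc m) * \<delta>)) \<le> (1 - \<nu> * \<delta>) * (real m * c * \<delta> * u) + c * \<delta> * u"
      proof -
        have "(1 - \<nu> * \<delta>) * (real m * c * \<delta> * u) + c * \<delta> * u - real (Suc m) * c * \<delta> * (1 - \<nu> * (real (Suc m) * \<delta>))
          = c * \<delta> * (\<nu> * \<delta>) * (1 + real m * (1 - u))"
          by (simp add: u_def algebra_simps)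
        also have "\<dots> \<ge> 0"
        proof -
          have "1 - u \<ge> 0" using \<nu> md by (simp add: u_def)
          then show ?thesis using c \<delta> \<nu> by (intro mult_nonneg_nonneg) auto
        qed
        finally show ?thesis by simp
      qed
      also have "\<dots> \<le> P \<delta> i i * P (real m * \<delta>) i j + P \<delta> i j * P (real m * \<delta>) j j"
      proof (rule add_mono)
        show "(1 - \<nu> * \<delta>) * (real m * c * \<delta> * u) \<le> P \<delta> i i * P (real m * \<delta>) i j"
          using diag(1)[of \<delta>] Suc.IH[OF m] \<delta> v u c unfolding u_def by (intro mult_mono) auto
        show "c * \<delta> * u \<le> P \<delta> i j * P (real m * \<delta>) j j"
          using diag(2)[OF md] P\<delta> u c \<delta> transition_functionD(1)[OF P, of \<delta>] unfolding u_def by (intro mult_mono) auto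
      qed
      also have "\<dots> = (\<Sum>k\<in>{i,j}. P \<delta> i k * P (real m * \<delta>) k j)" using ij by simp
      also have "\<dots> \<le> P (\<delta> + real m * \<delta>) i j" by (rule transition_function_ge[OF P]) (use \<delta> md in auto)
      finally show ?case by (simp add: algebra_simps)
    qed (simp add: P0)
    from this[of n] have "real n * c * \<delta> * (1 - \<nu> * h) \<le> P h i j" using \<delta>(3) by simp
    moreover have "real n * c * \<delta> * (1 - \<nu> * h) = z * (r * h * (1 - \<nu> * h))"
      unfolding c_def using \<delta>(3) by (simp flip: \<delta>(3))
    ultimately show "z * (r * h * (1 - \<nu> * h)) \<le> P h i j" by simp
  qed
qed

text \<open>Uniformisation: the first coin decides whether an event of total rate
  \<open>lam + mu\<close> falls into the mesh interval, the second whether it is an arrival.\<close>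

definition walk_step :: "real \<Rightarrow> real \<Rightarrow> real \<Rightarrow> int pmf" where
  "walk_step lam mu h = bind_pmf (bernoulli_pmf ((lam + mu) * h)) (\<lambda>b.
     map_pmf (\<lambda>c. if b then (if c then 1 else - 1) else 0) (bernoulli_pmf (lam / (lam + mu))))"

lemma finite_walk_step: "finite (set_pmf (walk_step lam mu h))"
  by (simp add: walk_step_def)

lemma integral_walk_step:
  fixes g :: "int \<Rightarrow> real"
  assumes "lam > 0" "mu > 0" "h \<ge> 0" "(lam + mu) * h \<le> 1"
  shows "(\<integral>\<xi>. g \<xi> \<partial>measure_pmf (walk_step lam mu h)) = lam * h * g 1 + mu * h * g (- 1) + (1 - (lam + mu) * h) * g 0"
proof -
  have p: "pmf (walk_step lam mu h) x = (if x = 1 then lam * h else if x = - 1 then mu * h else if x = 0 then 1 - (lam + mu) * h else 0)" for x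
  proof -
    have mp: "pmf (map_pmf f (bernoulli_pmf p)) x = (if f True = x then p else 0) + (if f False = x then 1 - p else 0)"
      if "0 \<le> p" "p \<le> 1" for f :: "bool \<Rightarrow> int" and p x
      using that by (simp add: map_pmf_def pmf_bind pmf_return indicator_def)
    define a where "a = lam / (lam + mu)"
    define s where "s = (lam + mu) * h"
    have a: "0 \<le> a" "a \<le> 1" "0 \<le> s" "s \<le> 1" using assms by (auto simp: a_def s_def)
    have as: "a * s = lam * h" using assms by (simp add: a_def s_def)
    then have "(1 - a) * s = mu * h" by (simp add: s_def algebra_simps)
    then show ?thesis unfolding walk_step_def pmf_bind a_def[symmetric] s_def[symmetric] integral_bernoulli_pmf[OF a(3,4)] mp[OF a(1,2)]
      using as by auto
  qed
  have "(\<integral>\<xi>. g \<xi> \<partial>measure_pmf (walk_step lam mu h)) = (\<Sum>x\<in>{1, -1, 0}. pmf (walk_step lam mu h) x *\<^sub>R g x)"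
    by (rule integral_measure_pmf) (auto simp: set_pmf_iff p split: if_splits)
  also have "\<dots> = lam * h * g 1 + mu * h * g (- 1) + (1 - (lam + mu) * h) * g 0" by (simp add: p)
  finally show ?thesis .
qed

definition walk_kernel :: "real \<Rightarrow> real \<Rightarrow> real \<Rightarrow> int \<Rightarrow> int pmf" where
  "walk_kernel lam mu h s = map_pmf (\<lambda>\<xi>. s + \<xi>) (walk_step lam mu h)"

text \<open>\<open>nat\<close> maps \<open>- 1\<close> to \<open>0\<close>: a service offered to the
  empty queue is lost.\<close>

definition queue_kernel :: "real \<Rightarrow> real \<Rightarrow> real \<Rightarrow> nat \<Rightarrow> nat pmf" where
  "queue_kernel lam mu h i = map_pmf (\<lambda>\<xi>. nat (int i + \<xi>)) (walk_step lam mu h)"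

lemma integral_queue_kernel:
  fixes g :: "nat \<Rightarrow> real"
  assumes "lam > 0" "mu > 0" "h \<ge> 0" "(lam + mu) * h \<le> 1"
  shows "(\<integral>y. g y \<partial>measure_pmf (queue_kernel lam mu h i)) =
    lam * h * g (Suc i) + mu * h * g (i - 1) + (1 - (lam + mu) * h) * g i"
proof -
  have "nat (int i + 1) = Suc i" "nat (int i - 1) = i - 1" by auto
  then show ?thesis unfolding queue_kernel_def integral_map_pmf integral_walk_step[OF assms] by simp
qed

lemma integral_walk_kernel:
  fixes g :: "int \<Rightarrow> real"
  assumes "lam > 0" "mu > 0" "h \<ge> 0" "(lam + mu) * h \<le> 1"
  shows "(\<integral>y. g y \<partial>measure_pmf (walk_kernel lam mu h s)) =
    lam * h * g (s + 1) + mu * h * g (s - 1) + (1 - (lam + mu) * h) * g s"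
  unfolding walk_kernel_def integral_map_pmf integral_walk_step[OF assms] by simp

section \<open>Comparison of the two kernels\<close>

lemma pmf_integral_ge_sum:
  fixes g :: "'s \<Rightarrow> real"
  assumes "finite A" "\<And>y. 0 \<le> g y" "\<And>y. g y \<le> 1"
  shows "(\<Sum>j\<in>A. pmf p j * g j) \<le> (\<integral>y. g y \<partial>measure_pmf p)"
proof -
  have "(\<Sum>j\<in>A. pmf p j * g j) = (\<integral>y. g y * indicator A y \<partial>measure_pmf p)"
    by (subst integral_measure_pmf_real[OF assms(1)]) (auto simp: indicator_def mult.commute split: if_splits)
  also have "\<dots> \<le> (\<integral>y. g y \<partial>measure_pmf p)"
    by (intro integral_mono integrable_pmf_bounded[of _ 1])
       (use assms in \<open>auto simp: indicator_def abs_le_iff intro: order_trans[of _ 0]\<close>)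
  finally show ?thesis .
qed

text \<open>Lower bounds on at most three entries of a row are enough. Both sides are probability
  measures, so the estimate from below for \<open>1 - g\<close> is the one from above for
  \<open>g\<close>, and the entries farther away are controlled by the total mass.\<close>

lemma row_pmf_close_queue_kernel:
  assumes P: "transition_function P" and q: "\<And>i j. ((\<lambda>h. (P h i j - P 0 i j) / h) \<longlongrightarrow> mm1_rates lam mu i j) (at_right 0)"
    and par: "lam > 0" "mu > 0" "h \<ge> 0" "(lam + mu) * h \<le> 1"
    and g: "\<And>y. 0 \<le> g y \<and> g y \<le> 1"
  shows "\<bar>(\<integral>y. g y \<partial>measure_pmf (row_pmf P h i)) - (\<integral>y. g y \<partial>measure_pmf (queue_kernel lam mu h i))\<bar> \<le> ((lam + mu) * h)\<^sup>2"
proof -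
  define \<nu> where "\<nu> = lam + mu"
  have \<nu>: "\<nu> \<ge> 0" "\<nu> * h \<le> 1" using par by (auto simp: \<nu>_def)
  \<comment> \<open>At the empty queue the rate \<open>lam + mu\<close> would be too coarse by a
    term linear in \<open>h\<close>, since there the kernel stays with probability
    \<open>1 - lam * h\<close>.\<close>
  have d0: "1 - lam * t \<le> P t 0 0" if "t \<ge> 0" for t
    using transition_function_diag_lower[OF P _ that, of 0 lam] q[of 0 0] by (simp add: mm1_rates_def)
  have d1: "1 - \<nu> * t \<le> P t i i" if "t \<ge> 0" for t i
  proof (cases "i = 0")
    case True
    have "lam * t \<le> \<nu> * t" using par that by (intro mult_right_mono) (auto simp: \<nu>_def)
    then show ?thesis using d0[OF that] True by simp
  next
    case False
    have "((\<lambda>h. (P h i i - P 0 i i) / h) \<longlongrightarrow> - \<nu>) (at_right 0)"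
      using q[of i i] False by (simp add: mm1_rates_def \<nu>_def)
    then show ?thesis by (rule transition_function_diag_lower[OF P _ that])
  qed
  have up: "lam * h * (1 - \<nu> * h) \<le> P h i (Suc i)" for i
    by (rule transition_function_offdiag_lower[OF P _ _ _ \<nu>(1) d1 d1 _ \<nu>(2)])
       (use q[of i "Suc i"] par in \<open>auto simp: mm1_rates_def\<close>)
  have down: "mu * h * (1 - \<nu> * h) \<le> P h (Suc i) i" for i
    by (rule transition_function_offdiag_lower[OF P _ _ _ \<nu>(1) d1 d1 _ \<nu>(2)])
       (use q[of "Suc i" i] par in \<open>auto simp: mm1_rates_def\<close>)
  have low: "(\<integral>y. g y \<partial>measure_pmf (queue_kernel lam mu h i)) - (\<nu> * h)\<^sup>2 \<le> (\<integral>y. g y \<partial>measure_pmf (row_pmf P h i))"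
    if g: "\<And>y. 0 \<le> g y \<and> g y \<le> 1" for g
  proof (cases i)
    case 0
    have "P h 0 0 * g 0 + P h 0 1 * g 1 \<le> (\<integral>y. g y \<partial>measure_pmf (row_pmf P h 0))"
      using pmf_integral_ge_sum[of "{0,1}" g "row_pmf P h 0"] g by (simp add: pmf_row_pmf[OF P par(3)])
    moreover have "(1 - lam * h) * g 0 \<le> P h 0 0 * g 0" using d0[OF par(3)] g by (intro mult_right_mono) auto
    moreover have "lam * h * (1 - \<nu> * h) * g 1 \<le> P h 0 1 * g 1" using up[of 0] g by (intro mult_right_mono) auto
    moreover have "lam * h * (\<nu> * h) * g 1 \<le> \<nu> * h * (\<nu> * h) * 1"
      using par g \<nu> by (intro mult_mono) (auto simp: \<nu>_def)
    ultimately show ?thesis unfolding 0 integral_queue_kernel[OF par]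
      by (simp add: \<nu>_def power2_eq_square algebra_simps)
  next
    case (Suc k)
    have "P h i k * g k + (P h i i * g i + P h i (Suc i) * g (Suc i)) \<le> (\<integral>y. g y \<partial>measure_pmf (row_pmf P h i))"
      using pmf_integral_ge_sum[of "{k,i,Suc i}" g "row_pmf P h i"] g Suc by (simp add: pmf_row_pmf[OF P par(3)])
    moreover have "mu * h * (1 - \<nu> * h) * g k \<le> P h i k * g k" using down[of k] g Suc by (intro mult_right_mono) auto
    moreover have "(1 - \<nu> * h) * g i \<le> P h i i * g i" using d1[OF par(3)] g by (intro mult_right_mono) auto
    moreover have "lam * h * (1 - \<nu> * h) * g (Suc i) \<le> P h i (Suc i) * g (Suc i)" using up[of i] g by (intro mult_right_mono) auto
    moreover have "lam * h * (\<nu> * h) * g (Suc i) \<le> lam * h * (\<nu> * h) * 1" "mu * h * (\<nu> * h) * g k \<le> mu * h * (\<nu> * h) * 1"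
      by (intro mult_left_mono; use par g \<nu> in simp)+
    moreover have "lam * h * (\<nu> * h) + mu * h * (\<nu> * h) = (\<nu> * h)\<^sup>2" by (simp add: \<nu>_def power2_eq_square algebra_simps)
    ultimately show ?thesis unfolding integral_queue_kernel[OF par] \<nu>_def[symmetric] using Suc
      by (simp add: algebra_simps)
  qed
  have i: "integrable (measure_pmf p) g" for p by (rule integrable_pmf_bounded[of _ 1]) (use g in \<open>auto simp: abs_le_iff intro: order_trans[of _ 0]\<close>)
  have "(\<integral>y. g y \<partial>measure_pmf (queue_kernel lam mu h i)) - (\<nu> * h)\<^sup>2 \<le> (\<integral>y. g y \<partial>measure_pmf (row_pmf P h i))" by (rule low[OF g])
  moreover have "(\<integral>y. 1 - g y \<partial>measure_pmf (queue_kernel lam mu h i)) - (\<nu> * h)\<^sup>2 \<le> (\<integral>y. 1 - g y \<partial>measure_pmf (row_pmf P h i))"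
    by (rule low) (use g in auto)
  ultimately show ?thesis using i unfolding \<nu>_def by (simp add: abs_le_iff)
qed

lemma skeleton_close_chain:
  assumes Q: "mm1_queue M lam mu Q" and par: "lam > 0" "mu > 0" "h \<ge> 0" "(lam + mu) * h \<le> 1"
    and f: "\<And>l. 0 \<le> f l \<and> f l \<le> (1::real)"
  shows "\<bar>(\<integral>\<omega>. f (skeleton Q h K \<omega>) \<partial>M) - (\<integral>l. f l \<partial>measure_pmf (chain (queue_kernel lam mu h) 0 K))\<bar> \<le> real K * ((lam + mu) * h)\<^sup>2"
proof -
  have mc: "markov_chain M 0 (mm1_rates lam mu) Q" using Q unfolding mm1_queue_def .
  obtain P where "transition_function P \<and> (\<forall>i j. ((\<lambda>h. (P h i j - P 0 i j) / h) \<longlongrightarrow> mm1_rates lam mu i j) (at_right 0)) \<and>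
    (\<forall>h\<ge>0. \<forall>K. distr M (count_space UNIV) (skeleton Q h K) = measure_pmf (chain (row_pmf P h) 0 K))"
    using skeleton_distr[OF mc] by (rule exE)
  then have P: "transition_function P" "\<And>i j. ((\<lambda>h. (P h i j - P 0 i j) / h) \<longlongrightarrow> mm1_rates lam mu i j) (at_right 0)"
    "\<And>h K. h \<ge> 0 \<Longrightarrow> distr M (count_space UNIV) (skeleton Q h K) = measure_pmf (chain (row_pmf P h) 0 K)"
    by simp_all
  have "(\<integral>\<omega>. f (skeleton Q h K \<omega>) \<partial>M) = (\<integral>l. f l \<partial>distr M (count_space UNIV) (skeleton Q h K))"
    by (rule integral_distr[symmetric]) (use skeleton_measurable markov_chainD(2)[OF mc] par in auto)
  then show ?thesis unfolding P(3)[OF par(3)]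
    using chain_total_variation[OF row_pmf_close_queue_kernel[OF P(1,2) par] f] by simp
qed

text \<open>The Skorokhod map for integer walks.\<close>

definition reflect :: "int list \<Rightarrow> nat \<Rightarrow> int" where
  "reflect l k = l ! k + Max ((\<lambda>i. max 0 (- (l ! i))) ` {..k})"

lemma reflect_append: "k < length l \<Longrightarrow> reflect (l @ [y]) k = reflect l k"
proof -
  assume k: "k < length l"
  then have "(\<lambda>i. max 0 (- ((l @ [y]) ! i))) ` {..k} = (\<lambda>i. max 0 (- (l ! i))) ` {..k}"
    by (intro image_cong) (auto simp: nth_append)
  then show ?thesis using k by (simp add: reflect_def nth_append)
qed

lemma reflect_nonneg: "0 \<le> reflect l k"
proof -
  have "max 0 (- (l ! k)) \<le> Max ((\<lambda>i. max 0 (- (l ! i))) ` {..k})" by (intro Max_ge) auto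
  then show ?thesis by (simp add: reflect_def)
qed

text \<open>Lindley's recursion. A step that would make the reflected walk negative is a new minimum
  of the free walk, and it raises the running maximum by exactly the missing amount.\<close>

lemma reflect_last:
  assumes "l \<noteq> []"
  shows "reflect (l @ [last l + \<xi>]) (length l) = max 0 (reflect l (length l - 1) + \<xi>)"
proof -
  obtain k where k: "length l = Suc k" using assms by (cases l) auto
  define m where "m = Max ((\<lambda>i. max 0 (- (l ! i))) ` {..k})"
  have "max 0 (- (l ! 0)) \<le> m" unfolding m_def by (intro Max_ge) auto
  then have m0: "0 \<le> m" by simp
  have "(\<lambda>i. max 0 (- ((l @ [last l + \<xi>]) ! i))) ` {..Suc k} = insert (max 0 (- (last l + \<xi>))) ((\<lambda>i. max 0 (- (l ! i))) ` {..k})"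
    unfolding atMost_Suc image_insert using k by (auto simp: nth_append image_iff less_Suc_eq_le)
  then have "Max ((\<lambda>i. max 0 (- ((l @ [last l + \<xi>]) ! i))) ` {..Suc k}) = max (max 0 (- (last l + \<xi>))) m"
    unfolding m_def by simp
  then have "reflect (l @ [last l + \<xi>]) (length l) = last l + \<xi> + max (max 0 (- (last l + \<xi>))) m"
    using k by (simp add: reflect_def nth_append)
  moreover have "reflect l (length l - 1) = last l + m" using k assms by (simp add: reflect_def m_def last_conv_nth)
  ultimately show ?thesis using m0 by (auto simp: max_def)
qed

definition reflect_list :: "int list \<Rightarrow> nat list" where
  "reflect_list l = map (\<lambda>k. nat (reflect l k)) [0..<length l]"

lemma reflect_list_append:
  assumes "l \<noteq> []"
  shows "reflect_list (l @ [last l + \<xi>]) = reflect_list l @ [nat (int (last (reflect_list l)) + \<xi>)]"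
proof -
  have "last (reflect_list l) = nat (reflect l (length l - 1))"
    using assms by (simp add: reflect_list_def last_map)
  then have "int (last (reflect_list l)) = reflect l (length l - 1)" using reflect_nonneg by simp
  then show ?thesis using reflect_last[OF assms, of \<xi>]
    by (auto simp: reflect_list_def reflect_append)
qed

text \<open>An exact identity in law: the lazy queue is the reflection of a free walk with the same
  steps. Estimates can be made for the free walk and carried over by deterministic bounds on
  \<open>reflect\<close>.\<close>

lemma chain_queue_kernel_eq:
  "chain (queue_kernel lam mu h) 0 K = map_pmf reflect_list (chain (walk_kernel lam mu h) 0 K)"
proof (induction K)
  case 0
  then show ?case by (simp add: reflect_list_def reflect_def)
next
  case (Suc K)
  have "chain (queue_kernel lam mu h) 0 (Suc K) = bind_pmf (chain (walk_kernel lam mu h) 0 K) (\<lambda>l.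
     map_pmf (\<lambda>\<xi>. reflect_list l @ [nat (int (last (reflect_list l)) + \<xi>)]) (walk_step lam mu h))"
    by (simp add: Suc bind_map_pmf queue_kernel_def pmf.map_comp comp_def)
  also have "\<dots> = bind_pmf (chain (walk_kernel lam mu h) 0 K) (\<lambda>l.
     map_pmf (\<lambda>\<xi>. reflect_list (l @ [last l + \<xi>])) (walk_step lam mu h))"
  proof (rule bind_pmf_cong[OF refl])
    fix l assume "l \<in> set_pmf (chain (walk_kernel lam mu h) 0 K)"
    then have "length l = Suc K" using chain_length[of l "walk_kernel lam mu h" 0 K] by simp
    then have "l \<noteq> []" by auto
    then show "map_pmf (\<lambda>\<xi>. reflect_list l @ [nat (int (last (reflect_list l)) + \<xi>)]) (walk_step lam mu h) =
      map_pmf (\<lambda>\<xi>. reflect_list (l @ [last l + \<xi>])) (walk_step lam mu h)"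
      by (simp add: reflect_list_append)
  qed
  also have "\<dots> = map_pmf reflect_list (chain (walk_kernel lam mu h) 0 (Suc K))"
    by (simp add: map_bind_pmf walk_kernel_def pmf.map_comp comp_def)
  finally show ?case .
qed

text \<open>Uniform bounds on dyadic meshes become bounds for all times of the block. The events
  increase with \<open>p\<close>, and the comparison error tends to \<open>0\<close>. A hit at any
  time persists for a short while to the right, because the queue is locally constant there and by
  the assumption on \<open>U\<close>; so a dyadic time sees it. In \<open>U i t j\<close> the state
  \<open>i\<close> is the one at the start of the block.\<close>

lemma queue_hit_bound:
  fixes U :: "nat \<Rightarrow> real \<Rightarrow> nat \<Rightarrow> bool"
  assumes Q: "mm1_queue M lam mu Q" and par: "lam > 0" "mu > 0" and \<Delta>: "\<Delta> > 0"
    and U: "\<And>i t j. U i t j \<Longrightarrow> \<exists>d>0. \<forall>s. t < s \<and> s < t + d \<longrightarrow> U i s j"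
    and bound: "\<forall>\<^sub>F p in sequentially. measure (measure_pmf (chain (queue_kernel lam mu (\<Delta> / 2 ^ p)) 0 (Suc r * 2 ^ p)))
       {l. \<exists>k. r * 2 ^ p \<le> k \<and> k \<le> Suc r * 2 ^ p \<and> U (l ! (r * 2 ^ p)) (real k * (\<Delta> / 2 ^ p)) (l ! k)} \<le> c"
  shows "mostly M c (\<lambda>\<omega>. \<forall>t. real r * \<Delta> \<le> t \<and> t \<le> real (Suc r) * \<Delta> \<longrightarrow> \<not> U (Q (real r * \<Delta>) \<omega>) t (Q t \<omega>))"
proof -
  have mc: "markov_chain M 0 (mm1_rates lam mu) Q" using Q unfolding mm1_queue_def .
  note mcD = markov_chainD[OF mc]
  interpret prob_space M by (rule mcD(1))
  define h where "h p = \<Delta> / 2 ^ p" for p :: nat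
  have h: "h p > 0" for p using \<Delta> by (simp add: h_def)
  have rh: "real (r * 2 ^ p) * h p = real r * \<Delta>" "real (Suc r * 2 ^ p) * h p = real (Suc r) * \<Delta>" for p by (simp_all add: h_def field_simps)
  define B where "B p = {l. \<exists>k. r * 2 ^ p \<le> k \<and> k \<le> Suc r * 2 ^ p \<and> U (l ! (r * 2 ^ p)) (real k * h p) (l ! k)}" for p
  define A where "A p = skeleton Q (h p) (Suc r * 2 ^ p) -` B p \<inter> space M" for p
  have sm: "skeleton Q (h p) K \<in> measurable M (count_space UNIV)" for p K
    by (rule skeleton_measurable[OF mcD(2)]) (use h[of p] in auto)
  have Am: "A p \<in> sets M" for p unfolding A_def by (rule measurable_sets[OF sm]) simp
  have A_iff: "\<omega> \<in> A p \<longleftrightarrow> \<omega> \<in> space M \<and> (\<exists>k. r * 2 ^ p \<le> k \<and> k \<le> Suc r * 2 ^ p \<and> U (Q (real r * \<Delta>) \<omega>) (real k * h p) (Q (real k * h p) \<omega>))" for \<omega> p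
  proof -
    have 1: "skeleton Q (h p) (Suc r * 2 ^ p) \<omega> ! (r * 2 ^ p) = Q (real r * \<Delta>) \<omega>"
      by (subst skeleton_nth) (simp_all only: rh, simp)
    show ?thesis unfolding A_def B_def vimage_def Int_def mem_Collect_eq 1 using skeleton_nth[of _ "Suc r * 2 ^ p" Q "h p" \<omega>] by auto
  qed
  have inc: "incseq A"
  proof (rule incseq_SucI, rule subsetI)
    fix p \<omega> assume "\<omega> \<in> A p"
    then obtain k where k: "\<omega> \<in> space M" "r * 2 ^ p \<le> k" "k \<le> Suc r * 2 ^ p" "U (Q (real r * \<Delta>) \<omega>) (real k * h p) (Q (real k * h p) \<omega>)"
      unfolding A_iff by blast
    have "real (2 * k) * h (Suc p) = real k * h p" by (simp add: h_def)
    moreover have "r * 2 ^ Suc p \<le> 2 * k" "2 * k \<le> Suc r * 2 ^ Suc p" using k(2,3) by simp_all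
    ultimately show "\<omega> \<in> A (Suc p)" unfolding A_iff using k(1,4) by (metis (no_types))
  qed
  \<comment> \<open>The total comparison error on mesh \<open>\<Delta> / 2^p\<close>:
    \<open>Suc r * 2^p\<close> steps of \<open>((lam + mu) * \<Delta> / 2^p)^2\<close> each give
    \<open>C / 2^p\<close>.\<close>
  define C where "C = real (Suc r) * (lam + mu)\<^sup>2 * \<Delta>\<^sup>2"
  have lim1: "(\<lambda>p. measure M (A p)) \<longlonglongrightarrow> measure M (\<Union>p. A p)"
    using Am by (intro finite_Lim_measure_incseq inc) auto
  have lim2: "(\<lambda>p. c + C / 2 ^ p) \<longlonglongrightarrow> c"
  proof -
    have "(\<lambda>p. c + C * (1/2) ^ p) \<longlonglongrightarrow> c + C * 0" by (intro tendsto_intros LIMSEQ_realpow_zero) auto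
    then show ?thesis by (simp add: power_one_over)
  qed
  have "\<forall>\<^sub>F p in sequentially. measure M (A p) \<le> c + C / 2 ^ p"
  proof -
    have "\<forall>\<^sub>F p in sequentially. (lam + mu) * h p \<le> 1"
    proof -
      have "(\<lambda>p. (lam + mu) * \<Delta> * (1/2) ^ p) \<longlonglongrightarrow> (lam + mu) * \<Delta> * 0" by (intro tendsto_intros LIMSEQ_realpow_zero) auto
      then have "\<forall>\<^sub>F p in sequentially. (lam + mu) * \<Delta> * (1/2) ^ p < 1" by (intro order_tendstoD) auto
      then show ?thesis by eventually_elim (simp add: h_def power_one_over)
    qed
    then show ?thesis using bound
    proof eventually_elim
      case (elim p)
      have "measure M (A p) = (\<integral>\<omega>. indicator (B p) (skeleton Q (h p) (Suc r * 2 ^ p) \<omega>) \<partial>M)"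
      proof -
        have "(\<integral>\<omega>. indicator (B p) (skeleton Q (h p) (Suc r * 2 ^ p) \<omega>) \<partial>M) = (\<integral>\<omega>. indicator (A p) \<omega> \<partial>M)"
          by (rule Bochner_Integration.integral_cong) (auto simp: A_def indicator_def)
        also have "\<dots> = measure M (A p)" using Am sets.sets_into_space[OF Am] by (simp add: Int_absorb2)
        finally show ?thesis by simp
      qed
      also have "\<dots> \<le> (\<integral>l. indicator (B p) l \<partial>measure_pmf (chain (queue_kernel lam mu (h p)) 0 (Suc r * 2 ^ p))) + real (Suc r * 2 ^ p) * ((lam + mu) * h p)\<^sup>2"
        using skeleton_close_chain[OF Q par less_imp_le[OF h] elim(1), of "indicator (B p)" "Suc r * 2 ^ p"] by (simp add: abs_le_iff indicator_def)
      also have "(\<integral>l. indicator (B p) l \<partial>measure_pmf (chain (queue_kernel lam mu (h p)) 0 (Suc r * 2 ^ p))) \<le> c"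
        using elim(2) unfolding B_def h_def by simp
      also have "real (Suc r * 2 ^ p) * ((lam + mu) * h p)\<^sup>2 = C / 2 ^ p"
        by (simp add: C_def h_def power2_eq_square divide_simps) (simp add: algebra_simps)
      finally show ?case by simp
    qed
  qed
  then have mA: "measure M (\<Union>p. A p) \<le> c" by (rule tendsto_le[OF sequentially_bot lim2 lim1])
  have "AE \<omega> in M. \<omega> \<notin> (\<Union>p. A p) \<longrightarrow> (\<forall>t. real r * \<Delta> \<le> t \<and> t \<le> real (Suc r) * \<Delta> \<longrightarrow> \<not> U (Q (real r * \<Delta>) \<omega>) t (Q t \<omega>))"
    using mcD(4) AE_space
  proof eventually_elim
    case (elim \<omega>)
    have False if \<omega>: "\<omega> \<notin> (\<Union>p. A p)" and t: "real r * \<Delta> \<le> t" "t \<le> real (Suc r) * \<Delta>" and Ut: "U (Q (real r * \<Delta>) \<omega>) t (Q t \<omega>)" for t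
    proof (cases "t = real (Suc r) * \<Delta>")
      \<comment> \<open>At the right end of the block there is no room to move to the right, but
        this time lies on every grid.\<close>
      case True
      then have "\<omega> \<in> A 0" unfolding A_iff using Ut elim(2) by (intro conjI exI[of _ "Suc r"]) (auto simp: h_def)
      then show False using \<omega> by blast
    next
      case False
      then have t2: "t < real (Suc r) * \<Delta>" using t by simp
      have t0: "0 \<le> t" using t(1) \<Delta> by (meson less_imp_le mult_nonneg_nonneg of_nat_0_le_iff order_trans)
      have "((\<lambda>t. real (Q t \<omega>)) \<longlongrightarrow> real (Q t \<omega>)) (at_right t)" using elim(1) t0 by (simp add: cadlag_def)
      then have "\<forall>\<^sub>F s in at_right t. dist (real (Q s \<omega>)) (real (Q t \<omega>)) < 1" by (rule tendstoD) simp
      \<comment> \<open>Integer values closer than \<open>1\<close> coincide: the path is constant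
        just after \<open>t\<close>.\<close>
      then have "\<forall>\<^sub>F s in at_right t. Q s \<omega> = Q t \<omega>" by eventually_elim (simp add: dist_real_def)
      then obtain b where b: "b > t" "\<And>s. t < s \<Longrightarrow> s < b \<Longrightarrow> Q s \<omega> = Q t \<omega>" by (auto simp: eventually_at_right_field)
      obtain d where d: "d > 0" "\<And>s. t < s \<Longrightarrow> s < t + d \<Longrightarrow> U (Q (real r * \<Delta>) \<omega>) s (Q t \<omega>)" using U[OF Ut] by blast
      define e where "e = min (b - t) (min d (real (Suc r) * \<Delta> - t))"
      have e: "e > 0" using b d t2 by (simp add: e_def)
      obtain p where p: "h p < e"
      proof -
        obtain p where "(1/2) ^ p < e / \<Delta>" using real_arch_pow_inv[of "e / \<Delta>" "1/2"] e \<Delta> by auto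
        then show thesis using that \<Delta> by (simp add: h_def power_one_over field_simps)
      qed
      \<comment> \<open>The first grid time strictly after \<open>t\<close>; the mesh is finer than
        \<open>e\<close>, so it still lies in the block and in the interval of constancy.\<close>
      define k where "k = nat (\<lfloor>t / h p\<rfloor> + 1)"
      have k: "real k = of_int \<lfloor>t / h p\<rfloor> + 1" using t0 h[of p] by (simp add: k_def)
      have "of_int \<lfloor>t / h p\<rfloor> * h p \<le> t" "t < (of_int \<lfloor>t / h p\<rfloor> + 1) * h p"
        using of_int_floor_le[of "t / h p"] real_of_int_floor_add_one_gt[of "t / h p"] h[of p]
        by (simp_all only: pos_le_divide_eq pos_divide_less_eq)
      then have k1: "t < real k * h p" "real k * h p \<le> t + h p" unfolding k by (simp_all add: distrib_right)
      have "real k * h p < b" "real k * h p < t + d" "real k * h p < real (Suc r) * \<Delta>" using k1 p by (auto simp: e_def)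
      then have "U (Q (real r * \<Delta>) \<omega>) (real k * h p) (Q (real k * h p) \<omega>)" using b(2) d(2) k1(1) by simp
      moreover have "real (r * 2 ^ p) * h p \<le> real k * h p" "real k * h p \<le> real (Suc r * 2 ^ p) * h p"
        unfolding rh using k1 t \<open>real k * h p < real (Suc r) * \<Delta>\<close> by linarith+
      then have "r * 2 ^ p \<le> k" "k \<le> Suc r * 2 ^ p"
        using h[of p] by (simp_all only: mult_le_cancel_right_pos of_nat_le_iff)
      ultimately have "\<omega> \<in> A p" unfolding A_iff using elim(2) by blast
      then show False using \<omega> by blast
    qed
    then show ?case by blast
  qed
  then show ?thesis using mA Am by (intro bexI[of _ "\<Union>p. A p"]) auto
qed

section \<open>Maximal inequalities\<close>

lemma finite_chain:
  assumes "\<And>s. finite (set_pmf (\<kappa> s))"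
  shows "finite (set_pmf (chain \<kappa> x K))"
  using assms by (induction K) auto

text \<open>Ville's maximal inequality: a nonnegative supermartingale \<open>V\<close> that is at
  least \<open>1\<close> on \<open>B\<close> is frozen at \<open>1\<close> from the first hit on,
  which keeps it a supermartingale.\<close>

lemma chain_hit_bound:
  fixes B :: "'s list \<Rightarrow> bool" and V :: "nat \<Rightarrow> 's list \<Rightarrow> real"
  assumes fin: "\<And>s. finite (set_pmf (\<kappa> s))"
    and V0: "\<And>m l. 0 \<le> V m l" and V1: "\<And>m l. length l > k0 \<Longrightarrow> B l \<Longrightarrow> 1 \<le> V m l"
    and step: "\<And>m l. length l > k0 \<Longrightarrow> (\<integral>y. V m (l @ [y]) \<partial>measure_pmf (\<kappa> (last l))) \<le> V (Suc m) l"
  shows "measure (measure_pmf (chain \<kappa> x (k0 + m))) {l. \<exists>k. k0 \<le> k \<and> k \<le> k0 + m \<and> B (take (Suc k) l)}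
    \<le> (\<integral>l. V m l \<partial>measure_pmf (chain \<kappa> x k0))"
proof -
  define hit where "hit l \<longleftrightarrow> (\<exists>k. k0 \<le> k \<and> k < length l \<and> B (take (Suc k) l))" for l
  define \<Psi> where "\<Psi> m l = (if hit l then 1 else V m l)" for m l
  have hit_append: "hit (l @ [y]) \<longleftrightarrow> hit l \<or> (k0 \<le> length l \<and> B (l @ [y]))" for l y
    unfolding hit_def by (auto simp: less_Suc_eq)
  note finc = finite_chain[of \<kappa>, OF fin]
  have int: "integrable (measure_pmf (\<kappa> s)) f" for s and f :: "'s \<Rightarrow> real" by (rule integrable_measure_pmf_finite[OF fin])
  have intc: "integrable (measure_pmf (chain \<kappa> x K)) f" for K and f :: "'s list \<Rightarrow> real" by (rule integrable_measure_pmf_finite[OF finc])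
  have "measure (measure_pmf (chain \<kappa> x (k0 + m))) {l. \<exists>k. k0 \<le> k \<and> k \<le> k0 + m \<and> B (take (Suc k) l)}
     = (\<integral>l. indicator {l. \<exists>k. k0 \<le> k \<and> k \<le> k0 + m \<and> B (take (Suc k) l)} l \<partial>measure_pmf (chain \<kappa> x (k0 + m)))" by simp
  also have "\<dots> \<le> (\<integral>l. \<Psi> 0 l \<partial>measure_pmf (chain \<kappa> x (k0 + m)))"
  proof (rule integral_mono_AE[OF intc intc AE_pmfI])
    fix l assume "l \<in> set_pmf (chain \<kappa> x (k0 + m))"
    then have "length l = Suc (k0 + m)" using chain_length[of l \<kappa> x "k0 + m"] by simp
    then show "indicator {l. \<exists>k. k0 \<le> k \<and> k \<le> k0 + m \<and> B (take (Suc k) l)} l \<le> \<Psi> 0 l"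
      using V0[of 0 l] by (auto simp: \<Psi>_def hit_def indicator_def less_Suc_eq_le)
  qed
  also have "\<dots> \<le> (\<integral>l. \<Psi> m l \<partial>measure_pmf (chain \<kappa> x k0))"
  proof (rule chain_supermartingale[OF fin])
    fix m and l :: "'s list" assume l: "length l > k0"
    show "(\<integral>y. \<Psi> m (l @ [y]) \<partial>measure_pmf (\<kappa> (last l))) \<le> \<Psi> (Suc m) l"
    proof (cases "hit l")
      case True
      then show ?thesis by (simp add: \<Psi>_def hit_append)
    next
      case False
      have "(\<integral>y. \<Psi> m (l @ [y]) \<partial>measure_pmf (\<kappa> (last l))) \<le> (\<integral>y. V m (l @ [y]) \<partial>measure_pmf (\<kappa> (last l)))"
        by (rule integral_mono[OF int int]) (use l False V1 in \<open>auto simp: \<Psi>_def hit_append\<close>)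
      then show ?thesis using step[OF l, of m] False by (simp add: \<Psi>_def)
    qed
  qed
  also have "\<dots> \<le> (\<integral>l. V m l \<partial>measure_pmf (chain \<kappa> x k0))"
  proof (rule integral_mono_AE[OF intc intc AE_pmfI])
    fix l assume "l \<in> set_pmf (chain \<kappa> x k0)"
    then have l: "length l = Suc k0" using chain_length[of l \<kappa> x k0] by simp
    then have "hit l \<Longrightarrow> B l" unfolding hit_def by (metis dual_order.antisym less_Suc_eq_le order_refl take_all)
    then show "\<Psi> m l \<le> V m l" using V1[of l m] l by (auto simp: \<Psi>_def)
  qed
  finally show ?thesis .
qed

section \<open>Bounds for the queue in the three regimes\<close>

lemma finite_kernels: "finite (set_pmf (walk_kernel lam mu h s))" "finite (set_pmf (queue_kernel lam mu h i))"
  by (simp_all add: walk_kernel_def queue_kernel_def finite_walk_step)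

lemma eventually_small_step: "\<forall>\<^sub>F p in sequentially. c * (\<Delta> / 2 ^ p) \<le> (1::real)"
proof -
  have "(\<lambda>p. c * \<Delta> * (1/2) ^ p) \<longlonglongrightarrow> c * \<Delta> * 0" by (intro tendsto_intros LIMSEQ_realpow_zero) auto
  then have "\<forall>\<^sub>F p in sequentially. c * \<Delta> * (1/2) ^ p < 1" by (intro order_tendstoD) auto
  then show ?thesis by eventually_elim (simp add: power_one_over)
qed

lemma take_Suc_last: "k < length l \<Longrightarrow> last (take (Suc k) l) = l ! k"
  by (simp add: take_Suc_conv_app_nth)

text \<open>For \<open>lam < mu\<close> the function \<open>(mu / lam) ^ i\<close> is harmonic for the queue away from \<open>0\<close>.\<close>

lemma queue_sup_tail:
  assumes Q: "mm1_queue M lam mu Q" and par: "lam > 0" "mu > 0" "lam < mu" and T: "T > 0"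
  shows "mostly M ((1 + (mu - lam) * T) * (lam / mu) ^ a) (\<lambda>\<omega>. \<forall>t. 0 \<le> t \<and> t \<le> T \<longrightarrow> Q t \<omega> < a)"
proof -
  have "\<forall>\<^sub>F p in sequentially. measure (measure_pmf (chain (queue_kernel lam mu (T / 2 ^ p)) 0 (Suc 0 * 2 ^ p)))
       {l. \<exists>k. 0 * 2 ^ p \<le> k \<and> k \<le> Suc 0 * 2 ^ p \<and> a \<le> l ! k} \<le> (1 + (mu - lam) * T) * (lam / mu) ^ a"
    using eventually_small_step[of "lam + mu" T]
  proof eventually_elim
    case (elim p)
    define h where "h = T / 2 ^ p"
    have h: "h \<ge> 0" "(lam + mu) * h \<le> 1" using T elim by (auto simp: h_def)
    \<comment> \<open>At \<open>0\<close> the harmonic function gains \<open>(mu - lam) * h\<close>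
      in one step, as a departure is lost there. The second summand pays this for each remaining
      step, and the last factor normalises to \<open>1\<close> at level \<open>a\<close>.\<close>
    define V where "V m l = ((mu / lam) ^ last l + (mu - lam) * h * real m) * (lam / mu) ^ a" for m l
    have "measure (measure_pmf (chain (queue_kernel lam mu h) 0 (0 + 2 ^ p)))
        {l. \<exists>k. 0 \<le> k \<and> k \<le> 0 + 2 ^ p \<and> a \<le> last (take (Suc k) l)}
        \<le> (\<integral>l. V (2 ^ p) l \<partial>measure_pmf (chain (queue_kernel lam mu h) 0 0))"
    proof (rule chain_hit_bound[where B = "\<lambda>l. a \<le> last l"])
      show "0 \<le> V m l" for m l unfolding V_def using par h by (intro mult_nonneg_nonneg add_nonneg_nonneg) auto
      show "1 \<le> V m l" if "a \<le> last l" for m l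
      proof -
        have "(mu / lam) ^ a \<le> (mu / lam) ^ last l" using par that by (intro power_increasing) auto
        also have "\<dots> \<le> (mu / lam) ^ last l + (mu - lam) * h * real m" using par h by simp
        finally have "(mu / lam) ^ a * (lam / mu) ^ a \<le> V m l" unfolding V_def using par by (intro mult_right_mono) auto
        moreover have "(mu / lam) ^ a * (lam / mu) ^ a = 1" using par by (simp flip: power_mult_distrib)
        ultimately show ?thesis by simp
      qed
      show "(\<integral>y. V m (l @ [y]) \<partial>measure_pmf (queue_kernel lam mu h (last l))) \<le> V (Suc m) l" for m l
      proof -
        define i where "i = last l"
        define W where "W j = (mu / lam) ^ j" for j :: nat
        have "lam * h * W (Suc i) + mu * h * W (i - 1) + (1 - (lam + mu) * h) * W i \<le> W i + (mu - lam) * h"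
        proof (cases i)
          case 0
          then show ?thesis using par h by (simp add: W_def field_simps)
        next
          case (Suc k)
          have "lam * h * W (Suc i) = mu * h * W i" "mu * h * W (i - 1) = lam * h * W i"
            using par by (auto simp: W_def Suc field_simps)
          then have "lam * h * W (Suc i) + mu * h * W (i - 1) + (1 - (lam + mu) * h) * W i =
            mu * h * W i + lam * h * W i + (1 - (lam + mu) * h) * W i" by (simp only:)
          also have "\<dots> = W i" by (simp add: algebra_simps)
          finally show ?thesis using par h by simp
        qed
        then have "(lam * h * W (Suc i) + mu * h * W (i - 1) + (1 - (lam + mu) * h) * W i + (mu - lam) * h * real m) * (lam / mu) ^ a
          \<le> (W i + (mu - lam) * h + (mu - lam) * h * real m) * (lam / mu) ^ a"
          using par by (intro mult_right_mono) auto
        then show ?thesis unfolding integral_queue_kernel[OF par(1,2) h] V_def last_snoc i_def[symmetric] W_def[symmetric]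
          by (simp add: algebra_simps)
      qed
    qed (simp_all add: finite_kernels)
    also have "(\<integral>l. V (2 ^ p) l \<partial>measure_pmf (chain (queue_kernel lam mu h) 0 0)) = (1 + (mu - lam) * T) * (lam / mu) ^ a"
      by (simp add: V_def h_def)
    also have "measure (measure_pmf (chain (queue_kernel lam mu h) 0 (0 + 2 ^ p)))
        {l. \<exists>k. 0 \<le> k \<and> k \<le> 0 + 2 ^ p \<and> a \<le> last (take (Suc k) l)} =
        measure (measure_pmf (chain (queue_kernel lam mu h) 0 (0 + 2 ^ p)))
        {l. \<exists>k. 0 \<le> k \<and> k \<le> 0 + 2 ^ p \<and> a \<le> l ! k}"
    proof (rule measure_pmf.finite_measure_eq_AE, unfold AE_measure_pmf_iff, intro ballI)
      fix l assume "l \<in> set_pmf (chain (queue_kernel lam mu h) 0 (0 + 2 ^ p))"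
      then have "length l = Suc (2 ^ p)" using chain_length[of l "queue_kernel lam mu h" 0 "0 + 2 ^ p"] by simp
      then have "last (take (Suc k) l) = l ! k" if "k \<le> 2 ^ p" for k using that by (intro take_Suc_last) simp
      then show "(l \<in> {l. \<exists>k. 0 \<le> k \<and> k \<le> 0 + 2 ^ p \<and> a \<le> last (take (Suc k) l)}) \<longleftrightarrow>
        (l \<in> {l. \<exists>k. 0 \<le> k \<and> k \<le> 0 + 2 ^ p \<and> a \<le> l ! k})" by auto
    qed simp_all
    finally show ?case by (simp add: h_def)
  qed
  then have "mostly M ((1 + (mu - lam) * T) * (lam / mu) ^ a) (\<lambda>\<omega>. \<forall>t. real 0 * T \<le> t \<and> t \<le> real (Suc 0) * T \<longrightarrow> \<not> a \<le> Q t \<omega>)"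
    by (rule queue_hit_bound[OF Q par(1,2) T, rotated]) (rule exI[of _ 1], simp)
  then show ?thesis by (simp add: not_le)
qed

lemma reflect_list_nth: "k < length l \<Longrightarrow> real (reflect_list l ! k) = of_int (reflect l k)"
  using reflect_nonneg[of l k] by (simp add: reflect_list_def)

text \<open>A walk within \<open>a\<close> of a line through \<open>0\<close> of nonnegative slope
  stays above \<open>- a\<close>, so reflection adds at most \<open>a\<close>.\<close>

lemma reflect_near_line:
  fixes a d :: real
  assumes d: "d \<ge> 0" and a: "\<And>i. i \<le> k \<Longrightarrow> \<bar>of_int (l ! i) - real i * d\<bar> < a"
  shows "\<bar>of_int (reflect l k) - real k * d\<bar> \<le> 2 * a"
proof -
  define m where "m = Max ((\<lambda>i. max 0 (- (l ! i))) ` {..k})"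
  have a0: "0 < a" using a[of 0] by linarith
  have "m \<in> (\<lambda>i. max 0 (- (l ! i))) ` {..k}" unfolding m_def by (intro Max_in) auto
  then obtain i where i: "i \<le> k" "m = max 0 (- (l ! i))" by auto
  have "0 \<le> real i * d" using d by simp
  then have "real_of_int m \<le> a" using a[OF i(1)] a0 i(2) by (auto simp: max_def abs_if split: if_splits)
  moreover have "0 \<le> m" using i(2) by simp
  moreover have "of_int (reflect l k) = real_of_int (l ! k) + of_int m" by (simp add: reflect_def m_def)
  ultimately show ?thesis using a[of k] by (auto simp: abs_less_iff abs_le_iff)
qed

lemma measure_queue_chain:
  "measure (measure_pmf (chain (queue_kernel lam mu h) 0 K)) A = measure (measure_pmf (chain (walk_kernel lam mu h) 0 K)) (reflect_list -` A)"
  by (simp add: chain_queue_kernel_eq)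

lemma measure_chain_mono:
  assumes "\<And>l. length l = Suc K \<Longrightarrow> l ! 0 = x \<Longrightarrow> l \<in> A \<Longrightarrow> l \<in> B"
  shows "measure (measure_pmf (chain \<kappa> x K)) A \<le> measure (measure_pmf (chain \<kappa> x K)) B"
  by (rule measure_pmf.finite_measure_mono_AE)
     (use assms chain_length in \<open>fastforce simp: AE_measure_pmf_iff\<close>)+

text \<open>Kolmogorov's inequality for the centred free walk with threshold \<open>a\<close>;
  reflection doubles the deviation. The one-step variance is at most \<open>(lam + mu) * h\<close>,
  and the potential adds this for each remaining step.\<close>

lemma queue_lln:
  assumes Q: "mm1_queue M lam mu Q" and par: "lam > 0" "mu > 0" "lam \<ge> mu" and T: "T > 0" and a: "a > 0"
  shows "mostly M ((lam + mu) * T / a\<^sup>2) (\<lambda>\<omega>. \<forall>t. 0 \<le> t \<and> t \<le> T \<longrightarrow> \<bar>real (Q t \<omega>) - (lam - mu) * t\<bar> \<le> 2 * a)"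
proof -
  have "\<forall>\<^sub>F p in sequentially. measure (measure_pmf (chain (queue_kernel lam mu (T / 2 ^ p)) 0 (Suc 0 * 2 ^ p)))
       {l. \<exists>k. 0 * 2 ^ p \<le> k \<and> k \<le> Suc 0 * 2 ^ p \<and> 2 * a < \<bar>real (l ! k) - (lam - mu) * (real k * (T / 2 ^ p))\<bar>} \<le> (lam + mu) * T / a\<^sup>2"
    using eventually_small_step[of "lam + mu" T]
  proof eventually_elim
    case (elim p)
    define h where "h = T / 2 ^ p"
    have h: "h \<ge> 0" "(lam + mu) * h \<le> 1" using T elim by (auto simp: h_def)
    define d where "d = (lam - mu) * h"
    have d: "d \<ge> 0" using par h by (simp add: d_def)
    define x where "x l = of_int (last l) - real (length l - 1) * d" for l :: "int list"
    define V where "V m l = ((x l)\<^sup>2 + (lam + mu) * h * real m) / a\<^sup>2" for m l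
    have "measure (measure_pmf (chain (queue_kernel lam mu h) 0 (2 ^ p))) {l. \<exists>k. k \<le> 2 ^ p \<and> 2 * a < \<bar>real (l ! k) - real k * d\<bar>}
      \<le> measure (measure_pmf (chain (walk_kernel lam mu h) 0 (0 + 2 ^ p))) {l. \<exists>k. 0 \<le> k \<and> k \<le> 0 + 2 ^ p \<and> a \<le> \<bar>x (take (Suc k) l)\<bar>}"
      unfolding measure_queue_chain add_0
    proof (rule measure_chain_mono)
      fix l :: "int list" assume len: "length l = Suc (2 ^ p)"
        and "l \<in> reflect_list -` {l. \<exists>k. k \<le> 2 ^ p \<and> 2 * a < \<bar>real (l ! k) - real k * d\<bar>}"
      then obtain k where k: "k \<le> 2 ^ p" "2 * a < \<bar>real (reflect_list l ! k) - real k * d\<bar>" by auto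
      then have "\<not> \<bar>of_int (reflect l k) - real k * d\<bar> \<le> 2 * a" using len by (simp add: reflect_list_nth)
      then obtain i where i: "i \<le> k" "a \<le> \<bar>of_int (l ! i) - real i * d\<bar>" using reflect_near_line[OF d, of k l a] by force
      have "x (take (Suc i) l) = of_int (l ! i) - real i * d" using i k len by (simp add: x_def take_Suc_last)
      then show "l \<in> {l. \<exists>k. 0 \<le> k \<and> k \<le> 2 ^ p \<and> a \<le> \<bar>x (take (Suc k) l)\<bar>}" using i k by (intro CollectI exI[of _ i]) auto
    qed
    also have "\<dots> \<le> (\<integral>l. V (2 ^ p) l \<partial>measure_pmf (chain (walk_kernel lam mu h) 0 0))"
    proof (rule chain_hit_bound[where B = "\<lambda>l. a \<le> \<bar>x l\<bar>"])
      show "0 \<le> V m l" for m l unfolding V_def using par h by (intro divide_nonneg_nonneg add_nonneg_nonneg) auto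
      show "1 \<le> V m l" if "a \<le> \<bar>x l\<bar>" for m l
      proof -
        have "a\<^sup>2 \<le> (x l)\<^sup>2" using that a by (metis abs_le_square_iff abs_of_pos)
        also have "\<dots> \<le> (x l)\<^sup>2 + (lam + mu) * h * real m" using par h by simp
        finally show ?thesis using a by (simp add: V_def)
      qed
      show "(\<integral>y. V m (l @ [y]) \<partial>measure_pmf (walk_kernel lam mu h (last l))) \<le> V (Suc m) l" if l: "length l > 0" for m l
      proof -
        define y where "y = x l"
        have xs: "x (l @ [last l + 1]) = y + 1 - d" "x (l @ [last l - 1]) = y - 1 - d" "x (l @ [last l]) = y - d"
        proof -
          obtain n where "length l = Suc n" using l by (cases l) auto
          then show "x (l @ [last l + 1]) = y + 1 - d" "x (l @ [last l - 1]) = y - 1 - d" "x (l @ [last l]) = y - d"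
            by (simp_all add: x_def y_def distrib_right)
        qed
        have "lam * h * (y + 1 - d)\<^sup>2 + mu * h * (y - 1 - d)\<^sup>2 + (1 - (lam + mu) * h) * (y - d)\<^sup>2 = y\<^sup>2 + (lam + mu) * h - d\<^sup>2"
          by (simp add: d_def power2_eq_square algebra_simps)
        then have 1: "lam * h * (y + 1 - d)\<^sup>2 + mu * h * (y - 1 - d)\<^sup>2 + (1 - (lam + mu) * h) * (y - d)\<^sup>2 \<le> y\<^sup>2 + (lam + mu) * h" by simp
        have "(\<integral>y. V m (l @ [y]) \<partial>measure_pmf (walk_kernel lam mu h (last l))) =
          (lam * h * (y + 1 - d)\<^sup>2 + mu * h * (y - 1 - d)\<^sup>2 + (1 - (lam + mu) * h) * (y - d)\<^sup>2 + (lam + mu) * h * real m) / a\<^sup>2"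
          unfolding integral_walk_kernel[OF par(1,2) h] V_def xs using a by (simp add: field_simps)
        also have "\<dots> \<le> (y\<^sup>2 + (lam + mu) * h + (lam + mu) * h * real m) / a\<^sup>2"
          using 1 by (intro divide_right_mono add_right_mono) auto
        also have "\<dots> = V (Suc m) l" by (simp add: V_def y_def algebra_simps)
        finally show ?thesis .
      qed
    qed (simp_all add: finite_kernels)
    also have "(\<integral>l. V (2 ^ p) l \<partial>measure_pmf (chain (walk_kernel lam mu h) 0 0)) = (lam + mu) * T / a\<^sup>2"
      by (simp add: V_def x_def h_def)
    finally show ?case by (simp add: h_def d_def algebra_simps)
  qed
  then have "mostly M ((lam + mu) * T / a\<^sup>2) (\<lambda>\<omega>. \<forall>t. real 0 * T \<le> t \<and> t \<le> real (Suc 0) * T \<longrightarrow> \<not> 2 * a < \<bar>real (Q t \<omega>) - (lam - mu) * t\<bar>)"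
  proof (rule queue_hit_bound[OF Q par(1,2) T, rotated])
    fix i j :: nat and t assume "2 * a < \<bar>real j - (lam - mu) * t\<bar>"
    moreover have "isCont (\<lambda>t. \<bar>real j - (lam - mu) * t\<bar>) t" by (intro continuous_intros)
    ultimately have "\<forall>\<^sub>F s in at t. 2 * a < \<bar>real j - (lam - mu) * s\<bar>" by (intro order_tendstoD) (auto simp: isCont_def)
    then obtain d where "d > 0" "\<And>s. s \<noteq> t \<Longrightarrow> dist s t < d \<Longrightarrow> 2 * a < \<bar>real j - (lam - mu) * s\<bar>" unfolding eventually_at by auto
    then show "\<exists>d>0. \<forall>s. t < s \<and> s < t + d \<longrightarrow> 2 * a < \<bar>real j - (lam - mu) * s\<bar>"
      by (intro exI[of _ d]) (auto simp: dist_real_def)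
  qed
  then show ?thesis by (simp add: not_less)
qed

text \<open>Between \<open>k0\<close> and \<open>k\<close> the running maximum grows by at most as
  much as the walk falls below its position at \<open>k0\<close>, hence by at most \<open>a\<close>;
  the walk itself contributes the other \<open>a\<close>.\<close>

lemma reflect_oscillation:
  fixes a :: real
  assumes k: "k0 \<le> k" and a: "\<And>i. k0 \<le> i \<Longrightarrow> i \<le> k \<Longrightarrow> \<bar>real_of_int (l ! i - l ! k0)\<bar> < a"
  shows "\<bar>real_of_int (reflect l k - reflect l k0)\<bar> \<le> 2 * a"
proof -
  define m where "m k = Max ((\<lambda>i. max 0 (- (l ! i))) ` {..k})" for k
  have m_ge: "max 0 (- (l ! i)) \<le> m k" if "i \<le> k" for i k unfolding m_def using that by (intro Max_ge) auto
  have a0: "0 < a" using a[of k0] k by simp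
  have "m k \<in> (\<lambda>i. max 0 (- (l ! i))) ` {..k}" unfolding m_def by (intro Max_in) auto
  then obtain i where i: "i \<le> k" "m k = max 0 (- (l ! i))" by auto
  have up: "real_of_int (m k) \<le> real_of_int (m k0) + a"
  proof (cases "i \<le> k0")
    case True
    then have "m k \<le> m k0" using m_ge[of i k0] i by simp
    then show ?thesis using a0 by linarith
  next
    case False
    then have "\<bar>real_of_int (l ! i - l ! k0)\<bar> < a" using a[of i] i by simp
    moreover have "max 0 (- (l ! k0)) \<le> m k0" by (rule m_ge) simp
    ultimately show ?thesis using i(2) a0 by (auto simp: max_def abs_less_iff split: if_splits)
  qed
  have "m k0 \<le> m k" unfolding m_def using k by (intro Max_mono) auto
  moreover have "reflect l k - reflect l k0 = (l ! k - l ! k0) + (m k - m k0)" by (simp add: reflect_def m_def)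
  moreover have "\<bar>real_of_int (l ! k - l ! k0)\<bar> < a" using a[of k] k by simp
  ultimately show ?thesis using up by (auto simp: abs_less_iff abs_le_iff)
qed

text \<open>With \<open>v\<close> the variance of a step, \<open>x^4 + 6 v m x^2 + v m + 3 (v m)^2\<close>, where \<open>m\<close> is the number of
  remaining steps, is a supermartingale along the walk.\<close>

lemma symmetric_walk_block:
  fixes a :: real
  assumes par: "lam > 0" and h: "h \<ge> 0" "2 * lam * h \<le> 1" and a: "a > 0"
  shows "measure (measure_pmf (chain (walk_kernel lam lam h) 0 (k0 + m)))
      {l. \<exists>k. k0 \<le> k \<and> k \<le> k0 + m \<and> a \<le> \<bar>real_of_int (l ! k - l ! k0)\<bar>}
    \<le> (2 * lam * h * real m + 3 * (2 * lam * h * real m)\<^sup>2) / a ^ 4"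
proof -
  define v where "v = 2 * lam * h"
  have v: "v \<ge> 0" using par h by (simp add: v_def)
  have h': "(lam + lam) * h \<le> 1" using h by simp
  define x where "x l = real_of_int (last l - l ! k0)" for l :: "int list"
  define V where "V m l = ((x l) ^ 4 + 6 * v * real m * (x l)\<^sup>2 + (v * real m + 3 * (v * real m)\<^sup>2)) / a ^ 4" for m l
  have "measure (measure_pmf (chain (walk_kernel lam lam h) 0 (k0 + m)))
      {l. \<exists>k. k0 \<le> k \<and> k \<le> k0 + m \<and> a \<le> \<bar>real_of_int (l ! k - l ! k0)\<bar>}
    \<le> measure (measure_pmf (chain (walk_kernel lam lam h) 0 (k0 + m)))
      {l. \<exists>k. k0 \<le> k \<and> k \<le> k0 + m \<and> a \<le> \<bar>x (take (Suc k) l)\<bar>}"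
  proof (rule measure_chain_mono)
    fix l :: "int list" assume len: "length l = Suc (k0 + m)"
      and "l \<in> {l. \<exists>k. k0 \<le> k \<and> k \<le> k0 + m \<and> a \<le> \<bar>real_of_int (l ! k - l ! k0)\<bar>}"
    then obtain k where k: "k0 \<le> k" "k \<le> k0 + m" "a \<le> \<bar>real_of_int (l ! k - l ! k0)\<bar>" by blast
    have "x (take (Suc k) l) = real_of_int (l ! k - l ! k0)" using k len by (simp add: x_def take_Suc_last)
    then show "l \<in> {l. \<exists>k. k0 \<le> k \<and> k \<le> k0 + m \<and> a \<le> \<bar>x (take (Suc k) l)\<bar>}" using k by auto
  qed
  also have "\<dots> \<le> (\<integral>l. V m l \<partial>measure_pmf (chain (walk_kernel lam lam h) 0 k0))"
  proof (rule chain_hit_bound[where B = "\<lambda>l. a \<le> \<bar>x l\<bar>"])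
    show "0 \<le> V m l" for m l unfolding V_def using v a by (intro divide_nonneg_nonneg add_nonneg_nonneg) auto
    show "1 \<le> V m l" if "a \<le> \<bar>x l\<bar>" for m l
    proof -
      have "a ^ 4 \<le> \<bar>x l\<bar> ^ 4" using that a by (intro power_mono) auto
      also have "\<bar>x l\<bar> ^ 4 = x l ^ 4" by simp
      also have "\<dots> \<le> x l ^ 4 + 6 * v * real m * (x l)\<^sup>2 + (v * real m + 3 * (v * real m)\<^sup>2)" using v by simp
      finally show ?thesis using a by (simp add: V_def)
    qed
    show "(\<integral>y. V m (l @ [y]) \<partial>measure_pmf (walk_kernel lam lam h (last l))) \<le> V (Suc m) l" if l: "length l > k0" for m l
    proof -
      define y where "y = x l"
      have xs: "x (l @ [last l + 1]) = y + 1" "x (l @ [last l - 1]) = y - 1" "x (l @ [last l]) = y"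
        using l by (auto simp: x_def y_def nth_append)
      define f where "f m y = y ^ 4 + 6 * v * real m * y\<^sup>2 + (v * real m + 3 * (v * real m)\<^sup>2)" for m y
      \<comment> \<open>Expanding the fourth power for a step of variance \<open>v\<close>: the
        coefficients of the potential are chosen so that all terms cancel up to the surplus
        \<open>3 v^2\<close>.\<close>
      have e: "v / 2 * f m (y + 1) + v / 2 * f m (y - 1) + (1 - v) * f m y + 3 * v\<^sup>2 = f (Suc m) y"
        by (simp add: f_def power2_eq_square power4_eq_xxxx algebra_simps)
      have E: "(\<integral>y. V m (l @ [y]) \<partial>measure_pmf (walk_kernel lam lam h (last l))) =
         (v / 2 * f m (y + 1) + v / 2 * f m (y - 1) + (1 - v) * f m y) / a ^ 4"
        unfolding integral_walk_kernel[OF par par h(1) h'] V_def xs f_def[symmetric]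
        using a by (simp add: v_def field_simps)
      have "v / 2 * f m (y + 1) + v / 2 * f m (y - 1) + (1 - v) * f m y \<le> f (Suc m) y"
        using e zero_le_power2[of v] by linarith
      then have "(v / 2 * f m (y + 1) + v / 2 * f m (y - 1) + (1 - v) * f m y) / a ^ 4 \<le> f (Suc m) y / a ^ 4"
        by (intro divide_right_mono) auto
      also have "\<dots> = V (Suc m) l" by (simp add: V_def f_def y_def)
      finally show ?thesis unfolding E .
    qed
  qed (simp_all add: finite_kernels)
  also have "\<dots> = (\<integral>l. (v * real m + 3 * (v * real m)\<^sup>2) / a ^ 4 \<partial>measure_pmf (chain (walk_kernel lam lam h) 0 k0))"
    by (rule integral_pmf_cong) (simp add: V_def x_def chain_last)
  finally show ?thesis by (simp add: v_def)
qed

text \<open>The fourth moment matters. With \<Delta> of order \<open>n/K\<close> and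
  \<open>a\<close> of order \<open>sqrt n\<close>, the bound for one block is of order
  \<open>1/K^2\<close> for large \<open>n\<close>, so that the union over \<open>K\<close> blocks is
  still small; second moments would give \<open>1/K\<close> per block.\<close>

lemma queue_oscillation:
  assumes Q: "mm1_queue M lam lam Q" and par: "lam > 0" and \<Delta>: "\<Delta> > 0" and a: "a > 0"
  shows "mostly M ((2 * lam * \<Delta> + 3 * (2 * lam * \<Delta>)\<^sup>2) / a ^ 4) (\<lambda>\<omega>. \<forall>t. real r * \<Delta> \<le> t \<and> t \<le> real (Suc r) * \<Delta> \<longrightarrow> \<bar>real (Q t \<omega>) - real (Q (real r * \<Delta>) \<omega>)\<bar> \<le> 2 * a)"
proof -
  have "\<forall>\<^sub>F p in sequentially. measure (measure_pmf (chain (queue_kernel lam lam (\<Delta> / 2 ^ p)) 0 (Suc r * 2 ^ p)))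
       {l. \<exists>k. r * 2 ^ p \<le> k \<and> k \<le> Suc r * 2 ^ p \<and> 2 * a < \<bar>real (l ! k) - real (l ! (r * 2 ^ p))\<bar>} \<le> (2 * lam * \<Delta> + 3 * (2 * lam * \<Delta>)\<^sup>2) / a ^ 4"
    using eventually_small_step[of "2 * lam" \<Delta>]
  proof eventually_elim
    case (elim p)
    define h where "h = \<Delta> / 2 ^ p"
    have h: "h \<ge> 0" "2 * lam * h \<le> 1" using \<Delta> elim by (auto simp: h_def)
    define k0 where "k0 = r * 2 ^ p"
    define m where "m = (2 ^ p :: nat)"
    have K: "Suc r * 2 ^ p = k0 + m" by (simp add: k0_def m_def)
    have "measure (measure_pmf (chain (queue_kernel lam lam h) 0 (k0 + m))) {l. \<exists>k. k0 \<le> k \<and> k \<le> k0 + m \<and> 2 * a < \<bar>real (l ! k) - real (l ! k0)\<bar>}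
      \<le> measure (measure_pmf (chain (walk_kernel lam lam h) 0 (k0 + m))) {l. \<exists>k. k0 \<le> k \<and> k \<le> k0 + m \<and> a \<le> \<bar>real_of_int (l ! k - l ! k0)\<bar>}"
      unfolding measure_queue_chain
    proof (rule measure_chain_mono)
      fix l :: "int list" assume len: "length l = Suc (k0 + m)"
        and "l \<in> reflect_list -` {l. \<exists>k. k0 \<le> k \<and> k \<le> k0 + m \<and> 2 * a < \<bar>real (l ! k) - real (l ! k0)\<bar>}"
      then obtain k where k: "k0 \<le> k" "k \<le> k0 + m" "2 * a < \<bar>real (reflect_list l ! k) - real (reflect_list l ! k0)\<bar>" by auto
      then have "\<not> \<bar>real_of_int (reflect l k - reflect l k0)\<bar> \<le> 2 * a" using len by (simp add: reflect_list_nth)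
      then obtain i where "k0 \<le> i" "i \<le> k" "a \<le> \<bar>real_of_int (l ! i - l ! k0)\<bar>" using reflect_oscillation[OF k(1), of l a] by force
      then show "l \<in> {l. \<exists>k. k0 \<le> k \<and> k \<le> k0 + m \<and> a \<le> \<bar>real_of_int (l ! k - l ! k0)\<bar>}"
        using k by (intro CollectI exI[of _ i]) auto
    qed
    also have "\<dots> \<le> (2 * lam * h * real m + 3 * (2 * lam * h * real m)\<^sup>2) / a ^ 4" by (rule symmetric_walk_block[OF par h a])
    also have "2 * lam * h * real m = 2 * lam * \<Delta>" by (simp add: h_def m_def)
    finally show ?case unfolding K k0_def[symmetric] h_def[symmetric] .
  qed
  then have "mostly M ((2 * lam * \<Delta> + 3 * (2 * lam * \<Delta>)\<^sup>2) / a ^ 4) (\<lambda>\<omega>. \<forall>t. real r * \<Delta> \<le> t \<and> t \<le> real (Suc r) * \<Delta> \<longrightarrow>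
      \<not> 2 * a < \<bar>real (Q t \<omega>) - real (Q (real r * \<Delta>) \<omega>)\<bar>)"
    by (rule queue_hit_bound[OF Q par par \<Delta>, rotated]) (rule exI[of _ 1], simp)
  then show ?thesis by (simp add: not_less)
qed

section \<open>Finite-dimensional convergence\<close>

text \<open>The rate \<epsilon> is the same for all test functions of the class. It comes from
  Skorokhod's coupling, in which the distance of the variables bounds the distance of all their
  images.\<close>

lemma weak_conv_uniform_Lipschitz:
  fixes \<mu> :: "nat \<Rightarrow> real measure"
  assumes \<mu>: "\<And>n. real_distribution (\<mu> n)" and \<nu>: "real_distribution \<nu>" and wc: "weak_conv_m \<mu> \<nu>" and C: "C \<ge> 0"
  shows "\<exists>\<epsilon>. \<epsilon> \<longlonglongrightarrow> 0 \<and> (\<forall>n \<phi>. (\<forall>x y. \<bar>\<phi> x - \<phi> y\<bar> \<le> C * \<bar>x - y\<bar>) \<longrightarrow> (\<forall>x. \<bar>\<phi> x\<bar> \<le> B) \<longrightarrow>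
     \<bar>(\<integral>x. \<phi> x \<partial>\<mu> n) - (\<integral>x. \<phi> x \<partial>\<nu>)\<bar> \<le> \<epsilon> n)"
proof -
  from Skorohod[OF \<mu> \<nu> wc] obtain \<Omega> :: "real measure" and Yn Y where S: "prob_space \<Omega>"
    "\<And>n. Yn n \<in> borel_measurable \<Omega>" "\<And>n. distr \<Omega> borel (Yn n) = \<mu> n"
    "Y \<in> measurable \<Omega> lborel" "distr \<Omega> borel Y = \<nu>" "\<And>x. x \<in> space \<Omega> \<Longrightarrow> (\<lambda>n. Yn n x) \<longlonglongrightarrow> Y x"
    by blast
  interpret prob_space \<Omega> by (rule S(1))
  have Y: "Y \<in> borel_measurable \<Omega>" using S(4) by simp
  note [measurable] = S(2) Y
  define \<epsilon> where "\<epsilon> n = (\<integral>x. min (C * \<bar>Yn n x - Y x\<bar>) (2 * \<bar>B\<bar>) \<partial>\<Omega>)" for n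
  have "\<epsilon> \<longlonglongrightarrow> (\<integral>x. 0 \<partial>\<Omega>)"
    unfolding \<epsilon>_def
  proof (rule integral_dominated_convergence[where w="\<lambda>_. 2 * \<bar>B\<bar>"])
    show "AE x in \<Omega>. (\<lambda>n. min (C * \<bar>Yn n x - Y x\<bar>) (2 * \<bar>B\<bar>)) \<longlonglongrightarrow> 0"
    proof (rule AE_I2)
      fix x assume "x \<in> space \<Omega>"
      from S(6)[OF this] have "(\<lambda>n. min (C * \<bar>Yn n x - Y x\<bar>) (2 * \<bar>B\<bar>)) \<longlonglongrightarrow> min (C * \<bar>Y x - Y x\<bar>) (2 * \<bar>B\<bar>)"
        by (intro tendsto_intros)
      then show "(\<lambda>n. min (C * \<bar>Yn n x - Y x\<bar>) (2 * \<bar>B\<bar>)) \<longlonglongrightarrow> 0" by simp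
    qed
  qed (use C in auto)
  moreover have "\<bar>(\<integral>x. \<phi> x \<partial>\<mu> n) - (\<integral>x. \<phi> x \<partial>\<nu>)\<bar> \<le> \<epsilon> n"
    if lip: "\<And>x y. \<bar>\<phi> x - \<phi> y\<bar> \<le> C * \<bar>x - y\<bar>" and bd: "\<And>x. \<bar>\<phi> x\<bar> \<le> B" for n and \<phi> :: "real \<Rightarrow> real"
  proof -
    have "continuous_on UNIV \<phi>"
    proof (rule continuous_onI)
      fix x e :: real assume "e > 0"
      show "\<exists>d>0. \<forall>x'\<in>UNIV. dist x' x < d \<longrightarrow> dist (\<phi> x') (\<phi> x) \<le> e"
      proof (intro exI[of _ "e / (C + 1)"] conjI ballI impI)
        fix x' assume "dist x' x < e / (C + 1)"
        then have "\<bar>x' - x\<bar> * (C + 1) \<le> e" using C by (simp add: dist_real_def pos_less_divide_eq)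
        moreover have "C * \<bar>x' - x\<bar> \<le> \<bar>x' - x\<bar> * (C + 1)" by (simp add: algebra_simps)
        ultimately show "dist (\<phi> x') (\<phi> x) \<le> e" using lip[of x' x] by (simp add: dist_real_def)
      qed (use \<open>e > 0\<close> C in simp)
    qed
    then have [measurable]: "\<phi> \<in> borel_measurable borel" by (rule borel_measurable_continuous_onI)
    have i: "integrable \<Omega> (\<lambda>x. \<phi> (Yn n x))" "integrable \<Omega> (\<lambda>x. \<phi> (Y x))"
      using bd by (auto intro!: integrable_const_bound[of _ B])
    have "(\<integral>x. \<phi> x \<partial>\<mu> n) - (\<integral>x. \<phi> x \<partial>\<nu>) = (\<integral>x. \<phi> (Yn n x) - \<phi> (Y x) \<partial>\<Omega>)"
      using i by (simp add: S(3)[symmetric] S(5)[symmetric] integral_distr)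
    also have "\<bar>\<dots>\<bar> \<le> (\<integral>x. \<bar>\<phi> (Yn n x) - \<phi> (Y x)\<bar> \<partial>\<Omega>)" by (rule integral_abs_bound)
    also have "\<dots> \<le> \<epsilon> n"
      unfolding \<epsilon>_def
    proof (rule integral_mono)
      show "integrable \<Omega> (\<lambda>x. min (C * \<bar>Yn n x - Y x\<bar>) (2 * \<bar>B\<bar>))"
        using C by (intro integrable_const_bound[of _ "2 * \<bar>B\<bar>"]) auto
      fix x
      have "\<bar>\<phi> (Yn n x) - \<phi> (Y x)\<bar> \<le> 2 * \<bar>B\<bar>" using bd[of "Yn n x"] bd[of "Y x"] by linarith
      then show "\<bar>\<phi> (Yn n x) - \<phi> (Y x)\<bar> \<le> min (C * \<bar>Yn n x - Y x\<bar>) (2 * \<bar>B\<bar>)" using lip by simp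
    qed (use i in auto)
    finally show ?thesis .
  qed
  ultimately show ?thesis by (intro exI[of _ \<epsilon>]) auto
qed

definition scaled_path :: "real \<Rightarrow> nat \<Rightarrow> int list \<Rightarrow> nat \<Rightarrow> real" where
  "scaled_path c R l r = (if r \<le> R then c * of_int (l ! r) else 0)"

text \<open>The coordinate \<open>z R\<close> enters twice, by itself and through
  \<open>z R + x\<close>, hence the constant \<open>2 * C\<close>.\<close>

lemma bounded_lipschitz_integral_last:
  assumes F: "bounded_lipschitz (Suc R) F" and D: "real_distribution D"
  shows "bounded_lipschitz R (\<lambda>z. \<integral>x. F (z(Suc R := z R + x)) \<partial>D)"
proof -
  interpret D: real_distribution D by fact
  obtain C B where F': "C \<ge> 0" "\<And>z z'. \<bar>F z - F z'\<bar> \<le> C * (\<Sum>k\<le>Suc R. \<bar>z k - z' k\<bar>)" "\<And>z. \<bar>F z\<bar> \<le> B" "B \<ge> 0"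
    using bounded_lipschitzE[OF F] by metis
  have m: "(\<lambda>x. F (z(Suc R := z R + x))) \<in> borel_measurable D" for z
  proof -
    have "(\<lambda>x. z(Suc R := z R + x)) \<in> borel_measurable borel"
    proof (rule measurable_coordinatewise_then_product)
      fix k show "(\<lambda>x. (z(Suc R := z R + x)) k) \<in> borel_measurable borel" by (cases "k = Suc R") auto
    qed
    from measurable_compose[OF this bounded_lipschitz_measurable[OF F]] show ?thesis by simp
  qed
  have i: "integrable D (\<lambda>x. F (z(Suc R := z R + x)))" for z
    using F' m by (intro D.integrable_const_bound[of _ B]) auto
  have lip: "\<bar>F (z(Suc R := z R + x)) - F (z'(Suc R := z' R + x))\<bar> \<le> 2 * C * (\<Sum>k\<le>R. \<bar>z k - z' k\<bar>)" for z z' x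
  proof -
    have "\<bar>F (z(Suc R := z R + x)) - F (z'(Suc R := z' R + x))\<bar> \<le> C * ((\<Sum>k\<le>R. \<bar>z k - z' k\<bar>) + \<bar>z R - z' R\<bar>)"
      using F'(2)[of "z(Suc R := z R + x)" "z'(Suc R := z' R + x)"] by simp
    also have "\<bar>z R - z' R\<bar> \<le> (\<Sum>k\<le>R. \<bar>z k - z' k\<bar>)" by (intro member_le_sum) auto
    finally show ?thesis using F'(1) by (simp add: mult_left_mono)
  qed
  have "\<bar>(\<integral>x. F (z(Suc R := z R + x)) \<partial>D) - (\<integral>x. F (z'(Suc R := z' R + x)) \<partial>D)\<bar> \<le> 2 * C * (\<Sum>k\<le>R. \<bar>z k - z' k\<bar>)" for z z'
  proof -
    have "\<bar>\<integral>x. F (z(Suc R := z R + x)) - F (z'(Suc R := z' R + x)) \<partial>D\<bar> \<le> (\<integral>x. \<bar>F (z(Suc R := z R + x)) - F (z'(Suc R := z' R + x))\<bar> \<partial>D)"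
      by (rule integral_abs_bound)
    also have "\<dots> \<le> (\<integral>x. 2 * C * (\<Sum>k\<le>R. \<bar>z k - z' k\<bar>) \<partial>D)" using i lip by (intro integral_mono) auto
    finally show ?thesis using i D.prob_space by simp
  qed
  moreover have "\<bar>\<integral>x. F (z(Suc R := z R + x)) \<partial>D\<bar> \<le> B" for z
  proof -
    have "\<bar>\<integral>x. F (z(Suc R := z R + x)) \<partial>D\<bar> \<le> (\<integral>x. \<bar>F (z(Suc R := z R + x))\<bar> \<partial>D)" by (rule integral_abs_bound)
    also have "\<dots> \<le> (\<integral>x. B \<partial>D)" using i F'(3) by (intro integral_mono) auto
    finally show ?thesis using D.prob_space by simp
  qed
  ultimately show ?thesis unfolding bounded_lipschitz_def using F'(1) by (intro conjI exI[of _ "2 * C"] exI[of _ B]) auto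
qed

text \<open>Induction on the number of steps. Given the past, the law of the last increment is
  replaced by its limit, with an error uniform in the past by
  \<open>weak_conv_uniform_Lipschitz\<close>; integrating it out leaves a functional
  \<open>G\<close> of one step fewer.\<close>

lemma random_walk_invariance:
  fixes \<xi> :: "nat \<Rightarrow> int pmf" and c :: "nat \<Rightarrow> real"
  assumes D: "real_distribution D" and wc: "weak_conv_m (\<lambda>n. distr (measure_pmf (\<xi> n)) borel (\<lambda>x. c n * of_int x)) D"
    and F: "bounded_lipschitz R F"
  shows "(\<lambda>n. \<integral>l. F (scaled_path (c n) R l) \<partial>measure_pmf (chain (\<lambda>s. map_pmf (\<lambda>x. s + x) (\<xi> n)) 0 R))
    \<longlonglongrightarrow> (\<integral>x. F (partial_sums R x) \<partial>(\<Pi>\<^sub>M i\<in>{..<R}. D))"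
  using F
proof (induction R arbitrary: F)
  case 0
  interpret P: prob_space "\<Pi>\<^sub>M i\<in>{}. D" by (rule prob_space_PiM) simp
  have "scaled_path (c n) 0 [0] = (\<lambda>_. 0)" for n by (auto simp: scaled_path_def)
  moreover have "partial_sums 0 x = (\<lambda>_. 0)" for x by (auto simp: partial_sums_def)
  ultimately show ?case by (simp add: P.prob_space[simplified])
next
  case (Suc R)
  interpret D: real_distribution D by fact
  interpret product_sigma_finite "\<lambda>_. D" by standard
  interpret P: prob_space "\<Pi>\<^sub>M i\<in>{..<Suc R}. D" by (rule prob_space_PiM) (rule D.prob_space_axioms)
  define Dn where "Dn n = distr (measure_pmf (\<xi> n)) borel (\<lambda>x. c n * of_int x)" for n
  have Dn: "real_distribution (Dn n)" for n
    unfolding Dn_def by (rule prob_space.real_distribution_distr[OF measure_pmf.prob_space_axioms]) simp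
  obtain C B where F': "C \<ge> 0" "\<And>z z'. \<bar>F z - F z'\<bar> \<le> C * (\<Sum>k\<le>Suc R. \<bar>z k - z' k\<bar>)" "\<And>z. \<bar>F z\<bar> \<le> B" "B \<ge> 0"
    using bounded_lipschitzE[OF Suc.prems] by metis
  obtain \<epsilon> where \<epsilon>: "\<epsilon> \<longlonglongrightarrow> 0" "\<And>n \<phi>. (\<forall>x y. \<bar>\<phi> x - \<phi> y\<bar> \<le> C * \<bar>x - y\<bar>) \<Longrightarrow> (\<forall>x. \<bar>\<phi> x\<bar> \<le> B) \<Longrightarrow>
     \<bar>(\<integral>x. \<phi> x \<partial>Dn n) - (\<integral>x. \<phi> x \<partial>D)\<bar> \<le> \<epsilon> n"
    using weak_conv_uniform_Lipschitz[where B=B and \<mu>=Dn, OF Dn D wc[folded Dn_def] F'(1)] by auto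
  define G where "G z = (\<integral>x. F (z(Suc R := z R + x)) \<partial>D)" for z
  have Gb: "bounded_lipschitz R G" unfolding G_def by (rule bounded_lipschitz_integral_last[OF Suc.prems D])
  let ?ch = "\<lambda>n R. measure_pmf (chain (\<lambda>s. map_pmf (\<lambda>x. s + x) (\<xi> n)) 0 R)"
  have IH: "(\<lambda>n. \<integral>l. G (scaled_path (c n) R l) \<partial>?ch n R) \<longlonglongrightarrow> (\<integral>x. G (partial_sums R x) \<partial>(\<Pi>\<^sub>M i\<in>{..<R}. D))"
    by (rule Suc.IH[OF Gb])
  have lim: "(\<integral>x. F (partial_sums (Suc R) x) \<partial>(\<Pi>\<^sub>M i\<in>{..<Suc R}. D)) = (\<integral>x. G (partial_sums R x) \<partial>(\<Pi>\<^sub>M i\<in>{..<R}. D))"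
  proof -
    have psm: "partial_sums (Suc R) \<in> borel_measurable (\<Pi>\<^sub>M i\<in>{..<Suc R}. D)"
      using partial_sums_measurable[of "Suc R"] by (simp cong: measurable_cong_sets sets_PiM_cong)
    have "integrable (\<Pi>\<^sub>M i\<in>{..<Suc R}. D) (\<lambda>x. F (partial_sums (Suc R) x))"
      using F'(3) measurable_compose[OF psm bounded_lipschitz_measurable[OF Suc.prems]] by (intro P.integrable_const_bound[of _ B]) auto
    then have "(\<integral>x. F (partial_sums (Suc R) x) \<partial>(\<Pi>\<^sub>M i\<in>{..<Suc R}. D)) =
      (\<integral>x. (\<integral>y. F (partial_sums (Suc R) (x(R := y))) \<partial>D) \<partial>(\<Pi>\<^sub>M i\<in>{..<R}. D))"
      using product_integral_insert[of "{..<R}" R "\<lambda>x. F (partial_sums (Suc R) x)"] by (simp add: lessThan_Suc)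
    moreover have "partial_sums (Suc R) (x(R := y)) = (partial_sums R x)(Suc R := partial_sums R x R + y)" for x y
      by (rule ext) (auto simp: partial_sums_def le_Suc_eq)
    ultimately show ?thesis by (simp add: G_def)
  qed
  have close: "\<bar>(\<integral>l. F (scaled_path (c n) (Suc R) l) \<partial>?ch n (Suc R)) - (\<integral>l. G (scaled_path (c n) R l) \<partial>?ch n R)\<bar> \<le> \<epsilon> n" for n
  proof -
    have "(\<integral>l. F (scaled_path (c n) (Suc R) l) \<partial>?ch n (Suc R)) =
      (\<integral>l. (\<integral>x. F (scaled_path (c n) (Suc R) (l @ [last l + x])) \<partial>measure_pmf (\<xi> n)) \<partial>?ch n R)"
      by (subst integral_chain_Suc[of _ B]) (use F' in auto)
    also have "\<dots> = (\<integral>l. (\<integral>x. F ((scaled_path (c n) R l)(Suc R := scaled_path (c n) R l R + x)) \<partial>Dn n) \<partial>?ch n R)"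
    proof (rule integral_pmf_cong)
      fix l assume "l \<in> set_pmf (chain (\<lambda>s. map_pmf (\<lambda>x. s + x) (\<xi> n)) 0 R)"
      then have len: "length l = Suc R" using chain_length[of l _ 0 R] by blast
      then have last: "last l = l ! R" by (subst last_conv_nth) auto
      have "scaled_path (c n) (Suc R) (l @ [last l + x]) = (scaled_path (c n) R l)(Suc R := scaled_path (c n) R l R + c n * of_int x)" for x
        by (rule ext) (auto simp: scaled_path_def nth_append len last less_Suc_eq_le algebra_simps)
      moreover have "(\<lambda>x. F ((scaled_path (c n) R l)(Suc R := scaled_path (c n) R l R + x))) \<in> borel_measurable borel"
      proof (rule measurable_compose[OF _ bounded_lipschitz_measurable[OF Suc.prems]], rule measurable_coordinatewise_then_product)
        fix k show "(\<lambda>x. ((scaled_path (c n) R l)(Suc R := scaled_path (c n) R l R + x)) k) \<in> borel_measurable borel"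
          by (cases "k = Suc R") auto
      qed
      ultimately show "(\<integral>x. F (scaled_path (c n) (Suc R) (l @ [last l + x])) \<partial>measure_pmf (\<xi> n)) =
        (\<integral>x. F ((scaled_path (c n) R l)(Suc R := scaled_path (c n) R l R + x)) \<partial>Dn n)"
        unfolding Dn_def by (subst integral_distr) simp_all
    qed
    finally have eq: "(\<integral>l. F (scaled_path (c n) (Suc R) l) \<partial>?ch n (Suc R)) =
      (\<integral>l. (\<integral>x. F ((scaled_path (c n) R l)(Suc R := scaled_path (c n) R l R + x)) \<partial>Dn n) \<partial>?ch n R)" .
    have each: "\<bar>(\<integral>x. F (z(Suc R := z R + x)) \<partial>Dn n) - G z\<bar> \<le> \<epsilon> n" for z
      unfolding G_def
    proof (rule \<epsilon>(2); intro allI)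
      fix x y
      have "\<bar>F (z(Suc R := z R + x)) - F (z(Suc R := z R + y))\<bar> \<le> C * (\<Sum>k\<le>Suc R. \<bar>(z(Suc R := z R + x)) k - (z(Suc R := z R + y)) k\<bar>)" by (rule F'(2))
      also have "(\<Sum>k\<le>Suc R. \<bar>(z(Suc R := z R + x)) k - (z(Suc R := z R + y)) k\<bar>) = \<bar>x - y\<bar>" by simp
      finally show "\<bar>F (z(Suc R := z R + x)) - F (z(Suc R := z R + y))\<bar> \<le> C * \<bar>x - y\<bar>" .
    qed (rule F'(3))
    obtain B1 where B1: "\<And>z. \<bar>\<integral>x. F (z(Suc R := z R + x)) \<partial>Dn n\<bar> \<le> B1"
      using bounded_lipschitz_integral_last[OF Suc.prems Dn[of n]] unfolding bounded_lipschitz_def by blast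
    obtain B2 where B2: "\<And>z. \<bar>G z\<bar> \<le> B2" using Gb unfolding bounded_lipschitz_def by blast
    have i: "integrable (?ch n R) (\<lambda>l. \<integral>x. F ((scaled_path (c n) R l)(Suc R := scaled_path (c n) R l R + x)) \<partial>Dn n)"
      "integrable (?ch n R) (\<lambda>l. G (scaled_path (c n) R l))"
      by (rule integrable_pmf_bounded[of _ B1], rule B1, rule integrable_pmf_bounded[of _ B2], rule B2)
    have "\<bar>(\<integral>l. (\<integral>x. F ((scaled_path (c n) R l)(Suc R := scaled_path (c n) R l R + x)) \<partial>Dn n) - G (scaled_path (c n) R l) \<partial>?ch n R)\<bar>
      \<le> (\<integral>l. \<bar>(\<integral>x. F ((scaled_path (c n) R l)(Suc R := scaled_path (c n) R l R + x)) \<partial>Dn n) - G (scaled_path (c n) R l)\<bar> \<partial>?ch n R)"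
      by (rule integral_abs_bound)
    also have "\<dots> \<le> (\<integral>l. \<epsilon> n \<partial>?ch n R)" using i each by (intro integral_mono) auto
    finally show ?thesis unfolding eq using i by simp
  qed
  have "(\<lambda>n. (\<integral>l. F (scaled_path (c n) (Suc R) l) \<partial>?ch n (Suc R)) - (\<integral>l. G (scaled_path (c n) R l) \<partial>?ch n R)) \<longlonglongrightarrow> 0"
    by (rule Lim_null_comparison[OF always_eventually[OF allI] \<epsilon>(1)]) (use close in simp)
  from tendsto_add[OF this IH] show ?case unfolding lim by simp
qed

section \<open>Blocks of steps and their characteristic functions\<close>

lemma chain_continue:
  "map_pmf (\<lambda>l. (take (Suc k) l, last l)) (chain \<kappa> x (k + m)) =
   bind_pmf (chain \<kappa> x k) (\<lambda>l. map_pmf (\<lambda>y. (l, y)) (map_pmf last (chain \<kappa> (last l) m)))"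
proof (induction m)
  case 0
  have "map_pmf (\<lambda>l. (take (Suc k) l, last l)) (chain \<kappa> x k) = map_pmf (\<lambda>l. (l, last l)) (chain \<kappa> x k)"
    using chain_length by (intro map_pmf_cong refl) (fastforce)
  then show ?case by (simp add: map_pmf_def bind_assoc_pmf bind_return_pmf)
next
  case (Suc m)
  have "map_pmf (\<lambda>l. (take (Suc k) l, last l)) (chain \<kappa> x (k + Suc m)) =
    bind_pmf (chain \<kappa> x (k + m)) (\<lambda>l. map_pmf (\<lambda>y. (take (Suc k) (l @ [y]), y)) (\<kappa> (last l)))"
    by (simp add: map_bind_pmf pmf.map_comp comp_def)
  also have "\<dots> = bind_pmf (chain \<kappa> x (k + m)) (\<lambda>l. map_pmf (\<lambda>y. (take (Suc k) l, y)) (\<kappa> (last l)))"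
  proof (rule bind_pmf_cong[OF refl])
    fix l assume "l \<in> set_pmf (chain \<kappa> x (k + m))"
    then have "length l = Suc (k + m)" using chain_length[of l \<kappa> x "k + m"] by simp
    then show "map_pmf (\<lambda>y. (take (Suc k) (l @ [y]), y)) (\<kappa> (last l)) = map_pmf (\<lambda>y. (take (Suc k) l, y)) (\<kappa> (last l))" by simp
  qed
  also have "\<dots> = bind_pmf (map_pmf (\<lambda>l. (take (Suc k) l, last l)) (chain \<kappa> x (k + m))) (\<lambda>(l, s). map_pmf (\<lambda>y. (l, y)) (\<kappa> s))"
    by (simp add: bind_map_pmf)
  also have "\<dots> = bind_pmf (chain \<kappa> x k) (\<lambda>l. bind_pmf (chain \<kappa> (last l) m) (\<lambda>l'. map_pmf (\<lambda>y. (l, y)) (\<kappa> (last l'))))"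
    unfolding Suc by (simp add: bind_assoc_pmf bind_map_pmf)
  also have "\<dots> = bind_pmf (chain \<kappa> x k) (\<lambda>l. map_pmf (\<lambda>y. (l, y)) (map_pmf last (chain \<kappa> (last l) (Suc m))))"
    by (simp add: map_bind_pmf pmf.map_comp comp_def)
  finally show ?case .
qed

text \<open>Gathers \<open>b\<close> steps into one. The number \<open>R\<close> of blocks then
  stays fixed while \<open>b\<close> grows with \<open>n\<close>, as
  \<open>random_walk_invariance\<close> demands.\<close>

lemma chain_subsample:
  "map_pmf (\<lambda>l. map (\<lambda>r. l ! (r * b)) [0..<Suc R]) (chain \<kappa> x (R * b)) = chain (\<lambda>s. map_pmf last (chain \<kappa> s b)) x R"
proof (induction R)
  case 0
  then show ?case by simp
next
  case (Suc R)
  let ?f = "\<lambda>R l. map (\<lambda>r. l ! (r * b)) [0..<Suc R]"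
  have "map_pmf (?f (Suc R)) (chain \<kappa> x (Suc R * b)) =
    map_pmf (\<lambda>(l, y). ?f R l @ [y]) (map_pmf (\<lambda>l. (take (Suc (R * b)) l, last l)) (chain \<kappa> x (R * b + b)))"
    unfolding pmf.map_comp comp_def
  proof (rule map_pmf_cong)
    fix l assume "l \<in> set_pmf (chain \<kappa> x (R * b + b))"
    then have len: "length l = Suc (R * b + b)" using chain_length[of l \<kappa> x "R * b + b"] by simp
    then have last: "last l = l ! (Suc R * b)" by (subst last_conv_nth) (auto simp: add.commute)
    have T: "take (Suc (R * b)) l ! (r * b) = l ! (r * b)" if "r < Suc R" for r
    proof -
      have "r * b \<le> R * b" using that by (intro mult_right_mono) auto
      then show ?thesis by (simp add: less_Suc_eq_le)
    qed
    have "?f R (take (Suc (R * b)) l) = ?f R l" by (rule map_cong[OF refl]) (rule T, simp del: upt_Suc)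
    then show "?f (Suc R) l = (case (take (Suc (R * b)) l, last l) of (l, y) \<Rightarrow> ?f R l @ [y])"
      unfolding last by simp
  qed (simp add: add.commute)
  also have "\<dots> = bind_pmf (chain \<kappa> x (R * b)) (\<lambda>l. map_pmf (\<lambda>y. ?f R l @ [y]) (map_pmf last (chain \<kappa> (last l) b)))"
    unfolding chain_continue by (simp add: map_bind_pmf pmf.map_comp comp_def)
  also have "\<dots> = bind_pmf (chain \<kappa> x (R * b)) (\<lambda>l. map_pmf (\<lambda>y. ?f R l @ [y]) (map_pmf last (chain \<kappa> (last (?f R l)) b)))"
  proof (rule bind_pmf_cong[OF refl])
    fix l assume "l \<in> set_pmf (chain \<kappa> x (R * b))"
    then have "last l = l ! (R * b)" by (rule chain_last)
    then show "map_pmf (\<lambda>y. ?f R l @ [y]) (map_pmf last (chain \<kappa> (last l) b)) = map_pmf (\<lambda>y. ?f R l @ [y]) (map_pmf last (chain \<kappa> (last (?f R l)) b))"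
      by simp
  qed
  also have "\<dots> = chain (\<lambda>s. map_pmf last (chain \<kappa> s b)) x (Suc R)"
    by (simp add: Suc[symmetric] bind_map_pmf del: upt_Suc)
  finally show ?case .
qed

lemma walk_translation:
  "map_pmf last (chain (walk_kernel lam mu h) s b) = map_pmf (\<lambda>x. s + x) (map_pmf last (chain (walk_kernel lam mu h) 0 b))"
proof (induction b)
  case 0
  then show ?case by simp
next
  case (Suc b)
  have *: "map_pmf last (chain (walk_kernel lam mu h) s (Suc b)) = bind_pmf (map_pmf last (chain (walk_kernel lam mu h) s b)) (walk_kernel lam mu h)" for s
    by (simp add: map_bind_pmf pmf.map_comp comp_def bind_map_pmf pmf.map_ident)
  show ?case unfolding * Suc[of] by (simp add: bind_map_pmf map_bind_pmf walk_kernel_def pmf.map_comp comp_def add.assoc)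
qed

text \<open>Cosine and sine are eigenfunctions of the symmetric kernel with eigenvalue
  \<open>1 - 2 * lam * h * (1 - cos \<theta>)\<close>; the start at \<open>0\<close> selects the
  values \<open>1\<close> and \<open>0\<close>.\<close>

lemma walk_cos_sin:
  assumes par: "lam > 0" and h: "h \<ge> 0" "2 * lam * h \<le> 1"
  shows "(\<integral>l. cos (\<theta> * of_int (last l)) \<partial>measure_pmf (chain (walk_kernel lam lam h) 0 b)) = (1 - 2 * lam * h * (1 - cos \<theta>)) ^ b"
    and "(\<integral>l. sin (\<theta> * of_int (last l)) \<partial>measure_pmf (chain (walk_kernel lam lam h) 0 b)) = 0"
proof -
  have h': "(lam + lam) * h \<le> 1" using h by simp
  show "(\<integral>l. cos (\<theta> * of_int (last l)) \<partial>measure_pmf (chain (walk_kernel lam lam h) 0 b)) = (1 - 2 * lam * h * (1 - cos \<theta>)) ^ b"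
  proof (induction b)
    case (Suc b)
    have "(\<integral>y. cos (\<theta> * of_int y) \<partial>measure_pmf (walk_kernel lam lam h s)) = (1 - 2 * lam * h * (1 - cos \<theta>)) * cos (\<theta> * of_int s)" for s
      unfolding integral_walk_kernel[OF par par h(1) h'] by (simp add: distrib_left right_diff_distrib cos_add cos_diff algebra_simps)
    then show ?case by (subst integral_chain_Suc[of _ 1]) (simp_all add: Suc)
  qed simp
  show "(\<integral>l. sin (\<theta> * of_int (last l)) \<partial>measure_pmf (chain (walk_kernel lam lam h) 0 b)) = 0"
  proof (induction b)
    case (Suc b)
    have "(\<integral>y. sin (\<theta> * of_int y) \<partial>measure_pmf (walk_kernel lam lam h s)) = (1 - 2 * lam * h * (1 - cos \<theta>)) * sin (\<theta> * of_int s)" for s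
      unfolding integral_walk_kernel[OF par par h(1) h'] by (simp add: distrib_left right_diff_distrib sin_add sin_diff algebra_simps)
    then show ?case by (subst integral_chain_Suc[of _ 1]) (simp_all add: Suc)
  qed simp
qed

text \<open>Here \<open>1 - cos (t / sqrt n)\<close> is about \<open>t^2 / (2 n)\<close>, so
  \<open>n^3\<close> times the defect of the base from \<open>1\<close> tends to
  \<open>lam * t^2 / q\<close>. Taking logarithms requires a positive base, which holds for large
  \<open>n\<close>.\<close>

lemma walk_char_limit:
  fixes lam t q :: real
  assumes "lam > 0" "q > 0"
  shows "(\<lambda>n. (1 - 2 * lam * (1 / (q * real n ^ 2)) * (1 - cos (t / sqrt (real n)))) ^ (n ^ 3)) \<longlonglongrightarrow> exp (- lam * t\<^sup>2 / q)"
proof -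
  let ?y = "\<lambda>n. 2 * lam * (1 / (q * real n ^ 2)) * (1 - cos (t / sqrt (real n)))"
  have "(\<lambda>n. real n ^ 3 * ln (1 - ?y n)) \<longlonglongrightarrow> - (lam * (inverse q * (t * t)))"
    using assms by real_asymp
  then have lim: "(\<lambda>n. exp (real n ^ 3 * ln (1 - ?y n))) \<longlonglongrightarrow> exp (- lam * t\<^sup>2 / q)"
    by (intro tendsto_exp) (simp add: power2_eq_square divide_inverse mult_ac)
  have "(\<lambda>n. ?y n) \<longlonglongrightarrow> 0" using assms by real_asymp
  then have "\<forall>\<^sub>F n in sequentially. ?y n < 1" by (rule order_tendstoD) simp
  then have "\<forall>\<^sub>F n in sequentially. exp (real n ^ 3 * ln (1 - ?y n)) = (1 - ?y n) ^ (n ^ 3)"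
  proof eventually_elim
    case (elim n)
    then show ?case using exp_of_nat_mult[of "n ^ 3" "ln (1 - ?y n)"] by simp
  qed
  from Lim_transform_eventually[OF lim this] show ?thesis .
qed

lemma brownian_motionD:
  assumes "brownian_motion N W"
  shows "levy_process N W" "\<And>t. t > 0 \<Longrightarrow> distributed N lborel (W t) (\<lambda>x. ennreal (normal_density 0 (sqrt t) x))"
    "AE \<omega> in N. continuous_on {0..} (\<lambda>t. W t \<omega>)"
  using assms unfolding brownian_motion_def by auto

lemma char_brownian:
  assumes W: "brownian_motion N W" and s: "s > 0"
  shows "char (distr N borel (\<lambda>\<omega>. c * W s \<omega>)) t = complex_of_real (exp (- (c * t)\<^sup>2 * s / 2))"
proof -
  note WD = brownian_motionD[OF W]
  interpret prob_space N by (rule levy_processD(1)[OF WD(1)])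
  have m: "W s \<in> borel_measurable N" using levy_processD(2)[OF WD(1)] s by simp
  have "distributed N lborel (\<lambda>\<omega>. (W s \<omega> - 0) / sqrt s) std_normal_density"
    using normal_standard_normal_convert[of "sqrt s" "W s" 0] WD(2)[OF s] s by simp
  then have d: "distr N lborel (\<lambda>\<omega>. W s \<omega> / sqrt s) = std_normal_distribution"
    by (simp add: distributed_distr_eq_density)
  have "char (distr N borel (\<lambda>\<omega>. c * W s \<omega>)) t = (\<integral>\<omega>. iexp (t * (c * W s \<omega>)) \<partial>N)"
    unfolding char_def using m by (subst integral_distr) auto
  also have "\<dots> = (\<integral>\<omega>. iexp (c * t * sqrt s * (W s \<omega> / sqrt s)) \<partial>N)"
    using s by (simp add: mult_ac)
  also have "\<dots> = (\<integral>x. iexp (c * t * sqrt s * x) \<partial>distr N lborel (\<lambda>\<omega>. W s \<omega> / sqrt s))"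
    using m by (subst integral_distr) auto
  also have "\<dots> = char std_normal_distribution (c * t * sqrt s)" unfolding d char_def by simp
  also have "\<dots> = complex_of_real (exp (- (c * t)\<^sup>2 * s / 2))"
    using s by (simp add: char_std_normal_distribution power_mult_distrib)
  finally show ?thesis .
qed

text \<open>At scale \<open>n\<close> a grid cell of length \<open>n / q\<close> gets \<open>n^3\<close> steps, so that the total variation error
  \<open>n^3 * mesh^2\<close> per cell tends to \<open>0\<close>.\<close>

definition mesh :: "real \<Rightarrow> nat \<Rightarrow> real" where "mesh q n = 1 / (q * real n ^ 2)"

lemma mesh_small:
  assumes "q > 0"
  shows "mesh q n \<ge> 0" "\<forall>\<^sub>F n in sequentially. c * mesh q n \<le> 1"
proof -
  show "mesh q n \<ge> 0" using assms by (simp add: mesh_def)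
  have "(\<lambda>n. c * mesh q n) \<longlonglongrightarrow> 0" unfolding mesh_def using assms by real_asymp
  then have "\<forall>\<^sub>F n in sequentially. c * mesh q n < 1" by (rule order_tendstoD) simp
  then show "\<forall>\<^sub>F n in sequentially. c * mesh q n \<le> 1" by eventually_elim simp
qed

text \<open>\<open>n^3\<close> steps of variance \<open>2 * lam / (q * n^2)\<close>, divided by
  \<open>n\<close>, give the variance \<open>2 * lam / q\<close> of the limit.\<close>

lemma walk_block_weak_conv:
  assumes W: "brownian_motion N W" and par: "lam > 0" "q > 0"
  shows "weak_conv_m (\<lambda>n. distr (measure_pmf (map_pmf last (chain (walk_kernel lam lam (mesh q n)) 0 (n ^ 3)))) borel (\<lambda>x. 1 / sqrt (real n) * of_int x))
     (distr N borel (\<lambda>\<omega>. sqrt (2 * lam) * W (1 / q) \<omega>))"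
proof (rule levy_continuity)
  note WD = brownian_motionD[OF W]
  interpret prob_space N by (rule levy_processD(1)[OF WD(1)])
  have m: "W (1 / q) \<in> borel_measurable N" using levy_processD(2)[OF WD(1)] par by simp
  let ?D = "\<lambda>n. distr (measure_pmf (map_pmf last (chain (walk_kernel lam lam (mesh q n)) 0 (n ^ 3)))) borel (\<lambda>x. 1 / sqrt (real n) * real_of_int x)"
  show "real_distribution (?D n)" for n
    by (rule prob_space.real_distribution_distr[OF measure_pmf.prob_space_axioms]) simp
  show "real_distribution (distr N borel (\<lambda>\<omega>. sqrt (2 * lam) * W (1 / q) \<omega>))"
    using m by (intro real_distribution_distr) simp
  fix t
  have "\<forall>\<^sub>F n in sequentially. char (?D n) t = complex_of_real ((1 - 2 * lam * (1 / (q * real n ^ 2)) * (1 - cos (t / sqrt (real n)))) ^ (n ^ 3))"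
    using mesh_small(2)[OF par(2), of "2 * lam"]
  proof eventually_elim
    case (elim n)
    let ?p = "measure_pmf (chain (walk_kernel lam lam (mesh q n)) 0 (n ^ 3))"
    have i: "integrable ?p (\<lambda>l. iexp (t / sqrt (real n) * of_int (last l)))"
      by (rule integrable_measure_pmf_finite) (rule finite_chain, rule finite_kernels)
    have "char (?D n) t = (\<integral>l. iexp (t / sqrt (real n) * of_int (last l)) \<partial>?p)"
      unfolding char_def by (subst integral_distr) simp_all
    also have "\<dots> = complex_of_real (\<integral>l. cos (t / sqrt (real n) * of_int (last l)) \<partial>?p) + \<i> * complex_of_real (\<integral>l. sin (t / sqrt (real n) * of_int (last l)) \<partial>?p)"
      using integral_Re[OF i] integral_Im[OF i] by (simp add: complex_eq_iff Re_exp Im_exp)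
    also have "\<dots> = complex_of_real ((1 - 2 * lam * (1 / (q * real n ^ 2)) * (1 - cos (t / sqrt (real n)))) ^ (n ^ 3))"
      unfolding walk_cos_sin(1)[OF par(1) mesh_small(1)[OF par(2)] elim] walk_cos_sin(2)[OF par(1) mesh_small(1)[OF par(2)] elim]
      by (simp add: mesh_def)
    finally show ?case .
  qed
  moreover have "(\<lambda>n. complex_of_real ((1 - 2 * lam * (1 / (q * real n ^ 2)) * (1 - cos (t / sqrt (real n)))) ^ (n ^ 3))) \<longlonglongrightarrow> complex_of_real (exp (- lam * t\<^sup>2 / q))"
    by (intro tendsto_of_real walk_char_limit par)
  moreover have "char (distr N borel (\<lambda>\<omega>. sqrt (2 * lam) * W (1 / q) \<omega>)) t = complex_of_real (exp (- lam * t\<^sup>2 / q))"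
    using char_brownian[OF W, of "1 / q" "sqrt (2 * lam)" t] par by (simp add: power_mult_distrib)
  ultimately show "(\<lambda>n. char (?D n) t) \<longlonglongrightarrow> char (distr N borel (\<lambda>\<omega>. sqrt (2 * lam) * W (1 / q) \<omega>)) t"
    by (simp add: tendsto_cong)
qed

lemma walk_grid_convergence:
  assumes W: "brownian_motion N W" and par: "lam > 0" "q > 0" and R: "R > 0" and F: "bounded_lipschitz R F"
  shows "(\<lambda>n. \<integral>l. F (\<lambda>r. if r \<le> R then 1 / sqrt (real n) * of_int (l ! (r * n ^ 3)) else 0)
        \<partial>measure_pmf (chain (walk_kernel lam lam (mesh q n)) 0 (R * n ^ 3)))
    \<longlonglongrightarrow> (\<integral>\<omega>. F (grid (\<lambda>t \<omega>. sqrt (2 * lam) * W t \<omega>) (1 / q) R \<omega>) \<partial>N)"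
proof -
  note WD = brownian_motionD[OF W]
  interpret prob_space N by (rule levy_processD(1)[OF WD(1)])
  define X where "X t \<omega> = sqrt (2 * lam) * W t \<omega>" for t \<omega>
  have X: "levy_process N X" unfolding X_def using levy_process_scale[OF WD(1), of 1 "sqrt (2 * lam)"] by simp
  have Xm: "X t \<in> borel_measurable N" if "t \<ge> 0" for t using levy_processD(2)[OF X that] .
  define D where "D = distr N borel (X (1 / q))"
  have D: "real_distribution D" unfolding D_def using Xm par by (intro real_distribution_distr) simp
  define \<xi> where "\<xi> n = map_pmf last (chain (walk_kernel lam lam (mesh q n)) 0 (n ^ 3))" for n
  have wc: "weak_conv_m (\<lambda>n. distr (measure_pmf (\<xi> n)) borel (\<lambda>x. 1 / sqrt (real n) * of_int x)) D"
    unfolding D_def \<xi>_def X_def by (rule walk_block_weak_conv[OF W par])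
  have "(\<lambda>n. \<integral>l. F (scaled_path (1 / sqrt (real n)) R l) \<partial>measure_pmf (chain (\<lambda>s. map_pmf (\<lambda>x. s + x) (\<xi> n)) 0 R))
    \<longlonglongrightarrow> (\<integral>x. F (partial_sums R x) \<partial>(\<Pi>\<^sub>M i\<in>{..<R}. D))"
    by (rule random_walk_invariance[OF D wc F])
  moreover have "(\<integral>x. F (partial_sums R x) \<partial>(\<Pi>\<^sub>M i\<in>{..<R}. D)) = (\<integral>\<omega>. F (grid X (1 / q) R \<omega>) \<partial>N)"
  proof -
    have psm: "partial_sums R \<in> borel_measurable (\<Pi>\<^sub>M i\<in>{..<R}. D)"
      using partial_sums_measurable[of R] unfolding D_def by (simp cong: measurable_cong_sets sets_PiM_cong)
    have "(\<integral>x. F (partial_sums R x) \<partial>(\<Pi>\<^sub>M i\<in>{..<R}. D)) = (\<integral>z. F z \<partial>distr (\<Pi>\<^sub>M i\<in>{..<R}. D) borel (partial_sums R))"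
      by (rule integral_distr[OF psm bounded_lipschitz_measurable[OF F], symmetric])
    also have "distr (\<Pi>\<^sub>M i\<in>{..<R}. D) borel (partial_sums R) = distr N borel (grid X (1 / q) R)"
      unfolding D_def by (rule levy_grid_distr[OF X _ R, symmetric]) (use par in simp)
    also have "(\<integral>z. F z \<partial>distr N borel (grid X (1 / q) R)) = (\<integral>\<omega>. F (grid X (1 / q) R \<omega>) \<partial>N)"
      by (rule integral_distr[OF grid_measurable[OF Xm] bounded_lipschitz_measurable[OF F]]) (use par in simp_all)
    finally show ?thesis .
  qed
  moreover have "(\<integral>l. F (scaled_path (1 / sqrt (real n)) R l) \<partial>measure_pmf (chain (\<lambda>s. map_pmf (\<lambda>x. s + x) (\<xi> n)) 0 R)) =
    (\<integral>l. F (\<lambda>r. if r \<le> R then 1 / sqrt (real n) * of_int (l ! (r * n ^ 3)) else 0)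
        \<partial>measure_pmf (chain (walk_kernel lam lam (mesh q n)) 0 (R * n ^ 3)))" for n
  proof -
    have "chain (\<lambda>s. map_pmf (\<lambda>x. s + x) (\<xi> n)) 0 R =
      map_pmf (\<lambda>l. map (\<lambda>r. l ! (r * n ^ 3)) [0..<Suc R]) (chain (walk_kernel lam lam (mesh q n)) 0 (R * n ^ 3))"
      unfolding chain_subsample \<xi>_def 
      by (rule arg_cong[where f = "\<lambda>\<kappa>. chain \<kappa> 0 R"], rule ext, rule walk_translation[symmetric])
    moreover have "scaled_path (1 / sqrt (real n)) R (map (\<lambda>r. l ! (r * n ^ 3)) [0..<Suc R]) =
       (\<lambda>r. if r \<le> R then 1 / sqrt (real n) * of_int (l ! (r * n ^ 3)) else 0)" for l
      by (rule ext) (simp add: scaled_path_def del: upt_Suc)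
    ultimately show ?thesis by (simp del: upt_Suc)
  qed
  ultimately show ?thesis by (simp add: X_def[abs_def])
qed

text \<open>The running maximum is taken on a grid \<open>m\<close> times finer than the one on
  which the result is read, since the path may dip between two coarse points.\<close>

definition grid_reflection :: "nat \<Rightarrow> nat \<Rightarrow> (nat \<Rightarrow> real) \<Rightarrow> nat \<Rightarrow> real" where
  "grid_reflection m J z k = (if k \<le> J then z (k * m) + Max ((\<lambda>i. max 0 (- z i)) ` {..k * m}) else 0)"

lemma Max_image_le:
  fixes f g :: "'i \<Rightarrow> real"
  assumes "finite A" "A \<noteq> {}" "\<And>i. i \<in> A \<Longrightarrow> f i \<le> g i + e"
  shows "Max (f ` A) \<le> Max (g ` A) + e"
proof -
  have "Max (f ` A) \<in> f ` A" using assms by (intro Max_in) auto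
  then obtain i where i: "i \<in> A" "Max (f ` A) = f i" by auto
  have "g i \<le> Max (g ` A)" using assms i by (intro Max_ge) auto
  then show ?thesis using assms(3)[OF i(1)] i(2) by simp
qed

text \<open>Each reflected value moves by at most twice the uniform distance of the paths, once for
  the path and once for its running maximum.\<close>

lemma bounded_lipschitz_grid_reflection:
  assumes "bounded_lipschitz J H"
  shows "bounded_lipschitz (J * m) (\<lambda>z. H (grid_reflection m J z))"
proof -
  obtain C B where H: "C \<ge> 0" "\<And>z z'. \<bar>H z - H z'\<bar> \<le> C * (\<Sum>k\<le>J. \<bar>z k - z' k\<bar>)" "\<And>z. \<bar>H z\<bar> \<le> B" "B \<ge> 0"
    using bounded_lipschitzE[OF assms] by metis
  have "\<bar>H (grid_reflection m J z) - H (grid_reflection m J z')\<bar> \<le> (C * (2 * real (Suc J))) * (\<Sum>i\<le>J * m. \<bar>z i - z' i\<bar>)" for z z'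
  proof -
    define S where "S = (\<Sum>i\<le>J * m. \<bar>z i - z' i\<bar>)"
    have le: "\<bar>z i - z' i\<bar> \<le> S" if "i \<le> J * m" for i
      unfolding S_def using that by (intro member_le_sum) auto
    have "\<bar>grid_reflection m J z k - grid_reflection m J z' k\<bar> \<le> 2 * S" if k: "k \<le> J" for k
    proof -
      have km: "k * m \<le> J * m" using k by simp
      have "Max ((\<lambda>i. max 0 (- z i)) ` {..k * m}) \<le> Max ((\<lambda>i. max 0 (- z' i)) ` {..k * m}) + S"
      proof (rule Max_image_le)
        fix i assume "i \<in> {..k * m}"
        then have "i \<le> J * m" using km by (auto intro: order_trans simp del: mult_le_cancel2)
        then have "\<bar>z i - z' i\<bar> \<le> S" by (rule le)
        then show "max 0 (- z i) \<le> max 0 (- z' i) + S" by (auto simp: max_def)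
      qed auto
      moreover have "Max ((\<lambda>i. max 0 (- z' i)) ` {..k * m}) \<le> Max ((\<lambda>i. max 0 (- z i)) ` {..k * m}) + S"
      proof (rule Max_image_le)
        fix i assume "i \<in> {..k * m}"
        then have "i \<le> J * m" using km by (auto intro: order_trans simp del: mult_le_cancel2)
        then have "\<bar>z i - z' i\<bar> \<le> S" by (rule le)
        then show "max 0 (- z' i) \<le> max 0 (- z i) + S" by (auto simp: max_def)
      qed auto
      moreover have "\<bar>z (k * m) - z' (k * m)\<bar> \<le> S" by (rule le[OF km])
      ultimately show ?thesis using k unfolding grid_reflection_def abs_le_iff by (simp only: if_True) linarith
    qed
    then have "(\<Sum>k\<le>J. \<bar>grid_reflection m J z k - grid_reflection m J z' k\<bar>) \<le> (\<Sum>k\<le>J. 2 * S)" by (intro sum_mono) auto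
    then have "C * (\<Sum>k\<le>J. \<bar>grid_reflection m J z k - grid_reflection m J z' k\<bar>) \<le> C * (2 * real (Suc J) * S)"
      using H(1) by (intro mult_left_mono) (simp_all add: algebra_simps)
    then show ?thesis using H(2)[of "grid_reflection m J z" "grid_reflection m J z'"] unfolding S_def by (simp add: mult.assoc)
  qed
  then show ?thesis unfolding bounded_lipschitz_def using H by (intro conjI exI[of _ "C * (2 * real (Suc J))"] exI[of _ B]) auto
qed

text \<open>By continuity the supremum is attained, and some grid point lies within
  \<open>t/m\<close> of where it is.\<close>

lemma running_max_tendsto:
  fixes f :: "real \<Rightarrow> real"
  assumes f: "continuous_on {0..t} f" and t: "t \<ge> 0"
  shows "(\<lambda>m. Max ((\<lambda>i. max 0 (- f (t * real i / real m))) ` {..m})) \<longlonglongrightarrow> (SUP s\<in>{0..t}. max (- f s) 0)"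
proof (rule LIMSEQ_I, unfold eventually_sequentially[symmetric])
  fix e :: real assume e: "e > 0"
  have g: "continuous_on {0..t} (\<lambda>s. max (- f s) 0)" using f by (intro continuous_intros)
  have bdd: "bdd_above ((\<lambda>s. max (- f s) 0) ` {0..t})"
    using compact_continuous_image[OF g] by (intro bounded_imp_bdd_above compact_imp_bounded) auto
  obtain s where s: "s \<in> {0..t}" "\<And>u. u \<in> {0..t} \<Longrightarrow> max (- f u) 0 \<le> max (- f s) 0"
    using continuous_attains_sup[OF _ _ g] t by auto
  have S: "(SUP s\<in>{0..t}. max (- f s) 0) = max (- f s) 0"
    using s bdd t by (intro antisym cSUP_least cSUP_upper) auto
  have "continuous (at s within {0..t}) (\<lambda>s. max (- f s) 0)" using g s by (auto simp: continuous_on_eq_continuous_within)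
  then obtain d where d: "d > 0" "\<And>u. u \<in> {0..t} \<Longrightarrow> dist u s < d \<Longrightarrow> dist (max (- f u) 0) (max (- f s) 0) < e"
    using e unfolding continuous_within_eps_delta by blast
  have "\<forall>\<^sub>F m in sequentially. real m > t / d"
    by (rule eventually_compose_filterlim[OF eventually_gt_at_top filterlim_real_sequentially])
  then show "\<forall>\<^sub>F m in sequentially. norm (Max ((\<lambda>i. max 0 (- f (t * real i / real m))) ` {..m}) - (SUP s\<in>{0..t}. max (- f s) 0)) < e"
    using eventually_gt_at_top[of 0]
  proof eventually_elim
    case (elim m)
    have in_t: "t * real i / real m \<in> {0..t}" if "i \<le> m" for i
      using that t elim(2) by (auto simp: field_simps intro: mult_left_mono)
    let ?M = "Max ((\<lambda>i. max 0 (- f (t * real i / real m))) ` {..m})"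
    have up: "?M \<le> max (- f s) 0"
      using s(2) in_t by (subst Max_le_iff) (auto simp: max.commute)
    obtain i where i: "i \<le> m" "\<bar>t * real i / real m - s\<bar> < d"
    proof (cases "t = 0")
      case True
      then show thesis using that[of 0] s(1) d(1) by simp
    next
      case False
      define i where "i = nat \<lfloor>s * real m / t\<rfloor>"
      have nn: "0 \<le> s * real m / t" using s(1) t by simp
      have fl: "real i \<le> s * real m / t" "s * real m / t < real i + 1"
        using nn of_int_floor_le[of "s * real m / t"] real_of_int_floor_add_one_gt[of "s * real m / t"] by (auto simp: i_def of_nat_nat)
      have "s * real m / t \<le> real m" using s(1) t False by (simp add: divide_le_eq mult_right_mono mult.commute)
      then have "i \<le> m" using fl(1) by linarith
      moreover have "t * real i / real m \<le> s" "s < t * real i / real m + t / real m"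
        using fl t False elim(2) by (auto simp: field_simps)
      moreover have "t / real m < d" using elim d(1) by (simp add: field_simps)
      ultimately show thesis using that[of i] by (simp add: abs_less_iff)
    qed
    have "dist (max (- f (t * real i / real m)) 0) (max (- f s) 0) < e"
      using d(2)[OF in_t[OF i(1)]] i(2) by (simp add: dist_real_def)
    then have "max (- f s) 0 < max (- f (t * real i / real m)) 0 + e" unfolding dist_real_def by linarith
    moreover have "max (- f (t * real i / real m)) 0 \<le> ?M" using i(1) by (subst max.commute, intro Max_ge) auto
    ultimately show ?case using up e unfolding S real_norm_def abs_less_iff by linarith
  qed
qed

lemma grid_reflection_tendsto:
  fixes X :: "real \<Rightarrow> 'a \<Rightarrow> real"
  assumes c: "continuous_on {0..} (\<lambda>t. X t \<omega>)" and j: "j > 0" and k: "k \<le> J"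
  shows "(\<lambda>m. grid_reflection (Suc m) J (grid X (1 / (real j * real (Suc m))) (J * Suc m) \<omega>) k)
     \<longlonglongrightarrow> skorokhod_reflection (\<lambda>t. X t \<omega>) (real k / real j)"
proof -
  define t where "t = real k / real j"
  have t: "t \<ge> 0" by (simp add: t_def)
  have ct: "continuous_on {0..t} (\<lambda>t. X t \<omega>)" by (rule continuous_on_subset[OF c]) auto
  have gi: "grid X (1 / (real j * real (Suc m))) (J * Suc m) \<omega> i = X (real i / (real j * real (Suc m))) \<omega>" if "i \<le> k * Suc m" for i m
  proof -
    have "k * Suc m \<le> J * Suc m" using k by (intro mult_right_mono) auto
    then show ?thesis using that by (simp add: grid_def)
  qed
  have eq: "grid_reflection (Suc m) J (grid X (1 / (real j * real (Suc m))) (J * Suc m) \<omega>) k =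
    X t \<omega> + Max ((\<lambda>i. max 0 (- X (real i / (real j * real (Suc m))) \<omega>)) ` {..k * Suc m})" for m
  proof -
    have "(\<lambda>i. max 0 (- grid X (1 / (real j * real (Suc m))) (J * Suc m) \<omega> i)) ` {..k * Suc m} =
      (\<lambda>i. max 0 (- X (real i / (real j * real (Suc m))) \<omega>)) ` {..k * Suc m}"
      by (rule image_cong[OF refl]) (use gi in auto)
    moreover have "grid X (1 / (real j * real (Suc m))) (J * Suc m) \<omega> (k * Suc m) = X t \<omega>"
    proof -
      have "real (k * Suc m) / (real j * real (Suc m)) = t" by (simp add: t_def del: of_nat_Suc mult_Suc_right)
      then show ?thesis using gi[of "k * Suc m" m] by (simp only: order_refl)
    qed
    ultimately show ?thesis using k by (simp add: grid_reflection_def)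
  qed
  have "(\<lambda>m. Max ((\<lambda>i. max 0 (- X (real i / (real j * real (Suc m))) \<omega>)) ` {..k * Suc m})) \<longlonglongrightarrow> (SUP s\<in>{0..t}. max (- X s \<omega>) 0)"
  proof (cases "k = 0")
    \<comment> \<open>The index \<open>k * Suc m\<close> tends to infinity only for positive
      \<open>k\<close>; at time \<open>0\<close> both sides reduce to a single point.\<close>
    case True
    then show ?thesis by (simp add: t_def max.commute)
  next
    case False
    have fl: "filterlim (\<lambda>m. k * Suc m) sequentially sequentially"
      using False by (intro filterlim_subseq) (auto simp: strict_mono_def)
    have "(\<lambda>m. Max ((\<lambda>i. max 0 (- X (t * real i / real (k * Suc m)) \<omega>)) ` {..k * Suc m})) \<longlonglongrightarrow> (SUP s\<in>{0..t}. max (- X s \<omega>) 0)"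
      by (rule filterlim_compose[OF running_max_tendsto[OF ct t] fl])
    moreover have "t * real i / real (k * Suc m) = real i / (real j * real (Suc m))" for i m
      using False j by (simp add: t_def divide_simps del: of_nat_Suc mult_Suc_right)
    ultimately show ?thesis by simp
  qed
  from tendsto_add[OF tendsto_const[of "X t \<omega>"] this] show ?thesis
    unfolding eq skorokhod_reflection_def t_def[symmetric] .
qed

lemma chain_take: "map_pmf (take (Suc K)) (chain \<kappa> x (K + m)) = chain \<kappa> x K"
proof -
  have "map_pmf fst (map_pmf (\<lambda>l. (take (Suc K) l, last l)) (chain \<kappa> x (K + m))) = chain \<kappa> x K"
    unfolding chain_continue by (simp add: map_bind_pmf pmf.map_comp comp_def bind_return_pmf')
  then show ?thesis by (simp add: pmf.map_comp comp_def)
qed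

text \<open>A union bound. The event for one block is read off an initial piece of the trajectory,
  whose law is again that of a chain.\<close>

lemma symmetric_walk_blocks:
  fixes a :: real
  assumes par: "lam > 0" and h: "h \<ge> 0" "2 * lam * h \<le> 1" and a: "a > 0"
  shows "measure (measure_pmf (chain (walk_kernel lam lam h) 0 (R * b)))
      {l. \<exists>r<R. \<exists>i. r * b \<le> i \<and> i \<le> Suc r * b \<and> a \<le> \<bar>real_of_int (l ! i - l ! (r * b))\<bar>}
    \<le> real R * ((2 * lam * h * real b + 3 * (2 * lam * h * real b)\<^sup>2) / a ^ 4)"
proof -
  define A where "A r = {l. \<exists>i. r * b \<le> i \<and> i \<le> Suc r * b \<and> a \<le> \<bar>real_of_int (l ! i - l ! (r * b))\<bar>}" for r
  let ?p = "\<lambda>K. chain (walk_kernel lam lam h) 0 K"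
  have "measure (measure_pmf (?p (R * b))) (\<Union>r\<in>{..<R}. A r) \<le> (\<Sum>r\<in>{..<R}. measure (measure_pmf (?p (R * b))) (A r))"
    by (rule measure_pmf.finite_measure_subadditive_finite) auto
  also have "\<dots> \<le> (\<Sum>r\<in>{..<R}. (2 * lam * h * real b + 3 * (2 * lam * h * real b)\<^sup>2) / a ^ 4)"
  proof (rule sum_mono)
    fix r assume "r \<in> {..<R}"
    then have "Suc r * b \<le> R * b" by (intro mult_right_mono) auto
    then obtain m where m: "R * b = Suc r * b + m" using le_Suc_ex by blast
    have "take (Suc (Suc r * b)) -` A r = A r"
      unfolding A_def vimage_def by (intro Collect_cong ex_cong) auto
    then have "measure (measure_pmf (?p (R * b))) (A r) = measure (measure_pmf (map_pmf (take (Suc (Suc r * b))) (?p (Suc r * b + m)))) (A r)"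
      by (simp add: m)
    also have "\<dots> = measure (measure_pmf (?p (r * b + b))) (A r)"
      unfolding chain_take by (simp add: add.commute)
    also have "\<dots> \<le> (2 * lam * h * real b + 3 * (2 * lam * h * real b)\<^sup>2) / a ^ 4"
      using symmetric_walk_block[OF par h a, of "r * b" b] unfolding A_def by (simp add: add.commute)
    finally show "measure (measure_pmf (?p (R * b))) (A r) \<le> (2 * lam * h * real b + 3 * (2 * lam * h * real b)\<^sup>2) / a ^ 4" .
  qed
  also have "(\<Union>r\<in>{..<R}. A r) = {l. \<exists>r<R. \<exists>i. r * b \<le> i \<and> i \<le> Suc r * b \<and> a \<le> \<bar>real_of_int (l ! i - l ! (r * b))\<bar>}"
    by (auto simp: A_def)
  finally show ?thesis by simp
qed

text \<open>Replacing the running maximum over all steps by the one over block starts loses at most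
  the oscillation inside the block where the maximum is attained.\<close>

lemma reflect_grid_reflection:
  fixes a c :: real
  assumes b: "b > 0" and c: "c \<ge> 0" and k: "k \<le> J" and a0: "a > 0"
    and osc: "\<And>r i. r < k * m \<Longrightarrow> r * b \<le> i \<Longrightarrow> i \<le> Suc r * b \<Longrightarrow> \<bar>real_of_int (l ! i - l ! (r * b))\<bar> < a"
  shows "\<bar>c * of_int (reflect l (k * m * b)) - grid_reflection m J (\<lambda>r. if r \<le> J * m then c * of_int (l ! (r * b)) else 0) k\<bar> \<le> c * a"
proof -
  define K where "K = k * m"
  have K: "K \<le> J * m" unfolding K_def using k by (rule mult_right_mono) simp
  define f where "f r = max 0 (- (c * of_int (l ! (r * b)) :: real))" for r
  define mx where "mx = Max ((\<lambda>i. max 0 (- (l ! i))) ` {..K * b})"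
  have mx_ge: "max 0 (- (l ! i)) \<le> mx" if "i \<le> K * b" for i unfolding mx_def using that by (intro Max_ge) auto
  have "mx \<in> (\<lambda>i. max 0 (- (l ! i))) ` {..K * b}" unfolding mx_def by (intro Max_in) auto
  then obtain i where i: "i \<le> K * b" "mx = max 0 (- (l ! i))" by auto
  have eq: "grid_reflection m J (\<lambda>r. if r \<le> J * m then c * of_int (l ! (r * b)) else 0) k = c * of_int (l ! (K * b)) + Max (f ` {..K})"
  proof -
    have "(\<lambda>i. max 0 (- (if i \<le> J * m then c * of_int (l ! (i * b)) else 0))) ` {..K} = f ` {..K}"
      by (rule image_cong[OF refl]) (use K in \<open>auto simp: f_def\<close>)
    then show ?thesis using k K by (simp add: grid_reflection_def K_def)
  qed
  have "Max (f ` {..K}) \<le> c * of_int mx"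
  proof (rule Max.boundedI)
    fix y assume "y \<in> f ` {..K}"
    then obtain r where r: "r \<le> K" "y = f r" by auto
    have "max 0 (- (l ! (r * b))) \<le> mx" using r(1) by (intro mx_ge) simp
    then have "0 \<le> real_of_int mx" "- real_of_int (l ! (r * b)) \<le> real_of_int mx" by linarith+
    then have "0 \<le> c * of_int mx" "c * (- of_int (l ! (r * b))) \<le> c * of_int mx"
      using c by (simp, intro mult_left_mono)
    then show "y \<le> c * of_int mx" using r by (simp add: f_def)
  qed auto
  moreover have "c * of_int mx \<le> Max (f ` {..K}) + c * a"
  proof -
    obtain r where r: "r \<le> K" "- real_of_int (l ! i) \<le> - real_of_int (l ! (r * b)) + a"
    proof (cases "i = K * b")
      \<comment> \<open>The final step \<open>K * b\<close> is itself a block start, but the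
        oscillation hypothesis covers only the blocks before it.\<close>
      case True
      then show thesis using that[of K] a0 by simp
    next
      case False
      then have iK: "i < K * b" using i by simp
      define r where "r = i div b"
      have r: "r < K" unfolding r_def using iK by (simp add: less_mult_imp_div_less)
      have di: "r * b + i mod b = i" unfolding r_def by (rule div_mult_mod_eq)
      have "r * b \<le> i" using di by linarith
      moreover have "i \<le> Suc r * b" unfolding mult_Suc using di mod_less_divisor[OF b, of i] by linarith
      ultimately have "\<bar>real_of_int (l ! i - l ! (r * b))\<bar> < a" using osc[of r i] r by (simp add: K_def)
      then show thesis using that[of r] r by (simp add: abs_less_iff)
    qed
    have "c * (- of_int (l ! i)) \<le> c * (- of_int (l ! (r * b)) + a)" using r(2) c by (intro mult_left_mono) auto
    moreover have "0 \<le> c * a" using c a0 by simp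
    ultimately have "c * of_int mx \<le> f r + c * a" using i(2) by (auto simp: f_def max_def algebra_simps)
    moreover have "f r \<le> Max (f ` {..K})" using r by (intro Max_ge) auto
    ultimately show ?thesis by simp
  qed
  moreover have "c * of_int (reflect l (k * m * b)) = c * of_int (l ! (K * b)) + c * of_int mx"
    by (simp add: reflect_def mx_def K_def distrib_left)
  ultimately show ?thesis unfolding eq using c a0 by (simp add: abs_le_iff)
qed

text \<open>Total variation is stated for test functions with values in \<open>[0, 1]\<close>; the
  affine map from \<open>[- B, B]\<close> contributes the factor \<open>2 * B\<close>.\<close>

lemma skeleton_close_chain_bounded:
  assumes Q: "mm1_queue M lam mu Q" and par: "lam > 0" "mu > 0" "h \<ge> 0" "(lam + mu) * h \<le> 1"
    and f: "\<And>l. \<bar>f l\<bar> \<le> (B::real)" and B: "B > 0"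
  shows "\<bar>(\<integral>\<omega>. f (skeleton Q h K \<omega>) \<partial>M) - (\<integral>l. f l \<partial>measure_pmf (chain (queue_kernel lam mu h) 0 K))\<bar> \<le> 2 * B * (real K * ((lam + mu) * h)\<^sup>2)"
proof -
  have mc: "markov_chain M 0 (mm1_rates lam mu) Q" using Q unfolding mm1_queue_def .
  interpret prob_space M by (rule markov_chainD(1)[OF mc])
  define g where "g l = (f l + B) / (2 * B)" for l
  have g01: "0 \<le> g l \<and> g l \<le> 1" for l
  proof -
    have "- B \<le> f l" "f l \<le> B" using f[of l] by (auto simp: abs_le_iff)
    then show ?thesis using B by (simp add: g_def)
  qed
  have m: "(\<lambda>\<omega>. f (skeleton Q h K \<omega>)) \<in> borel_measurable M"
    by (rule measurable_compose[OF skeleton_measurable[OF markov_chainD(2)[OF mc] par(3)]]) simp_all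
  have i1: "integrable M (\<lambda>\<omega>. f (skeleton Q h K \<omega>))" using m f by (intro integrable_const_bound[of _ B]) auto
  have i2: "integrable (measure_pmf (chain (queue_kernel lam mu h) 0 K)) f" by (rule integrable_pmf_bounded[OF f])
  have "\<bar>(\<integral>\<omega>. g (skeleton Q h K \<omega>) \<partial>M) - (\<integral>l. g l \<partial>measure_pmf (chain (queue_kernel lam mu h) 0 K))\<bar> \<le> real K * ((lam + mu) * h)\<^sup>2"
    by (rule skeleton_close_chain[OF Q par g01])
  moreover have "(\<integral>\<omega>. g (skeleton Q h K \<omega>) \<partial>M) - (\<integral>l. g l \<partial>measure_pmf (chain (queue_kernel lam mu h) 0 K)) =
    ((\<integral>\<omega>. f (skeleton Q h K \<omega>) \<partial>M) - (\<integral>l. f l \<partial>measure_pmf (chain (queue_kernel lam mu h) 0 K))) / (2 * B)"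
    unfolding g_def using i1 i2 by (simp add: prob_space diff_divide_distrib add_divide_distrib)
  ultimately show ?thesis using B by (simp add: abs_divide divide_le_eq mult.commute)
qed

section \<open>The rescaled queue on a grid\<close>

lemma integral_close:
  fixes f g :: "'s \<Rightarrow> real"
  assumes P: "prob_space P" and i: "integrable P f" "integrable P g" and A: "A \<in> sets P"
    and c: "AE x in P. x \<notin> A \<longrightarrow> \<bar>f x - g x\<bar> \<le> e" and B: "\<And>x. \<bar>f x\<bar> \<le> B" "\<And>x. \<bar>g x\<bar> \<le> B" and e: "e \<ge> 0"
  shows "\<bar>(\<integral>x. f x \<partial>P) - (\<integral>x. g x \<partial>P)\<bar> \<le> e + 2 * B * measure P A"
proof -
  interpret prob_space P by fact
  have iA: "integrable P (\<lambda>x. 2 * B * indicator A x)"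
    using A by (intro integrable_mult_right integrable_real_indicator) (auto simp: emeasure_eq_measure)
  have "\<bar>\<integral>x. f x - g x \<partial>P\<bar> \<le> (\<integral>x. \<bar>f x - g x\<bar> \<partial>P)" by (rule integral_abs_bound)
  also have "\<dots> \<le> (\<integral>x. e + 2 * B * indicator A x \<partial>P)"
  proof (rule integral_mono_AE)
    show "AE x in P. \<bar>f x - g x\<bar> \<le> e + 2 * B * indicator A x"
      using c
    proof eventually_elim
      case (elim x)
      show ?case using elim B[of x] e by (cases "x \<in> A") (auto simp: abs_le_iff)
    qed
  qed (use i iA in auto)
  also have "\<dots> = e + 2 * B * measure P A" using iA A by (simp add: prob_space)
  finally show ?thesis using i by simp
qed

definition rescaled :: "(real \<Rightarrow> 'a \<Rightarrow> nat) \<Rightarrow> real \<Rightarrow> nat \<Rightarrow> real \<Rightarrow> 'a \<Rightarrow> real" where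
  "rescaled Q \<delta> n t \<omega> = real n powr (- \<delta>) * real (Q (real n * t) \<omega>)"

lemma rescaled_measurable:
  assumes "mm1_queue M lam mu Q" "t \<ge> 0"
  shows "rescaled Q \<delta> n t \<in> borel_measurable M"
proof -
  have "Q (real n * t) \<in> measurable M (count_space UNIV)"
    using markov_chainD(2)[OF assms(1)[unfolded mm1_queue_def]] assms(2) by simp
  then have "(\<lambda>\<omega>. real (Q (real n * t) \<omega>)) \<in> borel_measurable M" by (rule measurable_compose) simp
  then show ?thesis unfolding rescaled_def by simp
qed

text \<open>Three errors add up: total variation between queue and reflected walk, the loss by
  reflecting at block starts only, and the probability that some block oscillates by
  \<open>e\<close> or more. As \<open>n\<close> grows the first and one part of the third vanish;
  the other part of the third is small for large \<open>m\<close>, the second for small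
  \<open>e\<close>.\<close>

lemma grid_approximation:
  assumes Q: "mm1_queue M lam lam Q" and par: "lam > 0" and H: "C \<ge> 0" "\<And>z z'. \<bar>H z - H z'\<bar> \<le> C * (\<Sum>k\<le>J. \<bar>z k - z' k\<bar>)" "\<And>z. \<bar>H z\<bar> \<le> B" "B > 0"
    and n: "n > 0" and j: "j > 0" and m: "m > 0" and small: "2 * lam * mesh (real j * real m) n \<le> 1" and e: "e > 0"
  shows "\<bar>(\<integral>\<omega>. H (grid (rescaled Q (1/2) n) (1 / real j) J \<omega>) \<partial>M) -
      (\<integral>l. H (grid_reflection m J (\<lambda>r. if r \<le> J * m then 1 / sqrt (real n) * of_int (l ! (r * n ^ 3)) else 0))
        \<partial>measure_pmf (chain (walk_kernel lam lam (mesh (real j * real m) n)) 0 (J * m * n ^ 3)))\<bar>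
    \<le> 8 * B * real J * lam\<^sup>2 / (real j ^ 2 * real m * real n) + C * real (Suc J) * e
      + 2 * B * ((2 * lam * real J / (real j * real n) + 12 * lam\<^sup>2 * real J / (real j ^ 2 * real m)) / e ^ 4)"
proof -
  define q where "q = real j * real m"
  have q: "q > 0" using j m by (simp add: q_def)
  define h where "h = mesh q n"
  have h: "h \<ge> 0" "2 * lam * h \<le> 1" using mesh_small(1)[OF q] small by (auto simp: h_def q_def)
  define b where "b = n ^ 3"
  have b: "b > 0" using n by (simp add: b_def)
  have hb: "h * real b = real n / q" using n q by (simp add: h_def b_def mesh_def power2_eq_square power3_eq_cube)
  define R where "R = J * m"
  define c where "c = 1 / sqrt (real n)"
  have c: "c > 0" using n by (simp add: c_def)
  have cn: "real n powr (- (1/2)) = c" 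
    unfolding c_def powr_minus powr_half_sqrt[OF of_nat_0_le_iff] inverse_eq_divide ..
  define f where "f l = H (\<lambda>k. if k \<le> J then c * real (l ! (k * m * b)) else 0)" for l :: "nat list"
  have f_bd: "\<bar>f l\<bar> \<le> B" for l unfolding f_def by (rule H(3))
  have kR: "k * m * b \<le> R * b" if "k \<le> J" for k unfolding R_def using that by (intro mult_right_mono) auto
  have 1: "(\<integral>\<omega>. H (grid (rescaled Q (1/2) n) (1 / real j) J \<omega>) \<partial>M) = (\<integral>\<omega>. f (skeleton Q h (R * b) \<omega>) \<partial>M)"
  proof -
    have "grid (rescaled Q (1/2) n) (1 / real j) J \<omega> = (\<lambda>k. if k \<le> J then c * real (skeleton Q h (R * b) \<omega> ! (k * m * b)) else 0)" for \<omega>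
    proof
      fix k
      show "grid (rescaled Q (1/2) n) (1 / real j) J \<omega> k = (if k \<le> J then c * real (skeleton Q h (R * b) \<omega> ! (k * m * b)) else 0)"
      proof (cases "k \<le> J")
        case True
        have "real (k * m * b) * h = real k * real m * (h * real b)" by (simp add: mult_ac)
        also have "\<dots> = real n * (real k * (1 / real j))" unfolding hb q_def using m by simp
        finally have "skeleton Q h (R * b) \<omega> ! (k * m * b) = Q (real n * (real k * (1 / real j))) \<omega>"
          using skeleton_nth[OF kR[OF True], of Q h \<omega>] by (simp only:)
        then show ?thesis using True by (simp add: grid_def rescaled_def cn)
      qed (simp add: grid_def)
    qed
    then show ?thesis by (simp add: f_def)
  qed
  have 2: "\<bar>(\<integral>\<omega>. f (skeleton Q h (R * b) \<omega>) \<partial>M) - (\<integral>l. f l \<partial>measure_pmf (chain (queue_kernel lam lam h) 0 (R * b)))\<bar>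
     \<le> 8 * B * real J * lam\<^sup>2 / (real j ^ 2 * real m * real n)"
  proof -
    have "\<bar>(\<integral>\<omega>. f (skeleton Q h (R * b) \<omega>) \<partial>M) - (\<integral>l. f l \<partial>measure_pmf (chain (queue_kernel lam lam h) 0 (R * b)))\<bar>
      \<le> 2 * B * (real (R * b) * ((lam + lam) * h)\<^sup>2)"
      by (rule skeleton_close_chain_bounded[OF Q par par h(1) _ f_bd H(4)]) (use h in simp)
    also have "real (R * b) * ((lam + lam) * h)\<^sup>2 = real R * (4 * lam\<^sup>2) * (h * (h * real b))"
      by (simp add: power2_eq_square algebra_simps)
    also have "\<dots> = 4 * real J * lam\<^sup>2 / (real j ^ 2 * real m * real n)"
      unfolding hb unfolding h_def mesh_def R_def q_def using n m j
      by (simp add: power2_eq_square divide_simps)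
    finally show ?thesis by (simp add: mult_ac)
  qed
  define p where "p = chain (walk_kernel lam lam h) 0 (R * b)"
  define z where "z l r = (if r \<le> R then c * of_int (l ! (r * b)) else 0)" for l :: "int list" and r
  define A where "A = {l. \<exists>r<R. \<exists>i. r * b \<le> i \<and> i \<le> Suc r * b \<and> e / c \<le> \<bar>real_of_int (l ! i - l ! (r * b))\<bar>}"
  have ec: "e / c > 0" using e c by simp
  have pA: "measure (measure_pmf p) A \<le> (2 * lam * real J / (real j * real n) + 12 * lam\<^sup>2 * real J / (real j ^ 2 * real m)) / e ^ 4"
  proof -
    have "measure (measure_pmf p) A \<le> real R * ((2 * lam * h * real b + 3 * (2 * lam * h * real b)\<^sup>2) / (e / c) ^ 4)"
      unfolding p_def A_def by (rule symmetric_walk_blocks[OF par h ec])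
    also have "2 * lam * h * real b = 2 * lam * (real n / q)" using hb by (simp add: mult.assoc)
    also have "(e / c) ^ 4 = e ^ 4 * (real n)\<^sup>2"
    proof -
      have "sqrt (real n) ^ 4 = (sqrt (real n) ^ 2) ^ 2" using power_mult[of "sqrt (real n)" 2 2] by simp
      then show ?thesis by (simp add: c_def power_mult_distrib)
    qed
    also have "real R * ((2 * lam * (real n / q) + 3 * (2 * lam * (real n / q))\<^sup>2) / (e ^ 4 * (real n)\<^sup>2)) =
      (2 * lam * real J / (real j * real n) + 12 * lam\<^sup>2 * real J / (real j ^ 2 * real m)) / e ^ 4"
      unfolding R_def q_def using n m j e by (simp add: power2_eq_square field_simps)
    finally show ?thesis .
  qed
  have "\<bar>(\<integral>l. f (reflect_list l) \<partial>measure_pmf p) - (\<integral>l. H (grid_reflection m J (z l)) \<partial>measure_pmf p)\<bar>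
    \<le> C * real (Suc J) * e + 2 * B * measure (measure_pmf p) A"
  proof (rule integral_close)
    show "prob_space (measure_pmf p)" by (rule measure_pmf.prob_space_axioms)
    show "integrable (measure_pmf p) (\<lambda>l. f (reflect_list l))" by (rule integrable_pmf_bounded[OF f_bd])
    show "integrable (measure_pmf p) (\<lambda>l. H (grid_reflection m J (z l)))" by (rule integrable_pmf_bounded[OF H(3)])
    show "AE l in measure_pmf p. l \<notin> A \<longrightarrow> \<bar>f (reflect_list l) - H (grid_reflection m J (z l))\<bar> \<le> C * real (Suc J) * e"
    proof (rule AE_pmfI, rule impI)
      fix l assume "l \<in> set_pmf p" and nA: "l \<notin> A"
      then have len: "length l = Suc (R * b)" using chain_length[of l "walk_kernel lam lam h" 0 "R * b"] by (simp add: p_def)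
      have each: "\<bar>c * real (reflect_list l ! (k * m * b)) - grid_reflection m J (z l) k\<bar> \<le> e" if k: "k \<le> J" for k
      proof -
        have kRm: "k * m \<le> R" unfolding R_def using k by (rule mult_right_mono) simp
        have "\<bar>c * of_int (reflect l (k * m * b)) - grid_reflection m J (\<lambda>r. if r \<le> J * m then c * of_int (l ! (r * b)) else 0) k\<bar> \<le> c * (e / c)"
        proof (rule reflect_grid_reflection[OF b less_imp_le[OF c] k ec])
          fix r i assume "r < k * m" "r * b \<le> i" "i \<le> Suc r * b"
          moreover from this have "r < R" using kRm by simp
          ultimately have "\<not> e / c \<le> \<bar>real_of_int (l ! i - l ! (r * b))\<bar>" using nA unfolding A_def by blast
          then show "\<bar>real_of_int (l ! i - l ! (r * b))\<bar> < e / c" by simp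
        qed
        moreover have "real (reflect_list l ! (k * m * b)) = of_int (reflect l (k * m * b))"
          by (rule reflect_list_nth) (simp only: len less_Suc_eq_le kR[OF k])
        moreover have "(\<lambda>r. if r \<le> J * m then c * of_int (l ! (r * b)) else 0) = z l" by (rule ext) (simp add: z_def R_def)
        ultimately show ?thesis using c by simp
      qed
      have "\<bar>f (reflect_list l) - H (grid_reflection m J (z l))\<bar> \<le>
        C * (\<Sum>k\<le>J. \<bar>(if k \<le> J then c * real (reflect_list l ! (k * m * b)) else 0) - grid_reflection m J (z l) k\<bar>)"
        unfolding f_def by (rule H(2))
      also have "\<dots> \<le> C * (\<Sum>k\<le>J. e)"
        using H(1) each by (intro mult_left_mono sum_mono) auto
      finally show "\<bar>f (reflect_list l) - H (grid_reflection m J (z l))\<bar> \<le> C * real (Suc J) * e" by (simp add: mult.assoc)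
    qed
  qed (use f_bd H e in auto)
  moreover have "(\<integral>l. f l \<partial>measure_pmf (chain (queue_kernel lam lam h) 0 (R * b))) = (\<integral>l. f (reflect_list l) \<partial>measure_pmf p)"
    unfolding p_def by (simp add: chain_queue_kernel_eq)
  moreover have "2 * B * measure (measure_pmf p) A \<le> 2 * B * ((2 * lam * real J / (real j * real n) + 12 * lam\<^sup>2 * real J / (real j ^ 2 * real m)) / e ^ 4)"
    using pA H(4) by (intro mult_left_mono) auto
  moreover have "(\<integral>l. H (grid_reflection m J (z l)) \<partial>measure_pmf p) =
    (\<integral>l. H (grid_reflection m J (\<lambda>r. if r \<le> J * m then 1 / sqrt (real n) * of_int (l ! (r * n ^ 3)) else 0))
        \<partial>measure_pmf (chain (walk_kernel lam lam (mesh (real j * real m) n)) 0 (J * m * n ^ 3)))"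
    unfolding p_def z_def[abs_def] R_def b_def c_def h_def q_def ..
  ultimately show ?thesis using 1 2 by linarith
qed

text \<open>The parameters are chosen in the order \<open>e\<close>, \<open>m\<close>,
  \<open>n\<close>, for five errors of at most one fifth of the target each. The refinement
  \<open>m\<close> must be fixed before \<open>n\<close>, as convergence of the walk is known for a
  fixed number of blocks.\<close>

lemma critical_fdd:
  assumes Q: "mm1_queue M lam lam Q" and par: "lam > 0" and W: "brownian_motion N W"
    and H: "bounded_lipschitz J H" and j: "j > 0" and J: "J > 0"
    and Z'm: "\<And>t. t \<ge> 0 \<Longrightarrow> Z' t \<in> borel_measurable N"
    and Z': "AE \<omega> in N. \<forall>t\<ge>0. Z' t \<omega> = skorokhod_reflection (\<lambda>t. sqrt (2 * lam) * W t \<omega>) t"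
  shows "(\<lambda>n. \<integral>\<omega>. H (grid (rescaled Q (1/2) n) (1 / real j) J \<omega>) \<partial>M) \<longlonglongrightarrow> (\<integral>\<omega>. H (grid Z' (1 / real j) J \<omega>) \<partial>N)"
proof -
  note WD = brownian_motionD[OF W]
  interpret N: prob_space N by (rule levy_processD(1)[OF WD(1)])
  define X where "X t \<omega> = sqrt (2 * lam) * W t \<omega>" for t \<omega>
  have Xm: "X t \<in> borel_measurable N" if "t \<ge> 0" for t unfolding X_def using levy_processD(2)[OF WD(1) that] by simp
  obtain C B0 where H0: "C \<ge> 0" "\<And>z z'. \<bar>H z - H z'\<bar> \<le> C * (\<Sum>k\<le>J. \<bar>z k - z' k\<bar>)" "\<And>z. \<bar>H z\<bar> \<le> B0" "B0 \<ge> 0"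
    using bounded_lipschitzE[OF H] by metis
  \<comment> \<open>The comparison of skeletons rescales by the bound, which therefore has to be
    positive.\<close>
  define B where "B = B0 + 1"
  have HB: "C \<ge> 0" "\<And>z z'. \<bar>H z - H z'\<bar> \<le> C * (\<Sum>k\<le>J. \<bar>z k - z' k\<bar>)" "\<And>z. \<bar>H z\<bar> \<le> B" "B > 0"
  proof -
    show "\<bar>H z\<bar> \<le> B" for z using H0(3)[of z] by (simp add: B_def)
  qed (use H0 in \<open>auto simp: B_def\<close>)
  define F where "F m z = H (grid_reflection m J z)" for m z
  have Fb: "bounded_lipschitz (J * m) (F m)" for m unfolding F_def by (rule bounded_lipschitz_grid_reflection[OF H])
  define T where "T = (\<integral>\<omega>. H (grid Z' (1 / real j) J \<omega>) \<partial>N)"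
  define Tm where "Tm m = (\<integral>\<omega>. F (Suc m) (grid X (1 / (real j * real (Suc m))) (J * Suc m) \<omega>) \<partial>N)" for m
  have lim_m: "Tm \<longlonglongrightarrow> T"
    unfolding T_def Tm_def
  proof (rule integral_dominated_convergence[where w="\<lambda>_. B"])
    show "(\<lambda>\<omega>. H (grid Z' (1 / real j) J \<omega>)) \<in> borel_measurable N"
      by (rule measurable_compose[OF grid_measurable[OF Z'm] bounded_lipschitz_measurable[OF H]]) simp_all
    show "(\<lambda>\<omega>. F (Suc m) (grid X (1 / (real j * real (Suc m))) (J * Suc m) \<omega>)) \<in> borel_measurable N" for m
      by (rule measurable_compose[OF grid_measurable[OF Xm] bounded_lipschitz_measurable[OF Fb]]) simp_all
    show "AE \<omega> in N. (\<lambda>m. F (Suc m) (grid X (1 / (real j * real (Suc m))) (J * Suc m) \<omega>)) \<longlonglongrightarrow> H (grid Z' (1 / real j) J \<omega>)"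
      using WD(3) Z'
    proof eventually_elim
      case (elim \<omega>)
      have cX: "continuous_on {0..} (\<lambda>t. X t \<omega>)" unfolding X_def using elim(1) by (intro continuous_intros)
      let ?g = "\<lambda>m. grid_reflection (Suc m) J (grid X (1 / (real j * real (Suc m))) (J * Suc m) \<omega>)"
      have g: "(\<lambda>m. ?g m k) \<longlonglongrightarrow> grid Z' (1 / real j) J \<omega> k" if "k \<le> J" for k
        using grid_reflection_tendsto[where X=X and \<omega>=\<omega>, OF cX j that] elim(2) that by (simp add: grid_def X_def)
      have "(\<lambda>m. C * (\<Sum>k\<le>J. \<bar>?g m k - grid Z' (1 / real j) J \<omega> k\<bar>)) \<longlonglongrightarrow> C * (\<Sum>k\<le>J. \<bar>grid Z' (1 / real j) J \<omega> k - grid Z' (1 / real j) J \<omega> k\<bar>)"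
        by (intro tendsto_intros g) auto
      then have lim0: "(\<lambda>m. C * (\<Sum>k\<le>J. \<bar>?g m k - grid Z' (1 / real j) J \<omega> k\<bar>)) \<longlonglongrightarrow> 0" by simp
      have "(\<lambda>m. H (?g m) - H (grid Z' (1 / real j) J \<omega>)) \<longlonglongrightarrow> 0"
        by (rule Lim_null_comparison[OF always_eventually[OF allI] lim0]) (use HB(2) in simp)
      then show ?case unfolding F_def by (rule LIM_zero_cancel)
    qed
  qed (use HB(3) in \<open>auto simp: F_def\<close>)
  show ?thesis unfolding T_def[symmetric]
  proof (rule LIMSEQ_I, unfold eventually_sequentially[symmetric])
    fix \<epsilon> :: real assume \<epsilon>: "\<epsilon> > 0"
    define e where "e = \<epsilon> / (5 * (C * real (Suc J) + 1))"
    have e: "e > 0" "C * real (Suc J) * e \<le> \<epsilon> / 5"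
    proof -
      have "0 \<le> C * real (Suc J)" using HB(1) by simp
      then show "e > 0" "C * real (Suc J) * e \<le> \<epsilon> / 5" using \<epsilon> by (auto simp: e_def field_simps simp del: of_nat_Suc)
    qed
    have "(\<lambda>m. 2 * B * (12 * lam\<^sup>2 * real J / (real j ^ 2 * real (Suc m)) / e ^ 4)) \<longlonglongrightarrow> 0"
      using j e(1) by real_asymp
    then have "\<forall>\<^sub>F m in sequentially. 2 * B * (12 * lam\<^sup>2 * real J / (real j ^ 2 * real (Suc m)) / e ^ 4) < \<epsilon> / 5"
      using \<epsilon> by (intro order_tendstoD) auto
    moreover have "\<forall>\<^sub>F m in sequentially. \<bar>Tm m - T\<bar> < \<epsilon> / 5"
      using tendstoD[OF lim_m, of "\<epsilon> / 5"] \<epsilon> by (simp add: dist_real_def)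
    ultimately have "\<forall>\<^sub>F m in sequentially. 2 * B * (12 * lam\<^sup>2 * real J / (real j ^ 2 * real (Suc m)) / e ^ 4) < \<epsilon> / 5 \<and> \<bar>Tm m - T\<bar> < \<epsilon> / 5"
      by (rule eventually_conj)
    then obtain m0 where m0: "2 * B * (12 * lam\<^sup>2 * real J / (real j ^ 2 * real (Suc m0)) / e ^ 4) < \<epsilon> / 5" "\<bar>Tm m0 - T\<bar> < \<epsilon> / 5"
      using eventually_happens'[OF sequentially_bot] by blast
    define m where "m = Suc m0"
    have m: "m > 0" by (simp add: m_def)
    define q where "q = real j * real m"
    have q: "q > 0" using j m by (simp add: q_def)
    have "(\<lambda>n. \<integral>l. F m (\<lambda>r. if r \<le> J * m then 1 / sqrt (real n) * of_int (l ! (r * n ^ 3)) else 0)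
        \<partial>measure_pmf (chain (walk_kernel lam lam (mesh q n)) 0 (J * m * n ^ 3))) \<longlonglongrightarrow> Tm m0"
      using walk_grid_convergence[OF W par q _ Fb, of m] J m by (simp add: Tm_def m_def q_def X_def[abs_def])
    then have ev1: "\<forall>\<^sub>F n in sequentially. \<bar>(\<integral>l. F m (\<lambda>r. if r \<le> J * m then 1 / sqrt (real n) * of_int (l ! (r * n ^ 3)) else 0)
        \<partial>measure_pmf (chain (walk_kernel lam lam (mesh q n)) 0 (J * m * n ^ 3))) - Tm m0\<bar> < \<epsilon> / 5"
      using \<epsilon> by (auto dest!: tendstoD[of _ _ _ "\<epsilon> / 5"] simp: dist_real_def)
    have "(\<lambda>n. 8 * B * real J * lam\<^sup>2 / (real j ^ 2 * real m * real n) + 2 * B * (2 * lam * real J / (real j * real n) / e ^ 4)) \<longlonglongrightarrow> 0"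
      using j m e(1) by real_asymp
    then have ev2: "\<forall>\<^sub>F n in sequentially. 8 * B * real J * lam\<^sup>2 / (real j ^ 2 * real m * real n) + 2 * B * (2 * lam * real J / (real j * real n) / e ^ 4) < \<epsilon> / 5"
      using \<epsilon> by (intro order_tendstoD) auto
    show "\<forall>\<^sub>F n in sequentially. norm ((\<integral>\<omega>. H (grid (rescaled Q (1/2) n) (1 / real j) J \<omega>) \<partial>M) - T) < \<epsilon>"
      using ev1 ev2 mesh_small(2)[OF q, of "2 * lam"] eventually_gt_at_top[of 0]
    proof eventually_elim
      case (elim n)
      define I where "I = (\<integral>l. F m (\<lambda>r. if r \<le> J * m then 1 / sqrt (real n) * of_int (l ! (r * n ^ 3)) else 0)
        \<partial>measure_pmf (chain (walk_kernel lam lam (mesh q n)) 0 (J * m * n ^ 3)))"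
      have "\<bar>(\<integral>\<omega>. H (grid (rescaled Q (1/2) n) (1 / real j) J \<omega>) \<partial>M) - I\<bar>
        \<le> 8 * B * real J * lam\<^sup>2 / (real j ^ 2 * real m * real n) + C * real (Suc J) * e
          + 2 * B * ((2 * lam * real J / (real j * real n) + 12 * lam\<^sup>2 * real J / (real j ^ 2 * real m)) / e ^ 4)"
        unfolding I_def F_def q_def
        by (rule grid_approximation[OF Q par HB elim(4) j m _ e(1)]) (use elim(3) in \<open>simp add: q_def\<close>)
      also have "\<dots> = (8 * B * real J * lam\<^sup>2 / (real j ^ 2 * real m * real n) + 2 * B * (2 * lam * real J / (real j * real n) / e ^ 4))
          + C * real (Suc J) * e + 2 * B * (12 * lam\<^sup>2 * real J / (real j ^ 2 * real m) / e ^ 4)"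
        by (simp add: add_divide_distrib distrib_left)
      finally show ?case using elim(1,2) e(2) m0 unfolding I_def[symmetric] m_def[symmetric] real_norm_def by linarith
    qed
  qed
qed

text \<open>\<open>queue_lln\<close> on \<open>[0, n S]\<close> with threshold
  \<open>n e / 2\<close>: the variance grows like \<open>n\<close>, the squared threshold like
  \<open>n^2\<close>.\<close>

lemma supercritical_close:
  assumes Q: "mm1_queue M lam mu Q" and par: "lam > 0" "mu > 0" "lam \<ge> mu" and S: "S > 0" and e: "e > 0"
  shows "\<forall>\<^sub>F n in sequentially. mostly M e (\<lambda>\<omega>. \<forall>t. 0 \<le> t \<and> t \<le> S \<longrightarrow> \<bar>rescaled Q 1 n t \<omega> - (lam - mu) * t\<bar> \<le> e)"
proof -
  have "(\<lambda>n. (lam + mu) * (real n * S) / (real n * (e / 2))\<^sup>2) \<longlonglongrightarrow> 0" using e by real_asymp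
  then have "\<forall>\<^sub>F n in sequentially. (lam + mu) * (real n * S) / (real n * (e / 2))\<^sup>2 < e" using e by (intro order_tendstoD) auto
  then show ?thesis using eventually_gt_at_top[of 0]
  proof eventually_elim
    case (elim n)
    have "mostly M ((lam + mu) * (real n * S) / (real n * (e / 2))\<^sup>2) (\<lambda>\<omega>. \<forall>t. 0 \<le> t \<and> t \<le> real n * S \<longrightarrow> \<bar>real (Q t \<omega>) - (lam - mu) * t\<bar> \<le> 2 * (real n * (e / 2)))"
      by (rule queue_lln[OF Q par]) (use elim S e in auto)
    then obtain A where A: "A \<in> sets M" "measure M A \<le> (lam + mu) * (real n * S) / (real n * (e / 2))\<^sup>2"
      "AE \<omega> in M. \<omega> \<notin> A \<longrightarrow> (\<forall>t. 0 \<le> t \<and> t \<le> real n * S \<longrightarrow> \<bar>real (Q t \<omega>) - (lam - mu) * t\<bar> \<le> 2 * (real n * (e / 2)))"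
      by blast
    have "AE \<omega> in M. \<omega> \<notin> A \<longrightarrow> (\<forall>t. 0 \<le> t \<and> t \<le> S \<longrightarrow> \<bar>rescaled Q 1 n t \<omega> - (lam - mu) * t\<bar> \<le> e)"
      using A(3)
    proof eventually_elim
      case el: (elim \<omega>)
      show ?case
      proof (intro impI allI)
        fix t assume \<omega>: "\<omega> \<notin> A" and t: "0 \<le> t \<and> t \<le> S"
        then have "real n * t \<le> real n * S" by (intro mult_left_mono) auto
        then have "\<bar>real (Q (real n * t) \<omega>) - (lam - mu) * (real n * t)\<bar> \<le> real n * e"
          using el[rule_format, OF \<omega>, of "real n * t"] t by simp
        moreover have "rescaled Q 1 n t \<omega> - (lam - mu) * t = (real (Q (real n * t) \<omega>) - (lam - mu) * (real n * t)) / real n"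
          using elim(2) by (simp add: rescaled_def powr_minus_divide diff_divide_distrib)
        ultimately show "\<bar>rescaled Q 1 n t \<omega> - (lam - mu) * t\<bar> \<le> e"
          using elim(2) by (simp add: abs_divide divide_le_eq mult.commute)
      qed
    qed
    then show ?case using A(1,2) elim(1) by (intro bexI[of _ A]) auto
  qed
qed

text \<open>The limit is deterministic, so closeness in probability on the grid is enough.\<close>

lemma supercritical_fdd:
  assumes Q: "mm1_queue M lam mu Q" and par: "lam > 0" "mu > 0" "lam \<ge> mu"
    and H: "bounded_lipschitz J H" and j: "j > 0" and N: "prob_space N"
  shows "(\<lambda>n. \<integral>\<omega>. H (grid (rescaled Q 1 n) (1 / real j) J \<omega>) \<partial>M) \<longlonglongrightarrow> (\<integral>\<omega>. H (grid (\<lambda>t \<omega>. (lam - mu) * t) (1 / real j) J \<omega>) \<partial>N)"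
proof -
  interpret M: prob_space M by (rule markov_chainD(1)[OF Q[unfolded mm1_queue_def]])
  interpret N: prob_space N by fact
  obtain C B where HB: "C \<ge> 0" "\<And>z z'. \<bar>H z - H z'\<bar> \<le> C * (\<Sum>k\<le>J. \<bar>z k - z' k\<bar>)" "\<And>z. \<bar>H z\<bar> \<le> B" "B \<ge> 0"
    using bounded_lipschitzE[OF H] by metis
  define y where "y k = (if k \<le> J then (lam - mu) * (real k * (1 / real j)) else 0)" for k
  have gy: "grid (\<lambda>t \<omega>. (lam - mu) * t) (1 / real j) J \<omega> = y" for \<omega> by (rule ext) (simp add: grid_def y_def)
  have Hm: "(\<lambda>\<omega>. H (grid (rescaled Q 1 n) (1 / real j) J \<omega>)) \<in> borel_measurable M" for n
    by (rule measurable_compose[OF grid_measurable[OF rescaled_measurable[OF Q]] bounded_lipschitz_measurable[OF H]]) simp_all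
  show ?thesis unfolding gy
  proof (rule LIMSEQ_I, unfold eventually_sequentially[symmetric])
    fix \<epsilon> :: real assume \<epsilon>: "\<epsilon> > 0"
    define e where "e = \<epsilon> / (2 * (C * real (Suc J) + 2 * B + 1))"
    have e: "e > 0" "C * real (Suc J) * e + 2 * B * e < \<epsilon>"
    proof -
      have nn: "0 \<le> C * real (Suc J)" using HB(1) by simp
      then show "e > 0" using \<epsilon> HB(4) unfolding e_def by (intro divide_pos_pos mult_pos_pos add_nonneg_pos) auto
      have "(C * real (Suc J) + 2 * B) * e < (2 * (C * real (Suc J) + 2 * B + 1)) * e"
        using \<open>e > 0\<close> nn HB(4) by (intro mult_strict_right_mono) auto
      also have "\<dots> = \<epsilon>" using nn HB(4) by (simp add: e_def)
      finally show "C * real (Suc J) * e + 2 * B * e < \<epsilon>" by (simp add: distrib_right)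
    qed
    \<comment> \<open>The summand \<open>1\<close> makes the horizon positive even for
      \<open>J = 0\<close>.\<close>
    have "real J / real j + 1 > 0" by (intro add_nonneg_pos) auto
    note ev = supercritical_close[OF Q par this e(1)]
    show "\<forall>\<^sub>F n in sequentially. norm ((\<integral>\<omega>. H (grid (rescaled Q 1 n) (1 / real j) J \<omega>) \<partial>M) - (\<integral>\<omega>. H y \<partial>N)) < \<epsilon>"
      using ev
    proof eventually_elim
      case (elim n)
      then obtain A where A: "A \<in> sets M" "measure M A \<le> e"
        "AE \<omega> in M. \<omega> \<notin> A \<longrightarrow> (\<forall>t. 0 \<le> t \<and> t \<le> real J / real j + 1 \<longrightarrow> \<bar>rescaled Q 1 n t \<omega> - (lam - mu) * t\<bar> \<le> e)" by auto
      have "\<bar>(\<integral>\<omega>. H (grid (rescaled Q 1 n) (1 / real j) J \<omega>) \<partial>M) - (\<integral>\<omega>. H y \<partial>M)\<bar> \<le> C * real (Suc J) * e + 2 * B * measure M A"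
      proof (rule integral_close[OF M.prob_space_axioms _ _ A(1)])
        show "integrable M (\<lambda>\<omega>. H (grid (rescaled Q 1 n) (1 / real j) J \<omega>))"
          using Hm HB(3) by (intro M.integrable_const_bound[of _ B]) auto
        show "AE \<omega> in M. \<omega> \<notin> A \<longrightarrow> \<bar>H (grid (rescaled Q 1 n) (1 / real j) J \<omega>) - H y\<bar> \<le> C * real (Suc J) * e"
          using A(3)
        proof eventually_elim
          case el: (elim \<omega>)
          show ?case
          proof
            assume \<omega>: "\<omega> \<notin> A"
            have "\<bar>H (grid (rescaled Q 1 n) (1 / real j) J \<omega>) - H y\<bar> \<le> C * (\<Sum>k\<le>J. \<bar>grid (rescaled Q 1 n) (1 / real j) J \<omega> k - y k\<bar>)" by (rule HB(2))
            also have "\<dots> \<le> C * (\<Sum>k\<le>J. e)"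
            proof (intro mult_left_mono sum_mono HB(1))
              fix k assume k: "k \<in> {..J}"
              have "real k / real j \<le> real J / real j" using k by (intro divide_right_mono) auto
              then show "\<bar>grid (rescaled Q 1 n) (1 / real j) J \<omega> k - y k\<bar> \<le> e"
                using el[rule_format, OF \<omega>, of "real k * (1 / real j)"] k by (simp add: grid_def y_def)
            qed
            finally show "\<bar>H (grid (rescaled Q 1 n) (1 / real j) J \<omega>) - H y\<bar> \<le> C * real (Suc J) * e" by (simp add: mult.assoc)
          qed
        qed
      qed (use HB e in auto)
      moreover have "2 * B * measure M A \<le> 2 * B * e" using A(2) HB(4) by (intro mult_left_mono) auto
      ultimately show ?case using e(2) by (simp add: M.prob_space N.prob_space)
    qed
  qed
qed

section \<open>The three regimes\<close>

text \<open>\<open>[0, S]\<close> is cut into \<open>K\<close> cells of length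
  \<open>\<eta>\<close>. Two times at distance at most \<open>\<eta>\<close> lie in the same cell or
  in adjacent ones, so three oscillations of size \<open>2 * a\<close> suffice. The total
  probability is of order \<open>1/K\<close> for large \<open>n\<close>, hence \<open>K\<close> is
  chosen before \<open>n\<close>.\<close>

lemma critical_modulus:
  assumes Q: "mm1_queue M lam lam Q" and par: "lam > 0" and S: "S > 0" and e: "e > 0"
  shows "\<exists>\<eta>>0. \<forall>\<^sub>F n in sequentially. mostly M e (\<lambda>\<omega>. oscillation_le (\<lambda>t. rescaled Q (1/2) n t \<omega>) S \<eta> e)"
proof -
  interpret prob_space M by (rule markov_chainD(1)[OF Q[unfolded mm1_queue_def]])
  \<comment> \<open>\<open>4096 = 8^4\<close> stems from the choice of \<open>a\<close> as
    \<open>e * sqrt n / 8\<close>, made below so that \<open>6 * a\<close> stays under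
    \<open>e * sqrt n\<close>.\<close>
  have "(\<lambda>K. 4096 * (12 * lam\<^sup>2 * S\<^sup>2 / real K) / e ^ 4) \<longlonglongrightarrow> 0" using e by real_asymp
  then have "\<forall>\<^sub>F K in sequentially. 4096 * (12 * lam\<^sup>2 * S\<^sup>2 / real K) / e ^ 4 < e / 2" using e by (intro order_tendstoD) auto
  then have "\<forall>\<^sub>F K in sequentially. 4096 * (12 * lam\<^sup>2 * S\<^sup>2 / real K) / e ^ 4 < e / 2 \<and> K > 0"
    using eventually_gt_at_top[of 0] by eventually_elim simp
  then obtain K :: nat where K: "4096 * (12 * lam\<^sup>2 * S\<^sup>2 / real K) / e ^ 4 < e / 2" "K > 0"
    using eventually_happens'[OF sequentially_bot] by blast
  define \<eta> where "\<eta> = S / real K"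
  have \<eta>: "\<eta> > 0" "real K * \<eta> = S" using S K by (auto simp: \<eta>_def)
  have "(\<lambda>n. 4096 * (2 * lam * S / real n) / e ^ 4) \<longlonglongrightarrow> 0" using e by real_asymp
  then have "\<forall>\<^sub>F n in sequentially. 4096 * (2 * lam * S / real n) / e ^ 4 < e / 2" using e by (intro order_tendstoD) auto
  then have "\<forall>\<^sub>F n in sequentially. mostly M e (\<lambda>\<omega>. oscillation_le (\<lambda>t. rescaled Q (1/2) n t \<omega>) S \<eta> e)"
    using eventually_gt_at_top[of 0]
  proof eventually_elim
    case (elim n)
    define a where "a = e * sqrt (real n) / 8"
    define \<Delta> where "\<Delta> = real n * \<eta>"
    have a: "a > 0" and \<Delta>: "\<Delta> > 0" using e \<eta> elim by (auto simp: a_def \<Delta>_def)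
    let ?b = "(2 * lam * \<Delta> + 3 * (2 * lam * \<Delta>)\<^sup>2) / a ^ 4"
    have "\<forall>r. \<exists>A. A\<in>sets M \<and> measure M A \<le> ?b \<and> (AE \<omega> in M. \<omega> \<notin> A \<longrightarrow>
       (\<forall>t. real r * \<Delta> \<le> t \<and> t \<le> real (Suc r) * \<Delta> \<longrightarrow> \<bar>real (Q t \<omega>) - real (Q (real r * \<Delta>) \<omega>)\<bar> \<le> 2 * a))"
      using queue_oscillation[OF Q par \<Delta> a] by blast
    from choice[OF this] obtain A where A: "\<And>r. A r \<in> sets M" "\<And>r. measure M (A r) \<le> ?b"
      "\<And>r. AE \<omega> in M. \<omega> \<notin> A r \<longrightarrow> (\<forall>t. real r * \<Delta> \<le> t \<and> t \<le> real (Suc r) * \<Delta> \<longrightarrow> \<bar>real (Q t \<omega>) - real (Q (real r * \<Delta>) \<omega>)\<bar> \<le> 2 * a)"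
      by blast
    have A3: "AE \<omega> in M. \<forall>r. \<omega> \<notin> A r \<longrightarrow> (\<forall>t. real r * \<Delta> \<le> t \<and> t \<le> real (Suc r) * \<Delta> \<longrightarrow> \<bar>real (Q t \<omega>) - real (Q (real r * \<Delta>) \<omega>)\<bar> \<le> 2 * a)"
      unfolding AE_all_countable using A(3) by blast
    have "measure M (\<Union>r\<in>{..<K}. A r) \<le> (\<Sum>r\<in>{..<K}. measure M (A r))"
      by (rule finite_measure_subadditive_finite) (use A in auto)
    also have "\<dots> \<le> (\<Sum>r\<in>{..<K}. ?b)" by (rule sum_mono) (rule A(2))
    also have "\<dots> = real K * ?b" by simp
    also have "\<dots> = 4096 * (2 * lam * S / real n) / e ^ 4 + 4096 * (12 * lam\<^sup>2 * S\<^sup>2 / real K) / e ^ 4"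
    proof -
      have "sqrt (real n) ^ 4 = (sqrt (real n) ^ 2) ^ 2" using power_mult[of "sqrt (real n)" 2 2] by simp
      then have a4: "a ^ 4 = e ^ 4 * (real n)\<^sup>2 / 4096" by (simp add: a_def power_mult_distrib power_divide)
      show ?thesis unfolding a4 \<Delta>_def \<eta>_def using K(2) elim(2) e by (simp add: power2_eq_square field_simps)
    qed
    also have "\<dots> \<le> e" using elim(1) K(1) by linarith
    finally have mA: "measure M (\<Union>r\<in>{..<K}. A r) \<le> e" .
    have "AE \<omega> in M. \<omega> \<notin> (\<Union>r\<in>{..<K}. A r) \<longrightarrow> (oscillation_le (\<lambda>t. rescaled Q (1/2) n t \<omega>) S \<eta> e)"
      using A3
    proof eventually_elim
      case el: (elim \<omega>)
      show ?case
      proof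
        assume \<omega>: "\<omega> \<notin> (\<Union>r\<in>{..<K}. A r)"
        define q where "q t = real (Q (real n * t) \<omega>)" for t
        have osc: "\<bar>q t - q (real r * \<eta>)\<bar> \<le> 2 * a" if "r < K" "real r * \<eta> \<le> t" "t \<le> real (Suc r) * \<eta>" for r t
        proof -
          have "real r * \<Delta> \<le> real n * t" "real n * t \<le> real (Suc r) * \<Delta>"
            using mult_left_mono[OF that(2), of "real n"] mult_left_mono[OF that(3), of "real n"] by (simp_all add: \<Delta>_def mult_ac)
          then have "\<bar>real (Q (real n * t) \<omega>) - real (Q (real r * \<Delta>) \<omega>)\<bar> \<le> 2 * a" using el \<omega> that(1) by blast
          then show ?thesis by (simp add: q_def \<Delta>_def mult_ac)
        qed
        have mono: "\<bar>q s - q t\<bar> \<le> 6 * a" if st: "0 \<le> s" "s \<le> t" "t \<le> S" "t - s \<le> \<eta>" for s t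
        proof -
          \<comment> \<open>The minimum matters for \<open>s = S\<close> only, which is counted in
            the last cell instead of a cell numbered \<open>K\<close>.\<close>
          define r where "r = min (nat \<lfloor>s / \<eta>\<rfloor>) (K - 1)"
          have fl: "of_int \<lfloor>s / \<eta>\<rfloor> * \<eta> \<le> s" "s < (of_int \<lfloor>s / \<eta>\<rfloor> + 1) * \<eta>"
            using of_int_floor_le[of "s / \<eta>"] real_of_int_floor_add_one_gt[of "s / \<eta>"] \<eta>(1) by (simp_all only: pos_le_divide_eq pos_divide_less_eq)
          have nn: "0 \<le> s / \<eta>" using st \<eta> by simp
          have "r \<le> K - 1" by (simp add: r_def)
          then have rK: "r < K" using K(2) by linarith
          have "real r \<le> of_int \<lfloor>s / \<eta>\<rfloor>" 
          proof -
            have "real r \<le> real (nat \<lfloor>s / \<eta>\<rfloor>)" unfolding r_def of_nat_le_iff by (rule min.cobounded1)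
            then show ?thesis using nn by simp
          qed
          then have "real r * \<eta> \<le> of_int \<lfloor>s / \<eta>\<rfloor> * \<eta>" using \<eta>(1) by (intro mult_right_mono) auto
          then have r1: "real r * \<eta> \<le> s" using fl(1) by linarith
          have r2: "s \<le> real (Suc r) * \<eta>"
          proof (cases "nat \<lfloor>s / \<eta>\<rfloor> \<le> K - 1")
            case True
            then have "real (Suc r) = of_int \<lfloor>s / \<eta>\<rfloor> + 1" using nn by (simp add: r_def)
            then show ?thesis using fl(2) by (simp add: add.commute)
          next
            case False
            then have "real (Suc r) = real K" using K(2) by (simp add: r_def)
            then show ?thesis using \<eta>(2) st by simp
          qed
          show ?thesis
          proof (cases "t \<le> real (Suc r) * \<eta>")
            case True
            have "\<bar>q s - q (real r * \<eta>)\<bar> \<le> 2 * a" by (rule osc[OF rK r1 r2])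
            moreover have "\<bar>q t - q (real r * \<eta>)\<bar> \<le> 2 * a" by (rule osc[OF rK _ True]) (use r1 st in simp)
            ultimately show ?thesis using a by linarith
          next
            case False
            have "real (Suc r) * \<eta> < real K * \<eta>" using False st(3) \<eta>(2) by linarith
            then have rK': "Suc r < K" using \<eta>(1) by simp
            have "t \<le> s + \<eta>" using st by simp
            then have t2: "t \<le> real (Suc (Suc r)) * \<eta>" using r2 by (simp add: algebra_simps)
            have "\<bar>q s - q (real r * \<eta>)\<bar> \<le> 2 * a" by (rule osc[OF rK r1 r2])
            moreover have "\<bar>q (real (Suc r) * \<eta>) - q (real r * \<eta>)\<bar> \<le> 2 * a"
              by (rule osc[OF rK]) (use \<eta>(1) in auto)
            moreover have "\<bar>q t - q (real (Suc r) * \<eta>)\<bar> \<le> 2 * a" by (rule osc[OF rK' _ t2]) (use False in simp)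
            ultimately show ?thesis by linarith
          qed
        qed
        have c: "real n powr (- (1/2)) = 1 / sqrt (real n)"
          unfolding powr_minus powr_half_sqrt[OF of_nat_0_le_iff] inverse_eq_divide ..
        show "oscillation_le (\<lambda>t. rescaled Q (1/2) n t \<omega>) S \<eta> e"
        proof (intro allI impI)
          fix s t assume st: "0 \<le> s \<and> s \<le> S \<and> 0 \<le> t \<and> t \<le> S \<and> \<bar>s - t\<bar> \<le> \<eta>"
          have "\<bar>q s - q t\<bar> \<le> 6 * a"
            using mono[of s t] mono[of t s] st by (cases "s \<le> t") (auto simp: abs_minus_commute)
          also have "\<dots> \<le> e * sqrt (real n)" using e by (simp add: a_def)
          finally have "\<bar>q s - q t\<bar> / sqrt (real n) \<le> e" using elim(2) by (simp add: divide_le_eq)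
          moreover have "rescaled Q (1/2) n s \<omega> - rescaled Q (1/2) n t \<omega> = (q s - q t) / sqrt (real n)"
            unfolding rescaled_def c q_def by (simp add: diff_divide_distrib)
          ultimately show "\<bar>rescaled Q (1/2) n s \<omega> - rescaled Q (1/2) n t \<omega>\<bar> \<le> e" by (simp add: abs_divide)
        qed
      qed
    qed
    then show ?case using mA A(1) by (intro bexI[of _ "\<Union>r\<in>{..<K}. A r"]) auto
  qed
  then show ?thesis using \<eta>(1) by blast
qed

lemma supercritical_modulus:
  assumes Q: "mm1_queue M lam mu Q" and par: "lam > 0" "mu > 0" "lam \<ge> mu" and S: "S > 0" and e: "e > 0"
  shows "\<exists>\<eta>>0. \<forall>\<^sub>F n in sequentially. mostly M e (\<lambda>\<omega>. oscillation_le (\<lambda>t. rescaled Q 1 n t \<omega>) S \<eta> e)"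
proof -
  \<comment> \<open>The drift over a time \<eta> is at most \<open>e/2\<close>; the deviations at
    both ends take \<open>e/4\<close> each.\<close>
  define \<eta> where "\<eta> = e / (2 * (lam - mu + 1))"
  have \<eta>: "\<eta> > 0" using e par by (simp add: \<eta>_def)
  have le: "(lam - mu) * \<eta> \<le> e / 2"
  proof -
    have "(lam - mu) * \<eta> \<le> (lam - mu + 1) * \<eta>" using \<eta> by (intro mult_right_mono) auto
    also have "\<dots> = e / 2"
    proof -
      have "p * (e / (2 * p)) = e / 2" if "p > 0" for p using that by simp
      from this[of "lam - mu + 1"] show ?thesis using par by (simp only: \<eta>_def)
    qed
    finally show ?thesis .
  qed
  have e4: "e / 4 > 0" using e by simp
  have "\<forall>\<^sub>F n in sequentially. mostly M e (\<lambda>\<omega>. oscillation_le (\<lambda>t. rescaled Q 1 n t \<omega>) S \<eta> e)"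
    using supercritical_close[OF Q par S e4]
  proof eventually_elim
    case (elim n)
    then obtain A where A: "A \<in> sets M" "measure M A \<le> e / 4"
      "AE \<omega> in M. \<omega> \<notin> A \<longrightarrow> (\<forall>t. 0 \<le> t \<and> t \<le> S \<longrightarrow> \<bar>rescaled Q 1 n t \<omega> - (lam - mu) * t\<bar> \<le> e / 4)" by blast
    have "AE \<omega> in M. \<omega> \<notin> A \<longrightarrow> (oscillation_le (\<lambda>t. rescaled Q 1 n t \<omega>) S \<eta> e)"
      using A(3)
    proof eventually_elim
      case el: (elim \<omega>)
      show ?case
      proof (intro impI allI)
        fix s t assume \<omega>: "\<omega> \<notin> A" and st: "0 \<le> s \<and> s \<le> S \<and> 0 \<le> t \<and> t \<le> S \<and> \<bar>s - t\<bar> \<le> \<eta>"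
        have 1: "\<bar>rescaled Q 1 n s \<omega> - (lam - mu) * s\<bar> \<le> e / 4" "\<bar>rescaled Q 1 n t \<omega> - (lam - mu) * t\<bar> \<le> e / 4" using el \<omega> st by auto
        have "\<bar>(lam - mu) * (s - t)\<bar> \<le> (lam - mu) * \<eta>" using st par by (simp add: abs_mult mult_left_mono)
        then have "\<bar>(lam - mu) * s - (lam - mu) * t\<bar> \<le> e / 2" using le by (simp add: right_diff_distrib)
        then show "\<bar>rescaled Q 1 n s \<omega> - rescaled Q 1 n t \<omega>\<bar> \<le> e" using 1 by linarith
      qed
    qed
    then show ?case using A(1,2) e by (intro bexI[of _ A]) auto
  qed
  then show ?thesis using \<eta> by blast
qed

text \<open>The left limits rest on monotonicity: just before \<open>t\<close> the time change
  either is constant, or stays strictly below \<open>l t\<close>, so that the left limit of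
  \<open>q\<close> at \<open>l t\<close> is inherited.\<close>

lemma cadlag_compose:
  assumes q: "q \<in> cadlag" and l: "time_change l"
  shows "(\<lambda>t. q (l t)) \<in> cadlag"
proof -
  note L = time_changeD[OF l]
  have l_right: "continuous (at t within {t..}) l" if "t \<ge> 0" for t
    using L(3) that by (auto simp: continuous_on_eq_continuous_within intro: continuous_within_subset)
  have 1: "((\<lambda>t. q (l t)) \<longlongrightarrow> q (l t)) (at_right t)" if t: "t \<ge> 0" for t
  proof -
    have "(q \<longlongrightarrow> q (l t)) (at_right (l t))" using q L(1)[OF t] by (auto simp: cadlag_def)
    then have "continuous (at (l t) within {l t..}) q" by (simp add: continuous_within at_within_Ici_at_right)
    moreover have "l ` {t..} \<subseteq> {l t..}" using L(2) t by auto
    ultimately have "continuous (at (l t) within l ` {t..}) q" by (rule continuous_within_subset)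
    from continuous_within_compose[OF l_right[OF t] this] show ?thesis
      by (simp add: continuous_within at_within_Ici_at_right comp_def)
  qed
  have 2: "\<exists>c. ((\<lambda>t. q (l t)) \<longlongrightarrow> c) (at_left t)" if t: "t > 0" for t
  proof (cases "\<exists>s. 0 \<le> s \<and> s < t \<and> l s = l t")
    case True
    then obtain s where s: "0 \<le> s" "s < t" "l s = l t" by blast
    have "\<forall>\<^sub>F u in at_left t. q (l u) = q (l t)"
      unfolding eventually_at_left[OF s(2)]
    proof (intro exI[of _ s] conjI allI impI s(2))
      fix u assume "s < u" "u < t"
      then have "l s \<le> l u" "l u \<le> l t" using L(2)[of s u] L(2)[of u t] s(1) by auto
      then show "q (l u) = q (l t)" using s(3) by simp
    qed
    then show ?thesis by (blast intro: tendsto_eventually)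
  next
    case False
    have lt: "l u < l t" if "0 \<le> u" "u < t" for u
      using L(2)[of u t] False that by force
    have "l t > 0" using lt[of 0] L(1)[of 0] t by simp
    then obtain c where c: "(q \<longlongrightarrow> c) (at_left (l t))" using q by (auto simp: cadlag_def)
    have "(l \<longlongrightarrow> l t) (at t within {0..})" using L(3) t by (auto simp: continuous_on_def)
    then have "(l \<longlongrightarrow> l t) (at t within {0<..<t})" by (rule tendsto_within_subset) auto
    moreover have "at t within {0<..<t} = at_left t" using t by (intro at_within_nhd[of _ "{0<..}"]) auto
    ultimately have "(l \<longlongrightarrow> l t) (at_left t)" by simp
    moreover have "\<forall>\<^sub>F u in at_left t. l u \<in> {..<l t} \<and> l u \<noteq> l t"
      unfolding eventually_at_left[OF t]
    proof (intro exI[of _ 0] conjI[OF t] allI impI)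
      fix u assume "0 < u" "u < t"
      then have "l u < l t" by (intro lt) auto
      then show "l u \<in> {..<l t} \<and> l u \<noteq> l t" by simp
    qed
    ultimately have "filterlim l (at_left (l t)) (at_left t)" by (simp add: filterlim_at)
    from filterlim_compose[OF c this] show ?thesis by blast
  qed
  show ?thesis using 1 2 by (simp add: cadlag_def)
qed

section \<open>Independence and regularity of the reflected limit\<close>

lemma indep_processes_map:
  assumes P: "prob_space P" and ind: "indep_processes P X Y"
    and G: "G \<in> measurable (PiM {0..} (\<lambda>_. borel)) (PiM {0..} (\<lambda>_. borel))"
    and H: "H \<in> measurable (PiM {0..} (\<lambda>_. borel)) (PiM {0..} (\<lambda>_. borel))"
    and X': "\<And>\<omega>. (\<lambda>t\<in>{0..}. X' t \<omega>) = G (\<lambda>t\<in>{0..}. X t \<omega>)"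
    and Y': "\<And>\<omega>. (\<lambda>t\<in>{0..}. Y' t \<omega>) = H (\<lambda>t\<in>{0..}. Y t \<omega>)"
  shows "indep_processes P X' Y'"
proof -
  interpret prob_space P by fact
  show ?thesis
    unfolding indep_processes_def X' Y'
    using indep_var_compose[OF ind[unfolded indep_processes_def] G H] by (simp add: comp_def)
qed

lemma component_measurable: "(t::real) \<ge> 0 \<Longrightarrow> (\<lambda>z. z t) \<in> borel_measurable (PiM {0..} (\<lambda>_. borel :: real measure))"
  by (intro measurable_component_singleton) simp

text \<open>The running supremum inherits the modulus of continuity of the function; the interval
  \<open>[0, t + 1]\<close> leaves room to the right of \<open>t\<close>.\<close>

lemma skorokhod_reflection_continuous:
  fixes f :: "real \<Rightarrow> real"
  assumes f: "continuous_on {0..} f"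
  shows "continuous_on {0..} (skorokhod_reflection f)"
proof -
  define h where "h s = max (- f s) 0" for s
  have h: "continuous_on {0..} h" unfolding h_def using f by (intro continuous_intros)
  define g where "g t = (SUP s\<in>{0..t}. h s)" for t
  have bdd: "bdd_above (h ` {0..t})" for t
    using compact_continuous_image[OF continuous_on_subset[OF h], of "{0..t}"]
    by (intro bounded_imp_bdd_above compact_imp_bounded) auto
  have hg: "h s \<le> g t" if "0 \<le> s" "s \<le> t" for s t unfolding g_def using that bdd by (intro cSUP_upper) auto
  have gle: "g t \<le> c" if "0 \<le> t" "\<And>s. 0 \<le> s \<Longrightarrow> s \<le> t \<Longrightarrow> h s \<le> c" for t c
    unfolding g_def using that by (intro cSUP_least) auto
  have "continuous_on {0..} g"
    unfolding continuous_on_iff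
  proof (intro ballI allI impI)
    fix t e :: real assume t: "t \<in> {0..}" and e: "0 < e"
    have "uniformly_continuous_on {0..t+1} h"
      by (rule compact_uniformly_continuous[OF continuous_on_subset[OF h]]) auto
    then obtain d where d: "d > 0" "\<And>u v. u \<in> {0..t+1} \<Longrightarrow> v \<in> {0..t+1} \<Longrightarrow> dist v u < d \<Longrightarrow> dist (h v) (h u) < e/2"
      unfolding uniformly_continuous_on_def using e by (metis half_gt_zero)
    have key: "g u \<le> g v \<and> g v \<le> g u + e/2" if "0 \<le> u" "u \<le> v" "v \<le> t + 1" "v - u < d" for u v
    proof
      show "g u \<le> g v" by (rule gle) (use that hg in auto)
      show "g v \<le> g u + e/2"
      proof (rule gle)
        fix s assume s: "0 \<le> s" "s \<le> v"
        show "h s \<le> g u + e/2"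
        proof (cases "s \<le> u")
          case True
          then show ?thesis using hg[of s u] s e by simp
        next
          case False
          then have "dist (h s) (h u) < e/2" using that s by (intro d(2)) (auto simp: dist_real_def)
          then show ?thesis using hg[of u u] that unfolding dist_real_def by linarith
        qed
      qed (use that in simp)
    qed
    show "\<exists>d>0. \<forall>x'\<in>{0..}. dist x' t < d \<longrightarrow> dist (g x') (g t) < e"
    proof (intro exI[of _ "min d 1"] conjI ballI impI)
      fix u assume u: "u \<in> {0..}" "dist u t < min d 1"
      show "dist (g u) (g t) < e"
      proof (cases "u \<le> t")
        case True
        then show ?thesis using key[of u t] u e by (auto simp: dist_real_def)
      next
        case False
        then show ?thesis using key[of t u] u t e by (auto simp: dist_real_def)
      qed
    qed (use d in simp)
  qed
  then have "continuous_on {0..} (\<lambda>t. f t + g t)" using f by (intro continuous_intros)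
  moreover have "skorokhod_reflection f = (\<lambda>t. f t + g t)" by (rule ext) (simp add: skorokhod_reflection_def g_def h_def)
  ultimately show ?thesis by simp
qed

text \<open>Multiplication by \<open>c \<ge> 0\<close> commutes with finite maxima, and by
  continuity the supremum is their limit along refining grids.\<close>

lemma skorokhod_reflection_scale:
  fixes f :: "real \<Rightarrow> real"
  assumes f: "continuous_on {0..} f" and c: "c \<ge> 0" and t: "t \<ge> 0"
  shows "skorokhod_reflection (\<lambda>s. c * f s) t = c * skorokhod_reflection f t"
proof -
  have f': "continuous_on {0..t} f" by (rule continuous_on_subset[OF f]) auto
  have cf: "continuous_on {0..t} (\<lambda>s. c * f s)" using f' by (intro continuous_intros)
  have "Max ((\<lambda>i. max 0 (- (c * f (t * real i / real m)))) ` {..m}) = c * Max ((\<lambda>i. max 0 (- f (t * real i / real m))) ` {..m})" for m :: nat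
  proof -
    have "mono (\<lambda>x::real. c * x)" using c by (intro monoI mult_left_mono)
    from mono_Max_commute[OF this, of "(\<lambda>i. max 0 (- f (t * real i / real m))) ` {..m}"]
    show ?thesis using c by (simp add: image_image max_mult_distrib_left)
  qed
  then have "(\<lambda>m. c * Max ((\<lambda>i. max 0 (- f (t * real i / real m))) ` {..m})) \<longlonglongrightarrow> (SUP s\<in>{0..t}. max (- (c * f s)) 0)"
    using running_max_tendsto[OF cf t] by simp
  moreover have "(\<lambda>m. c * Max ((\<lambda>i. max 0 (- f (t * real i / real m))) ` {..m})) \<longlonglongrightarrow> c * (SUP s\<in>{0..t}. max (- f s) 0)"
    by (intro tendsto_intros running_max_tendsto[OF f' t])
  ultimately have "(SUP s\<in>{0..t}. max (- (c * f s)) 0) = c * (SUP s\<in>{0..t}. max (- f s) 0)" by (rule LIMSEQ_unique)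
  then show ?thesis by (simp add: skorokhod_reflection_def distrib_left)
qed

text \<open>Unlike \<open>skorokhod_reflection\<close>, with which it agrees on continuous paths, this is a measurable
  function of the coordinates of the path. That is needed to carry over independence.\<close>

definition coordinate_reflection :: "(real \<Rightarrow> real) \<Rightarrow> real \<Rightarrow> real" where
  "coordinate_reflection f t = lim (\<lambda>m. f t + Max ((\<lambda>i. max 0 (- f (t * real i / real m))) ` {..m}))"

lemma coordinate_reflection_eq:
  assumes f: "continuous_on {0..} f" and t: "t \<ge> 0"
  shows "coordinate_reflection f t = skorokhod_reflection f t"
proof -
  have f': "continuous_on {0..t} f" by (rule continuous_on_subset[OF f]) auto
  have "(\<lambda>m. f t + Max ((\<lambda>i. max 0 (- f (t * real i / real m))) ` {..m})) \<longlonglongrightarrow> skorokhod_reflection f t"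
    unfolding skorokhod_reflection_def by (intro tendsto_intros running_max_tendsto[OF f' t])
  then show ?thesis unfolding coordinate_reflection_def by (rule limI)
qed

lemma coordinate_reflection_measurable:
  assumes X: "\<And>t. t \<ge> 0 \<Longrightarrow> X t \<in> borel_measurable N" and t: "t \<ge> 0"
  shows "(\<lambda>\<omega>. coordinate_reflection (\<lambda>s. X s \<omega>) t) \<in> borel_measurable N"
proof -
  have "(\<lambda>\<omega>. Max ((\<lambda>i. max 0 (- X (t * real i / real m) \<omega>)) ` {..m})) \<in> borel_measurable N" for m :: nat
    by (rule borel_measurable_Max) (use X t in \<open>auto intro!: borel_measurable_max borel_measurable_uminus\<close>)
  then show ?thesis unfolding coordinate_reflection_def using X[OF t] by (intro borel_measurable_lim_metric borel_measurable_add)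
qed

lemma coordinate_reflection_cong:
  assumes "\<And>s. s \<ge> 0 \<Longrightarrow> f s = g s" "t \<ge> 0"
  shows "coordinate_reflection f t = coordinate_reflection g t"
  unfolding coordinate_reflection_def using assms by simp

lemma scaled_queue_cadlag:
  assumes Q: "mm1_queue M lam mu Q" and L: "inverse_stable_subordinator M \<alpha> L" and \<alpha>: "\<alpha> > 0"
  shows "AE \<omega> in M. (\<lambda>t. scaled_queue \<alpha> \<delta> (\<lambda>t \<omega>. Q (L t \<omega>) \<omega>) n t \<omega>) \<in> cadlag"
proof -
  obtain good: "AE \<omega> in M. time_change (\<lambda>t. L t \<omega>)" using inverse_stable_subordinatorE[OF L \<alpha>] by blast
  show ?thesis using good markov_chainD(4)[OF Q[unfolded mm1_queue_def]]
  proof eventually_elim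
    case (elim \<omega>)
    define c where "c = real n powr (1 / \<alpha>)"
    \<comment> \<open>For \<open>n = 0\<close> the factor is \<open>0\<close>; the path property is
      required for every \<open>n\<close>.\<close>
    have c: "c \<ge> 0" by (simp add: c_def)
    note LD = time_changeD[OF elim(1)]
    have "time_change (\<lambda>t. L (c * t) \<omega>)"
      unfolding time_change_def
    proof (intro conjI allI impI)
      show "0 \<le> L (c * t) \<omega>" if "0 \<le> t" for t using LD(1) c that by simp
      show "mono_on {0..} (\<lambda>t. L (c * t) \<omega>)"
        using c by (auto simp: mono_on_def intro!: LD(2) mult_left_mono)
      show "continuous_on {0..} (\<lambda>t. L (c * t) \<omega>)"
        by (rule continuous_on_compose2[OF LD(3)]) (use c in \<open>auto intro!: continuous_intros\<close>)
    qed
    from cadlag_compose[OF elim(2) this] have *: "(\<lambda>t. real (Q (L (c * t) \<omega>) \<omega>)) \<in> cadlag" .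
    have "(\<lambda>t. real n powr (- \<delta>) * real (Q (L (c * t) \<omega>) \<omega>)) \<in> cadlag"
      unfolding cadlag_def
    proof (intro CollectI conjI allI impI)
      fix t :: real assume "t \<ge> 0"
      then show "((\<lambda>t. real n powr (- \<delta>) * real (Q (L (c * t) \<omega>) \<omega>)) \<longlongrightarrow> real n powr (- \<delta>) * real (Q (L (c * t) \<omega>) \<omega>)) (at_right t)"
        using * by (intro tendsto_mult tendsto_const) (simp add: cadlag_def)
    next
      fix t :: real assume "t > 0"
      then obtain x where "((\<lambda>t. real (Q (L (c * t) \<omega>) \<omega>)) \<longlongrightarrow> x) (at_left t)" using * unfolding cadlag_def by blast
      from tendsto_mult[OF tendsto_const this] show "\<exists>x. ((\<lambda>t. real n powr (- \<delta>) * real (Q (L (c * t) \<omega>) \<omega>)) \<longlongrightarrow> x) (at_left t)" by blast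
    qed
    then show ?case by (simp add: scaled_queue_def c_def)
  qed
qed

text \<open>Isolates what differs between the two regimes with a limit in law: the candidate
  \<open>Z'\<close>, convergence on grids, and a modulus in probability.\<close>

lemma fractional_queue_converges:
  fixes M :: "'a measure" and N :: "'b measure"
  assumes \<alpha>: "\<alpha> > 0" and Q: "mm1_queue M lam mu Q" and L: "inverse_stable_subordinator M \<alpha> L"
    and ind: "indep_processes M (\<lambda>t \<omega>. real (Q t \<omega>)) L"
    and L2: "inverse_stable_subordinator N \<alpha> L2"
    and Z': "\<And>t. t \<ge> 0 \<Longrightarrow> Z' t \<in> borel_measurable N"
    and ind2: "indep_processes N Z' L2"
    and cont: "AE \<omega> in N. continuous_on {0..} (\<lambda>t. Z' t \<omega>)"
    and fdd: "\<And>j J H. j > 0 \<Longrightarrow> J > 0 \<Longrightarrow> bounded_lipschitz J H \<Longrightarrow>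
       (\<lambda>n. \<integral>\<omega>. H (grid (rescaled Q \<delta> n) (1 / real j) J \<omega>) \<partial>M) \<longlonglongrightarrow> (\<integral>\<omega>. H (grid Z' (1 / real j) J \<omega>) \<partial>N)"
    and modulus: "\<And>S e. S > 0 \<Longrightarrow> e > 0 \<Longrightarrow> \<exists>\<eta>>0. \<forall>\<^sub>F n in sequentially. mostly M e (\<lambda>\<omega>. oscillation_le (\<lambda>t. rescaled Q \<delta> n t \<omega>) S \<eta> e)"
    and Y: "AE \<omega> in N. \<forall>t\<ge>0. Y t \<omega> = Z' (L2 t \<omega>) \<omega>"
  shows "converges_in_distribution_U M (scaled_queue \<alpha> \<delta> (\<lambda>t \<omega>. Q (L t \<omega>) \<omega>)) N Y"
proof (rule composition_converges[where Z = "rescaled Q \<delta>" and Z' = Z' and \<alpha> = \<alpha> and ?L2.0 = L2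
    and ?L1.0 = "\<lambda>n t \<omega>. L (real n powr (1 / \<alpha>) * t) \<omega> / real n"])
  show M: "prob_space M" by (rule markov_chainD(1)[OF Q[unfolded mm1_queue_def]])
  show "inverse_stable_subordinator M \<alpha> (\<lambda>t \<omega>. L (real n powr (1 / \<alpha>) * t) \<omega> / real n)" if "n > 0" for n
    by (rule inverse_stable_subordinator_scale[OF L _ \<alpha>]) (use that in simp)
  show "rescaled Q \<delta> n t \<in> borel_measurable M" if "t \<ge> 0" for n t by (rule rescaled_measurable[OF Q that])
  show "indep_processes M (rescaled Q \<delta> n) (\<lambda>t \<omega>. L (real n powr (1 / \<alpha>) * t) \<omega> / real n)" for n
  proof (rule indep_processes_map[OF M ind])
    show "(\<lambda>z. \<lambda>t\<in>{0..}. real n powr (- \<delta>) * z (real n * t)) \<in> measurable (PiM {0..} (\<lambda>_. borel)) (PiM {0..} (\<lambda>_. borel))"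
      by (intro measurable_restrict borel_measurable_times component_measurable) auto
    show "(\<lambda>l. \<lambda>t\<in>{0..}. l (real n powr (1 / \<alpha>) * t) / real n) \<in> measurable (PiM {0..} (\<lambda>_. borel)) (PiM {0..} (\<lambda>_. borel))"
      by (intro measurable_restrict borel_measurable_divide component_measurable) auto
  qed (auto simp: rescaled_def)
  show "AE \<omega> in M. \<forall>t\<ge>0. scaled_queue \<alpha> \<delta> (\<lambda>t \<omega>. Q (L t \<omega>) \<omega>) n t \<omega> = rescaled Q \<delta> n (L (real n powr (1 / \<alpha>) * t) \<omega> / real n) \<omega>"
    if "n > 0" for n
    using that by (intro AE_I2) (simp add: scaled_queue_def rescaled_def)
  show "AE \<omega> in M. (\<lambda>t. scaled_queue \<alpha> \<delta> (\<lambda>t \<omega>. Q (L t \<omega>) \<omega>) n t \<omega>) \<in> cadlag" for n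
    by (rule scaled_queue_cadlag[OF Q L \<alpha>])
qed (use assms in auto)

text \<open>The level \<open>n^\<delta> / k\<close> is exceeded on \<open>[0, n^2]\<close> with
  probability at most a polynomial in \<open>n\<close> times a geometric term in
  \<open>n^\<delta>\<close>. Such a stretched exponential is summable for every positive
  \<delta>.\<close>

lemma subcritical_sup:
  assumes Q: "mm1_queue M lam mu Q" and par: "lam > 0" "mu > 0" "lam < mu" and \<delta>: "\<delta> > 0" and k: "k > 0"
  shows "AE \<omega> in M. \<forall>\<^sub>F n in sequentially. \<forall>t. 0 \<le> t \<and> t \<le> (real n)\<^sup>2 \<longrightarrow> real (Q t \<omega>) \<le> real n powr \<delta> / k"
proof -
  interpret prob_space M by (rule markov_chainD(1)[OF Q[unfolded mm1_queue_def]])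
  define \<rho> where "\<rho> = lam / mu"
  have \<rho>: "0 < \<rho>" "\<rho> < 1" using par by (auto simp: \<rho>_def)
  define a where "a n = nat \<lceil>real n powr \<delta> / k\<rceil>" for n
  have "\<forall>n. \<exists>A. A \<in> sets M \<and> (n > 0 \<longrightarrow> measure M A \<le> (1 + (mu - lam) * (real n)\<^sup>2) * \<rho> ^ a n \<and>
    (AE \<omega> in M. \<omega> \<notin> A \<longrightarrow> (\<forall>t. 0 \<le> t \<and> t \<le> (real n)\<^sup>2 \<longrightarrow> Q t \<omega> < a n)))"
  proof
    fix n
    show "\<exists>A. A \<in> sets M \<and> (n > 0 \<longrightarrow> measure M A \<le> (1 + (mu - lam) * (real n)\<^sup>2) * \<rho> ^ a n \<and>
      (AE \<omega> in M. \<omega> \<notin> A \<longrightarrow> (\<forall>t. 0 \<le> t \<and> t \<le> (real n)\<^sup>2 \<longrightarrow> Q t \<omega> < a n)))"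
    proof (cases "n > 0")
      case True
      then have "(real n)\<^sup>2 > 0" by simp
      from queue_sup_tail[OF Q par this, of "a n"] show ?thesis unfolding \<rho>_def by blast
    qed auto
  qed
  from choice[OF this] obtain A where A: "\<And>n. A n \<in> sets M"
    "\<And>n. n > 0 \<Longrightarrow> measure M (A n) \<le> (1 + (mu - lam) * (real n)\<^sup>2) * \<rho> ^ a n"
    "\<And>n. n > 0 \<Longrightarrow> AE \<omega> in M. \<omega> \<notin> A n \<longrightarrow> (\<forall>t. 0 \<le> t \<and> t \<le> (real n)\<^sup>2 \<longrightarrow> Q t \<omega> < a n)"
    by blast
  have "AE \<omega> in M. \<forall>\<^sub>F n in sequentially. \<omega> \<in> space M - A n"
  proof (rule borel_cantelli_AE1)
    show "summable (\<lambda>n. measure M (A n))"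
    proof (rule summable_comparison_test_ev)
      show "summable (\<lambda>n. 1 / real n ^ 2)" using inverse_power_summable[of 2, where 'a=real] by (simp add: divide_inverse)
      have "(\<lambda>n. (1 + (mu - lam) * (real n)\<^sup>2) * \<rho> powr (real n powr \<delta> / k) * real n ^ 2) \<longlonglongrightarrow> 0"
      proof -
        define g where "g = - ln \<rho>"
        define c where "c = mu - lam"
        have gc: "g > 0" "c > 0" using \<rho> par by (auto simp: g_def c_def)
        have "(\<lambda>n. (1 + c * (real n)\<^sup>2) * exp (- g * (real n powr \<delta> / k)) * real n ^ 2) \<longlonglongrightarrow> 0"
          using gc \<delta> k by real_asymp
        then show ?thesis using \<rho> by (simp add: g_def c_def powr_def mult.commute)
      qed
      then have "\<forall>\<^sub>F n in sequentially. (1 + (mu - lam) * (real n)\<^sup>2) * \<rho> powr (real n powr \<delta> / k) * real n ^ 2 < 1"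
        by (rule order_tendstoD) simp
      then show "\<forall>\<^sub>F n in sequentially. norm (measure M (A n)) \<le> 1 / real n ^ 2"
        using eventually_gt_at_top[of 0]
      proof eventually_elim
        case (elim n)
        have "\<rho> ^ a n = \<rho> powr real (a n)" using \<rho> by (simp add: powr_realpow)
        also have "\<dots> \<le> \<rho> powr (real n powr \<delta> / k)"
          using \<rho> real_nat_ceiling_ge[of "real n powr \<delta> / k"] by (intro powr_mono') (auto simp: a_def)
        finally have "(1 + (mu - lam) * (real n)\<^sup>2) * \<rho> ^ a n \<le> (1 + (mu - lam) * (real n)\<^sup>2) * \<rho> powr (real n powr \<delta> / k)"
          using par by (intro mult_left_mono) auto
        then have "measure M (A n) * real n ^ 2 \<le> (1 + (mu - lam) * (real n)\<^sup>2) * \<rho> powr (real n powr \<delta> / k) * real n ^ 2"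
          using A(2)[OF elim(2)] by (intro mult_right_mono) auto
        then have "measure M (A n) * real n ^ 2 \<le> 1" using elim(1) by linarith
        then show ?case using elim(2) by (simp add: le_divide_eq)
      qed
    qed
  qed (use A in \<open>auto simp: emeasure_eq_measure\<close>)
  moreover have "AE \<omega> in M. \<forall>n. n > 0 \<longrightarrow> \<omega> \<notin> A n \<longrightarrow> (\<forall>t. 0 \<le> t \<and> t \<le> (real n)\<^sup>2 \<longrightarrow> Q t \<omega> < a n)"
    unfolding AE_all_countable by (intro allI AE_impI A(3))
  ultimately show ?thesis
  proof eventually_elim
    case el: (elim \<omega>)
    show ?case using el(1) eventually_gt_at_top[of 0]
    proof eventually_elim
      case (elim n)
      show ?case
      proof (intro allI impI)
        fix t assume "0 \<le> t \<and> t \<le> (real n)\<^sup>2"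
        then have "Q t \<omega> < a n" using el(2) elim by blast
        then have "int (Q t \<omega>) < \<lceil>real n powr \<delta> / k\<rceil>" by (simp add: a_def zless_nat_eq_int_zless)
        then show "real (Q t \<omega>) \<le> real n powr \<delta> / k" by (simp add: less_ceiling_iff)
      qed
    qed
  qed
qed

theorem theorem3p2:
  fixes M :: "'a measure" and N :: "'b measure"
    and \<alpha> lam mu \<rho> :: real
    and Q1 :: "real \<Rightarrow> 'a \<Rightarrow> nat"
    and W L :: "real \<Rightarrow> 'b \<Rightarrow> real"
  assumes "0 < \<alpha>" "\<alpha> < 1" "lam > 0" "mu > 0"
    and "\<rho> = lam / mu"
    and "fractional_mm1_queue M \<alpha> lam mu Q1"
    and "brownian_motion N W"
    and "inverse_stable_subordinator N \<alpha> L"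
    and "indep_processes N W L"
  shows
    "(\<rho> > 1 \<longrightarrow>
        converges_in_distribution_U M (scaled_queue \<alpha> 1 Q1)
          N (\<lambda>t \<omega>. (lam - mu) * L t \<omega>)) \<and>
     (\<rho> = 1 \<longrightarrow>
        converges_in_distribution_U M (scaled_queue \<alpha> (1 / 2) Q1)
          N (\<lambda>t \<omega>. sqrt (2 * lam) * skorokhod_reflection (\<lambda>s. W s \<omega>) (L t \<omega>))) \<and>
     (\<rho> < 1 \<longrightarrow>
        (\<forall>\<delta>>0. AE \<omega> in M. \<forall>T>0.
           (\<lambda>n. SUP t\<in>{0<..T}. ereal (scaled_queue \<alpha> \<delta> Q1 n t \<omega>)) \<longlonglongrightarrow> 0))"
proof -
  obtain Q LM where Q: "mm1_queue M lam mu Q" and LM: "inverse_stable_subordinator M \<alpha> LM"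
    and ind: "indep_processes M (\<lambda>t \<omega>. real (Q t \<omega>)) LM" and Q1: "Q1 = (\<lambda>t \<omega>. Q (LM t \<omega>) \<omega>)"
    using assms(6) unfolding fractional_mm1_queue_def by blast
  note WD = brownian_motionD[OF assms(7)]
  have N: "prob_space N" by (rule levy_processD(1)[OF WD(1)])
  have Wm: "W t \<in> borel_measurable N" if "t \<ge> 0" for t by (rule levy_processD(2)[OF WD(1) that])
  have id_meas: "(\<lambda>l. l) \<in> measurable (PiM {0..} (\<lambda>_. borel)) (PiM {0..} (\<lambda>_. borel :: real measure))" by simp
  obtain goodN: "AE \<omega> in N. time_change (\<lambda>t. L t \<omega>)" using inverse_stable_subordinatorE[OF assms(8,1)] by blast
  show ?thesis
  proof (intro conjI impI allI)
    assume "\<rho> > 1"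
    then have ge: "lam \<ge> mu" using assms(3-5) by (simp add: less_divide_eq)
    show "converges_in_distribution_U M (scaled_queue \<alpha> 1 Q1) N (\<lambda>t \<omega>. (lam - mu) * L t \<omega>)"
      unfolding Q1
    proof (rule fractional_queue_converges[OF assms(1) Q LM ind assms(8), where Z' = "\<lambda>t \<omega>. (lam - mu) * t"])
      \<comment> \<open>A deterministic process is a constant image of \<open>W\<close>, so its
        independence of \<open>L\<close> is inherited from \<open>W\<close>.\<close>
      show "indep_processes N (\<lambda>t \<omega>. (lam - mu) * t) L"
        by (rule indep_processes_map[OF N assms(9) _ id_meas, where G = "\<lambda>_. \<lambda>t\<in>{0..}. (lam - mu) * t"])
           (auto intro!: measurable_const simp: space_PiM)
      show "(\<lambda>n. \<integral>\<omega>. H (grid (rescaled Q 1 n) (1 / real j) J \<omega>) \<partial>M) \<longlonglongrightarrow> (\<integral>\<omega>. H (grid (\<lambda>t \<omega>. (lam - mu) * t) (1 / real j) J \<omega>) \<partial>N)"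
        if "j > 0" "bounded_lipschitz J H" for j J H
        by (rule supercritical_fdd[OF Q assms(3,4) ge that(2,1) N])
    qed (auto intro!: continuous_intros supercritical_modulus[OF Q assms(3,4) ge])
  next
    assume "\<rho> = 1"
    then have eq: "mu = lam" using assms(3-5) by simp
    note Q' = Q[unfolded eq]
    define X where "X t \<omega> = sqrt (2 * lam) * W t \<omega>" for t \<omega>
    have Xm: "X t \<in> borel_measurable N" if "t \<ge> 0" for t unfolding X_def using Wm[OF that] by simp
    define Z where "Z t \<omega> = coordinate_reflection (\<lambda>s. X s \<omega>) t" for t \<omega>
    have Zm: "Z t \<in> borel_measurable N" if "t \<ge> 0" for t unfolding Z_def by (rule coordinate_reflection_measurable[OF Xm that])
    have XC: "AE \<omega> in N. continuous_on {0..} (\<lambda>t. X t \<omega>)"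
      using WD(3) by eventually_elim (auto simp: X_def intro!: continuous_intros)
    have ZX: "AE \<omega> in N. \<forall>t\<ge>0. Z t \<omega> = skorokhod_reflection (\<lambda>t. X t \<omega>) t"
      using XC by eventually_elim (simp add: Z_def coordinate_reflection_eq)
    show "converges_in_distribution_U M (scaled_queue \<alpha> (1 / 2) Q1) N (\<lambda>t \<omega>. sqrt (2 * lam) * skorokhod_reflection (\<lambda>s. W s \<omega>) (L t \<omega>))"
      unfolding Q1
    proof (rule fractional_queue_converges[OF assms(1) Q LM ind assms(8) Zm])
      show "indep_processes N Z L"
      proof (rule indep_processes_map[OF N assms(9) _ id_meas, where G = "\<lambda>w. \<lambda>t\<in>{0..}. coordinate_reflection (\<lambda>s. sqrt (2 * lam) * w s) t"])
        show "(\<lambda>w. \<lambda>t\<in>{0..}. coordinate_reflection (\<lambda>s. sqrt (2 * lam) * w s) t) \<in> measurable (PiM {0..} (\<lambda>_. borel)) (PiM {0..} (\<lambda>_. borel))"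
          by (intro measurable_restrict coordinate_reflection_measurable borel_measurable_times component_measurable) auto
        show "(\<lambda>t\<in>{0..}. Z t \<omega>) = (\<lambda>t\<in>{0..}. coordinate_reflection (\<lambda>s. sqrt (2 * lam) * (\<lambda>t\<in>{0..}. W t \<omega>) s) t)" for \<omega>
          unfolding Z_def X_def by (intro restrict_ext coordinate_reflection_cong) auto
      qed simp
      show "AE \<omega> in N. continuous_on {0..} (\<lambda>t. Z t \<omega>)"
        using ZX XC
      proof eventually_elim
        case (elim \<omega>)
        show ?case using skorokhod_reflection_continuous[OF elim(2)]
          by (rule continuous_on_cong[THEN iffD1, rotated -1]) (use elim(1) in auto)
      qed
      show "(\<lambda>n. \<integral>\<omega>. H (grid (rescaled Q (1 / 2) n) (1 / real j) J \<omega>) \<partial>M) \<longlonglongrightarrow> (\<integral>\<omega>. H (grid Z (1 / real j) J \<omega>) \<partial>N)"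
        if "j > 0" "J > 0" "bounded_lipschitz J H" for j J H
        by (rule critical_fdd[OF Q' assms(3,7) that(3,1,2) Zm]) (use ZX in \<open>simp_all add: X_def\<close>)
      \<comment> \<open>The factor \<open>sqrt (2 * lam)\<close> stands outside the reflection in
        the claim and inside it in \<open>Z\<close>, where the limit of the walk produces
        it.\<close>
      show "AE \<omega> in N. \<forall>t\<ge>0. sqrt (2 * lam) * skorokhod_reflection (\<lambda>s. W s \<omega>) (L t \<omega>) = Z (L t \<omega>) \<omega>"
        using ZX WD(3) goodN
      proof eventually_elim
        case (elim \<omega>)
        show ?case
        proof (intro allI impI)
          fix t :: real assume "t \<ge> 0"
          then have "L t \<omega> \<ge> 0" by (rule time_changeD(1)[OF elim(3)])
          then show "sqrt (2 * lam) * skorokhod_reflection (\<lambda>s. W s \<omega>) (L t \<omega>) = Z (L t \<omega>) \<omega>"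
            using elim(1) skorokhod_reflection_scale[OF elim(2), of "sqrt (2 * lam)" "L t \<omega>"] assms(3) by (simp add: X_def)
        qed
      qed
    qed (auto intro!: critical_modulus[OF Q' assms(3)])
  next
    fix \<delta> :: real assume "\<rho> < 1" and \<delta>: "\<delta> > 0"
    then have lt: "lam < mu" using assms(3-5) by (simp add: divide_less_eq)
    obtain goodM: "AE \<omega> in M. time_change (\<lambda>t. LM t \<omega>)" using inverse_stable_subordinatorE[OF LM assms(1)] by blast
    \<comment> \<open>Countably many thresholds \<open>1 / (k + 1)\<close> and a growth bound valid
      for all \<open>T\<close> leave one null set, independent of \<open>T\<close>.\<close>
    have "AE \<omega> in M. \<forall>k::nat. \<forall>\<^sub>F n in sequentially. \<forall>t. 0 \<le> t \<and> t \<le> (real n)\<^sup>2 \<longrightarrow> real (Q t \<omega>) \<le> real n powr \<delta> / real (Suc k)"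
      unfolding AE_all_countable by (intro allI subcritical_sup[OF Q assms(3,4) lt \<delta>]) simp
    then show "AE \<omega> in M. \<forall>T>0. (\<lambda>n. SUP t\<in>{0<..T}. ereal (scaled_queue \<alpha> \<delta> Q1 n t \<omega>)) \<longlonglongrightarrow> 0"
      using goodM inverse_stable_growth[OF LM assms(1)]
    proof eventually_elim
      case el: (elim \<omega>)
      note LD = time_changeD[OF el(2)]
      show ?case
      proof (intro allI impI)
        fix T :: real assume T: "T > 0"
        let ?S = "\<lambda>n. SUP t\<in>{0<..T}. ereal (scaled_queue \<alpha> \<delta> Q1 n t \<omega>)"
        have nonneg: "0 \<le> ?S n" for n
        proof -
          have "0 \<le> ereal (scaled_queue \<alpha> \<delta> Q1 n T \<omega>)" by (simp add: scaled_queue_def)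
          also have "\<dots> \<le> ?S n" using T by (intro SUP_upper) auto
          finally show ?thesis .
        qed
        have le: "\<forall>\<^sub>F n in sequentially. ?S n \<le> ereal (1 / real (Suc k))" for k
          using el(1)[rule_format, of k] el(3)[rule_format, OF T] eventually_gt_at_top[of 0]
        proof eventually_elim
          case (elim n)
          show ?case
          proof (rule SUP_least)
            fix t assume t: "t \<in> {0<..T}"
            define c where "c = real n powr (1 / \<alpha>)"
            have "c * t \<le> c * T" using t by (intro mult_left_mono) (auto simp: c_def)
            then have "LM (c * t) \<omega> \<le> LM (c * T) \<omega>" "0 \<le> LM (c * t) \<omega>" using LD(1,2) t by (auto simp: c_def)
            then have "real (Q (LM (c * t) \<omega>) \<omega>) \<le> real n powr \<delta> / real (Suc k)"
              using elim(1)[rule_format, of "LM (c * t) \<omega>"] elim(2) by (simp add: c_def)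
            then have "real n powr (- \<delta>) * real (Q (LM (c * t) \<omega>) \<omega>) \<le> real n powr (- \<delta>) * (real n powr \<delta> / real (Suc k))"
              by (intro mult_left_mono) auto
            also have "\<dots> = 1 / real (Suc k)" using elim(3) by (simp add: powr_minus)
            finally show "ereal (scaled_queue \<alpha> \<delta> Q1 n t \<omega>) \<le> ereal (1 / real (Suc k))"
              by (simp add: scaled_queue_def Q1 c_def)
          qed
        qed
        show "?S \<longlonglongrightarrow> 0"
        proof (rule order_tendstoI)
          fix x :: ereal assume "x < 0"
          then show "\<forall>\<^sub>F n in sequentially. x < ?S n" using nonneg by (intro always_eventually allI) (rule less_le_trans)
        next
          fix x :: ereal assume "0 < x"
          then obtain r :: real where r: "0 < ereal r" "ereal r < x" using ereal_dense2 by blast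
          then obtain k where "1 / real (Suc k) < r" using nat_approx_posE[of r] by auto
          then have "ereal (1 / real (Suc k)) < x" using r(2) by (meson ereal_less_eq(3) le_less_trans less_imp_le)
          then show "\<forall>\<^sub>F n in sequentially. ?S n < x"
            using le[of k] by (auto elim!: eventually_mono intro: le_less_trans)
        qed
      qed
    qed
  qed
qed

end
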